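(* Let $p \in (0,2)$ and $\varepsilon \in (0,1)$. There is a $(1+\varepsilon)$-approximation algorithm for the Entrywise $\ell_p$-Rank-$k$ Approximation problem running in time $n^{\mathrm{poly}(k/\varepsilon)}$.
   Context: Entrywise $\ell_p$-Rank-$k$ Approximation: given an $n\times d$ matrix $A$ (with $n \ge d$) whose entries are integers bounded in absolute value by $\mathrm{poly}(n)$, and a positive integer $k$, output $U\in\mathbb{R}^{n\times k}$ and $V\in\mathbb{R}^{k\times d}$ minimizing $\|A-UV\|_p^p=\sum_{i,j}|A_{i,j}-(UV)_{i,j}|^p$. An algorithm is an $\alpha$-approximation if it outputs $U,V$ with $\|A-UV\|_p^p\le \alpha\cdot\min_{U'\in\mathbb{R}^{n\times k},V'\in\mathbb{R}^{k\times d}}\|A-U'V'\|_p^p$. The model of computation is the unit-cost RAM. *)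

theory Defs
  imports Complex_Main "HOL-Computational_Algebra.Polynomial" "Jordan_Normal_Form.Matrix"
begin

text \<open>
  The unit-cost RAM of Cook and Reckhow: registers hold arbitrary integers, the arithmetic
  instructions are addition and subtraction, and every instruction costs one step. Multiplication
  is deliberately not a unit-cost instruction: on unbounded integers it would let a polynomial
  number of steps decide all of PSPACE, whereas on numbers with \<open>b\<close> bits it can be
  programmed with addition and subtraction in a number of steps polynomial in \<open>b\<close>.

  The exponent \<open>p\<close> is an arbitrary real number, so it is available to the machine through its
  binary expansion only: \<open>Digit i j\<close> queries one binary digit of \<open>p\<close>. Without such access the
  problem would not be solvable by any program for uncomputable \<open>p\<close>.
\<close>

datatype instr =
    Const nat int
  | Add nat nat nat
  | Sub nat nat nat
  | Load nat nat
  | Store nat nat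
  | JumpPos nat nat
  | Read nat
  | Print nat
  | Digit nat nat

record state =
  pc :: nat
  mem :: "nat \<Rightarrow> int"
  inp :: "int list"
  outp :: "int list"

definition binary_digit :: "real \<Rightarrow> nat \<Rightarrow> int" where
  "binary_digit x m = \<lfloor>x * 2 ^ m\<rfloor> mod 2"

text \<open>A negative content used as an address or digit position counts as 0, because of
  \<^const>\<open>nat\<close>; reading from the exhausted input yields 0.\<close>

fun exec :: "real \<Rightarrow> instr \<Rightarrow> state \<Rightarrow> state" where
  "exec p (Const i c) s = s\<lparr>pc := pc s + 1, mem := (mem s)(i := c)\<rparr>"
| "exec p (Add i j l) s = s\<lparr>pc := pc s + 1, mem := (mem s)(i := mem s j + mem s l)\<rparr>"
| "exec p (Sub i j l) s = s\<lparr>pc := pc s + 1, mem := (mem s)(i := mem s j - mem s l)\<rparr>"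
| "exec p (Load i j) s = s\<lparr>pc := pc s + 1, mem := (mem s)(i := mem s (nat (mem s j)))\<rparr>"
| "exec p (Store i j) s = s\<lparr>pc := pc s + 1, mem := (mem s)(nat (mem s i) := mem s j)\<rparr>"
| "exec p (JumpPos i l) s = s\<lparr>pc := (if mem s i > 0 then l else pc s + 1)\<rparr>"
| "exec p (Read i) s =
     s\<lparr>pc := pc s + 1, mem := (mem s)(i := (case inp s of [] \<Rightarrow> 0 | x # _ \<Rightarrow> x)), inp := tl (inp s)\<rparr>"
| "exec p (Print i) s = s\<lparr>pc := pc s + 1, outp := outp s @ [mem s i]\<rparr>"
| "exec p (Digit i j) s =
     s\<lparr>pc := pc s + 1, mem := (mem s)(i := binary_digit p (nat (mem s j)))\<rparr>"

definition halted :: "instr list \<Rightarrow> state \<Rightarrow> bool" where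
  "halted P s \<longleftrightarrow> length P \<le> pc s"

definition step :: "real \<Rightarrow> instr list \<Rightarrow> state \<Rightarrow> state" where
  "step p P s = (if halted P s then s else exec p (P ! pc s) s)"

definition init :: "int list \<Rightarrow> state" where
  "init xs = \<lparr>pc = 0, mem = (\<lambda>_. 0), inp = xs, outp = []\<rparr>"

text \<open>On input \<open>xs\<close>, program \<open>P\<close> halts after at most \<open>t\<close> steps, having printed \<open>ys\<close>.\<close>

definition ram_computes :: "real \<Rightarrow> instr list \<Rightarrow> int list \<Rightarrow> nat \<Rightarrow> int list \<Rightarrow> bool" where
  "ram_computes p P xs t ys \<longleftrightarrow>
     (let s = (step p P ^^ t) (init xs) in halted P s \<and> outp s = ys)"

definition instance_input :: "int mat \<Rightarrow> nat \<Rightarrow> int list" where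
  "instance_input A k =
     [int (dim_row A), int (dim_col A), int k] @
     [A $$ (i, j). i \<leftarrow> [0..<dim_row A], j \<leftarrow> [0..<dim_col A]]"

text \<open>The output lists the entries of \<open>U\<close> and then those of \<open>V\<close>, both row by row, each entry
  being a rational number given by two consecutive integers, numerator and nonzero
  denominator.\<close>

definition rat_mat :: "nat \<Rightarrow> nat \<Rightarrow> int list \<Rightarrow> real mat" where
  "rat_mat nr nc xs =
     mat nr nc (\<lambda>(i, j). real_of_int (xs ! (2 * (i * nc + j))) /
                         real_of_int (xs ! (2 * (i * nc + j) + 1)))"

definition encodes_factors ::
  "nat \<Rightarrow> nat \<Rightarrow> nat \<Rightarrow> int list \<Rightarrow> real mat \<Rightarrow> real mat \<Rightarrow> bool" where
  "encodes_factors n k d ys U V \<longleftrightarrow>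
     length ys = 2 * (n * k + k * d) \<and>
     (\<forall>m < n * k + k * d. ys ! (2 * m + 1) \<noteq> 0) \<and>
     U = rat_mat n k ys \<and> V = rat_mat k d (drop (2 * (n * k)) ys)"

text \<open>\<open>lp_norm_pow p M\<close> is the \<open>p\<close>-th power of the entrywise \<open>p\<close>-norm of \<open>M\<close>.\<close>

definition lp_norm_pow :: "real \<Rightarrow> real mat \<Rightarrow> real" where
  "lp_norm_pow p M = (\<Sum>i<dim_row M. \<Sum>j<dim_col M. \<bar>M $$ (i, j)\<bar> powr p)"

definition lp_error :: "real \<Rightarrow> int mat \<Rightarrow> real mat \<Rightarrow> real mat \<Rightarrow> real" where
  "lp_error p A U V = lp_norm_pow p (map_mat real_of_int A - U * V)"

definition lp_rank_opt :: "real \<Rightarrow> nat \<Rightarrow> int mat \<Rightarrow> real" where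
  "lp_rank_opt p k A =
     (INF (U, V) \<in> carrier_mat (dim_row A) k \<times> carrier_mat k (dim_col A). lp_error p A U V)"

end

theory Submission
  imports Defs "HOL-Library.FuncSet" "Jordan_Normal_Form.Determinant"
begin

text \<open>
A near-optimal factorisation can be rounded to integer matrices \<open>U\<close>, \<open>V\<close> over a common
  denominator \<open>D\<close>, all of size \<open>n\<close> to the power \<open>poly (k / \<epsilon>)\<close>: rescaling along a maximal
  minor of the product keeps the entries bounded, and a nonzero minor of order \<open>k + 1\<close> of \<open>A\<close>
  bounds a positive optimum from below. Given \<open>U\<close>, a weighted sample of \<open>poly (k / \<epsilon>)\<close> rows,
  drawn by \<open>\<ell>\<^sub>p\<close> sensitivities, has the property that solving every column of the sampled
  regression problem nearly optimally yields a nearly optimal \<open>V\<close>. The algorithm enumerates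
  \<open>D\<close>, the sampled rows, their rounded weights and the sampled rows of \<open>U\<close>, solves each column on the
  grid, then each row of \<open>U\<close> on the grid against the resulting \<open>V\<close>, and keeps the best guess.
  Real powers are replaced by integers \<open>T\<close> proportional to \<open>(N / D\<^sup>2)\<^sup>p\<close> up to a factor close to 1,
  which only needs the leading binary digits of \<open>p\<close>.

  On the machine, every value is a function of the memory, and every loop runs exactly as often as
  register 0 says, the body being switched off once the intended bound is reached. Such functions
  are closed under composition, with running time polynomial in register 0.
\<close>

section \<open>Spanning families by maximal minors\<close>

text \<open>Guessing all of \<open>U\<close> would take a number of guesses exponential in
  \<open>n\<close>, so the number of sampled rows must not grow with \<open>n\<close> or
  \<open>d\<close>. A guarantee that holds with constant probability for a single column would need
  a union bound over \<open>d\<close> columns, and hence more samples. Instead the excess cost of a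
  column is bounded, on almost every sample, by a quantity \<open>Psi\<close> whose expectation is a
  small multiple of the column's own cost. These expectations can be added up over all columns, and
  Markov's inequality for the sum yields one sample that serves all columns together. Bad events
  need only a probability that is polynomially small in k / \<epsilon>.

  For \<open>p < 1\<close> the p-norm violates the triangle inequality, so all estimates rest on two
  elementary facts about \<bar>a + b\<bar> powr p: one with factor 4 on both terms, one with a
  factor close to 1 on the main term.

  The sample is only shown to exist; the algorithm finds an equally good one by enumeration and is
  deterministic. Its loops are bounded by a register that itself has to be computed, which is why
  running time and loop bounds shape the second half.\<close>

definition minor :: "nat \<Rightarrow> (nat \<Rightarrow> nat) \<Rightarrow> (nat \<Rightarrow> nat \<Rightarrow> real) \<Rightarrow> real" where
  "minor s I t = det (mat s s (\<lambda>(a, b). t b (I a)))"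

lemma minor_cong:
  assumes "\<And>a b. a < s \<Longrightarrow> b < s \<Longrightarrow> t b (I a) = t' b (I' a)"
  shows "minor s I t = minor s I' t'"
  unfolding minor_def by (rule arg_cong[where f = det], rule eq_matI) (use assms in auto)

lemma permutes_less_upt: "(\<pi> :: nat \<Rightarrow> nat) permutes {0..<s} \<Longrightarrow> a < s \<Longrightarrow> \<pi> a < s"
  using permutes_in_image[of \<pi> "{0..<s}" a] by simp

text \<open>Every estimate on minors is made term by term in this sum: size in
  \<open>minor_bound\<close>, integrality in \<open>minor_Ints\<close>, stability under perturbation
  of the entries in \<open>cost_lower_bound\<close>.\<close>

lemma minor_Leibniz:
  "minor s I t = (\<Sum>\<pi>\<in>{\<pi>. \<pi> permutes {0..<s}}. signof \<pi> * (\<Prod>a = 0..<s. t (\<pi> a) (I a)))"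
  unfolding minor_def
  by (subst det_def'[where n = s]) (auto intro!: sum.cong prod.cong simp: permutes_less_upt)

lemma minor_bound:
  assumes "\<And>a b. a < s \<Longrightarrow> b < s \<Longrightarrow> \<bar>t b (I a)\<bar> \<le> M"
  shows "\<bar>minor s I t\<bar> \<le> fact s * M ^ s"
proof -
  have "\<bar>minor s I t\<bar> \<le> (\<Sum>\<pi>\<in>{\<pi>. \<pi> permutes {0..<s}}. \<bar>signof \<pi> * (\<Prod>a = 0..<s. t (\<pi> a) (I a))\<bar>)"
    unfolding minor_Leibniz by (rule sum_abs)
  also have "\<dots> \<le> (\<Sum>\<pi>\<in>{\<pi>. \<pi> permutes {0..<s}}. M ^ s)"
  proof (rule sum_mono)
    fix \<pi> assume \<pi>: "\<pi> \<in> {\<pi>. \<pi> permutes {0..<s}}"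
    have "\<bar>signof \<pi> * (\<Prod>a = 0..<s. t (\<pi> a) (I a))\<bar> = (\<Prod>a = 0..<s. \<bar>t (\<pi> a) (I a)\<bar>)"
      by (simp add: abs_mult abs_prod sign_def)
    also have "\<dots> \<le> (\<Prod>a = 0..<s. M)"
      by (rule prod_mono) (use assms \<pi> in \<open>auto simp: permutes_less_upt\<close>)
    finally show "\<bar>signof \<pi> * (\<Prod>a = 0..<s. t (\<pi> a) (I a))\<bar> \<le> M ^ s" by simp
  qed
  also have "\<dots> = fact s * M ^ s" by (simp add: card_permutations)
  finally show ?thesis .
qed

lemma minor_Ints:
  assumes "\<And>a b. a < s \<Longrightarrow> b < s \<Longrightarrow> t b (I a) \<in> \<int>"
  shows "minor s I t \<in> \<int>"
  unfolding minor_Leibniz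
  by (intro Ints_sum Ints_mult Ints_prod) (use assms in \<open>auto simp: permutes_less_upt sign_def\<close>)

text \<open>Laplace expansion along the new row. The cofactors involve only the rows
  \<open>I\<close> and so do not depend on \<open>i\<close>: when the left side vanishes for all
  \<open>i\<close>, this one identity writes the whole column \<open>y\<close> as a combination of
  the \<open>t b\<close>, with the same coefficients in every row.\<close>

lemma minor_bordered:
  "minor (Suc s) (I(s := i)) (t(s := y)) =
     y i * minor s I t + (\<Sum>b<s. t b i * ((-1) ^ (s + b) * minor s I (\<lambda>b'. (t(s := y)) (if b' < b then b' else Suc b'))))"
proof -
  let ?A = "mat (Suc s) (Suc s) (\<lambda>(a, b). (t(s := y)) b ((I(s := i)) a))"
  have A: "?A \<in> carrier_mat (Suc s) (Suc s)" by simp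
  have del: "det (mat_delete ?A s b) = minor s I (\<lambda>b'. (t(s := y)) (if b' < b then b' else Suc b'))" if "b < Suc s" for b
    unfolding minor_def mat_delete_def by (rule arg_cong[where f = det], rule eq_matI) (use that in auto)
  have "minor (Suc s) (I(s := i)) (t(s := y)) = (\<Sum>b<Suc s. ?A $$ (s, b) * cofactor ?A s b)"
    unfolding minor_def by (rule laplace_expansion_row[OF A]) simp
  also have "\<dots> = (\<Sum>b<Suc s. (t(s := y)) b i * ((-1) ^ (s + b) * minor s I (\<lambda>b'. (t(s := y)) (if b' < b then b' else Suc b'))))"
    by (rule sum.cong) (auto simp: cofactor_def del fun_upd_same simp del: fun_upd_apply)
  also have "\<dots> = y i * minor s I (\<lambda>b'. (t(s := y)) (if b' < s then b' else Suc b')) +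
     (\<Sum>b<s. t b i * ((-1) ^ (s + b) * minor s I (\<lambda>b'. (t(s := y)) (if b' < b then b' else Suc b'))))"
  proof -
    have "(\<Sum>b<s. (t(s := y)) b i * ((-1) ^ (s + b) * minor s I (\<lambda>b'. (t(s := y)) (if b' < b then b' else Suc b')))) =
      (\<Sum>b<s. t b i * ((-1) ^ (s + b) * minor s I (\<lambda>b'. (t(s := y)) (if b' < b then b' else Suc b'))))"
      by (rule sum.cong) auto
    moreover have "(-1 :: real) ^ (s + s) = 1" by simp
    ultimately show ?thesis unfolding sum.lessThan_Suc by (simp only: fun_upd_same)
  qed
  also have "minor s I (\<lambda>b'. (t(s := y)) (if b' < s then b' else Suc b')) = minor s I t"
    by (rule minor_cong) auto
  finally show ?thesis .
qed

text \<open>Both factors are padded with zeros to order \<open>Suc k\<close>; the padded right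
  factor has a zero row, so its determinant vanishes.\<close>

lemma minor_rank:
  assumes "\<And>a b. a < Suc k \<Longrightarrow> b < Suc k \<Longrightarrow> t b (I a) = (\<Sum>l<k. P a l * Q l b)"
  shows "minor (Suc k) I t = 0"
proof -
  let ?P = "mat (Suc k) (Suc k) (\<lambda>(a, l). if l < k then P a l else 0)"
  let ?Q = "mat (Suc k) (Suc k) (\<lambda>(l, b). if l < k then Q l b else 0)"
  have "mat (Suc k) (Suc k) (\<lambda>(a, b). t b (I a)) = ?P * ?Q"
    by (rule eq_matI) (auto simp: assms scalar_prod_def sum.atLeast0_lessThan_Suc lessThan_atLeast0 intro!: sum.cong)
  then have "minor (Suc k) I t = det ?P * det ?Q" unfolding minor_def by (simp add: det_mult[of _ "Suc k"])
  also have "det ?Q = (\<Sum>b<Suc k. ?Q $$ (k, b) * cofactor ?Q k b)" by (rule laplace_expansion_row) auto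
  also have "\<dots> = 0" by (rule sum.neutral) auto
  finally show ?thesis by simp
qed

text \<open>Up to a factor 2, \<open>t\<close> maximizes a minor of maximal size; Cramer's rule, in the form of the
  vanishing of all bordered minors, then expresses every element of \<open>T\<close> with small coefficients.\<close>

lemma spanner:
  assumes bdd: "\<And>y i. y \<in> T \<Longrightarrow> i < n \<Longrightarrow> \<bar>y i\<bar> \<le> M"
    and rank: "\<And>I t. (\<And>b. b < Suc k \<Longrightarrow> t b \<in> T) \<Longrightarrow> (\<And>a. a < Suc k \<Longrightarrow> I a < n) \<Longrightarrow> minor (Suc k) I t = 0"
  obtains t :: "nat \<Rightarrow> nat \<Rightarrow> real" and D :: real and s where
    "\<And>b. b < k \<Longrightarrow> t b \<in> T \<or> t b = (\<lambda>_. 0)" "D \<noteq> 0" "s \<le> k" "\<bar>D\<bar> \<le> fact s * M ^ s"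
    "(\<And>y i. y \<in> T \<Longrightarrow> i < n \<Longrightarrow> y i \<in> \<int>) \<Longrightarrow> D \<in> \<int>"
    "\<And>y. y \<in> T \<Longrightarrow> \<exists>N. (\<forall>b<k. \<bar>N b\<bar> \<le> 2 * \<bar>D\<bar>) \<and> (\<forall>i<n. y i * D = (\<Sum>b<k. N b * t b i)) \<and>
       ((\<forall>y\<in>T. \<forall>i<n. y i \<in> \<int>) \<longrightarrow> (\<forall>b<k. N b \<in> \<int>))"
proof -
  define ok where "ok s \<longleftrightarrow> (\<exists>I t. (\<forall>b<s. t b \<in> T) \<and> (\<forall>a<s. I a < n) \<and> minor s I t \<noteq> 0)" for s
  \<comment> \<open>The empty determinant is 1, so a largest \<open>s\<close> exists even when
    \<open>T\<close> is empty or contains only zero.\<close>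
  have "ok 0" unfolding ok_def minor_def by (intro exI[of _ "\<lambda>_. 0"] exI[of _ "\<lambda>_ _. 0"]) auto
  moreover have "\<not> ok (Suc k)" unfolding ok_def using rank by blast
  ultimately obtain s where s: "s \<le> k" "ok s" "\<not> ok (Suc s)"
  proof -
    assume a: "\<not> ok (Suc k)" "ok 0" and that: "\<And>s. s \<le> k \<Longrightarrow> ok s \<Longrightarrow> \<not> ok (Suc s) \<Longrightarrow> thesis"
    define m where "m = (LEAST m. \<not> ok m)"
    have m: "\<not> ok m" "m \<le> Suc k" using a LeastI[of "\<lambda>m. \<not> ok m"] Least_le[of "\<lambda>m. \<not> ok m"] unfolding m_def by auto
    then obtain m' where m': "m = Suc m'" using a by (cases m) auto
    have "ok m'" using not_less_Least[of m' "\<lambda>m. \<not> ok m"] m' unfolding m_def by auto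
    then show thesis using that[of m'] m m' by auto
  qed
  from s(2) obtain I t0 where I: "\<forall>a<s. I a < n" and t0: "\<forall>b<s. t0 b \<in> T" "minor s I t0 \<noteq> 0" unfolding ok_def by blast
  \<comment> \<open>The rows \<open>I\<close> stay fixed while the columns range over the possibly
    infinite set \<open>T\<close>. Taking a value above half the supremum avoids the question
    whether it is attained.\<close>
  define V where "V = {\<bar>minor s I t\<bar> | t. \<forall>b<s. t b \<in> T}"
  have Vb: "v \<le> fact s * M ^ s" if "v \<in> V" for v using that I bdd unfolding V_def by (auto intro!: minor_bound)
  have bV: "bdd_above V" using Vb by (rule bdd_aboveI)
  have in0: "\<bar>minor s I t0\<bar> \<in> V" using t0 unfolding V_def by blast
  have "0 < Sup V" using cSup_upper[OF in0 bV] t0 by linarith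
  then have "Sup V / 2 < Sup V" by simp
  then obtain v where v: "v \<in> V" "Sup V / 2 < v" using less_cSupD[of V "Sup V / 2"] in0 by blast
  then obtain t where t: "\<forall>b<s. t b \<in> T" "Sup V / 2 < \<bar>minor s I t\<bar>" unfolding V_def by blast
  define D where "D = minor s I t"
  have D0: "D \<noteq> 0" using t \<open>0 < Sup V\<close> by (auto simp: D_def)
  have le: "\<bar>minor s I t'\<bar> \<le> 2 * \<bar>D\<bar>" if "\<forall>b<s. t' b \<in> T" for t'
  proof -
    have "\<bar>minor s I t'\<bar> \<in> V" using that unfolding V_def by blast
    then show ?thesis using cSup_upper[OF _ bV] t(2) unfolding D_def by force
  qed
  \<comment> \<open>Zero columns fill the family up to length \<open>k\<close>; their coefficients
    \<open>N b\<close> are zero as well.\<close>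
  define tt where "tt b = (if b < s then t b else (\<lambda>_. 0))" for b
  show ?thesis
  proof (rule that[of tt D s])
    show "tt b \<in> T \<or> tt b = (\<lambda>_. 0)" for b using t by (auto simp: tt_def)
    show "\<bar>D\<bar> \<le> fact s * M ^ s" unfolding D_def by (rule minor_bound) (use t I bdd in auto)
    show "D \<in> \<int>" if "\<And>y i. y \<in> T \<Longrightarrow> i < n \<Longrightarrow> y i \<in> \<int>"
      unfolding D_def by (rule minor_Ints) (use t I that in auto)
    fix y assume y: "y \<in> T"
    define t' where "t' b = (\<lambda>b'. (t(s := y)) (if b' < b then b' else Suc b'))" for b
    \<comment> \<open>Up to sign these are minors of order \<open>s\<close> with columns from
      \<open>T\<close> in which one \<open>t b\<close> has given way to \<open>y\<close>: hence the
      bound by twice \<bar>D\<bar>, and integrality when \<open>T\<close> is integral.\<close>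
    define N where "N b = (if b < s then - ((-1) ^ (s + b) * minor s I (t' b)) else 0)" for b
    have t': "\<forall>b'<s. t' b b' \<in> T" for b
      using t y unfolding t'_def by auto
    have aN: "\<bar>N b\<bar> \<le> 2 * \<bar>D\<bar>" for b using le[OF t'] by (auto simp: N_def abs_mult)
    have "y i * D = (\<Sum>b<k. N b * tt b i)" if i: "i < n" for i
    proof -
      have "\<forall>b<Suc s. (t(s := y)) b \<in> T" "\<forall>a<Suc s. (I(s := i)) a < n" using t y I i by auto
      then have "minor (Suc s) (I(s := i)) (t(s := y)) = 0" using s(3) unfolding ok_def by blast
      then have "y i * D + (\<Sum>b<s. t b i * ((-1) ^ (s + b) * minor s I (t' b))) = 0"
        unfolding minor_bordered t'_def[symmetric] D_def[symmetric] .
      then have "y i * D = (\<Sum>b<s. N b * tt b i)" by (simp add: N_def tt_def sum_negf mult.commute)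
      also have "\<dots> = (\<Sum>b<k. N b * tt b i)" using s(1) by (intro sum.mono_neutral_left) (auto simp: N_def)
      finally show ?thesis .
    qed
    moreover have "N b \<in> \<int>" if "\<forall>y\<in>T. \<forall>i<n. y i \<in> \<int>" for b
      unfolding N_def using t' I that by (auto intro!: Ints_mult minor_Ints)
    ultimately show "\<exists>N. (\<forall>b<k. \<bar>N b\<bar> \<le> 2 * \<bar>D\<bar>) \<and> (\<forall>i<n. y i * D = (\<Sum>b<k. N b * tt b i)) \<and>
       ((\<forall>y\<in>T. \<forall>i<n. y i \<in> \<int>) \<longrightarrow> (\<forall>b<k. N b \<in> \<int>))"
      using aN by blast
  qed (use D0 s in auto)
qed

section \<open>The power function and finite expectations\<close>

text \<open>Bounding both terms by the larger one treats the subadditive range \<open>p < 1\<close>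
  and the convex range \<open>p > 1\<close> alike; the factor 4 is \<open>2 powr 2\<close>.\<close>

lemma abs_powr_add_le:
  fixes a b p :: real
  assumes "0 < p" "p \<le> 2"
  shows "\<bar>a + b\<bar> powr p \<le> 4 * (\<bar>a\<bar> powr p + \<bar>b\<bar> powr p)"
proof -
  let ?m = "max \<bar>a\<bar> \<bar>b\<bar>"
  have "\<bar>a + b\<bar> powr p \<le> (2 * ?m) powr p" using assms by (intro powr_mono2) auto
  also have "\<dots> = 2 powr p * ?m powr p" by (simp add: powr_mult)
  also have "\<dots> \<le> 2 powr 2 * ?m powr p" using assms by (intro mult_right_mono powr_mono) auto
  also have "?m powr p \<le> \<bar>a\<bar> powr p + \<bar>b\<bar> powr p" by (auto simp: max_def)
  finally show ?thesis by simp
qed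

text \<open>Two regimes. If \<bar>b\<bar> is at most \<open>\<eta> / 4\<close> times \<bar>a\<bar>,
  the ratio of the two powers lies between the squares of \<open>1 - \<eta> / 4\<close> and
  \<open>1 + \<eta> / 4\<close>, hence within \<open>\<eta>\<close> of 1. Otherwise \<bar>a\<bar>
  and \<bar>a + b\<bar> are both at most \<open>5 / \<eta>\<close> times \<bar>b\<bar>, and the
  square of \<open>5 / \<eta>\<close> gives the constant. It takes the place of the triangle
  inequality wherever the main term must keep a factor close to 1.\<close>

lemma abs_powr_diff_le:
  fixes a b p \<eta> :: real
  assumes "0 < p" "p \<le> 2" "0 < \<eta>" "\<eta> \<le> 1"
  shows "\<bar>\<bar>a + b\<bar> powr p - \<bar>a\<bar> powr p\<bar> \<le> \<eta> * \<bar>a\<bar> powr p + 25 / \<eta>\<^sup>2 * \<bar>b\<bar> powr p"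
proof (cases "\<bar>b\<bar> \<le> \<eta> / 4 * \<bar>a\<bar>")
  case True
  have pa: "0 \<le> \<bar>a\<bar> powr p" and pb: "0 \<le> 25 / \<eta>\<^sup>2 * \<bar>b\<bar> powr p" using assms by auto
  have up: "\<bar>a + b\<bar> \<le> (1 + \<eta> / 4) * \<bar>a\<bar>" and lo: "(1 - \<eta> / 4) * \<bar>a\<bar> \<le> \<bar>a + b\<bar>"
    using True by (auto simp: algebra_simps)
  have e4: "0 < 1 - \<eta> / 4" using assms by auto
  have "\<bar>a + b\<bar> powr p \<le> ((1 + \<eta> / 4) * \<bar>a\<bar>) powr p"
    using up assms by (intro powr_mono2) auto
  also have "\<dots> = (1 + \<eta> / 4) powr p * \<bar>a\<bar> powr p" using assms by (simp add: powr_mult)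
  also have "\<dots> \<le> (1 + \<eta> / 4) powr 2 * \<bar>a\<bar> powr p" using assms by (intro mult_right_mono powr_mono) auto
  also have "(1 + \<eta> / 4) powr 2 = (1 + \<eta> / 4)\<^sup>2" using assms by simp
  also have "(1 + \<eta> / 4)\<^sup>2 * \<bar>a\<bar> powr p \<le> (1 + \<eta>) * \<bar>a\<bar> powr p"
  proof (rule mult_right_mono[OF _ pa])
    have "\<eta> * \<eta> \<le> \<eta>" using assms by (simp add: mult_left_le)
    moreover have "(1 + \<eta> / 4)\<^sup>2 = 1 + \<eta> / 2 + \<eta> * \<eta> / 16" by (simp add: power2_eq_square algebra_simps)
    ultimately show "(1 + \<eta> / 4)\<^sup>2 \<le> 1 + \<eta>" using assms by linarith
  qed
  finally have 1: "\<bar>a + b\<bar> powr p \<le> (1 + \<eta>) * \<bar>a\<bar> powr p" .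
  have "(1 - \<eta>) * \<bar>a\<bar> powr p \<le> (1 - \<eta> / 4)\<^sup>2 * \<bar>a\<bar> powr p"
    by (rule mult_right_mono[OF _ pa]) (use assms in \<open>simp add: power2_eq_square algebra_simps\<close>)
  also have "(1 - \<eta> / 4)\<^sup>2 = (1 - \<eta> / 4) powr 2" using e4 by simp
  also have "(1 - \<eta> / 4) powr 2 * \<bar>a\<bar> powr p \<le> (1 - \<eta> / 4) powr p * \<bar>a\<bar> powr p"
    using assms e4 by (intro mult_right_mono powr_mono') auto
  also have "\<dots> = ((1 - \<eta> / 4) * \<bar>a\<bar>) powr p" using e4 by (simp add: powr_mult)
  also have "\<dots> \<le> \<bar>a + b\<bar> powr p" using lo e4 assms by (intro powr_mono2) auto
  finally have 2: "(1 - \<eta>) * \<bar>a\<bar> powr p \<le> \<bar>a + b\<bar> powr p" .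
  have "\<bar>a + b\<bar> powr p \<le> \<bar>a\<bar> powr p + \<eta> * \<bar>a\<bar> powr p" "\<bar>a\<bar> powr p - \<eta> * \<bar>a\<bar> powr p \<le> \<bar>a + b\<bar> powr p"
    using 1 2 by (simp_all add: algebra_simps)
  then show ?thesis using pb by (intro abs_leI) linarith+
next
  case False
  then have a: "\<bar>a\<bar> \<le> 4 / \<eta> * \<bar>b\<bar>" using assms by (simp add: field_simps)
  have "1 \<le> 1 / \<eta>" using assms by simp
  then have b: "\<bar>b\<bar> \<le> 1 / \<eta> * \<bar>b\<bar>" using mult_right_mono[of 1 "1 / \<eta>" "\<bar>b\<bar>"] by simp
  have bnd: "x powr p \<le> 25 / \<eta>\<^sup>2 * \<bar>b\<bar> powr p" if "0 \<le> x" "x \<le> 5 / \<eta> * \<bar>b\<bar>" for x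
  proof -
    have "x powr p \<le> (5 / \<eta> * \<bar>b\<bar>) powr p" using that assms by (intro powr_mono2) auto
    also have "\<dots> = (5 / \<eta>) powr p * \<bar>b\<bar> powr p" by (rule powr_mult)
    also have "\<dots> \<le> (5 / \<eta>) powr 2 * \<bar>b\<bar> powr p" using assms by (intro mult_right_mono powr_mono) auto
    also have "(5 / \<eta>) powr 2 = 25 / \<eta>\<^sup>2" using assms by (simp add: power_divide)
    finally show ?thesis .
  qed
  have "\<bar>a\<bar> \<le> 5 / \<eta> * \<bar>b\<bar>" "\<bar>a + b\<bar> \<le> 5 / \<eta> * \<bar>b\<bar>" 
  proof -
    have "5 / \<eta> * \<bar>b\<bar> = 4 / \<eta> * \<bar>b\<bar> + 1 / \<eta> * \<bar>b\<bar>" by (simp add: add_divide_distrib[symmetric] ring_distribs(2)[symmetric])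
    then show "\<bar>a\<bar> \<le> 5 / \<eta> * \<bar>b\<bar>" "\<bar>a + b\<bar> \<le> 5 / \<eta> * \<bar>b\<bar>" using a b by linarith+
  qed
  from bnd[OF _ this(1)] bnd[OF _ this(2)]
  have 1: "\<bar>a\<bar> powr p \<le> 25 / \<eta>\<^sup>2 * \<bar>b\<bar> powr p" "\<bar>a + b\<bar> powr p \<le> 25 / \<eta>\<^sup>2 * \<bar>b\<bar> powr p" by auto
  have 2: "0 \<le> \<bar>a\<bar> powr p" "0 \<le> \<bar>a + b\<bar> powr p" "0 \<le> \<eta> * \<bar>a\<bar> powr p" using assms by auto
  show ?thesis using 1 2 by (intro abs_leI) linarith+
qed

text \<open>The sum is at most \<open>k\<close> times its largest term, and for
  \<open>k \<ge> 1\<close> the \<open>p\<close>-th power of \<open>k\<close> is at most its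
  square.\<close>

lemma abs_powr_lincomb_le:
  fixes c b :: "nat \<Rightarrow> real"
  assumes "0 < p" "p \<le> 2" "\<And>l. l < k \<Longrightarrow> \<bar>c l\<bar> powr p \<le> M"
  shows "\<bar>\<Sum>l<k. c l * b l\<bar> powr p \<le> (real k)\<^sup>2 * M * (\<Sum>l<k. \<bar>b l\<bar> powr p)"
proof (cases "k = 0")
  case False
  define m where "m = Max ((\<lambda>l. \<bar>c l * b l\<bar>) ` {..<k})"
  have fin: "finite ((\<lambda>l. \<bar>c l * b l\<bar>) ` {..<k})" and ne: "(\<lambda>l. \<bar>c l * b l\<bar>) ` {..<k} \<noteq> {}" using False by auto
  obtain l0 where l0: "l0 < k" "m = \<bar>c l0 * b l0\<bar>" using Max_in[OF fin ne] unfolding m_def by auto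
  have le: "\<bar>c l * b l\<bar> \<le> m" if "l < k" for l using Max_ge[OF fin] that unfolding m_def by auto
  have "\<bar>\<Sum>l<k. c l * b l\<bar> \<le> (\<Sum>l<k. \<bar>c l * b l\<bar>)" by (rule sum_abs)
  also have "\<dots> \<le> (\<Sum>l<k. m)" by (rule sum_mono) (use le in auto)
  finally have "\<bar>\<Sum>l<k. c l * b l\<bar> powr p \<le> (real k * m) powr p" using assms by (intro powr_mono2) auto
  also have "\<dots> = real k powr p * (\<bar>c l0\<bar> powr p * \<bar>b l0\<bar> powr p)" using l0 by (simp add: powr_mult abs_mult)
  also have "\<dots> \<le> real k powr 2 * (M * (\<Sum>l<k. \<bar>b l\<bar> powr p))"
  proof (intro mult_mono powr_mono)
    show "\<bar>b l0\<bar> powr p \<le> (\<Sum>l<k. \<bar>b l\<bar> powr p)" using l0 by (intro member_le_sum) auto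
    show "0 \<le> M" using assms(3)[OF l0(1)] powr_ge_zero order_trans by blast
  qed (use assms l0 False in \<open>auto intro!: sum_nonneg\<close>)
  finally show ?thesis using False by (simp add: mult.assoc)
qed (use assms in simp)

lemma exp_le_quadratic:
  fixes x :: real assumes "\<bar>x\<bar> \<le> 1" shows "exp x \<le> 1 + x + x\<^sup>2"
proof (cases "0 \<le> x")
  case True then show ?thesis using exp_bound[of x] assms by auto
next
  case False
  define y where "y = -x"
  have y: "0 \<le> y" "y \<le> 1" using False assms by (auto simp: y_def)
  \<comment> \<open>The product equals \<open>1 + y ^ 3\<close>.\<close>
  have "1 \<le> (1 - y + y\<^sup>2) * (1 + y)" using y by (simp add: algebra_simps power2_eq_square)
  also have "\<dots> \<le> (1 - y + y\<^sup>2) * exp y"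
    using y exp_ge_add_one_self[of y] by (intro mult_left_mono) auto
  finally have "exp (- y) \<le> 1 - y + y\<^sup>2" by (simp add: exp_minus field_simps)
  then show ?thesis by (simp add: y_def)
qed

section \<open>Expectations over independent draws from a finite distribution\<close>

definition expect :: "nat \<Rightarrow> (nat \<Rightarrow> real) \<Rightarrow> nat \<Rightarrow> ((nat \<Rightarrow> nat) \<Rightarrow> real) \<Rightarrow> real" where
  "expect n q r f = (\<Sum>\<omega>\<in>PiE {..<r} (\<lambda>_. {..<n}). (\<Prod>t<r. q (\<omega> t)) * f \<omega>)"

text \<open>Independence of the draws. The rules for one and for two coordinates follow by putting
  the constant 1 at all other positions, and exponential moments factorize in the same way.\<close>

lemma expect_prod: "expect n q r (\<lambda>\<omega>. \<Prod>t<r. F t (\<omega> t)) = (\<Prod>t<r. \<Sum>i<n. q i * F t i)"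
  unfolding expect_def by (subst prod_sum_PiE) (auto simp: prod.distrib)

lemma expect_add: "expect n q r (\<lambda>\<omega>. f \<omega> + g \<omega>) = expect n q r f + expect n q r g"
  by (simp add: expect_def algebra_simps sum.distrib)

lemma expect_cmult: "expect n q r (\<lambda>\<omega>. c * f \<omega>) = c * expect n q r f"
  by (simp add: expect_def algebra_simps sum_distrib_left)

lemma expect_sum: "expect n q r (\<lambda>\<omega>. \<Sum>j\<in>J. f j \<omega>) = (\<Sum>j\<in>J. expect n q r (f j))"
  unfolding expect_def by (simp add: sum_distrib_left) (rule sum.swap)

lemma expect_mono:
  assumes "\<And>i. i < n \<Longrightarrow> 0 \<le> q i" "\<And>\<omega>. \<omega> \<in> PiE {..<r} (\<lambda>_. {..<n}) \<Longrightarrow> f \<omega> \<le> g \<omega>"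
  shows "expect n q r f \<le> expect n q r g"
  unfolding expect_def using assms by (intro sum_mono mult_left_mono prod_nonneg) (auto simp: PiE_iff)

lemma expect_1:
  assumes "(\<Sum>i<n. q i) = 1" shows "expect n q r (\<lambda>\<omega>. c) = c"
  using expect_prod[of n q r "\<lambda>_ _. 1"] expect_cmult[of n q r c "\<lambda>_. 1"] assms by simp

lemma expect_single:
  assumes "(\<Sum>i<n. q i) = 1" "t < r"
  shows "expect n q r (\<lambda>\<omega>. \<phi> (\<omega> t)) = (\<Sum>i<n. q i * \<phi> i)"
proof -
  have "(\<Prod>u<r. if u = t then \<phi> (\<omega> u) else 1) = \<phi> (\<omega> t)" for \<omega> using assms(2) by simp
  then have "expect n q r (\<lambda>\<omega>. \<phi> (\<omega> t)) = expect n q r (\<lambda>\<omega>. \<Prod>u<r. (\<lambda>u i. if u = t then \<phi> i else 1) u (\<omega> u))"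
    by simp
  also have "\<dots> = (\<Prod>u<r. if u = t then (\<Sum>i<n. q i * \<phi> i) else 1)"
    unfolding expect_prod[of n q r "\<lambda>u i. if u = t then \<phi> i else 1"] by (rule prod.cong) (auto simp: assms)
  finally show ?thesis using assms(2) by simp
qed

lemma expect_pair:
  assumes "(\<Sum>i<n. q i) = 1" "t < r" "s < r" "s \<noteq> t"
  shows "expect n q r (\<lambda>\<omega>. \<phi> (\<omega> t) * \<chi> (\<omega> s)) = (\<Sum>i<n. q i * \<phi> i) * (\<Sum>i<n. q i * \<chi> i)"
proof -
  have two: "(\<Prod>u<r. if u = t then (x::real) else if u = s then y else 1) = x * y" for x y
  proof -
    have "(\<Prod>u<r. if u = t then x else if u = s then y else 1) = (\<Prod>u<r. (if u = t then x else 1) * (if u = s then y else 1))"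
      by (rule prod.cong) (use assms in auto)
    then show ?thesis using assms by (simp add: prod.distrib)
  qed
  have "(\<lambda>\<omega>. \<phi> (\<omega> t) * \<chi> (\<omega> s)) = (\<lambda>\<omega>. \<Prod>u<r. (\<lambda>u i. if u = t then \<phi> i else if u = s then \<chi> i else 1) u (\<omega> u))"
  proof
    fix \<omega> :: "nat \<Rightarrow> nat"
    have "(\<Prod>u<r. if u = t then \<phi> (\<omega> u) else if u = s then \<chi> (\<omega> u) else 1) = (\<Prod>u<r. if u = t then \<phi> (\<omega> t) else if u = s then \<chi> (\<omega> s) else 1)"
      by (rule prod.cong) auto
    then show "\<phi> (\<omega> t) * \<chi> (\<omega> s) = (\<Prod>u<r. (\<lambda>u i. if u = t then \<phi> i else if u = s then \<chi> i else 1) u (\<omega> u))"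
      unfolding two by simp
  qed
  then have "expect n q r (\<lambda>\<omega>. \<phi> (\<omega> t) * \<chi> (\<omega> s)) = (\<Prod>u<r. if u = t then (\<Sum>i<n. q i * \<phi> i) else if u = s then (\<Sum>i<n. q i * \<chi> i) else 1)"
    by (simp only: expect_prod[of n q r "\<lambda>u i. if u = t then \<phi> i else if u = s then \<chi> i else 1"])
      (rule prod.cong, auto simp: assms)
  then show ?thesis unfolding two .
qed

lemma expect_sample_sum:
  assumes "(\<Sum>i<n. q i) = 1"
  shows "expect n q r (\<lambda>\<omega>. \<Sum>t<r. \<phi> (\<omega> t)) = real r * (\<Sum>i<n. q i * \<phi> i)"
  unfolding expect_sum using expect_single[OF assms] by simp

text \<open>After centring \<open>\<phi>\<close>, independence leaves only the diagonal of the
  double sum; the subtracted square of the mean is then dropped.\<close>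

lemma expect_variance:
  assumes q: "(\<Sum>i<n. q i) = 1" "\<And>i. i < n \<Longrightarrow> 0 \<le> q i"
  shows "expect n q r (\<lambda>\<omega>. ((\<Sum>t<r. \<phi> (\<omega> t)) - real r * (\<Sum>i<n. q i * \<phi> i))\<^sup>2) \<le> real r * (\<Sum>i<n. q i * (\<phi> i)\<^sup>2)"
proof -
  define \<mu> where "\<mu> = (\<Sum>i<n. q i * \<phi> i)"
  define \<psi> where "\<psi> i = \<phi> i - \<mu>" for i
  have "(\<Sum>i<n. q i * \<mu>) = \<mu>" by (simp add: sum_distrib_right[symmetric] q)
  then have m0: "(\<Sum>i<n. q i * \<psi> i) = 0" by (simp add: \<psi>_def right_diff_distrib sum_subtractf) (simp add: \<mu>_def)
  have "((\<Sum>t<r. \<phi> (\<omega> t)) - real r * \<mu>)\<^sup>2 = (\<Sum>t<r. \<Sum>s<r. \<psi> (\<omega> t) * \<psi> (\<omega> s))" for \<omega>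
  proof -
    have "(\<Sum>t<r. \<phi> (\<omega> t)) - real r * \<mu> = (\<Sum>t<r. \<psi> (\<omega> t))" by (simp add: \<psi>_def sum_subtractf)
    then show ?thesis by (simp add: power2_eq_square sum_product)
  qed
  then have "expect n q r (\<lambda>\<omega>. ((\<Sum>t<r. \<phi> (\<omega> t)) - real r * \<mu>)\<^sup>2) = (\<Sum>t<r. \<Sum>s<r. expect n q r (\<lambda>\<omega>. \<psi> (\<omega> t) * \<psi> (\<omega> s)))"
    by (simp add: expect_sum)
  also have "\<dots> = (\<Sum>t<r. \<Sum>s<r. if s = t then (\<Sum>i<n. q i * (\<psi> i)\<^sup>2) else 0)"
  proof (intro sum.cong refl)
    fix t s assume "t \<in> {..<r}" "s \<in> {..<r}"
    then show "expect n q r (\<lambda>\<omega>. \<psi> (\<omega> t) * \<psi> (\<omega> s)) = (if s = t then \<Sum>i<n. q i * (\<psi> i)\<^sup>2 else 0)"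
      using expect_pair[OF q(1), of t r s \<psi> \<psi>] expect_single[OF q(1), of t r "\<lambda>i. \<psi> i * \<psi> i"] m0
      by (auto simp: power2_eq_square)
  qed
  also have "\<dots> = real r * (\<Sum>i<n. q i * (\<psi> i)\<^sup>2)" by simp
  also have "(\<Sum>i<n. q i * (\<psi> i)\<^sup>2) = (\<Sum>i<n. q i * (\<phi> i)\<^sup>2) - \<mu>\<^sup>2"
  proof -
    have "(\<Sum>i<n. q i * (\<psi> i)\<^sup>2) = (\<Sum>i<n. q i * (\<phi> i)\<^sup>2 - 2 * \<mu> * (q i * \<phi> i) + \<mu>\<^sup>2 * q i)"
      by (rule sum.cong) (auto simp: \<psi>_def power2_eq_square algebra_simps)
    also have "\<dots> = (\<Sum>i<n. q i * (\<phi> i)\<^sup>2) - 2 * \<mu> * \<mu> + \<mu>\<^sup>2"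
      by (simp add: sum.distrib sum_subtractf \<mu>_def q flip: sum_distrib_left)
    finally show ?thesis by (simp add: power2_eq_square)
  qed
  also have "real r * ((\<Sum>i<n. q i * (\<phi> i)\<^sup>2) - \<mu>\<^sup>2) \<le> real r * (\<Sum>i<n. q i * (\<phi> i)\<^sup>2)"
    by (intro mult_left_mono) auto
  finally show ?thesis by (simp add: \<mu>_def)
qed

text \<open>Chernoff's method: the quadratic bound on \<open>exp\<close> limits the exponential
  moment of the centred variable to \<open>exp (4 * a\<^sup>2 * M\<^sup>2)\<close>. The hypothesis
  \<open>s \<le> 4 * M\<close> keeps \<open>\<bar>a * Y i\<bar>\<close> at most 1, the range of that
  quadratic bound.\<close>

lemma expect_exp_upper:
  assumes q: "(\<Sum>i<n. q i) = 1" "\<And>i. i < n \<Longrightarrow> 0 \<le> q i"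
    and X: "\<And>i. i < n \<Longrightarrow> \<bar>X i\<bar> \<le> M" and s: "0 < s" "s \<le> 4 * M" 
  shows "expect n q r (\<lambda>\<omega>. of_bool (real r * s \<le> (\<Sum>t<r. X (\<omega> t)) - real r * (\<Sum>i<n. q i * X i))) \<le> exp (- (real r * s\<^sup>2 / (16 * M\<^sup>2)))"
proof -
  define \<mu> where "\<mu> = (\<Sum>i<n. q i * X i)"
  define Y where "Y i = X i - \<mu>" for i
  \<comment> \<open>This value minimizes the final exponent
    \<open>4 * a\<^sup>2 * M\<^sup>2 - a * s\<close> per draw.\<close>
  define a where "a = s / (8 * M\<^sup>2)"
  have M: "0 < M" using s by auto
  have a: "0 < a" using M s by (simp add: a_def)
  have "\<bar>\<mu>\<bar> \<le> (\<Sum>i<n. \<bar>q i * X i\<bar>)" unfolding \<mu>_def by (rule sum_abs)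
  also have "\<dots> \<le> (\<Sum>i<n. q i * M)" by (rule sum_mono) (use X q in \<open>auto simp: abs_mult intro!: mult_mono\<close>)
  finally have mu: "\<bar>\<mu>\<bar> \<le> M" using q by (simp flip: sum_distrib_right)
  have Y: "\<bar>Y i\<bar> \<le> 2 * M" if "i < n" for i using X[OF that] mu by (auto simp: Y_def)
  have aY: "\<bar>a * Y i\<bar> \<le> 1" if "i < n" for i
  proof -
    have "\<bar>a * Y i\<bar> \<le> a * (2 * M)" using Y[OF that] a by (simp add: abs_mult)
    also have "\<dots> = s / (4 * M)" using M by (simp add: a_def power2_eq_square)
    also have "\<dots> \<le> 1" using s M by simp
    finally show ?thesis .
  qed
  have "(\<Sum>i<n. q i * \<mu>) = \<mu>" by (simp add: sum_distrib_right[symmetric] q)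
  then have Y0: "(\<Sum>i<n. q i * Y i) = 0" by (simp add: Y_def right_diff_distrib sum_subtractf) (simp add: \<mu>_def)
  have mgf: "(\<Sum>i<n. q i * exp (a * Y i)) \<le> exp (4 * a\<^sup>2 * M\<^sup>2)"
  proof -
    have "(\<Sum>i<n. q i * exp (a * Y i)) \<le> (\<Sum>i<n. q i * (1 + a * Y i + a\<^sup>2 * (4 * M\<^sup>2)))"
    proof (rule sum_mono, rule mult_left_mono)
      fix i assume i: "i \<in> {..<n}"
      have "exp (a * Y i) \<le> 1 + a * Y i + (a * Y i)\<^sup>2" using aY i by (intro exp_le_quadratic) auto
      also have "(a * Y i)\<^sup>2 \<le> a\<^sup>2 * (4 * M\<^sup>2)"
        using Y[of i] i power_mono[of "\<bar>Y i\<bar>" "2 * M" 2] by (simp add: power_mult_distrib mult_left_mono)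
      finally show "exp (a * Y i) \<le> 1 + a * Y i + a\<^sup>2 * (4 * M\<^sup>2)" by simp
    qed (use q in auto)
    also have "\<dots> = 1 + a * (\<Sum>i<n. q i * Y i) + a\<^sup>2 * (4 * M\<^sup>2)"
      using q(1) by (simp add: algebra_simps sum.distrib flip: sum_distrib_left sum_distrib_right)
    also have "\<dots> \<le> exp (4 * a\<^sup>2 * M\<^sup>2)"
      using exp_ge_add_one_self[of "4 * a\<^sup>2 * M\<^sup>2"] unfolding Y0 by (simp add: mult_ac)
    finally show ?thesis .
  qed
  have "expect n q r (\<lambda>\<omega>. of_bool (real r * s \<le> (\<Sum>t<r. X (\<omega> t)) - real r * \<mu>)) \<le> expect n q r (\<lambda>\<omega>. exp (- (a * real r * s)) * (\<Prod>t<r. exp (a * Y (\<omega> t))))"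
  proof (rule expect_mono)
    fix \<omega>
    have eq: "exp (- (a * real r * s)) * (\<Prod>t<r. exp (a * Y (\<omega> t))) = exp (a * ((\<Sum>t<r. X (\<omega> t)) - real r * \<mu> - real r * s))"
      by (simp add: Y_def sum_subtractf exp_sum[symmetric] exp_add[symmetric] algebra_simps flip: sum_distrib_left)
    show "of_bool (real r * s \<le> (\<Sum>t<r. X (\<omega> t)) - real r * \<mu>) \<le> exp (- (a * real r * s)) * (\<Prod>t<r. exp (a * Y (\<omega> t)))"
      unfolding eq using a by (auto simp: of_bool_def)
  qed (use q in auto)
  also have "\<dots> = exp (- (a * real r * s)) * (\<Sum>i<n. q i * exp (a * Y i)) ^ r"
    unfolding expect_cmult by (simp add: expect_prod[of n q r "\<lambda>_ i. exp (a * Y i)"])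
  also have "\<dots> \<le> exp (- (a * real r * s)) * exp (4 * a\<^sup>2 * M\<^sup>2) ^ r"
    using mgf q by (intro mult_left_mono power_mono sum_nonneg) auto
  also have "\<dots> = exp (real r * (4 * a\<^sup>2 * M\<^sup>2) - a * real r * s)"
    by (simp add: exp_of_nat_mult[symmetric] exp_add[symmetric])
  also have "real r * (4 * a\<^sup>2 * M\<^sup>2) - a * real r * s = - (real r * s\<^sup>2 / (16 * M\<^sup>2))"
    using M by (simp add: a_def field_simps power2_eq_square)
  finally show ?thesis by (simp add: \<mu>_def)
qed

lemma expect_exp_abs:
  assumes q: "(\<Sum>i<n. q i) = 1" "\<And>i. i < n \<Longrightarrow> 0 \<le> q i"
    and X: "\<And>i. i < n \<Longrightarrow> \<bar>X i\<bar> \<le> M" and s: "0 < s" "s \<le> 4 * M" 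
  shows "expect n q r (\<lambda>\<omega>. of_bool (real r * s \<le> \<bar>(\<Sum>t<r. X (\<omega> t)) - real r * (\<Sum>i<n. q i * X i)\<bar>)) \<le> 2 * exp (- (real r * s\<^sup>2 / (16 * M\<^sup>2)))"
proof -
  have "expect n q r (\<lambda>\<omega>. of_bool (real r * s \<le> \<bar>(\<Sum>t<r. X (\<omega> t)) - real r * (\<Sum>i<n. q i * X i)\<bar>))
    \<le> expect n q r (\<lambda>\<omega>. of_bool (real r * s \<le> (\<Sum>t<r. X (\<omega> t)) - real r * (\<Sum>i<n. q i * X i)) +
        of_bool (real r * s \<le> (\<Sum>t<r. - X (\<omega> t)) - real r * (\<Sum>i<n. q i * (- X i))))"
    by (rule expect_mono) (use q in \<open>auto simp: sum_negf of_bool_def abs_if\<close>)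
  also have "\<dots> \<le> 2 * exp (- (real r * s\<^sup>2 / (16 * M\<^sup>2)))"
  proof -
    have "expect n q r (\<lambda>\<omega>. of_bool (real r * s \<le> (\<Sum>t<r. X (\<omega> t)) - real r * (\<Sum>i<n. q i * X i))) \<le> exp (- (real r * s\<^sup>2 / (16 * M\<^sup>2)))"
      by (rule expect_exp_upper) (use q X s in auto)
    moreover have "expect n q r (\<lambda>\<omega>. of_bool (real r * s \<le> (\<Sum>t<r. - X (\<omega> t)) - real r * (\<Sum>i<n. q i * (- X i)))) \<le> exp (- (real r * s\<^sup>2 / (16 * M\<^sup>2)))"
      by (rule expect_exp_upper) (use q X s in auto)
    ultimately show ?thesis unfolding expect_add by linarith
  qed
  finally show ?thesis .
qed

section \<open>Sampling rows\<close>

text \<open>The family \<open>b\<close> stands for a spanning family of the column space, and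
  \<open>q\<close> dominates its sensitivities up to the factor \<open>2 * k\<close>. One large
  parameter \<open>z\<close> measures all errors: constants and \<open>k\<close> are absorbed into a
  further power of it. In the bound on \<open>r\<close>, the factor \<open>z powr (44 / p)\<close>
  pays for the fineness of a grid in coefficient space, which grows as \<open>p\<close> tends to
  0.\<close>

locale sampling =
  fixes p z :: real and n k r :: nat and b :: "nat \<Rightarrow> nat \<Rightarrow> real" and q :: "nat \<Rightarrow> real"
  assumes p0: "0 < p" and p2: "p \<le> 2" and z: "10000 \<le> z" and kz: "2 * real k \<le> z"
    and q0: "\<And>i. i < n \<Longrightarrow> 0 < q i" and q1: "(\<Sum>i<n. q i) = 1"
    and psi: "\<And>i. i < n \<Longrightarrow> (\<Sum>l<k. \<bar>b l i\<bar> powr p) \<le> 2 * real k * q i"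
    and r: "z ^ 60 * z powr (44 / p) \<le> real r"
begin

abbreviation "EE \<equiv> expect n q r"
abbreviation "\<Omega> \<equiv> PiE {..<r} (\<lambda>_. {..<n})"

definition vec :: "(nat \<Rightarrow> real) \<Rightarrow> nat \<Rightarrow> real" where
  "vec c i = (\<Sum>l<k. c l * b l i)"

text \<open>The importance-weighted estimator of the sum of \<open>g\<close>: each draw is divided
  by its probability, which makes it unbiased (\<open>EX_S\<close>).\<close>

definition S :: "(nat \<Rightarrow> nat) \<Rightarrow> (nat \<Rightarrow> real) \<Rightarrow> real" where
  "S \<omega> g = (\<Sum>t<r. g (\<omega> t) / q (\<omega> t)) / real r"

lemma q0': "i < n \<Longrightarrow> 0 \<le> q i" using q0 by (simp add: less_imp_le)

lemma z0: "0 < z" and z1: "1 \<le> z" using z by auto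

lemma zpow: "i \<le> j \<Longrightarrow> z ^ i \<le> z ^ j" by (rule power_increasing[OF _ z1])

lemma zw: "1 \<le> z powr (44 / p)" using z1 p0 by (intro ge_one_powr_ge_zero) auto

lemma r60: "z ^ 60 \<le> real r"
proof -
  have "z ^ 60 * 1 \<le> z ^ 60 * z powr (44 / p)" using zw z0 by (intro mult_left_mono) auto
  then show ?thesis using r by linarith
qed

lemma r0: "0 < real r" using r60 z0 zero_less_power[of z 60] by linarith

lemma zpow_div: "z ^ i / z ^ (i + j) = 1 / z ^ j" using z0 by (simp add: power_add)

lemma zpow_div_add: "z ^ (i + j) / z ^ i = z ^ j" using z0 by (simp add: power_add)

lemma z_small: "x \<le> z \<Longrightarrow> 0 \<le> x \<Longrightarrow> x / z ^ Suc j \<le> 1 / z ^ j"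
  using z0 by (simp add: field_simps)

lemma S_add: "S \<omega> (\<lambda>i. g i + h i) = S \<omega> g + S \<omega> h"
  by (simp add: S_def sum.distrib add_divide_distrib)

lemma S_diff: "S \<omega> (\<lambda>i. g i - h i) = S \<omega> g - S \<omega> h"
  by (simp add: S_def sum_subtractf diff_divide_distrib)

lemma S_cmult: "S \<omega> (\<lambda>i. c * g i) = c * S \<omega> g"
  by (simp add: S_def sum_distrib_left)

lemma S_le_mult:
  assumes "\<omega> \<in> \<Omega>" "\<And>i. i < n \<Longrightarrow> g i \<le> c * q i"
  shows "S \<omega> g \<le> c"
proof -
  have "(\<Sum>t<r. g (\<omega> t) / q (\<omega> t)) \<le> (\<Sum>t<r. c)"
    by (rule sum_mono) (use assms q0 in \<open>auto simp: PiE_iff field_simps\<close>)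
  then show ?thesis using r0 by (simp add: S_def field_simps)
qed

lemma S_mono:
  assumes "\<omega> \<in> \<Omega>" "\<And>i. i < n \<Longrightarrow> g i \<le> h i"
  shows "S \<omega> g \<le> S \<omega> h"
  unfolding S_def using assms q0 q0'
  by (intro divide_right_mono sum_mono) (auto simp: PiE_iff intro!: divide_right_mono)

lemma S_nonneg: "\<omega> \<in> \<Omega> \<Longrightarrow> (\<And>i. i < n \<Longrightarrow> 0 \<le> g i) \<Longrightarrow> 0 \<le> S \<omega> g"
  using S_mono[of \<omega> "\<lambda>_. 0" g] by (simp add: S_def)

lemma EX_S: "EE (\<lambda>\<omega>. S \<omega> g) = (\<Sum>i<n. g i)"
proof -
  have "EE (\<lambda>\<omega>. S \<omega> g) = (1 / real r) * EE (\<lambda>\<omega>. \<Sum>t<r. g (\<omega> t) / q (\<omega> t))"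
    unfolding expect_cmult[symmetric] by (simp add: S_def)
  also have "\<dots> = (\<Sum>i<n. q i * (g i / q i))"
    using expect_sample_sum[OF q1, of r "\<lambda>i. g i / q i"] r0 by simp
  also have "\<dots> = (\<Sum>i<n. g i)" by (rule sum.cong) (use q0 in \<open>force\<close>)+
  finally show ?thesis .
qed

text \<open>The sensitivity bound: no coordinate carries more than \<open>z ^ 3 * q i\<close> times
  the size \<open>Y\<close>, so dividing by \<open>q i\<close> in \<open>S\<close> leaves bounded
  summands. The cube is that of \<open>2 * k\<close>: the combination contributes
  \<open>4 * k\<^sup>2\<close> and \<open>psi\<close> contributes \<open>2 * k\<close>.\<close>

lemma vec_bound:
  assumes "\<And>l. l < k \<Longrightarrow> \<bar>c l\<bar> powr p \<le> 4 * Y" "i < n" "0 \<le> Y"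
  shows "\<bar>vec c i\<bar> powr p \<le> z ^ 3 * Y * q i"
proof -
  have "\<bar>vec c i\<bar> powr p \<le> (real k)\<^sup>2 * (4 * Y) * (\<Sum>l<k. \<bar>b l i\<bar> powr p)"
    unfolding vec_def using assms by (intro abs_powr_lincomb_le p0 p2) auto
  also have "\<dots> \<le> (real k)\<^sup>2 * (4 * Y) * (2 * real k * q i)"
    using psi assms by (intro mult_left_mono) auto
  also have "\<dots> = (2 * real k) ^ 3 * (Y * q i)" by (simp add: power2_eq_square power3_eq_cube)
  also have "\<dots> \<le> z ^ 3 * (Y * q i)"
    using kz assms q0' by (intro mult_right_mono power_mono) auto
  finally show ?thesis by (simp add: mult.assoc)
qed

text \<open>The change of the loss rather than the loss itself, switched off outside
  \<open>L\<close>. With \<open>L = UNIV\<close> and zero \<open>\<rho>\<close> it serves the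
  embedding property, with \<open>L = - heavy \<rho>\<close> the light part of a regression
  problem.\<close>

definition G :: "nat set \<Rightarrow> (nat \<Rightarrow> real) \<Rightarrow> (nat \<Rightarrow> real) \<Rightarrow> nat \<Rightarrow> real" where
  "G L \<rho> c i = (if i \<in> L then \<bar>vec c i - \<rho> i\<bar> powr p - \<bar>\<rho> i\<bar> powr p else 0)"

text \<open>Hoeffding's bound on a grid in coefficient space, extended by continuity.\<close>

lemma uniform_deviation:
  assumes f: "0 < f" and \<rho>: "\<And>i. i < n \<Longrightarrow> i \<in> L \<Longrightarrow> \<bar>\<rho> i\<bar> powr p \<le> z ^ 14 * f * q i"
  shows "EE (\<lambda>\<omega>. of_bool (\<exists>c. (\<forall>l<k. \<bar>c l\<bar> powr p \<le> 400 * f) \<and>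
      f / z\<^sup>2 < \<bar>S \<omega> (G L \<rho> c) - (\<Sum>i<n. G L \<rho> c i)\<bar>)) \<le> 1 / z ^ 20"
proof -
  \<comment> \<open>Half the side of the coefficient box. The grid divides it into \<open>m\<close>
    steps, where \<open>m powr p\<close> is at least \<open>z ^ 44\<close>.\<close>
  define T where "T = (400 * f) powr (1 / p)"
  define w where "w = z powr (44 / p)"
  define m where "m = nat \<lceil>w\<rceil>"
  have Tp: "T powr p = 400 * f" using f p0 by (simp add: T_def powr_powr)
  have T0: "0 < T" using f by (simp add: T_def)
  have w1: "1 \<le> w" using zw by (simp add: w_def)
  have mw: "w \<le> real m" "real m \<le> w + 1" using w1 unfolding m_def by linarith+
  have m0: "0 < real m" using mw w1 by linarith
  have mp: "z ^ 44 \<le> real m powr p"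
  proof -
    have "w powr p \<le> real m powr p" using mw w1 p0 by (intro powr_mono2) auto
    moreover have "w powr p = z ^ 44" using p0 z0 by (simp add: w_def powr_powr)
    ultimately show ?thesis by simp
  qed
  define A where "A = PiE {..<k} (\<lambda>_. {- int m..int m})"
  define cc where "cc a l = T * of_int (a l) / real m" for a :: "nat \<Rightarrow> int" and l
  have finA: "finite A" unfolding A_def by (intro finite_PiE) auto
  have cardA: "real (card A) = (2 * real m + 1) ^ k" unfolding A_def by (simp add: card_PiE)
  have cc_small: "\<bar>cc a l\<bar> powr p \<le> 400 * f" if "a \<in> A" "l < k" for a l
  proof -
    have "a l \<in> {- int m..int m}" using that unfolding A_def by (auto simp: PiE_iff)
    then have "\<bar>a l\<bar> \<le> int m" by auto
    then have "\<bar>real_of_int (a l)\<bar> \<le> real m" by linarith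
    then have "\<bar>cc a l\<bar> \<le> T" using T0 m0 by (simp add: cc_def abs_mult field_simps)
    then have "\<bar>cc a l\<bar> powr p \<le> T powr p" using p0 by (intro powr_mono2) auto
    then show ?thesis using Tp by simp
  qed
  have vb: "\<bar>vec c i\<bar> powr p \<le> z ^ 4 * f * q i" if "\<forall>l<k. \<bar>c l\<bar> powr p \<le> 400 * f" "i < n" for c i
  proof -
    have "\<bar>vec c i\<bar> powr p \<le> z ^ 3 * (100 * f) * q i" using that f by (intro vec_bound) auto
    also have "\<dots> \<le> z ^ 3 * (z * f) * q i" using z f z0 q0'[OF that(2)] by (intro mult_right_mono mult_left_mono) auto
    finally show ?thesis by (simp add: power_numeral_reduce algebra_simps)
  qed
  have vr: "\<bar>vec c i - \<rho> i\<bar> powr p \<le> z ^ 15 * f * q i" if "\<forall>l<k. \<bar>c l\<bar> powr p \<le> 400 * f" "i < n" "i \<in> L" for c i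
  proof -
    have "\<bar>vec c i - \<rho> i\<bar> powr p \<le> 4 * (\<bar>vec c i\<bar> powr p + \<bar>\<rho> i\<bar> powr p)"
      using abs_powr_add_le[OF p0 p2, of "vec c i" "- \<rho> i"] by simp
    also have "\<dots> \<le> 4 * (z ^ 4 * f * q i + z ^ 14 * f * q i)" using vb that \<rho> by (intro mult_left_mono add_mono) auto
    also have "\<dots> \<le> 4 * (z ^ 14 * f * q i + z ^ 14 * f * q i)"
      using zpow[of 4 14] f q0'[OF that(2)] by (intro mult_left_mono add_mono mult_right_mono) auto
    also have "\<dots> = 8 * (z ^ 14 * f * q i)" by simp
    also have "\<dots> \<le> z * (z ^ 14 * f * q i)" using z f z0 q0'[OF that(2)] by (intro mult_right_mono) auto
    finally show ?thesis by (simp add: power_numeral_reduce algebra_simps)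
  qed
  have Gb: "\<bar>G L \<rho> c i\<bar> \<le> z ^ 15 * f * q i" if "\<forall>l<k. \<bar>c l\<bar> powr p \<le> 400 * f" "i < n" for c i
  proof (cases "i \<in> L")
    case True
    have "\<bar>\<rho> i\<bar> powr p \<le> z ^ 15 * f * q i"
    proof -
      have "z ^ 14 * (f * q i) \<le> z ^ 15 * (f * q i)"
        using zpow[of 14 15] f q0'[OF that(2)] by (intro mult_right_mono) auto
      then show ?thesis using \<rho>[OF that(2) True] by (simp add: mult.assoc)
    qed
    moreover have "0 \<le> \<bar>\<rho> i\<bar> powr p" "0 \<le> \<bar>vec c i - \<rho> i\<bar> powr p" by auto
    ultimately have "\<bar>\<bar>vec c i - \<rho> i\<bar> powr p - \<bar>\<rho> i\<bar> powr p\<bar> \<le> z ^ 15 * f * q i"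
      using vr[OF that True] by (intro abs_leI) linarith+
    then show ?thesis using True by (simp add: G_def)
  next
    case False then show ?thesis using f z0 q0'[OF that(2)] by (simp add: G_def)
  qed
  have cont: "\<bar>G L \<rho> c i - G L \<rho> c' i\<bar> \<le> 2 / z ^ 3 * f * q i"
    if c: "\<forall>l<k. \<bar>c' l\<bar> powr p \<le> 400 * f" "\<And>l. l < k \<Longrightarrow> \<bar>c l - c' l\<bar> \<le> T / real m" and i: "i < n" for c c' i
  proof (cases "i \<in> L")
    case True
    have fq: "0 \<le> f * q i" using f q0'[OF i] by simp
    have "\<bar>c l - c' l\<bar> powr p \<le> 400 * f / z ^ 44" if "l < k" for l
    proof -
      have "\<bar>c l - c' l\<bar> powr p \<le> (T / real m) powr p" using c(2)[OF that] p0 by (intro powr_mono2) auto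
      also have "\<dots> = 400 * f / real m powr p" using T0 m0 Tp by (simp add: powr_divide)
      also have "\<dots> \<le> 400 * f / z ^ 44" using mp z0 f m0 by (intro divide_left_mono mult_pos_pos) auto
      finally show ?thesis .
    qed
    then have "\<bar>vec (\<lambda>l. c l - c' l) i\<bar> powr p \<le> z ^ 3 * (100 * f / z ^ 44) * q i"
      using f z0 i by (intro vec_bound) auto
    also have "vec (\<lambda>l. c l - c' l) i = vec c i - vec c' i" by (simp add: vec_def left_diff_distrib sum_subtractf)
    finally have d: "\<bar>vec c i - vec c' i\<bar> powr p \<le> z ^ 3 * (100 * f / z ^ 44) * q i" .
    \<comment> \<open>With relative error \<open>1 / z ^ 18\<close> the main term drops from
      \<open>z ^ 15\<close> to \<open>1 / z ^ 3\<close>. The other term pays \<open>z ^ 36\<close>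
      for the squared reciprocal and \<open>z ^ 3\<close> for the sensitivities and gains
      \<open>z ^ 44\<close> from the grid, which leaves \<open>1 / z ^ 5\<close> up to a
      constant.\<close>
    have "\<bar>\<bar>vec c i - \<rho> i\<bar> powr p - \<bar>vec c' i - \<rho> i\<bar> powr p\<bar> \<le>
       1 / z ^ 18 * \<bar>vec c' i - \<rho> i\<bar> powr p + 25 / (1 / z ^ 18)\<^sup>2 * \<bar>vec c i - vec c' i\<bar> powr p"
      using abs_powr_diff_le[OF p0 p2, of "1 / z ^ 18" "vec c' i - \<rho> i" "vec c i - vec c' i"] z0 one_le_power[OF z1, of 18] by simp
    also have "\<dots> \<le> 1 / z ^ 18 * (z ^ 15 * f * q i) + 25 / (1 / z ^ 18)\<^sup>2 * (z ^ 3 * (100 * f / z ^ 44) * q i)"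
      using vr[OF c(1) i True] d z0 by (intro add_mono mult_left_mono) auto
    also have "\<dots> = (z ^ 15 / z ^ (15 + 3)) * (f * q i) + 2500 * (z ^ 39 / z ^ (39 + 5)) * (f * q i)"
    proof -
      have 1: "25 / (1 / z ^ 18)\<^sup>2 = 25 * z ^ 36" by (simp add: power_divide flip: power_mult)
      have 2: "z ^ 39 = z ^ 36 * z ^ 3" by (simp flip: power_add)
      have "25 * z ^ 36 * (z ^ 3 * (100 * f / z ^ 44) * q i) = 2500 * ((z ^ 36 * z ^ 3) / z ^ 44) * (f * q i)" by (simp add: mult_ac)
      then show ?thesis unfolding 1 2 by simp
    qed
    also have "\<dots> = 1 / z ^ 3 * (f * q i) + 2500 / z ^ Suc 4 * (f * q i)" unfolding zpow_div by simp
    also have "\<dots> \<le> 1 / z ^ 3 * (f * q i) + 1 / z ^ 4 * (f * q i)"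
      using z_small[of 2500 4] z fq by (intro add_mono mult_right_mono) auto
    also have "1 / z ^ 4 \<le> 1 / z ^ 3" using zpow[of 3 4] z0 by (intro divide_left_mono) auto
    then have "1 / z ^ 3 * (f * q i) + 1 / z ^ 4 * (f * q i) \<le> 1 / z ^ 3 * (f * q i) + 1 / z ^ 3 * (f * q i)"
      using fq by (intro add_left_mono mult_right_mono)
    also have "\<dots> = 2 / z ^ 3 * f * q i" by simp
    finally show ?thesis using True by (simp add: G_def)
  next
    case False then show ?thesis using f z0 q0'[OF i] by (simp add: G_def)
  qed
  define dev where "dev \<omega> c = \<bar>S \<omega> (G L \<rho> c) - (\<Sum>i<n. G L \<rho> c i)\<bar>" for \<omega> c
  have net: "\<exists>a\<in>A. f / (2 * z\<^sup>2) \<le> dev \<omega> (cc a)"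
    if c: "\<forall>l<k. \<bar>c l\<bar> powr p \<le> 400 * f" "f / z\<^sup>2 < dev \<omega> c" and \<omega>: "\<omega> \<in> \<Omega>" for \<omega> c
  proof -
    define a where "a = restrict (\<lambda>l. \<lfloor>c l * real m / T\<rfloor>) {..<k}"
    have cT: "\<bar>c l\<bar> \<le> T" if "l < k" for l
    proof (rule ccontr)
      assume "\<not> \<bar>c l\<bar> \<le> T"
      then have "T powr p < \<bar>c l\<bar> powr p" using T0 p0 by (intro powr_less_mono2) auto
      then show False using c(1) that Tp by (metis not_le)
    qed
    have aA: "a \<in> A"
    proof -
      have "- int m \<le> \<lfloor>c l * real m / T\<rfloor> \<and> \<lfloor>c l * real m / T\<rfloor> \<le> int m" if "l < k" for l
      proof -
        have "- real m \<le> c l * real m / T" "c l * real m / T \<le> real m"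
          using mult_right_mono[of "- T" "c l" "real m"] mult_right_mono[of "c l" T "real m"] cT[OF that] T0 m0
          by (auto simp: field_simps abs_le_iff)
        then show ?thesis by (auto simp: le_floor_iff floor_le_iff)
      qed
      then show ?thesis by (auto simp: A_def a_def)
    qed
    have near: "\<bar>c l - cc a l\<bar> \<le> T / real m" if "l < k" for l
    proof -
      have al: "a l = \<lfloor>c l * real m / T\<rfloor>" using that by (simp add: a_def)
      have "\<bar>c l * real m / T - of_int (a l)\<bar> \<le> 1" unfolding al by linarith
      moreover have "c l - cc a l = T / real m * (c l * real m / T - of_int (a l))"
        using T0 m0 by (simp add: cc_def field_simps)
      ultimately have "\<bar>c l - cc a l\<bar> \<le> T / real m * 1" unfolding abs_mult
        using T0 m0 mult_left_mono[of "\<bar>c l * real m / T - of_int (a l)\<bar>" 1 "T / real m"] by (simp add: abs_mult)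
      then show ?thesis by simp
    qed
    have cs: "\<forall>l<k. \<bar>cc a l\<bar> powr p \<le> 400 * f" using cc_small[OF aA] by blast
    note ct = cont[OF cs near]
    have "S \<omega> (G L \<rho> c) - S \<omega> (G L \<rho> (cc a)) \<le> 2 / z ^ 3 * f"
      unfolding S_diff[symmetric] using ct by (intro S_le_mult[OF \<omega>]) (auto simp: abs_le_iff)
    moreover have "S \<omega> (G L \<rho> (cc a)) - S \<omega> (G L \<rho> c) \<le> 2 / z ^ 3 * f"
      unfolding S_diff[symmetric] using ct by (intro S_le_mult[OF \<omega>]) (auto simp: abs_le_iff)
    moreover have "\<bar>(\<Sum>i<n. G L \<rho> c i) - (\<Sum>i<n. G L \<rho> (cc a) i)\<bar> \<le> 2 / z ^ 3 * f"
    proof -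
      have "\<bar>(\<Sum>i<n. G L \<rho> c i) - (\<Sum>i<n. G L \<rho> (cc a) i)\<bar> \<le> (\<Sum>i<n. \<bar>G L \<rho> c i - G L \<rho> (cc a) i\<bar>)"
        unfolding sum_subtractf[symmetric] by (rule sum_abs)
      also have "\<dots> \<le> (\<Sum>i<n. 2 / z ^ 3 * f * q i)" by (rule sum_mono) (use ct in auto)
      also have "\<dots> = 2 / z ^ 3 * f" unfolding sum_distrib_left[symmetric] q1 by simp
      finally show ?thesis .
    qed
    moreover have "4 / z ^ 3 * f \<le> f / (2 * z\<^sup>2)"
    proof -
      have "8 / z ^ Suc 2 * f \<le> 1 / z ^ 2 * f" using z_small[of 8 2] z f by (intro mult_right_mono) auto
      then show ?thesis by (simp add: eval_nat_numeral)
    qed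
    moreover have "f / z\<^sup>2 = f / (2 * z\<^sup>2) + f / (2 * z\<^sup>2)" by simp
    ultimately have "f / (2 * z\<^sup>2) \<le> dev \<omega> (cc a)" using c(2) unfolding dev_def by (simp add: abs_if split: if_splits)
    then show ?thesis using aA by blast
  qed
  \<comment> \<open>Summands are at most \<open>z ^ 15 * f\<close> and the deviation is
    \<open>f / (2 * z\<^sup>2)\<close>, which gives the exponent
    \<open>r / (64 * z ^ 34)\<close>.\<close>
  have hoeff: "EE (\<lambda>\<omega>. of_bool (f / (2 * z\<^sup>2) \<le> dev \<omega> (cc a))) \<le> 2 * exp (- (real r / z ^ 36))" if a: "a \<in> A" for a
  proof -
    have cs: "\<forall>l<k. \<bar>cc a l\<bar> powr p \<le> 400 * f" using cc_small[OF a] by blast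
    define X where "X i = G L \<rho> (cc a) i / q i" for i
    have XM: "\<bar>X i\<bar> \<le> z ^ 15 * f" if "i < n" for i
      using Gb[OF cs that] q0[OF that] by (simp add: X_def field_simps)
    have mean: "(\<Sum>i<n. q i * X i) = (\<Sum>i<n. G L \<rho> (cc a) i)"
      by (rule sum.cong) (use q0 in \<open>force simp: X_def\<close>)+
    have s: "0 < f / (2 * z\<^sup>2)" "f / (2 * z\<^sup>2) \<le> 4 * (z ^ 15 * f)"
    proof -
      have "f / (2 * z\<^sup>2) \<le> f / 1" using f one_le_power[OF z1, of 2] by (intro divide_left_mono) linarith+
      also have "\<dots> \<le> 4 * z ^ 15 * f" using f one_le_power[OF z1, of 15] by simp
      finally show "f / (2 * z\<^sup>2) \<le> 4 * (z ^ 15 * f)" by simp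
    qed (use f z0 in auto)
    have "EE (\<lambda>\<omega>. of_bool (f / (2 * z\<^sup>2) \<le> dev \<omega> (cc a)))
       = EE (\<lambda>\<omega>. of_bool (real r * (f / (2 * z\<^sup>2)) \<le> \<bar>(\<Sum>t<r. X (\<omega> t)) - real r * (\<Sum>i<n. q i * X i)\<bar>))"
    proof -
      have "f / (2 * z\<^sup>2) \<le> dev \<omega> (cc a) \<longleftrightarrow> real r * (f / (2 * z\<^sup>2)) \<le> \<bar>(\<Sum>t<r. X (\<omega> t)) - real r * (\<Sum>i<n. q i * X i)\<bar>" for \<omega>
      proof -
        have "(\<Sum>t<r. X (\<omega> t)) - real r * (\<Sum>i<n. q i * X i) = real r * (S \<omega> (G L \<rho> (cc a)) - (\<Sum>i<n. G L \<rho> (cc a) i))"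
          unfolding mean using r0 by (simp add: S_def X_def right_diff_distrib)
        then have "\<bar>(\<Sum>t<r. X (\<omega> t)) - real r * (\<Sum>i<n. q i * X i)\<bar> = real r * dev \<omega> (cc a)" unfolding dev_def by (simp add: abs_mult)
        then show ?thesis using r0 by (simp only: mult_le_cancel_left_pos)
      qed
      then show ?thesis by simp
    qed
    also have "\<dots> \<le> 2 * exp (- (real r * (f / (2 * z\<^sup>2))\<^sup>2 / (16 * (z ^ 15 * f)\<^sup>2)))"
      by (rule expect_exp_abs[OF q1 q0' XM s])
    also have "real r * (f / (2 * z\<^sup>2))\<^sup>2 / (16 * (z ^ 15 * f)\<^sup>2) = real r / (64 * z ^ 34)"
    proof -
      have 1: "(f / (2 * z\<^sup>2))\<^sup>2 = f\<^sup>2 / (4 * z ^ 4)" by (simp add: power_divide power_mult_distrib flip: power_mult)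
      have 2: "(z ^ 15 * f)\<^sup>2 = z ^ 30 * f\<^sup>2" by (simp add: power_mult_distrib flip: power_mult)
      have 3: "z ^ 34 = z ^ 4 * z ^ 30" by (simp flip: power_add)
      have "f\<^sup>2 \<noteq> 0" "z ^ 4 \<noteq> 0" "z ^ 30 \<noteq> 0" using f z0 by auto
      then show ?thesis unfolding 1 2 3 by (simp add: divide_simps)
    qed
    also have "2 * exp (- (real r / (64 * z ^ 34))) \<le> 2 * exp (- (real r / z ^ 36))"
    proof -
      have "64 * z ^ 34 \<le> z * z ^ 34" using z z0 by (intro mult_right_mono) auto
      also have "\<dots> \<le> z ^ 36" using zpow[of 35 36] by (simp add: power_numeral_reduce)
      finally have "real r / z ^ 36 \<le> real r / (64 * z ^ 34)" using z0 r0 by (intro divide_left_mono) auto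
      then show ?thesis by simp
    qed
    finally show ?thesis .
  qed
  have "EE (\<lambda>\<omega>. of_bool (\<exists>c. (\<forall>l<k. \<bar>c l\<bar> powr p \<le> 400 * f) \<and> f / z\<^sup>2 < dev \<omega> c))
     \<le> EE (\<lambda>\<omega>. \<Sum>a\<in>A. of_bool (f / (2 * z\<^sup>2) \<le> dev \<omega> (cc a)))"
  proof (rule expect_mono)
    fix \<omega> assume \<omega>: "\<omega> \<in> \<Omega>"
    show "(of_bool (\<exists>c. (\<forall>l<k. \<bar>c l\<bar> powr p \<le> 400 * f) \<and> f / z\<^sup>2 < dev \<omega> c) :: real) \<le> (\<Sum>a\<in>A. of_bool (f / (2 * z\<^sup>2) \<le> dev \<omega> (cc a)))"
    proof (cases "\<exists>c. (\<forall>l<k. \<bar>c l\<bar> powr p \<le> 400 * f) \<and> f / z\<^sup>2 < dev \<omega> c")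
      case True
      then obtain a where a: "a \<in> A" "f / (2 * z\<^sup>2) \<le> dev \<omega> (cc a)" using net \<omega> by blast
      have "(1::real) \<le> (\<Sum>a\<in>A. of_bool (f / (2 * z\<^sup>2) \<le> dev \<omega> (cc a)))"
        using member_le_sum[OF a(1), of "\<lambda>a. of_bool (f / (2 * z\<^sup>2) \<le> dev \<omega> (cc a)) :: real"] a(2) finA by simp
      then show ?thesis using True by simp
    next
      case False
      then have "(of_bool (\<exists>c. (\<forall>l<k. \<bar>c l\<bar> powr p \<le> 400 * f) \<and> f / z\<^sup>2 < dev \<omega> c) :: real) = 0" by (simp only: of_bool_eq)
      then show ?thesis by (simp only:) (simp add: sum_nonneg)
    qed
  qed (rule q0')
  also have "\<dots> \<le> real (card A) * (2 * exp (- (real r / z ^ 36)))"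
    unfolding expect_sum by (rule sum_bounded_above) (rule hoeff)
  \<comment> \<open>The grid has at most \<open>exp (z\<^sup>2 * w)\<close> points, while the bound
    on \<open>r\<close> puts \<open>z ^ 24 * w\<close> into the exponent; the union bound over the
    grid is therefore cheap.\<close>
  also have "\<dots> \<le> exp (z\<^sup>2 * w) * (2 * exp (- (z ^ 24 * w)))"
  proof (intro mult_mono)
    have "(2 * real m + 1) ^ k \<le> exp (2 * real m) ^ k" using exp_ge_add_one_self[of "2 * real m"] by (intro power_mono) linarith+
    also have "\<dots> = exp (real k * (2 * real m))" by (simp add: exp_of_nat_mult)
    also have "real k * (2 * real m) \<le> z\<^sup>2 * w"
    proof -
      have "2 * real k * real m \<le> z * (2 * w)" using kz mw w1 z0 by (intro mult_mono) auto
      also have "\<dots> \<le> z * (z * w)" using z z0 w1 by (intro mult_left_mono mult_right_mono) auto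
      finally show ?thesis by (simp add: power2_eq_square mult_ac)
    qed
    finally show "real (card A) \<le> exp (z\<^sup>2 * w)" unfolding cardA by simp
    have "z ^ 24 = z ^ 60 / z ^ 36" using zpow_div_add[of 36 24] by simp
    then have "z ^ 24 * w = z ^ 60 * w / z ^ 36" by (simp only: times_divide_eq_left)
    also have "\<dots> \<le> real r / z ^ 36" using r z0 by (intro divide_right_mono) (auto simp: w_def)
    finally show "exp (- (real r / z ^ 36)) \<le> exp (- (z ^ 24 * w))" by simp
  qed auto
  also have "\<dots> = 2 * exp (- ((z ^ 24 - z\<^sup>2) * w))" by (simp add: exp_add[symmetric] algebra_simps)
  also have "\<dots> \<le> 2 * exp (- (z ^ 22))"
  proof -
    have "z ^ 22 + z\<^sup>2 \<le> 2 * z ^ 22" using zpow[of 2 22] by simp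
    also have "\<dots> \<le> z\<^sup>2 * z ^ 22" using one_le_power[OF z1, of 1] z z0 mult_mono[of 2 z 1 z] by (intro mult_right_mono) (auto simp: power2_eq_square)
    also have "\<dots> = z ^ 24" by (simp flip: power_add)
    finally have 1: "z ^ 22 * 1 \<le> (z ^ 24 - z\<^sup>2) * 1" by simp
    also have "\<dots> \<le> (z ^ 24 - z\<^sup>2) * w" using w1 zpow[of 2 24] by (intro mult_left_mono) auto
    finally show ?thesis by simp
  qed
  also have "\<dots> \<le> 2 / z ^ 22"
  proof -
    have "z ^ 22 \<le> exp (z ^ 22)" using exp_ge_add_one_self[of "z ^ 22"] by linarith
    then show ?thesis using z0 by (simp add: exp_minus field_simps)
  qed
  also have "2 / z ^ 22 \<le> 1 / z ^ 21" using z_small[of 2 21] z by simp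
  also have "\<dots> \<le> 1 / z ^ 20" using zpow[of 20 21] z0 by (intro divide_left_mono) auto
  finally show ?thesis by (simp add: dev_def)
qed

end

section \<open>A deterministic bound on the excess cost for a given sample\<close>

context sampling begin

text \<open>Only a lower bound on the sampled norm: it prevents a solution of the sampled problem
  from being much larger than the sample shows. The condition on \<open>c\<close> is what the
  spanning family provides for every element of the column space.\<close>

definition embeds :: "(nat \<Rightarrow> nat) \<Rightarrow> bool" where
  "embeds \<omega> \<longleftrightarrow> (\<forall>c. (\<forall>l<k. \<bar>c l\<bar> powr p \<le> 4 * (\<Sum>i<n. \<bar>vec c i\<bar> powr p)) \<longrightarrow>
     (\<Sum>i<n. \<bar>vec c i\<bar> powr p) / 2 \<le> S \<omega> (\<lambda>i. \<bar>vec c i\<bar> powr p))"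

definition fsum :: "(nat \<Rightarrow> real) \<Rightarrow> real" where
  "fsum \<rho> = (\<Sum>i<n. \<bar>\<rho> i\<bar> powr p)"

text \<open>Sensitivities bound the column space, not the residual. At these coordinates the
  residual is so large for its probability that a single hit could dominate the estimate, and the
  exponential bound does not apply.\<close>

definition heavy :: "(nat \<Rightarrow> real) \<Rightarrow> nat set" where
  "heavy \<rho> = {i. i < n \<and> z ^ 14 * fsum \<rho> * q i < \<bar>\<rho> i\<bar> powr p}"

definition FL :: "(nat \<Rightarrow> real) \<Rightarrow> (nat \<Rightarrow> nat) \<Rightarrow> real" where
  "FL \<rho> \<omega> = S \<omega> (\<lambda>i. if i \<in> heavy \<rho> then 0 else \<bar>\<rho> i\<bar> powr p)"

definition FH :: "(nat \<Rightarrow> real) \<Rightarrow> (nat \<Rightarrow> nat) \<Rightarrow> real" where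
  "FH \<rho> \<omega> = S \<omega> (\<lambda>i. if i \<in> heavy \<rho> then \<bar>\<rho> i\<bar> powr p else 0)"

definition hits :: "(nat \<Rightarrow> real) \<Rightarrow> (nat \<Rightarrow> nat) \<Rightarrow> real" where
  "hits \<rho> \<omega> = (\<Sum>t<r. of_bool (\<omega> t \<in> heavy \<rho>))"

definition deviates :: "(nat \<Rightarrow> real) \<Rightarrow> (nat \<Rightarrow> nat) \<Rightarrow> bool" where
  "deviates \<rho> \<omega> \<longleftrightarrow> (\<exists>c. (\<forall>l<k. \<bar>c l\<bar> powr p \<le> 400 * fsum \<rho>) \<and>
      fsum \<rho> / z\<^sup>2 < \<bar>S \<omega> (G (- heavy \<rho>) \<rho> c) - (\<Sum>i<n. G (- heavy \<rho>) \<rho> c i)\<bar>)"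

text \<open>A bound on the excess that holds in every case, with indicators for the bad events: many
  heavy hits, or a light part that is overestimated or not uniformly approximated. A bad event still
  leaves a bound of order \<open>z ^ 14 * fsum \<rho>\<close>, plus \<open>FH\<close> in the first
  case, which its small probability outweighs. The last two terms are the good case.\<close>

definition Psi :: "(nat \<Rightarrow> real) \<Rightarrow> (nat \<Rightarrow> nat) \<Rightarrow> real" where
  "Psi \<rho> \<omega> = of_bool (real r / z ^ 11 < hits \<rho> \<omega>) * (100 * z ^ 14 * fsum \<rho> + 100 * FH \<rho> \<omega>)
     + of_bool (2 * fsum \<rho> < FL \<rho> \<omega> \<or> deviates \<rho> \<omega>) * (200 * z ^ 14 * fsum \<rho>)
     + 4000 / z\<^sup>2 * FH \<rho> \<omega> + 2000 / z\<^sup>2 * fsum \<rho>"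

lemma fsum_nonneg: "0 \<le> fsum \<rho>" by (simp add: fsum_def sum_nonneg)

lemma FH_nonneg: "\<omega> \<in> \<Omega> \<Longrightarrow> 0 \<le> FH \<rho> \<omega>" unfolding FH_def by (rule S_nonneg) auto

lemma FL_nonneg: "\<omega> \<in> \<Omega> \<Longrightarrow> 0 \<le> FL \<rho> \<omega>" unfolding FL_def by (rule S_nonneg) auto

lemma FL_le: "\<omega> \<in> \<Omega> \<Longrightarrow> FL \<rho> \<omega> \<le> z ^ 14 * fsum \<rho>"
  unfolding FL_def by (rule S_le_mult) (use fsum_nonneg z0 q0' in \<open>auto simp: heavy_def not_less\<close>)

lemma S_heavy_le:
  assumes \<omega>: "\<omega> \<in> \<Omega>" and g: "\<And>i. i < n \<Longrightarrow> g i \<le> c * q i" and c: "0 \<le> c"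
  shows "S \<omega> (\<lambda>i. if i \<in> heavy \<rho> then g i else 0) \<le> c * (hits \<rho> \<omega> / real r)"
proof -
  have "(\<Sum>t<r. (if \<omega> t \<in> heavy \<rho> then g (\<omega> t) else 0) / q (\<omega> t)) \<le> (\<Sum>t<r. c * of_bool (\<omega> t \<in> heavy \<rho>))"
    by (rule sum_mono) (use \<omega> g q0 in \<open>auto simp: PiE_iff field_simps\<close>)
  then have "S \<omega> (\<lambda>i. if i \<in> heavy \<rho> then g i else 0) \<le> (\<Sum>t<r. c * of_bool (\<omega> t \<in> heavy \<rho>)) / real r"
    unfolding S_def using r0 by (intro divide_right_mono) auto
  then show ?thesis unfolding hits_def sum_distrib_left[symmetric] by simp
qed

text \<open>The sampled excess splits into a light and a heavy part. On a heavy sample the loss can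
  fall only by a little of \<open>\<bar>\<rho> i\<bar> powr p\<close> and a multiple of
  \<open>\<bar>vec c i\<bar> powr p\<close>; when few samples are heavy, the latter is tiny by the
  sensitivity bound. So the light part inherits the near-optimality \<open>D\<close>, and there the
  sample estimates the full excess uniformly. On the heavy coordinates of the full problem,
  \<open>vec c\<close> is negligible against \<open>\<rho>\<close>.\<close>

lemma excess_le_Psi:
  assumes \<omega>: "\<omega> \<in> \<Omega>" and emb: "embeds \<omega>"
    and c: "\<And>l. l < k \<Longrightarrow> \<bar>c l\<bar> powr p \<le> 4 * (\<Sum>i<n. \<bar>vec c i\<bar> powr p)"
    and D: "S \<omega> (\<lambda>i. \<bar>vec c i - \<rho> i\<bar> powr p) \<le> (1 + 1 / z\<^sup>2) * S \<omega> (\<lambda>i. \<bar>\<rho> i\<bar> powr p)"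
  shows "(\<Sum>i<n. \<bar>vec c i - \<rho> i\<bar> powr p) - fsum \<rho> \<le> Psi \<rho> \<omega>"
proof -
  define y where "y = vec c"
  define Y where "Y = (\<Sum>i<n. \<bar>y i\<bar> powr p)"
  define f where "f = fsum \<rho>"
  define \<eta> where "\<eta> = 1 / z\<^sup>2"
  define H where "H = heavy \<rho>"
  define fl where "fl = FL \<rho> \<omega>"
  define fh where "fh = FH \<rho> \<omega>"
  define d where "d = (\<Sum>i<n. \<bar>y i - \<rho> i\<bar> powr p) - f"
  define SYL where "SYL = S \<omega> (\<lambda>i. if i \<in> H then 0 else \<bar>y i\<bar> powr p)"
  define SYH where "SYH = S \<omega> (\<lambda>i. if i \<in> H then \<bar>y i\<bar> powr p else 0)"
  define g where "g i = \<bar>y i - \<rho> i\<bar> powr p - \<bar>\<rho> i\<bar> powr p" for i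
  define DL where "DL = S \<omega> (\<lambda>i. if i \<in> H then 0 else g i)"
  define DH where "DH = S \<omega> (\<lambda>i. if i \<in> H then g i else 0)"
  define C where "C = 25 / \<eta>\<^sup>2"
  define a1 where "a1 = \<eta> * fl"
  define a2 where "a2 = \<eta> * fh"
  define a3 where "a3 = \<eta> * f"
  define cs where "cs = C * SYH"
  define zf where "zf = z ^ 14 * f"
  define Nf where "Nf = hits \<rho> \<omega> / real r"
  have Y0: "0 \<le> Y" by (simp add: Y_def sum_nonneg)
  have f0: "0 \<le> f" by (simp add: f_def fsum_nonneg)
  have fl0: "0 \<le> fl" and fh0: "0 \<le> fh" and flK: "fl \<le> z ^ 14 * f"
    using FL_nonneg FH_nonneg FL_le \<omega> by (auto simp: fl_def fh_def f_def)
  have \<eta>: "0 < \<eta>" "\<eta> \<le> 1" "\<eta> \<le> 1 / 100" 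
  proof -
    have "100 \<le> z ^ 1" using z by simp
    also have "\<dots> \<le> z\<^sup>2" by (rule zpow) simp
    finally show "0 < \<eta>" "\<eta> \<le> 1" "\<eta> \<le> 1 / 100" using z0 by (auto simp: \<eta>_def field_simps)
  qed
  have Cz: "C = 25 * z ^ 4" by (simp add: C_def \<eta>_def power_divide flip: power_mult)
  have C0: "0 \<le> C" by (simp add: C_def)
  have yq: "\<bar>y i\<bar> powr p \<le> z ^ 3 * Y * q i" if "i < n" for i
    unfolding y_def by (rule vec_bound) (use c that Y0 in \<open>auto simp: Y_def y_def\<close>)
  have S_split: "S \<omega> h = S \<omega> (\<lambda>i. if i \<in> H then 0 else h i) + S \<omega> (\<lambda>i. if i \<in> H then h i else 0)" for h
    unfolding S_add[symmetric] by (rule arg_cong[where f = "S \<omega>"]) auto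
  have SF: "S \<omega> (\<lambda>i. \<bar>\<rho> i\<bar> powr p) = fl + fh" using S_split[of "\<lambda>i. \<bar>\<rho> i\<bar> powr p"] by (simp add: fl_def fh_def FL_def FH_def H_def)
  have SD: "DL + DH \<le> a1 + a2"
  proof -
    have "DL + DH = S \<omega> g" using S_split[of g] by (simp add: DL_def DH_def)
    also have "\<dots> = S \<omega> (\<lambda>i. \<bar>y i - \<rho> i\<bar> powr p) - (fl + fh)" unfolding g_def S_diff SF ..
    also have "\<dots> \<le> \<eta> * (fl + fh)" using D unfolding SF y_def \<eta>_def by (simp add: algebra_simps)
    finally show ?thesis by (simp add: a1_def a2_def distrib_left)
  qed
  have SY: "S \<omega> (\<lambda>i. \<bar>y i\<bar> powr p) = SYL + SYH" using S_split[of "\<lambda>i. \<bar>y i\<bar> powr p"] by (simp add: SYL_def SYH_def)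
  have SYge: "Y / 2 \<le> SYL + SYH"
    using emb c unfolding embeds_def SY[symmetric] Y_def y_def by blast
  have y4: "\<bar>y i\<bar> powr p \<le> 4 * (g i + 2 * \<bar>\<rho> i\<bar> powr p)" for i
    using abs_powr_add_le[OF p0 p2, of "y i - \<rho> i" "\<rho> i"] by (simp add: g_def)
  have d1: "d \<le> 4 * Y + 3 * f"
  proof -
    have "(\<Sum>i<n. \<bar>y i - \<rho> i\<bar> powr p) \<le> (\<Sum>i<n. 4 * (\<bar>y i\<bar> powr p + \<bar>\<rho> i\<bar> powr p))"
      by (rule sum_mono) (use abs_powr_add_le[OF p0 p2, of _ "- _"] in \<open>force\<close>)
    also have "\<dots> = 4 * (Y + f)" by (simp add: Y_def f_def fsum_def sum.distrib flip: sum_distrib_left)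
    finally show ?thesis by (simp add: d_def)
  qed
  have gabs: "\<bar>g i\<bar> \<le> \<eta> * \<bar>\<rho> i\<bar> powr p + C * \<bar>y i\<bar> powr p" for i
    using abs_powr_diff_le[OF p0 p2 \<eta>(1,2), of "- \<rho> i" "y i"] by (simp add: g_def C_def add.commute)
  have SYLle: "SYL \<le> 4 * (DL + 2 * fl)"
  proof -
    have "SYL \<le> S \<omega> (\<lambda>i. 4 * ((if i \<in> H then 0 else g i) + 2 * (if i \<in> H then 0 else \<bar>\<rho> i\<bar> powr p)))"
      unfolding SYL_def by (rule S_mono[OF \<omega>]) (use y4 in auto)
    also have "\<dots> = 4 * (DL + 2 * fl)" unfolding S_cmult S_add DL_def fl_def FL_def H_def ..
    finally show ?thesis .
  qed
  have SYle: "SYL + SYH \<le> 4 * (DL + DH + 2 * (fl + fh))"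
  proof -
    have "S \<omega> (\<lambda>i. \<bar>y i\<bar> powr p) \<le> S \<omega> (\<lambda>i. 4 * (g i + 2 * \<bar>\<rho> i\<bar> powr p))" by (rule S_mono[OF \<omega>]) (use y4 in auto)
    also have "\<dots> = 4 * (S \<omega> g + 2 * (fl + fh))" unfolding S_cmult S_add SF ..
    also have "S \<omega> g = DL + DH" using S_split[of g] by (simp add: DL_def DH_def)
    finally show ?thesis unfolding SY .
  qed
  have aF: "a1 \<le> fl" "a2 \<le> fh" unfolding a1_def a2_def using \<eta> fl0 fh0 by (simp_all add: mult_left_le_one_le)
  \<comment> \<open>Embedding and near-optimality bound the solution by the sampled residual in all
    cases; this yields the worst-case bound \<open>A\<close>.\<close>
  have Y24: "Y \<le> 24 * (fl + fh)" using SYge SYle SD aF by argo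
  have fzf: "f \<le> zf" unfolding zf_def using one_le_power[OF z1, of 14] f0 mult_right_mono[of 1 "z ^ 14" f] by simp
  have flK': "fl \<le> zf" using flK by (simp add: zf_def)
  have A: "d \<le> 100 * z ^ 14 * f + 100 * fh"
  proof -
    have "d \<le> 100 * zf + 100 * fh" using d1 Y24 flK' fzf fh0 f0 by argo
    then show ?thesis by (simp add: zf_def mult.assoc)
  qed
  have fz: "0 \<le> z ^ 14 * f" using f0 z0 by simp
  have nn: "0 \<le> 4000 / z\<^sup>2 * fh" "0 \<le> 2000 / z\<^sup>2 * f" using fh0 f0 by auto
  have main: "d \<le> of_bool (real r / z ^ 11 < hits \<rho> \<omega>) * (100 * z ^ 14 * f + 100 * fh)
     + of_bool (2 * f < fl \<or> deviates \<rho> \<omega>) * (200 * z ^ 14 * f) + 4000 / z\<^sup>2 * fh + 2000 / z\<^sup>2 * f"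
  proof (cases "real r / z ^ 11 < hits \<rho> \<omega>")
    case True
    have "0 \<le> (of_bool (2 * f < fl \<or> deviates \<rho> \<omega>) :: real) * (200 * z ^ 14 * f)" using fz by (simp add: mult.assoc)
    moreover have "d \<le> of_bool (real r / z ^ 11 < hits \<rho> \<omega>) * (100 * z ^ 14 * f + 100 * fh)" using A True by simp
    ultimately show ?thesis using nn by linarith
  next
    case False
    then have Nf: "Nf \<le> 1 / z ^ 11" using r0 z0 by (simp add: Nf_def field_simps)
    \<comment> \<open>Per unit of probability a coordinate of \<open>y\<close> has at most
      \<open>z ^ 3 * Y\<close>, and at most one draw in \<open>z ^ 11\<close> is heavy.\<close>
    have SYH: "SYH \<le> z ^ 3 * Y * (1 / z ^ 11)"
    proof -
      have "SYH \<le> z ^ 3 * Y * Nf" unfolding SYH_def Nf_def H_def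
        by (rule S_heavy_le[OF \<omega> yq]) (use Y0 z0 in auto)
      also have "\<dots> \<le> z ^ 3 * Y * (1 / z ^ 11)" using Nf Y0 z0 by (intro mult_left_mono) auto
      finally show ?thesis .
    qed
    also have "\<dots> = z ^ 3 / z ^ (3 + 8) * Y" by simp
    also have "\<dots> = 1 / z ^ 8 * Y" unfolding zpow_div ..
    finally have SYH8: "SYH \<le> 1 / z ^ 8 * Y" .
    have CSYH: "C * SYH \<le> 1 / z ^ 3 * Y"
    proof -
      have "C * SYH \<le> C * (1 / z ^ 8 * Y)" using SYH8 C0 by (rule mult_left_mono)
      also have "\<dots> = 25 * (z ^ 4 / z ^ (4 + 4)) * Y" by (simp add: Cz)
      also have "\<dots> = 25 / z ^ Suc 3 * Y" unfolding zpow_div by simp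
      also have "\<dots> \<le> 1 / z ^ 3 * Y" using z_small[of 25 3] z Y0 by (intro mult_right_mono) auto
      finally show ?thesis .
    qed
    have z3: "1 / z ^ 3 \<le> 1 / 32" and z8: "1 / z ^ 8 \<le> 1 / 32" and z32: "1 / z ^ 3 \<le> 1 / z\<^sup>2 / 10000"
    proof -
      have "32 \<le> z ^ 1" using z by simp
      then have "32 \<le> z ^ 3" "32 \<le> z ^ 8" using zpow[of 1 3] zpow[of 1 8] by linarith+
      then show "1 / z ^ 3 \<le> 1 / 32" "1 / z ^ 8 \<le> 1 / 32" using z0 by (simp_all add: divide_le_eq_1_pos)
      have "10000 / z ^ Suc 2 \<le> 1 / z ^ 2" by (rule z_small) (use z in auto)
      then show "1 / z ^ 3 \<le> 1 / z\<^sup>2 / 10000" by (simp add: numeral_3_eq_3)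
    qed
    have SYHs: "SYH \<le> Y / 32" "cs \<le> Y / 32"
      using order_trans[OF SYH8 mult_right_mono[OF z8 Y0]] order_trans[OF CSYH mult_right_mono[OF z3 Y0]] by (simp_all add: cs_def)
    have DHge: "- a2 - cs \<le> DH"
    proof -
      have "S \<omega> (\<lambda>i. (- \<eta>) * (if i \<in> H then \<bar>\<rho> i\<bar> powr p else 0) + (- C) * (if i \<in> H then \<bar>y i\<bar> powr p else 0)) \<le> DH"
        unfolding DH_def by (rule S_mono[OF \<omega>]) (use gabs in \<open>auto simp: abs_le_iff\<close>, smt (verit))
      then show ?thesis unfolding S_add S_cmult by (simp add: fh_def FH_def SYH_def H_def a2_def cs_def)
    qed
    \<comment> \<open>The light part may lose what \<open>D\<close> allows, \<open>a1 + a2\<close>,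
      and in addition what the heavy samples can save, \<open>a2 + cs\<close>.\<close>
    have DLle: "DL \<le> a1 + 2 * a2 + cs" using SD DHge by argo
    have \<eta>0: "0 \<le> a2" "0 \<le> a3" unfolding a2_def a3_def using \<eta> fh0 f0 by auto
    have Yb: "Y \<le> 48 * fl + 32 * a2" using SYge SYLle DLle SYHs aF(1) \<eta>0 fl0 by argo
    have \<eta>fh: "4000 / z\<^sup>2 * fh = 4000 * a2" "2000 / z\<^sup>2 * f = 2000 * a3" by (simp_all add: \<eta>_def a2_def a3_def)
    show ?thesis
    proof (cases "2 * f < fl \<or> deviates \<rho> \<omega>")
      case True
      have "d \<le> 200 * zf + 4000 * a2 + 2000 * a3" using d1 Yb flK' fzf \<eta>0 f0 by argo
      then show ?thesis using True False \<eta>fh by (simp add: mult.assoc zf_def)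
    next
      case good: False
      then have fl2: "fl \<le> 2 * f" by simp
      show ?thesis
      \<comment> \<open>If the sampled heavy residual dominates, the crude bound \<open>d1\<close>
        is already within \<open>4000 * a2\<close>. Otherwise \<open>Y \<le> 100 * f\<close>, which
        is the origin of the radius \<open>400 * f\<close> in \<open>deviates\<close>: coefficients
        are bounded by four times the norm.\<close>
      proof (cases "4 * f < 32 * a2")
        case True
        then have "d \<le> 4000 * a2" using d1 Yb fl2 f0 by argo
        then show ?thesis using \<eta>fh \<eta>0 good \<open>\<not> real r / z ^ 11 < hits \<rho> \<omega>\<close> by simp
      next
        case F2: False
        then have Y100: "Y \<le> 100 * f" using Yb fl2 F2 by argo
        have csm: "\<forall>l<k. \<bar>c l\<bar> powr p \<le> 400 * fsum \<rho>" using c Y100 unfolding Y_def y_def f_def by fastforce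
        have dev: "\<bar>S \<omega> (G (- H) \<rho> c) - (\<Sum>i<n. G (- H) \<rho> c i)\<bar> \<le> f / z\<^sup>2"
          using good csm unfolding deviates_def H_def f_def by (meson not_le)
        have Geq: "G (- H) \<rho> c = (\<lambda>i. if i \<in> H then 0 else g i)" by (auto simp: G_def g_def y_def)
        have dL: "(\<Sum>i<n. if i \<in> H then 0 else g i) \<le> DL + a3"
          using dev unfolding Geq DL_def by (simp add: \<eta>_def a3_def abs_le_iff)
        have dH: "(\<Sum>i<n. if i \<in> H then g i else 0) \<le> \<eta> * f + 2500 / z ^ 7 * f"
        proof -
          have "(if i \<in> H then g i else 0) \<le> \<eta> * \<bar>\<rho> i\<bar> powr p + 2500 / z ^ 7 * \<bar>\<rho> i\<bar> powr p" if "i < n" for i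
          proof (cases "i \<in> H")
            case True
            \<comment> \<open>Heaviness turns the bound on \<open>y\<close> in terms of
              \<open>q i\<close> into one in terms of the residual itself: \<open>z ^ 14\<close>
              beats the \<open>z ^ 3\<close> of the sensitivities and the \<open>z ^ 4\<close> of
              \<open>C\<close>.\<close>
            have "z ^ 14 * f * q i \<le> \<bar>\<rho> i\<bar> powr p" using True by (simp add: H_def heavy_def f_def)
            then have "100 * z ^ 3 * (f * q i) \<le> 100 * z ^ 3 * (\<bar>\<rho> i\<bar> powr p / z ^ 14)"
              using z0 by (intro mult_left_mono) (auto simp: field_simps)
            moreover have "z ^ 3 * Y * q i \<le> z ^ 3 * (100 * f) * q i"
              using Y100 z0 q0'[OF that] by (intro mult_right_mono mult_left_mono) auto
            ultimately have "\<bar>y i\<bar> powr p \<le> 100 * z ^ 3 * (\<bar>\<rho> i\<bar> powr p / z ^ 14)"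
              using yq[OF that] by (simp add: mult_ac)
            then have "C * \<bar>y i\<bar> powr p \<le> C * (100 * z ^ 3 * (\<bar>\<rho> i\<bar> powr p / z ^ 14))" using C0 by (rule mult_left_mono)
            also have "\<dots> = 2500 * (z ^ 7 / z ^ (7 + 7)) * \<bar>\<rho> i\<bar> powr p"
            proof -
              have "z ^ 7 = z ^ 4 * z ^ 3" by (simp flip: power_add)
              then show ?thesis unfolding Cz by (simp only: numeral_plus_numeral mult_ac times_divide_eq_right) simp
            qed
            also have "\<dots> = 2500 / z ^ 7 * \<bar>\<rho> i\<bar> powr p" unfolding zpow_div by simp
            finally show ?thesis using gabs[of i] True by simp
          next
            case False then show ?thesis using \<eta> z0 by simp
          qed
          then have "(\<Sum>i<n. if i \<in> H then g i else 0) \<le> (\<Sum>i<n. \<eta> * \<bar>\<rho> i\<bar> powr p + 2500 / z ^ 7 * \<bar>\<rho> i\<bar> powr p)"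
            by (intro sum_mono) auto
          also have "\<dots> = \<eta> * f + 2500 / z ^ 7 * f" by (simp add: sum.distrib f_def fsum_def sum_distrib_left)
          finally show ?thesis .
        qed
        have "d = (\<Sum>i<n. g i)" by (simp add: d_def g_def sum_subtractf f_def fsum_def)
        also have "\<dots> = (\<Sum>i<n. (if i \<in> H then 0 else g i) + (if i \<in> H then g i else 0))" by (rule sum.cong) auto
        finally have dsum: "d = (\<Sum>i<n. if i \<in> H then 0 else g i) + (\<Sum>i<n. if i \<in> H then g i else 0)" by (simp add: sum.distrib)
        have b1: "2500 / z ^ 7 * f \<le> a3" unfolding a3_def
        proof (rule mult_right_mono[OF _ f0])
          have "2500 / z ^ Suc 6 \<le> 1 / z ^ 6" by (rule z_small) (use z in auto)
          also have "\<dots> \<le> 1 / z\<^sup>2" using zpow[of 2 6] z0 by (intro divide_left_mono) auto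
          finally show "2500 / z ^ 7 \<le> \<eta>" by (simp add: \<eta>_def)
        qed
        have b2: "cs \<le> a3" unfolding cs_def
        proof -
          have "C * SYH \<le> 1 / z ^ 3 * (100 * f)" using CSYH Y100 z0 mult_left_mono[of Y "100 * f" "1 / z ^ 3"] by simp
          also have "\<dots> \<le> 1 / z\<^sup>2 / 10000 * (100 * f)" using z32 f0 by (intro mult_right_mono) auto
          also have "\<dots> = a3 / 100" by (simp add: \<eta>_def a3_def)
          also have "\<dots> \<le> a3" using \<eta>0 by simp
          finally show "C * SYH \<le> a3" .
        qed
        have b3: "a1 \<le> 2 * a3" unfolding a1_def a3_def using fl2 \<eta> mult_left_mono[of fl "2 * f" \<eta>] by simp
        have "d \<le> 6 * a3 + 2 * a2" using dsum dL dH[folded a3_def] DLle b1 b2 b3 by argo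
        then show ?thesis using \<eta>fh \<eta>0 good \<open>\<not> real r / z ^ 11 < hits \<rho> \<omega>\<close> by simp
      qed
    qed
  qed
  then show ?thesis by (simp add: Psi_def d_def f_def fl_def fh_def y_def)
qed

end

section \<open>Expectation of the excess bound and choice of a sample\<close>

context sampling begin

text \<open>Markov's inequality under \<open>q\<close>: a positive residual makes the probability of
  the heavy coordinates at most \<open>1 / z ^ 14\<close>.\<close>

lemma heavy_mass: "z ^ 14 * fsum \<rho> * (\<Sum>i<n. q i * of_bool (i \<in> heavy \<rho>)) \<le> fsum \<rho>"
proof -
  have "z ^ 14 * fsum \<rho> * (\<Sum>i<n. q i * of_bool (i \<in> heavy \<rho>)) = (\<Sum>i<n. z ^ 14 * fsum \<rho> * q i * of_bool (i \<in> heavy \<rho>))"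
    by (rule trans[OF sum_distrib_left]) (simp only: mult.assoc)
  also have "\<dots> \<le> (\<Sum>i<n. \<bar>\<rho> i\<bar> powr p)"
    by (rule sum_mono) (auto simp: heavy_def)
  finally show ?thesis by (simp add: fsum_def)
qed

lemma heavy_empty:
  assumes "fsum \<rho> = 0" shows "heavy \<rho> = {}"
proof (rule equals0I)
  fix i assume "i \<in> heavy \<rho>"
  then have i: "i < n" "z ^ 14 * fsum \<rho> * q i < \<bar>\<rho> i\<bar> powr p" unfolding heavy_def by blast+
  have "\<bar>\<rho> i\<bar> powr p \<le> fsum \<rho>" unfolding fsum_def using i by (intro member_le_sum) auto
  then show False using i(2) unfolding assms by linarith
qed

lemma heavy_mass': "0 < fsum \<rho> \<Longrightarrow> (\<Sum>i<n. q i * of_bool (i \<in> heavy \<rho>)) \<le> 1 / z ^ 14"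
  using heavy_mass[of \<rho>] z0 by (simp add: field_simps)

lemma EE_FH: "EE (FH \<rho>) \<le> fsum \<rho>"
  unfolding FH_def EX_S fsum_def by (rule sum_mono) auto

lemma inv_r: "z ^ i / real r \<le> 1 / z ^ j" if "i + j \<le> 60"
proof -
  have "z ^ i * z ^ j \<le> z ^ 60" unfolding power_add[symmetric] by (rule zpow[OF that])
  also have "\<dots> \<le> real r" by (rule r60)
  finally show ?thesis using r0 z0 by (simp add: field_simps)
qed

text \<open>Chebyshev's inequality. The expected number of hits is at most
  \<open>r / z ^ 14\<close>, less than half of the threshold \<open>r / z ^ 11\<close>.\<close>

lemma EE_many_hits:
  assumes f: "0 < fsum \<rho>"
  shows "EE (\<lambda>\<omega>. of_bool (real r / z ^ 11 < hits \<rho> \<omega>)) \<le> 4 * (z ^ 8 / real r)"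
proof -
  define hq where "hq = (\<Sum>i<n. q i * of_bool (i \<in> heavy \<rho>))"
  have hq: "hq \<le> 1 / z ^ 14" using heavy_mass'[OF f] by (simp add: hq_def)
  have hq0: "0 \<le> hq" unfolding hq_def by (rule sum_nonneg) (use q0' in auto)
  define a where "a = real r / (2 * z ^ 11)"
  have a0: "0 < a" using r0 z0 by (simp add: a_def)
  have ra: "real r * hq \<le> a"
  proof -
    have "real r * hq \<le> real r * (1 / z ^ 14)" using hq r0 by (intro mult_left_mono) auto
    also have "\<dots> = real r * (1 / z ^ (11 + 3))" by simp
    also have "\<dots> = real r / z ^ 11 * (1 / z ^ 3)" by (simp only: power_add) simp
    also have "\<dots> \<le> real r / z ^ 11 * (1 / 2)"
    proof (intro mult_left_mono)
      have "2 \<le> z ^ 1" using z by simp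
      also have "\<dots> \<le> z ^ 3" by (rule zpow) simp
      finally show "1 / z ^ 3 \<le> 1 / 2" using z0 by (intro divide_left_mono) auto
    qed (use r0 z0 in auto)
    finally show ?thesis by (simp add: a_def)
  qed
  have "EE (\<lambda>\<omega>. of_bool (real r / z ^ 11 < hits \<rho> \<omega>)) \<le> EE (\<lambda>\<omega>. 1 / a\<^sup>2 * (hits \<rho> \<omega> - real r * hq)\<^sup>2)"
  proof (rule expect_mono[OF q0'])
    fix \<omega>
    show "of_bool (real r / z ^ 11 < hits \<rho> \<omega>) \<le> 1 / a\<^sup>2 * (hits \<rho> \<omega> - real r * hq)\<^sup>2"
    proof (cases "real r / z ^ 11 < hits \<rho> \<omega>")
      case True
      have "real r / z ^ 11 = 2 * a" by (simp add: a_def)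
      then have "a \<le> hits \<rho> \<omega> - real r * hq" using True ra by linarith
      then have "a\<^sup>2 \<le> (hits \<rho> \<omega> - real r * hq)\<^sup>2" using a0 by (intro power_mono) auto
      then show ?thesis using True a0 by simp
    qed simp
  qed
  also have "\<dots> \<le> 1 / a\<^sup>2 * (real r * (\<Sum>i<n. q i * (of_bool (i \<in> heavy \<rho>))\<^sup>2))"
    unfolding expect_cmult hits_def hq_def
    by (intro mult_left_mono expect_variance[OF q1 q0', where \<phi> = "\<lambda>i. of_bool (i \<in> heavy \<rho>)"]) auto
  also have "(\<Sum>i<n. q i * (of_bool (i \<in> heavy \<rho>))\<^sup>2) = hq" unfolding hq_def by (rule sum.cong) auto
  also have "1 / a\<^sup>2 * (real r * hq) \<le> 1 / a\<^sup>2 * (real r * (1 / z ^ 14))"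
    using hq r0 by (intro mult_left_mono) auto
  also have "\<dots> = 4 * (z ^ 22 / z ^ 14) / real r"
  proof -
    have "(z ^ 11)\<^sup>2 = z ^ 22" by (simp flip: power_mult)
    then have a2: "a\<^sup>2 = real r * real r / (4 * z ^ 22)"
      unfolding a_def power_divide power_mult_distrib by (simp add: power2_eq_square[of "real r"])
    show ?thesis unfolding a2 using r0 by simp
  qed
  also have "z ^ 22 / z ^ 14 = z ^ 8" using zpow_div_add[of 14 8] by simp
  finally show ?thesis by simp
qed

text \<open>If a heavy row is among many heavy hits, then many of the \<^emph>\<open>other\<close> samples are heavy, an
  independent and unlikely event.\<close>

lemma EE_many_hits_FH:
  assumes f: "0 < fsum \<rho>"
  shows "EE (\<lambda>\<omega>. of_bool (real r / z ^ 11 < hits \<rho> \<omega>) * FH \<rho> \<omega>) \<le> 2 / z ^ 3 * fsum \<rho>"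
proof -
  define h where "h i = (of_bool (i \<in> heavy \<rho>) :: real)" for i
  define hq where "hq = (\<Sum>i<n. q i * h i)"
  have hq: "hq \<le> 1 / z ^ 14" using heavy_mass'[OF f] by (simp add: hq_def h_def)
  have hq0: "0 \<le> hq" unfolding hq_def h_def by (rule sum_nonneg) (use q0' in auto)
  define \<phi> where "\<phi> i = (if i \<in> heavy \<rho> then \<bar>\<rho> i\<bar> powr p else 0) / q i" for i
  have \<phi>0: "0 \<le> \<phi> i" if "i < n" for i using q0'[OF that] by (simp add: \<phi>_def)
  have q\<phi>: "(\<Sum>i<n. q i * \<phi> i) \<le> fsum \<rho>"
    unfolding fsum_def
  proof (rule sum_mono)
    fix i assume "i \<in> {..<n}"
    then show "q i * \<phi> i \<le> \<bar>\<rho> i\<bar> powr p" using q0[of i] by (simp add: \<phi>_def)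
  qed
  \<comment> \<open>One factor \<open>r\<close> is the normalization of \<open>FH\<close>; the rest
    divides by \<open>r / (2 * z ^ 11)\<close>, a lower bound for the number of other heavy
    draws.\<close>
  define A where "A = 2 * z ^ 11 / (real r * real r)"
  have A0: "0 \<le> A" using z0 by (simp add: A_def)
  have "EE (\<lambda>\<omega>. of_bool (real r / z ^ 11 < hits \<rho> \<omega>) * FH \<rho> \<omega>) \<le>
     EE (\<lambda>\<omega>. A * (\<Sum>t<r. \<Sum>s\<in>{..<r} - {t}. \<phi> (\<omega> t) * h (\<omega> s)))"
  proof (rule expect_mono[OF q0'])
    fix \<omega> assume \<omega>: "\<omega> \<in> \<Omega>"
    have ph0: "0 \<le> \<phi> (\<omega> t)" if "t < r" for t using \<phi>0 \<omega> that by (auto simp: PiE_iff)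
    have h0: "0 \<le> h i" for i by (simp add: h_def)
    show "of_bool (real r / z ^ 11 < hits \<rho> \<omega>) * FH \<rho> \<omega> \<le> A * (\<Sum>t<r. \<Sum>s\<in>{..<r} - {t}. \<phi> (\<omega> t) * h (\<omega> s))"
    proof (cases "real r / z ^ 11 < hits \<rho> \<omega>")
      case True
      have FHe: "FH \<rho> \<omega> = (\<Sum>t<r. \<phi> (\<omega> t)) / real r" by (simp add: FH_def S_def \<phi>_def)
      have two: "2 \<le> real r / z ^ 11"
      proof -
        have "2 * z ^ 11 \<le> z * z ^ 11" using z z0 by (intro mult_right_mono) auto
        also have "\<dots> = z ^ 12" by (simp flip: power_Suc)
        also have "\<dots> \<le> z ^ 60" by (rule zpow) simp
        also have "\<dots> \<le> real r" by (rule r60)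
        finally show ?thesis using z0 by (simp add: field_simps)
      qed
      have "\<phi> (\<omega> t) / real r \<le> A * (\<Sum>s\<in>{..<r} - {t}. \<phi> (\<omega> t) * h (\<omega> s))" if t: "t < r" for t
      proof (cases "\<omega> t \<in> heavy \<rho>")
        case h: True
        have "hits \<rho> \<omega> = h (\<omega> t) + (\<Sum>s\<in>{..<r} - {t}. h (\<omega> s))"
          unfolding hits_def h_def[symmetric] using t by (simp add: sum.remove)
        then have "real r / (2 * z ^ 11) \<le> (\<Sum>s\<in>{..<r} - {t}. h (\<omega> s))" using h True two by (simp add: h_def)
        then have "A * \<phi> (\<omega> t) * (real r / (2 * z ^ 11)) \<le> A * \<phi> (\<omega> t) * (\<Sum>s\<in>{..<r} - {t}. h (\<omega> s))"
          using A0 ph0[OF t] by (intro mult_left_mono) auto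
        moreover have "A * \<phi> (\<omega> t) * (real r / (2 * z ^ 11)) = \<phi> (\<omega> t) / real r"
          using r0 z0 by (simp add: A_def)
        ultimately show ?thesis by (simp add: sum_distrib_left mult.assoc)
      next
        case False
        then have "\<phi> (\<omega> t) = 0" by (simp add: \<phi>_def)
        then show ?thesis by simp
      qed
      then have "(\<Sum>t<r. \<phi> (\<omega> t) / real r) \<le> (\<Sum>t<r. A * (\<Sum>s\<in>{..<r} - {t}. \<phi> (\<omega> t) * h (\<omega> s)))"
        by (intro sum_mono) auto
      then show ?thesis using True by (simp add: FHe sum_divide_distrib sum_distrib_left)
    next
      case False
      have "0 \<le> A * (\<Sum>t<r. \<Sum>s\<in>{..<r} - {t}. \<phi> (\<omega> t) * h (\<omega> s))"
        using A0 ph0 h0 by (intro mult_nonneg_nonneg sum_nonneg) auto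
      then show ?thesis using False by simp
    qed
  qed
  also have "\<dots> = A * (\<Sum>t<r. \<Sum>s\<in>{..<r} - {t}. (\<Sum>i<n. q i * \<phi> i) * hq)"
    unfolding expect_cmult expect_sum hq_def
    by (intro arg_cong[where f = "\<lambda>x. A * x"] sum.cong refl expect_pair[OF q1]) auto
  also have "\<dots> \<le> A * (\<Sum>t<r. \<Sum>s<r. fsum \<rho> * (1 / z ^ 14))"
  proof (intro mult_left_mono sum_mono)
    fix t
    have "(\<Sum>s\<in>{..<r} - {t}. (\<Sum>i<n. q i * \<phi> i) * hq) \<le> (\<Sum>s\<in>{..<r} - {t}. fsum \<rho> * (1 / z ^ 14))"
      using q\<phi> hq hq0 fsum_nonneg by (intro sum_mono mult_mono) auto
    also have "\<dots> \<le> (\<Sum>s<r. fsum \<rho> * (1 / z ^ 14))"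
      using fsum_nonneg z0 by (intro sum_mono2) auto
    finally show "(\<Sum>s\<in>{..<r} - {t}. (\<Sum>i<n. q i * \<phi> i) * hq) \<le> (\<Sum>s<r. fsum \<rho> * (1 / z ^ 14))" .
  qed (rule A0)
  also have "\<dots> = 2 * (z ^ 11 / z ^ (11 + 3)) * fsum \<rho>" using r0 by (simp add: A_def)
  also have "\<dots> = 2 / z ^ 3 * fsum \<rho>" unfolding zpow_div by simp
  finally show ?thesis .
qed

text \<open>Chebyshev's inequality. Light summands are at most \<open>z ^ 14 * fsum \<rho>\<close>,
  so their second moment is at most that times their mean.\<close>

lemma EE_FL_large:
  assumes f: "0 < fsum \<rho>"
  shows "EE (\<lambda>\<omega>. of_bool (2 * fsum \<rho> < FL \<rho> \<omega>)) \<le> z ^ 14 / real r"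
proof -
  let ?f = "fsum \<rho>"
  define \<phi> where "\<phi> i = (if i \<in> heavy \<rho> then 0 else \<bar>\<rho> i\<bar> powr p) / q i" for i
  have q\<phi>: "(\<Sum>i<n. q i * \<phi> i) \<le> ?f"
    unfolding fsum_def
  proof (rule sum_mono)
    fix i assume "i \<in> {..<n}"
    then show "q i * \<phi> i \<le> \<bar>\<rho> i\<bar> powr p" using q0[of i] by (simp add: \<phi>_def)
  qed
  have \<phi>K: "0 \<le> \<phi> i" "\<phi> i \<le> z ^ 14 * ?f" if "i < n" for i
    using q0[OF that] that f z0 by (auto simp: \<phi>_def heavy_def not_less field_simps)
  define \<mu> where "\<mu> = (\<Sum>i<n. q i * \<phi> i)"
  have "EE (\<lambda>\<omega>. of_bool (2 * ?f < FL \<rho> \<omega>)) \<le> EE (\<lambda>\<omega>. 1 / (real r * ?f)\<^sup>2 * ((\<Sum>t<r. \<phi> (\<omega> t)) - real r * \<mu>)\<^sup>2)"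
  proof (rule expect_mono[OF q0'])
    fix \<omega>
    show "of_bool (2 * ?f < FL \<rho> \<omega>) \<le> 1 / (real r * ?f)\<^sup>2 * ((\<Sum>t<r. \<phi> (\<omega> t)) - real r * \<mu>)\<^sup>2"
    proof (cases "2 * ?f < FL \<rho> \<omega>")
      case True
      have "FL \<rho> \<omega> = (\<Sum>t<r. \<phi> (\<omega> t)) / real r" by (simp add: FL_def S_def \<phi>_def)
      then have "(\<Sum>t<r. \<phi> (\<omega> t)) = real r * FL \<rho> \<omega>" using r0 by simp
      then have "real r * (2 * ?f) \<le> (\<Sum>t<r. \<phi> (\<omega> t))" using True r0 mult_left_mono[of "2 * ?f" "FL \<rho> \<omega>" "real r"] by simp
      moreover have "real r * \<mu> \<le> real r * ?f" using q\<phi> r0 by (simp add: \<mu>_def)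
      ultimately have "real r * ?f \<le> (\<Sum>t<r. \<phi> (\<omega> t)) - real r * \<mu>" by (simp add: algebra_simps)
      then have "(real r * ?f)\<^sup>2 \<le> ((\<Sum>t<r. \<phi> (\<omega> t)) - real r * \<mu>)\<^sup>2" using f r0 by (intro power_mono) auto
      moreover have "0 < (real r * ?f)\<^sup>2" using f r0 by simp
      ultimately have "1 \<le> 1 / (real r * ?f)\<^sup>2 * ((\<Sum>t<r. \<phi> (\<omega> t)) - real r * \<mu>)\<^sup>2" by (simp add: field_simps)
      then show ?thesis using True by simp
    qed simp
  qed
  also have "\<dots> \<le> 1 / (real r * ?f)\<^sup>2 * (real r * (\<Sum>i<n. q i * (\<phi> i)\<^sup>2))"
    unfolding expect_cmult \<mu>_def by (intro mult_left_mono expect_variance[OF q1 q0']) auto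
  also have "\<dots> \<le> 1 / (real r * ?f)\<^sup>2 * (real r * (z ^ 14 * ?f * ?f))"
  proof (intro mult_left_mono)
    have "(\<Sum>i<n. q i * (\<phi> i)\<^sup>2) \<le> (\<Sum>i<n. z ^ 14 * ?f * (q i * \<phi> i))"
    proof (rule sum_mono)
      fix i assume "i \<in> {..<n}"
      then have i: "i < n" by simp
      have "q i * \<phi> i * \<phi> i \<le> q i * \<phi> i * (z ^ 14 * ?f)" using \<phi>K[OF i] q0'[OF i] by (intro mult_left_mono) auto
      then show "q i * (\<phi> i)\<^sup>2 \<le> z ^ 14 * ?f * (q i * \<phi> i)" by (simp add: power2_eq_square mult_ac)
    qed
    also have "\<dots> = z ^ 14 * ?f * \<mu>" by (simp add: \<mu>_def sum_distrib_left)
    also have "\<dots> \<le> z ^ 14 * ?f * ?f" using q\<phi> f z0 by (intro mult_left_mono) (auto simp: \<mu>_def)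
    finally show "(\<Sum>i<n. q i * (\<phi> i)\<^sup>2) \<le> z ^ 14 * ?f * ?f" .
  qed auto
  also have "\<dots> = z ^ 14 / real r" using f r0 by (simp add: power2_eq_square)
  finally show ?thesis .
qed

lemma EE_deviates:
  assumes f: "0 < fsum \<rho>"
  shows "EE (\<lambda>\<omega>. of_bool (deviates \<rho> \<omega>)) \<le> 1 / z ^ 20"
  unfolding deviates_def by (rule uniform_deviation[OF f]) (auto simp: heavy_def not_less)

text \<open>\<open>FH\<close> is not concentrated, but its expectation is at most
  \<open>fsum \<rho>\<close>, and the small factor in front of it asks for no more. The bad events
  are rare enough to swallow \<open>z ^ 14\<close>. The bound is proportional to
  \<open>fsum \<rho>\<close> and thus can be summed over columns.\<close>

lemma EE_Psi: "EE (Psi \<rho>) \<le> 7000 / z\<^sup>2 * fsum \<rho>"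
proof (cases "fsum \<rho> = 0")
  case True
  then have "Psi \<rho> = (\<lambda>_. 0)" using heavy_empty[OF True] by (auto simp: Psi_def FH_def S_def)
  then show ?thesis using True by (simp add: expect_def)
next
  case False
  then have f: "0 < fsum \<rho>" using fsum_nonneg[of \<rho>] by linarith
  let ?f = "fsum \<rho>" and ?E = "1 / z\<^sup>2"
  let ?h = "\<lambda>\<omega>. of_bool (real r / z ^ 11 < hits \<rho> \<omega>) :: real"
  let ?a = "\<lambda>\<omega>. of_bool (2 * ?f < FL \<rho> \<omega>) :: real" and ?d = "\<lambda>\<omega>. of_bool (deviates \<rho> \<omega>) :: real"
  have "EE (Psi \<rho>) \<le> EE (\<lambda>\<omega>. 100 * z ^ 14 * ?f * ?h \<omega> + 100 * (?h \<omega> * FH \<rho> \<omega>) + 200 * z ^ 14 * ?f * ?a \<omega> + 200 * z ^ 14 * ?f * ?d \<omega>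
     + 4000 / z\<^sup>2 * FH \<rho> \<omega> + 2000 / z\<^sup>2 * ?f)"
  proof (rule expect_mono[OF q0'])
    fix \<omega> assume \<omega>: "\<omega> \<in> \<Omega>"
    have zf: "0 \<le> 200 * z ^ 14 * ?f" using f z0 by simp
    have "(of_bool (2 * ?f < FL \<rho> \<omega> \<or> deviates \<rho> \<omega>) :: real) \<le> ?a \<omega> + ?d \<omega>" by auto
    from mult_right_mono[OF this zf]
    show "Psi \<rho> \<omega> \<le> 100 * z ^ 14 * ?f * ?h \<omega> + 100 * (?h \<omega> * FH \<rho> \<omega>) + 200 * z ^ 14 * ?f * ?a \<omega> + 200 * z ^ 14 * ?f * ?d \<omega>
     + 4000 / z\<^sup>2 * FH \<rho> \<omega> + 2000 / z\<^sup>2 * ?f"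
      unfolding Psi_def by (simp only: distrib_left distrib_right mult_ac)
  qed
  also have "\<dots> = 100 * z ^ 14 * ?f * EE ?h + 100 * EE (\<lambda>\<omega>. ?h \<omega> * FH \<rho> \<omega>) + 200 * z ^ 14 * ?f * EE ?a + 200 * z ^ 14 * ?f * EE ?d
     + 4000 / z\<^sup>2 * EE (FH \<rho>) + 2000 / z\<^sup>2 * ?f"
    by (simp only: expect_add expect_cmult expect_1[OF q1])
  also have "\<dots> \<le> 100 * z ^ 14 * ?f * (4 * (z ^ 8 / real r)) + 100 * (2 / z ^ 3 * ?f) + 200 * z ^ 14 * ?f * (z ^ 14 / real r)
     + 200 * z ^ 14 * ?f * (1 / z ^ 20) + 4000 / z\<^sup>2 * ?f + 2000 / z\<^sup>2 * ?f"
    using f z0 by (intro add_mono mult_left_mono EE_many_hits EE_many_hits_FH EE_FL_large EE_deviates EE_FH order_refl) auto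
  also have "\<dots> = 400 * (z ^ 22 / real r) * ?f + 200 / z ^ Suc 2 * ?f + 200 * (z ^ 28 / real r) * ?f + 200 * (z ^ 14 / z ^ (14 + 6)) * ?f
     + 4000 * ?E * ?f + 2000 * ?E * ?f"
  proof -
    have z22: "z ^ 22 = z ^ 14 * z ^ 8" and z28: "z ^ 28 = z ^ 14 * z ^ 14" by (simp_all flip: power_add)
    have "100 * z ^ 14 * ?f * (4 * (z ^ 8 / real r)) = 400 * ((z ^ 14 * z ^ 8) / real r) * ?f" by simp
    moreover have "200 * z ^ 14 * ?f * (z ^ 14 / real r) = 200 * ((z ^ 14 * z ^ 14) / real r) * ?f" by simp
    moreover have "200 * z ^ 14 * ?f * (1 / z ^ 20) = 200 * (z ^ 14 / z ^ (14 + 6)) * ?f" by simp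
    moreover have "100 * (2 / z ^ 3 * ?f) = 200 / z ^ Suc 2 * ?f" by (simp add: numeral_3_eq_3)
    moreover have "4000 / z\<^sup>2 * ?f = 4000 * ?E * ?f" "2000 / z\<^sup>2 * ?f = 2000 * ?E * ?f" by simp_all
    ultimately show ?thesis unfolding z22 z28 by linarith
  qed
  also have "\<dots> \<le> 400 * (1 / z ^ 3) * ?f + ?E * ?f + 200 * (1 / z ^ 3) * ?f + 200 * (1 / z ^ 3) * ?f + 4000 * ?E * ?f + 2000 * ?E * ?f"
  proof (intro add_mono mult_right_mono mult_left_mono inv_r order_refl)
    show "200 / z ^ Suc 2 \<le> ?E" by (rule z_small) (use z in auto)
    show "z ^ 14 / z ^ (14 + 6) \<le> 1 / z ^ 3" unfolding zpow_div using zpow[of 3 6] z0 by (intro divide_left_mono) auto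
  qed (use f in auto)
  also have "\<dots> = 800 / z ^ Suc 2 * ?f + 6001 * ?E * ?f" by (simp add: algebra_simps numeral_3_eq_3)
  also have "\<dots> \<le> ?E * ?f + 6001 * ?E * ?f"
    using z_small[of 800 2] z f by (intro add_mono mult_right_mono) auto
  also have "\<dots> \<le> 7000 / z\<^sup>2 * ?f" using f z0 by (simp add: divide_right_mono)
  finally show ?thesis .
qed

text \<open>By homogeneity a violating vector may be scaled to norm 1, where its coefficients
  satisfy the bound 4; it then violates the uniform deviation bound for zero residual and
  \<open>f = 1\<close>.\<close>

lemma EE_not_embeds: "EE (\<lambda>\<omega>. of_bool (\<not> embeds \<omega>)) \<le> 1 / z ^ 20"
proof -
  have "EE (\<lambda>\<omega>. of_bool (\<not> embeds \<omega>)) \<le> EE (\<lambda>\<omega>. of_bool (\<exists>c. (\<forall>l<k. \<bar>c l\<bar> powr p \<le> 400 * 1) \<and>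
      1 / z\<^sup>2 < \<bar>S \<omega> (G UNIV (\<lambda>_. 0) c) - (\<Sum>i<n. G UNIV (\<lambda>_. 0) c i)\<bar>))"
  proof (rule expect_mono[OF q0'])
    fix \<omega> assume \<omega>: "\<omega> \<in> \<Omega>"
    have "\<exists>c. (\<forall>l<k. \<bar>c l\<bar> powr p \<le> 400 * 1) \<and>
      1 / z\<^sup>2 < \<bar>S \<omega> (G UNIV (\<lambda>_. 0) c) - (\<Sum>i<n. G UNIV (\<lambda>_. 0) c i)\<bar>" if ne: "\<not> embeds \<omega>"
    proof -
      obtain c where c: "\<forall>l<k. \<bar>c l\<bar> powr p \<le> 4 * (\<Sum>i<n. \<bar>vec c i\<bar> powr p)"
        and lt: "S \<omega> (\<lambda>i. \<bar>vec c i\<bar> powr p) < (\<Sum>i<n. \<bar>vec c i\<bar> powr p) / 2"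
        using ne unfolding embeds_def by (auto simp: not_le)
      define Y where "Y = (\<Sum>i<n. \<bar>vec c i\<bar> powr p)"
      have "0 \<le> S \<omega> (\<lambda>i. \<bar>vec c i\<bar> powr p)" by (rule S_nonneg[OF \<omega>]) auto
      then have Y: "0 < Y" using lt by (simp add: Y_def)
      define s where "s = Y powr (- 1 / p)"
      have "s powr p = Y powr (- 1 / p * p)" unfolding s_def by (rule powr_powr)
      then have sp: "s powr p = 1 / Y" using Y p0 by (simp add: powr_minus_divide)
      have s0: "0 \<le> s" by (simp add: s_def)
      have "vec (\<lambda>l. s * c l) i = s * vec c i" for i by (simp add: vec_def sum_distrib_left mult.assoc)
      then have Geq: "G UNIV (\<lambda>_. 0) (\<lambda>l. s * c l) = (\<lambda>i. 1 / Y * \<bar>vec c i\<bar> powr p)"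
        using s0 p0 by (auto simp: G_def abs_mult powr_mult sp)
      have 1: "\<forall>l<k. \<bar>s * c l\<bar> powr p \<le> 400 * 1"
      proof (intro allI impI)
        fix l assume "l < k"
        have "\<bar>s * c l\<bar> powr p = \<bar>c l\<bar> powr p / Y" using s0 by (simp add: abs_mult powr_mult sp)
        also have "\<dots> \<le> 4" using c \<open>l < k\<close> Y by (simp add: Y_def field_simps)
        finally show "\<bar>s * c l\<bar> powr p \<le> 400 * 1" by simp
      qed
      have "S \<omega> (G UNIV (\<lambda>_. 0) (\<lambda>l. s * c l)) < 1 / 2" unfolding Geq S_cmult using lt Y by (simp add: Y_def field_simps)
      moreover have "(\<Sum>i<n. G UNIV (\<lambda>_. 0) (\<lambda>l. s * c l) i) = 1"
        unfolding Geq using Y by (simp add: Y_def flip: sum_divide_distrib)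
      moreover have "1 / z\<^sup>2 \<le> 1 / 2"
      proof -
        have "2 \<le> z ^ 1" using z by simp
        also have "\<dots> \<le> z\<^sup>2" by (rule zpow) simp
        finally show ?thesis by (intro divide_left_mono) auto
      qed
      ultimately have "1 / z\<^sup>2 < \<bar>S \<omega> (G UNIV (\<lambda>_. 0) (\<lambda>l. s * c l)) - (\<Sum>i<n. G UNIV (\<lambda>_. 0) (\<lambda>l. s * c l) i)\<bar>" by linarith
      with 1 show ?thesis by (intro exI[of _ "\<lambda>l. s * c l"] conjI)
    qed
    then show "(of_bool (\<not> embeds \<omega>) :: real) \<le> of_bool (\<exists>c. (\<forall>l<k. \<bar>c l\<bar> powr p \<le> 400 * 1) \<and>
      1 / z\<^sup>2 < \<bar>S \<omega> (G UNIV (\<lambda>_. 0) c) - (\<Sum>i<n. G UNIV (\<lambda>_. 0) c i)\<bar>)"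
      by (cases "embeds \<omega>") (simp_all only: of_bool_eq not_True_eq_False not_False_eq_True simp_thms order_refl zero_less_eq_of_bool)
  qed
  also have "\<dots> \<le> 1 / z ^ 20"
    by (rule uniform_deviation[of 1 UNIV "\<lambda>_. 0"]) (simp, simp add: q0' z0 less_imp_le)
  finally show ?thesis .
qed

text \<open>Markov's inequality for the sum over \<open>J\<close>, at twice its expectation: however
  many columns there are, failure has probability at most 1/2, and the embedding fails with
  probability at most \<open>1 / z ^ 20\<close>, so some sample avoids both.\<close>

theorem good_sample:
  assumes J: "finite J"
  obtains \<omega> where "\<omega> \<in> \<Omega>" "embeds \<omega>" "(\<Sum>j\<in>J. Psi (\<rho> j) \<omega>) \<le> 14000 / z\<^sup>2 * (\<Sum>j\<in>J. fsum (\<rho> j))"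
proof -
  define F where "F = (\<Sum>j\<in>J. fsum (\<rho> j))"
  define P where "P \<omega> = (\<Sum>j\<in>J. Psi (\<rho> j) \<omega>)" for \<omega>
  have F0: "0 \<le> F" by (simp add: F_def sum_nonneg fsum_nonneg)
  have Psi0: "0 \<le> Psi \<rho> \<omega>" if "\<omega> \<in> \<Omega>" for \<rho> \<omega>
    unfolding Psi_def using fsum_nonneg FH_nonneg[OF that] z0 by (intro add_nonneg_nonneg mult_nonneg_nonneg) auto
  have EP: "EE P \<le> 7000 / z\<^sup>2 * F"
    unfolding P_def expect_sum F_def sum_distrib_left by (rule sum_mono) (rule EE_Psi)
  have "\<exists>\<omega>\<in>\<Omega>. embeds \<omega> \<and> P \<omega> \<le> 14000 / z\<^sup>2 * F"
  proof (rule ccontr)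
    assume "\<not> ?thesis"
    then have no: "\<And>\<omega>. \<omega> \<in> \<Omega> \<Longrightarrow> embeds \<omega> \<Longrightarrow> 14000 / z\<^sup>2 * F < P \<omega>" by auto
    have z2: "0 < z\<^sup>2" using z0 by simp
    have small: "1 / z ^ 20 < 1 / 2"
    proof -
      have "2 < z ^ 1" using z by simp
      also have "\<dots> \<le> z ^ 20" by (rule zpow) simp
      finally show ?thesis by (intro divide_strict_left_mono) auto
    qed
    show False
    \<comment> \<open>Markov's inequality divides by \<open>F\<close>. If it is zero, every
      \<open>Psi (\<rho> j)\<close> vanishes identically and only the embedding matters.\<close>
    proof (cases "F = 0")
      case True
      have all0: "fsum (\<rho> j) = 0" if "j \<in> J" for j
        using True that unfolding F_def by (simp add: sum_nonneg_eq_0_iff[OF J fsum_nonneg])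
      have "Psi (\<rho> j) \<omega> = 0" if j: "j \<in> J" for j \<omega>
        using all0[OF j] heavy_empty[OF all0[OF j]] by (simp add: Psi_def FH_def S_def)
      then have P0: "P \<omega> = 0" for \<omega> by (simp add: P_def)
      have ne: "\<not> embeds \<omega>" if "\<omega> \<in> \<Omega>" for \<omega> using no[OF that] True P0[of \<omega>] by auto
      have "EE (\<lambda>\<omega>. 1) \<le> EE (\<lambda>\<omega>. of_bool (\<not> embeds \<omega>))"
        by (rule expect_mono[OF q0']) (simp_all add: ne)
      then show False using small EE_not_embeds by (simp add: expect_1[OF q1])
    next
      case False
      then have F: "0 < F" using F0 by simp
      define A where "A = z\<^sup>2 / (14000 * F)"
      have A0: "0 < A" using F z2 by (simp add: A_def)
      have "EE (\<lambda>\<omega>. 1) \<le> EE (\<lambda>\<omega>. of_bool (\<not> embeds \<omega>) + A * P \<omega>)"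
      proof (rule expect_mono[OF q0'])
        fix \<omega> assume \<omega>: "\<omega> \<in> \<Omega>"
        have P0: "0 \<le> P \<omega>" unfolding P_def by (rule sum_nonneg) (rule Psi0[OF \<omega>])
        show "1 \<le> of_bool (\<not> embeds \<omega>) + A * P \<omega>"
        proof (cases "embeds \<omega>")
          case True
          have "1 = A * (14000 / z\<^sup>2 * F)" using F z2 by (simp add: A_def)
          also have "\<dots> \<le> A * P \<omega>" using no[OF \<omega> True] A0 by (intro mult_left_mono) auto
          finally show ?thesis using True by simp
        next
          case False then show ?thesis using A0 P0 by simp
        qed
      qed
      also have "\<dots> \<le> 1 / z ^ 20 + A * (7000 / z\<^sup>2 * F)"
        unfolding expect_add expect_cmult using EE_not_embeds EP A0 by (intro add_mono mult_left_mono) auto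
      also have "A * (7000 / z\<^sup>2 * F) = 1 / 2" using F z2 by (simp add: A_def)
      finally show False using small by (simp add: expect_1[OF q1])
    qed
  qed
  then show ?thesis using that by (auto simp: P_def F_def)
qed

end

text \<open>Existence is enough, since the algorithm tries all samples. The comparison is with an
  arbitrary \<open>X\<close> because the algorithm minimizes over a grid in which the reference
  solution is just one point; and \<open>\<omega>\<close>, \<open>w\<close> are fixed before
  \<open>X'\<close>, which is computed from them.\<close>

theorem sampling_exists:
  fixes p z :: real and n k r d :: nat and U A X :: "nat \<Rightarrow> nat \<Rightarrow> real"
  assumes p: "0 < p" "p \<le> 2" and z: "10000 \<le> z" "2 * real k \<le> z" and k: "1 \<le> k" and n: "1 \<le> n"
    and r: "z ^ 60 * z powr (44 / p) \<le> real r"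
  obtains \<omega> w where "\<And>t. t < r \<Longrightarrow> \<omega> t < n" "\<And>t. t < r \<Longrightarrow> 1 \<le> w t \<and> w t \<le> z * real n"
    "\<And>X'. (\<And>j. j < d \<Longrightarrow> (\<Sum>t<r. w t * \<bar>(\<Sum>l<k. U (\<omega> t) l * X' l j) - A (\<omega> t) j\<bar> powr p)
        \<le> (1 + 1 / z\<^sup>2) * (\<Sum>t<r. w t * \<bar>(\<Sum>l<k. U (\<omega> t) l * X l j) - A (\<omega> t) j\<bar> powr p)) \<Longrightarrow>
      (\<Sum>j<d. \<Sum>i<n. \<bar>(\<Sum>l<k. U i l * X' l j) - A i j\<bar> powr p)
        \<le> (1 + 14000 / z\<^sup>2) * (\<Sum>j<d. \<Sum>i<n. \<bar>(\<Sum>l<k. U i l * X l j) - A i j\<bar> powr p)"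
proof -
  define ux where "ux x i = (\<Sum>l<k. U i l * x l)" for x i
  \<comment> \<open>The unit ball of the column space of \<open>U\<close>; through a nearly maximal
    minor each of its elements gets coefficients of absolute value at most 2.\<close>
  define T where "T = {ux x | x. (\<Sum>i<n. \<bar>ux x i\<bar> powr p) \<le> 1}"
  have T1: "(\<Sum>i<n. \<bar>y i\<bar> powr p) \<le> 1" if "y \<in> T" for y using that by (auto simp: T_def)
  have Tb: "\<bar>y i\<bar> \<le> 1" if "y \<in> T" "i < n" for y i
  proof (rule ccontr)
    assume "\<not> \<bar>y i\<bar> \<le> 1"
    then have "1 powr p < \<bar>y i\<bar> powr p" using p by (intro powr_less_mono2) auto
    moreover have "\<bar>y i\<bar> powr p \<le> (\<Sum>i<n. \<bar>y i\<bar> powr p)" using that by (intro member_le_sum) auto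
    ultimately show False using T1[OF that(1)] by simp
  qed
  have rank: "minor (Suc k) I t = 0" if t: "\<And>b. b < Suc k \<Longrightarrow> t b \<in> T" for I t
  proof -
    have "\<forall>b. \<exists>x. b < Suc k \<longrightarrow> t b = ux x" using t unfolding T_def by blast
    then obtain x where x: "\<And>b. b < Suc k \<Longrightarrow> t b = ux (x b)" by metis
    show ?thesis by (rule minor_rank[where P = "\<lambda>a l. U (I a) l" and Q = "\<lambda>l b. x b l"]) (simp add: x ux_def)
  qed
  obtain b :: "nat \<Rightarrow> nat \<Rightarrow> real" and D :: real where b: "\<And>l. l < k \<Longrightarrow> b l \<in> T \<or> b l = (\<lambda>_. 0)" and D: "D \<noteq> 0"
    and N: "\<And>y. y \<in> T \<Longrightarrow> \<exists>N. (\<forall>l<k. \<bar>N l\<bar> \<le> 2 * \<bar>D\<bar>) \<and> (\<forall>i<n. y i * D = (\<Sum>l<k. N l * b l i))"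
  proof (rule spanner[of T n 1 k])
    show "\<bar>y i\<bar> \<le> 1" if "y \<in> T" "i < n" for y i using Tb that .
    show "minor (Suc k) I t = 0" if "\<And>b. b < Suc k \<Longrightarrow> t b \<in> T" "\<And>a. a < Suc k \<Longrightarrow> I a < n" for I t
      by (rule rank[OF that(1)])
    fix t :: "nat \<Rightarrow> nat \<Rightarrow> real" and D :: real
    assume t: "\<And>b. b < k \<Longrightarrow> t b \<in> T \<or> t b = (\<lambda>_. 0)" and D: "D \<noteq> 0"
      and N: "\<And>y. y \<in> T \<Longrightarrow> \<exists>N. (\<forall>b<k. \<bar>N b\<bar> \<le> 2 * \<bar>D\<bar>) \<and> (\<forall>i<n. y i * D = (\<Sum>b<k. N b * t b i)) \<and>
       ((\<forall>y\<in>T. \<forall>i<n. y i \<in> \<int>) \<longrightarrow> (\<forall>b<k. N b \<in> \<int>))"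
    have "\<exists>N. (\<forall>l<k. \<bar>N l\<bar> \<le> 2 * \<bar>D\<bar>) \<and> (\<forall>i<n. y i * D = (\<Sum>l<k. N l * t l i))" if "y \<in> T" for y
      using N[OF that] by (elim exE conjE) (intro exI conjI)
    with that[of t D] t D show thesis by blast
  qed
  define \<psi> where "\<psi> i = (\<Sum>l<k. \<bar>b l i\<bar> powr p)" for i
  define Z where "Z = (\<Sum>i<n. \<psi> i + 1 / real n)"
  \<comment> \<open>Sensitivities mixed with the uniform distribution: the summand
    \<open>1 / real n\<close> keeps every probability positive and the weights
    \<open>1 / q i\<close> below \<open>z * real n\<close>, so that rounded weights can be
    enumerated.\<close>
  define q where "q i = (\<psi> i + 1 / real n) / Z" for i
  have \<psi>0: "0 \<le> \<psi> i" for i by (simp add: \<psi>_def sum_nonneg)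
  have n0: "0 < real n" using n by simp
  have Zeq: "Z = (\<Sum>i<n. \<psi> i) + 1" using n0 by (simp add: Z_def sum.distrib)
  have "(\<Sum>i<n. \<psi> i) = (\<Sum>l<k. \<Sum>i<n. \<bar>b l i\<bar> powr p)" unfolding \<psi>_def by (rule sum.swap)
  also have "\<dots> \<le> (\<Sum>l<k. 1)" 
  proof (rule sum_mono)
    fix l assume "l \<in> {..<k}"
    then consider "b l \<in> T" | "b l = (\<lambda>_. 0)" using b by blast
    then show "(\<Sum>i<n. \<bar>b l i\<bar> powr p) \<le> 1" by cases (use T1 p in auto)
  qed

  finally have Z2: "Z \<le> 2 * real k" using k by (simp add: Zeq)
  have Z1: "1 \<le> Z" unfolding Zeq using sum_nonneg[of "{..<n}" \<psi>] \<psi>0 by simp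
  have qpos: "0 < q i" for i using \<psi>0[of i] n0 Z1 by (simp add: q_def add_nonneg_pos)
  have q1: "(\<Sum>i<n. q i) = 1" using Z1 by (simp add: q_def Z_def flip: sum_divide_distrib)
  have qle: "q i \<le> 1" if "i < n" for i using member_le_sum[of i "{..<n}" q] qpos that q1 by (simp add: less_imp_le)
  have psi: "\<psi> i \<le> 2 * real k * q i" for i
  proof -
    have "\<psi> i \<le> \<psi> i + 1 / real n" using n0 by simp
    also have "\<dots> = Z * q i" using Z1 by (simp add: q_def)
    also have "\<dots> \<le> 2 * real k * q i" using Z2 qpos[of i] by (intro mult_right_mono) auto
    finally show ?thesis .
  qed
  have qge: "1 / q i \<le> z * real n" for i
  proof -
    have "1 / real n \<le> \<psi> i + 1 / real n" using \<psi>0 by simp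
    also have "\<dots> = Z * q i" using Z1 by (simp add: q_def)
    also have "\<dots> \<le> z * q i" using Z2 z qpos[of i] by (intro mult_right_mono) auto
    finally show ?thesis using qpos[of i] n0 by (simp add: field_simps)
  qed
  interpret sampling p z n k r b q
    by unfold_locales (simp_all only: p z qpos q1 psi[unfolded \<psi>_def] r)
  have coef: "\<exists>c. (\<forall>i<n. vec c i = ux x i) \<and> (\<forall>l<k. \<bar>c l\<bar> powr p \<le> 4 * (\<Sum>i<n. \<bar>ux x i\<bar> powr p))" for x
  proof -
    define Y where "Y = (\<Sum>i<n. \<bar>ux x i\<bar> powr p)"
    have Y0: "0 \<le> Y" by (simp add: Y_def sum_nonneg)
    show ?thesis
    proof (cases "Y = 0")
      case True
      then have "\<forall>i\<in>{..<n}. \<bar>ux x i\<bar> powr p = 0" unfolding Y_def by (subst (asm) sum_nonneg_eq_0_iff) auto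
      then have "\<forall>i<n. vec (\<lambda>_. 0) i = ux x i" by (simp add: vec_def)
      then show ?thesis using Y0 unfolding Y_def by (intro exI[of _ "\<lambda>_. 0"]) auto
    next
      case False
      then have Y: "0 < Y" using Y0 by simp
      \<comment> \<open>Division by the \<open>p\<close>-th root of \<open>Y\<close> normalizes the
        vector; scaling back turns coefficients at most 2 into
        \<open>\<bar>c l\<bar> powr p \<le> 4 * Y\<close>.\<close>
      define s where "s = Y powr (1 / p)"
      have s0: "0 < s" using Y by (simp add: s_def)
      have "s powr p = Y powr (1 / p * p)" unfolding s_def by (rule powr_powr)
      then have sp: "s powr p = Y" using Y p by simp
      have uxs: "ux (\<lambda>l. x l / s) i = ux x i / s" for i by (simp add: ux_def sum_divide_distrib)
      have "(\<Sum>i<n. \<bar>ux (\<lambda>l. x l / s) i\<bar> powr p) = (\<Sum>i<n. \<bar>ux x i\<bar> powr p / Y)"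
        by (rule sum.cong) (use s0 in \<open>auto simp: uxs powr_divide sp\<close>)
      also have "\<dots> = 1" using Y by (simp add: Y_def flip: sum_divide_distrib)
      finally have "ux (\<lambda>l. x l / s) \<in> T" unfolding T_def by auto
      from N[OF this] obtain N where N1: "\<forall>l<k. \<bar>N l\<bar> \<le> 2 * \<bar>D\<bar>" "\<forall>i<n. ux (\<lambda>l. x l / s) i * D = (\<Sum>l<k. N l * b l i)" by blast
      define c where "c l = s * (N l / D)" for l
      have "vec c i = ux x i" if "i < n" for i
      proof -
        have "vec c i = s / D * (\<Sum>l<k. N l * b l i)" by (simp add: vec_def c_def sum_distrib_left mult.assoc)
        also have "\<dots> = s / D * (ux x i / s * D)" using N1(2) that by (simp add: uxs)
        finally show ?thesis using D s0 by simp
      qed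
      moreover have "\<bar>c l\<bar> powr p \<le> 4 * Y" if "l < k" for l
      proof -
        have "\<bar>N l / D\<bar> \<le> 2" using N1(1) that D by (simp add: field_simps)
        then have "\<bar>N l / D\<bar> powr p \<le> 2 powr p" using p by (intro powr_mono2) auto
        also have "\<dots> \<le> 2 powr 2" using p by (intro powr_mono) auto
        finally have "\<bar>N l / D\<bar> powr p \<le> 4" by simp
        then have "Y * \<bar>N l / D\<bar> powr p \<le> Y * 4" using Y by (intro mult_left_mono) auto
        moreover have "\<bar>c l\<bar> powr p = Y * \<bar>N l / D\<bar> powr p" using s0 by (simp add: c_def abs_mult powr_mult powr_divide sp)
        ultimately show ?thesis by simp
      qed
      ultimately show ?thesis unfolding Y_def by blast
    qed
  qed
  define \<rho> where "\<rho> j i = A i j - ux (\<lambda>l. X l j) i" for j i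
  obtain \<omega> where \<omega>: "\<omega> \<in> PiE {..<r} (\<lambda>_. {..<n})" "embeds \<omega>" "(\<Sum>j<d. Psi (\<rho> j) \<omega>) \<le> 14000 / z\<^sup>2 * (\<Sum>j<d. fsum (\<rho> j))"
    using good_sample[of "{..<d}" \<rho>] by auto
  have \<omega>n: "\<omega> t < n" if "t < r" for t using \<omega>(1) that by (auto simp: PiE_iff)
  define w where "w t = 1 / q (\<omega> t)" for t
  have Sw: "S \<omega> g = (\<Sum>t<r. w t * g (\<omega> t)) / real r" for g by (simp add: S_def w_def)
  have r0': "0 < real r" by (rule r0)
  show ?thesis
  proof (rule that[of \<omega> w])
    show "1 \<le> w t \<and> w t \<le> z * real n" if "t < r" for t
      using qle[OF \<omega>n[OF that]] qpos[of "\<omega> t"] qge by (auto simp: w_def)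
    fix X'
    assume near: "\<And>j. j < d \<Longrightarrow> (\<Sum>t<r. w t * \<bar>(\<Sum>l<k. U (\<omega> t) l * X' l j) - A (\<omega> t) j\<bar> powr p)
        \<le> (1 + 1 / z\<^sup>2) * (\<Sum>t<r. w t * \<bar>(\<Sum>l<k. U (\<omega> t) l * X l j) - A (\<omega> t) j\<bar> powr p)"
    have col: "(\<Sum>i<n. \<bar>(\<Sum>l<k. U i l * X' l j) - A i j\<bar> powr p) \<le> fsum (\<rho> j) + Psi (\<rho> j) \<omega>" if j: "j < d" for j
    proof -
      obtain c where c: "\<forall>i<n. vec c i = ux (\<lambda>l. X' l j - X l j) i"
         "\<forall>l<k. \<bar>c l\<bar> powr p \<le> 4 * (\<Sum>i<n. \<bar>ux (\<lambda>l. X' l j - X l j) i\<bar> powr p)" using coef by blast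
      have diff: "vec c i - \<rho> j i = (\<Sum>l<k. U i l * X' l j) - A i j" if "i < n" for i
        using c(1) that by (simp add: \<rho>_def ux_def right_diff_distrib sum_subtractf)
      have abs\<rho>: "\<bar>\<rho> j i\<bar> = \<bar>(\<Sum>l<k. U i l * X l j) - A i j\<bar>" for i by (simp add: \<rho>_def ux_def)
      have "(\<Sum>i<n. \<bar>vec c i - \<rho> j i\<bar> powr p) - fsum (\<rho> j) \<le> Psi (\<rho> j) \<omega>"
      proof (rule excess_le_Psi[OF \<omega>(1,2)])
        show "\<bar>c l\<bar> powr p \<le> 4 * (\<Sum>i<n. \<bar>vec c i\<bar> powr p)" if "l < k" for l using c that by simp
        have "S \<omega> (\<lambda>i. \<bar>vec c i - \<rho> j i\<bar> powr p) = (\<Sum>t<r. w t * \<bar>(\<Sum>l<k. U (\<omega> t) l * X' l j) - A (\<omega> t) j\<bar> powr p) / real r"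
          unfolding Sw by (rule arg_cong[where f = "\<lambda>x. x / real r"], rule sum.cong) (use diff \<omega>n in auto)
        also have "\<dots> \<le> (1 + 1 / z\<^sup>2) * (\<Sum>t<r. w t * \<bar>(\<Sum>l<k. U (\<omega> t) l * X l j) - A (\<omega> t) j\<bar> powr p) / real r"
          using near[OF j] r0' by (intro divide_right_mono) auto
        also have "\<dots> = (1 + 1 / z\<^sup>2) * S \<omega> (\<lambda>i. \<bar>\<rho> j i\<bar> powr p)" unfolding Sw abs\<rho> by simp
        finally show "S \<omega> (\<lambda>i. \<bar>vec c i - \<rho> j i\<bar> powr p) \<le> (1 + 1 / z\<^sup>2) * S \<omega> (\<lambda>i. \<bar>\<rho> j i\<bar> powr p)" .
      qed
      moreover have "(\<Sum>i<n. \<bar>vec c i - \<rho> j i\<bar> powr p) = (\<Sum>i<n. \<bar>(\<Sum>l<k. U i l * X' l j) - A i j\<bar> powr p)"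
        by (rule sum.cong) (use diff in auto)
      ultimately show ?thesis by simp
    qed
    have fs: "fsum (\<rho> j) = (\<Sum>i<n. \<bar>(\<Sum>l<k. U i l * X l j) - A i j\<bar> powr p)" for j
      unfolding fsum_def by (rule sum.cong) (auto simp: \<rho>_def ux_def abs_minus_commute)
    have "(\<Sum>j<d. \<Sum>i<n. \<bar>(\<Sum>l<k. U i l * X' l j) - A i j\<bar> powr p) \<le> (\<Sum>j<d. fsum (\<rho> j) + Psi (\<rho> j) \<omega>)"
      by (rule sum_mono) (use col in auto)
    also have "\<dots> \<le> (\<Sum>j<d. fsum (\<rho> j)) + 14000 / z\<^sup>2 * (\<Sum>j<d. fsum (\<rho> j))" using \<omega>(3) by (simp add: sum.distrib)
    also have "\<dots> = (1 + 14000 / z\<^sup>2) * (\<Sum>j<d. fsum (\<rho> j))" by (simp add: algebra_simps)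
    finally show "(\<Sum>j<d. \<Sum>i<n. \<bar>(\<Sum>l<k. U i l * X' l j) - A i j\<bar> powr p)
        \<le> (1 + 14000 / z\<^sup>2) * (\<Sum>j<d. \<Sum>i<n. \<bar>(\<Sum>l<k. U i l * X l j) - A i j\<bar> powr p)" unfolding fs .
  qed (rule \<omega>n)
qed

section \<open>Rounding to a grid\<close>

definition cost :: "real \<Rightarrow> nat \<Rightarrow> nat \<Rightarrow> nat \<Rightarrow> (nat \<Rightarrow> nat \<Rightarrow> real) \<Rightarrow> (nat \<Rightarrow> nat \<Rightarrow> real) \<Rightarrow> (nat \<Rightarrow> nat \<Rightarrow> real) \<Rightarrow> real" where
  "cost p n d k A U V = (\<Sum>i<n. \<Sum>j<d. \<bar>A i j - (\<Sum>l<k. U i l * V l j)\<bar> powr p)"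

lemma cost_nonneg: "0 \<le> cost p n d k A U V" by (simp add: cost_def sum_nonneg)

lemma entry_le_cost:
  assumes "i < n" "j < d"
  shows "\<bar>A i j - (\<Sum>l<k. U i l * V l j)\<bar> powr p \<le> cost p n d k A U V"
proof -
  have "\<bar>A i j - (\<Sum>l<k. U i l * V l j)\<bar> powr p \<le> (\<Sum>j<d. \<bar>A i j - (\<Sum>l<k. U i l * V l j)\<bar> powr p)"
    using assms by (intro member_le_sum) auto
  also have "\<dots> \<le> cost p n d k A U V" unfolding cost_def
    using assms by (intro member_le_sum[of i "{..<n}" "\<lambda>i. \<Sum>j<d. \<bar>A i j - (\<Sum>l<k. U i l * V l j)\<bar> powr p"]) (auto intro: sum_nonneg)
  finally show ?thesis .
qed

text \<open>Dividing all factors by \<open>X\<close> reduces this to the telescoping bound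
  \<open>norm_prod_diff\<close>; since \<open>1 \<le> X\<close>, the division does not enlarge the
  differences.\<close>

lemma abs_prod_diff_le:
  fixes x y :: "nat \<Rightarrow> real"
  assumes "1 \<le> X" "\<And>a. a < m \<Longrightarrow> \<bar>x a\<bar> \<le> X" "\<And>a. a < m \<Longrightarrow> \<bar>y a\<bar> \<le> X" "\<And>a. a < m \<Longrightarrow> \<bar>x a - y a\<bar> \<le> e"
  shows "\<bar>(\<Prod>a = 0..<m. x a) - (\<Prod>a = 0..<m. y a)\<bar> \<le> X ^ m * (real m * e)"
proof -
  have X: "0 < X" using assms by simp
  have eq: "(\<Prod>a = 0..<m. x a) - (\<Prod>a = 0..<m. y a) = X ^ m * ((\<Prod>a = 0..<m. x a / X) - (\<Prod>a = 0..<m. y a / X))"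
    using X by (simp add: prod_dividef right_diff_distrib)
  have "\<bar>(\<Prod>a = 0..<m. x a / X) - (\<Prod>a = 0..<m. y a / X)\<bar> \<le> (\<Sum>a = 0..<m. \<bar>x a / X - y a / X\<bar>)"
    using norm_prod_diff[of "{0..<m}" "\<lambda>a. x a / X" "\<lambda>a. y a / X"] assms X by (simp add: divide_le_eq)
  also have "\<dots> \<le> (\<Sum>a = 0..<m. e)"
  proof (rule sum_mono)
    fix a assume a: "a \<in> {0..<m}"
    have "\<bar>x a / X - y a / X\<bar> = \<bar>x a - y a\<bar> / X" using X by (simp add: diff_divide_distrib[symmetric] abs_divide)
    also have "\<dots> \<le> \<bar>x a - y a\<bar> / 1" using assms(1) by (intro divide_left_mono) auto
    also have "\<dots> \<le> e" using assms(4) a by simp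
    finally show "\<bar>x a / X - y a / X\<bar> \<le> e" .
  qed
  finally show ?thesis unfolding eq abs_mult using X by (simp add: mult_left_mono)
qed

text \<open>A nonzero integral minor has absolute value at least 1, whereas the corresponding minor
  of any product of inner dimension \<open>k\<close> vanishes. If all entries of the product were
  within \<open>1 / Q\<close> of those of \<open>A\<close>, the Leibniz sums would differ by at most
  1/2.\<close>

lemma cost_lower_bound:
  assumes p: "0 < p" and A: "\<And>i j. i < n \<Longrightarrow> j < d \<Longrightarrow> A i j \<in> \<int> \<and> \<bar>A i j\<bar> \<le> M" and M: "1 \<le> M"
    and I: "\<And>a. a < Suc k \<Longrightarrow> I a < n" and J: "\<And>b. b < Suc k \<Longrightarrow> J b < d"
    and nz: "minor (Suc k) I (\<lambda>b i. A i (J b)) \<noteq> 0"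
  shows "(1 / (2 * fact (Suc k) * real (Suc k) * (M + 1) ^ Suc k)) powr p \<le> cost p n d k A U V"
proof (rule ccontr)
  define Q where "Q = 2 * fact (Suc k) * real (Suc k) * (M + 1) ^ Suc k"
  define e where "e = 1 / Q"
  define W where "W i j = (\<Sum>l<k. U i l * V l j)" for i j
  have den: "1 \<le> Q"
  proof -
    have f: "1 \<le> (fact (Suc k) :: real)" by (rule fact_ge_1)
    have w: "1 \<le> (M + 1) ^ Suc k" using M by (intro one_le_power) simp
    have "1 * 1 \<le> fact (Suc k) * real (Suc k)" using f by (intro mult_mono) auto
    then have "1 * 1 \<le> fact (Suc k) * real (Suc k) * (M + 1) ^ Suc k" using w by (intro mult_mono) (auto simp del: fact_Suc)
    then show ?thesis unfolding Q_def by (simp only: mult.assoc)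
  qed
  have e: "0 < e" "e \<le> 1" using den by (auto simp: e_def)
  assume "\<not> ?thesis"
  then have small: "cost p n d k A U V < e powr p" by (simp add: e_def Q_def)
  have close: "\<bar>A i j - W i j\<bar> \<le> e" if "i < n" "j < d" for i j
  proof (rule ccontr)
    assume "\<not> ?thesis"
    then have "e powr p < \<bar>A i j - W i j\<bar> powr p" using e p by (intro powr_less_mono2) auto
    then show False using entry_le_cost[OF that, where A = A and k = k and U = U and V = V and p = p] small unfolding W_def by linarith
  qed
  have "minor (Suc k) I (\<lambda>b i. A i (J b)) \<in> \<int>" by (rule minor_Ints) (use A I J in auto)
  then have ge1: "1 \<le> \<bar>minor (Suc k) I (\<lambda>b i. A i (J b))\<bar>" using nz Ints_nonzero_abs_ge1 by blast
  have W0: "minor (Suc k) I (\<lambda>b i. W i (J b)) = 0"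
    by (rule minor_rank[where P = "\<lambda>a l. U (I a) l" and Q = "\<lambda>l b. V l (J b)"]) (simp add: W_def)
  have "\<bar>minor (Suc k) I (\<lambda>b i. A i (J b)) - minor (Suc k) I (\<lambda>b i. W i (J b))\<bar>
    \<le> (\<Sum>\<pi>\<in>{\<pi>. \<pi> permutes {0..<Suc k}}. \<bar>signof \<pi> * (\<Prod>a = 0..<Suc k. A (I a) (J (\<pi> a))) - signof \<pi> * (\<Prod>a = 0..<Suc k. W (I a) (J (\<pi> a)))\<bar>)"
    unfolding minor_Leibniz sum_subtractf[symmetric] by (rule sum_abs)
  also have "\<dots> \<le> (\<Sum>\<pi>\<in>{\<pi>. \<pi> permutes {0..<Suc k}}. (M + 1) ^ Suc k * (real (Suc k) * e))"
  proof (rule sum_mono)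
    fix \<pi> assume \<pi>: "\<pi> \<in> {\<pi>. \<pi> permutes {0..<Suc k}}"
    have ij: "I a < n" "J (\<pi> a) < d" if "a < Suc k" for a using that I J \<pi> permutes_less_upt[of \<pi> "Suc k" a] by auto
    have "\<bar>(\<Prod>a = 0..<Suc k. A (I a) (J (\<pi> a))) - (\<Prod>a = 0..<Suc k. W (I a) (J (\<pi> a)))\<bar> \<le> (M + 1) ^ Suc k * (real (Suc k) * e)"
    proof (rule abs_prod_diff_le)
      fix a assume a: "a < Suc k"
      show "\<bar>A (I a) (J (\<pi> a))\<bar> \<le> M + 1" using A[OF ij[OF a]] by linarith
      show c: "\<bar>A (I a) (J (\<pi> a)) - W (I a) (J (\<pi> a))\<bar> \<le> e" using close[OF ij[OF a]] .
      show "\<bar>W (I a) (J (\<pi> a))\<bar> \<le> M + 1" using c A[OF ij[OF a]] e(2) by linarith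
    qed (use M in auto)
    moreover have "\<bar>signof \<pi> * x - signof \<pi> * y\<bar> = \<bar>x - y\<bar>" for x y :: real by (simp add: sign_def abs_minus_commute)
    ultimately show "\<bar>signof \<pi> * (\<Prod>a = 0..<Suc k. A (I a) (J (\<pi> a))) - signof \<pi> * (\<Prod>a = 0..<Suc k. W (I a) (J (\<pi> a)))\<bar>
       \<le> (M + 1) ^ Suc k * (real (Suc k) * e)" by simp
  qed
  also have "\<dots> = fact (Suc k) * ((M + 1) ^ Suc k * (real (Suc k) * e))" by (simp add: card_permutations del: fact_Suc)
  also have "\<dots> = 1 / 2"
  proof -
    have "(M + 1) ^ Suc k \<noteq> 0" "(fact (Suc k) :: real) \<noteq> 0" "real (Suc k) \<noteq> 0" using M by auto
    then show ?thesis unfolding e_def Q_def by (simp only: divide_simps mult_ac) simp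
  qed
  finally show False using ge1 W0 by simp
qed

lemma round_product_error:
  fixes t v D :: real
  assumes D: "1 \<le> D" and t: "\<bar>t\<bar> \<le> M" and v: "\<bar>v\<bar> \<le> 2"
  shows "\<bar>of_int \<lfloor>D * t\<rfloor> * of_int \<lfloor>D * v\<rfloor> / D\<^sup>2 - t * v\<bar> \<le> (M + 3) / D"
proof -
  define \<alpha> where "\<alpha> = D * t - of_int \<lfloor>D * t\<rfloor>"
  define \<beta> where "\<beta> = D * v - of_int \<lfloor>D * v\<rfloor>"
  have ab: "0 \<le> \<alpha>" "\<alpha> \<le> 1" "0 \<le> \<beta>" "\<beta> \<le> 1" unfolding \<alpha>_def \<beta>_def by linarith+
  have "of_int \<lfloor>D * t\<rfloor> * of_int \<lfloor>D * v\<rfloor> / D\<^sup>2 - t * v = (D * t - \<alpha>) * (D * v - \<beta>) / D\<^sup>2 - t * v" by (simp add: \<alpha>_def \<beta>_def)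
  also have "\<dots> = (\<alpha> * \<beta> / D - t * \<beta> - \<alpha> * v) / D" using D by (simp add: field_simps power2_eq_square)
  finally have "\<bar>of_int \<lfloor>D * t\<rfloor> * of_int \<lfloor>D * v\<rfloor> / D\<^sup>2 - t * v\<bar> = \<bar>\<alpha> * \<beta> / D - t * \<beta> - \<alpha> * v\<bar> / D" using D by (simp add: abs_divide)
  also have "\<dots> \<le> (M + 3) / D"
  proof (rule divide_right_mono)
    have "\<bar>\<alpha> * \<beta> / D\<bar> \<le> 1" using ab D mult_mono[of \<alpha> 1 \<beta> 1] by (simp add: abs_mult field_simps)
    moreover have "\<bar>t * \<beta>\<bar> \<le> M * 1" unfolding abs_mult using t ab by (intro mult_mono) auto
    moreover have "\<bar>\<alpha> * v\<bar> \<le> 1 * 2" unfolding abs_mult using v ab by (intro mult_mono) auto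
    ultimately show "\<bar>\<alpha> * \<beta> / D - t * \<beta> - \<alpha> * v\<bar> \<le> M + 3" by linarith
  qed (use D in simp)
  finally show ?thesis .
qed

lemma fact_le_two_power: "s \<le> k \<Longrightarrow> 1 \<le> k \<Longrightarrow> (fact s :: real) \<le> 2 ^ (k * k)"
proof -
  assume a: "s \<le> k" "1 \<le> k"
  have "(fact s :: real) \<le> real s ^ s" using fact_le_power[of s] by simp
  also have "\<dots> \<le> (2 ^ k) ^ k"
  proof -
    have "real s \<le> 2 ^ k" using a less_exp[of k] by (metis le_less_trans less_imp_le of_nat_le_iff of_nat_numeral of_nat_power)
    then have "real s ^ s \<le> (2 ^ k) ^ s" by (intro power_mono) auto
    also have "\<dots> \<le> (2 ^ k) ^ k" using a by (intro power_increasing) auto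
    finally show ?thesis .
  qed
  finally show ?thesis by (simp add: power_mult)
qed

theorem grid_exists:
  fixes p :: real and c0 :: nat
  assumes p: "0 < p" "p < 2"
  obtains c :: nat where "\<And>n d k E Big (A :: nat \<Rightarrow> nat \<Rightarrow> int) opt.
    1 \<le> n \<Longrightarrow> d \<le> n \<Longrightarrow> 1 \<le> k \<Longrightarrow> 1 \<le> E \<Longrightarrow>
    (\<And>i j. i < n \<Longrightarrow> j < d \<Longrightarrow> \<bar>A i j\<bar> \<le> int ((n + 2) ^ c0)) \<Longrightarrow> (n + 2) ^ (c * (k * E)\<^sup>2) \<le> Big \<Longrightarrow>
    (\<And>U V. opt \<le> cost p n d k (\<lambda>i j. of_int (A i j)) U V) \<Longrightarrow>
    (\<And>x. opt < x \<Longrightarrow> \<exists>U V. cost p n d k (\<lambda>i j. of_int (A i j)) U V < x) \<Longrightarrow>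
    \<exists>D U V. 1 \<le> D \<and> D \<le> Big \<and> (\<forall>i<n. \<forall>l<k. \<bar>U i l\<bar> \<le> int Big) \<and> (\<forall>l<k. \<forall>j<d. \<bar>V l j\<bar> \<le> int Big) \<and>
      cost p n d k (\<lambda>i j. of_int (A i j)) (\<lambda>i l. of_int (U i l) / real D) (\<lambda>l j. of_int (V l j) / real D) \<le> (1 + 1 / real E) * opt"
proof -
  \<comment> \<open>An exponent that undoes \<open>powr p\<close>: a bound \<open>B \<ge> 1\<close>
    on a \<open>p\<close>-th power gives the bound \<open>B ^ P\<close> on its base.\<close>
  define P where "P = nat \<lceil>1 / p\<rceil>"
  define c1 where "c1 = (2 * c0 + 6) * P"
  define c where "c = 2 * c1 + 2 * c0 + 30 + 17 * P"
  have P: "1 / p \<le> real P" unfolding P_def by linarith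
  show ?thesis
  proof (rule that[of c], goal_cases)
    case (1 n d k E Big A opt)
    note n = 1(1) and dn = 1(2) and k = 1(3) and E = 1(4) and A = 1(5) and Big = 1(6) and lower = 1(7) and approx = 1(8)
    define N where "N = real (n + 2)"
    define M where "M = N ^ c0"
    define x where "x = (k * E)\<^sup>2"
    define a where "a i j = real_of_int (A i j)" for i j
    have N3: "3 \<le> N" and nN: "real n \<le> N" using n by (auto simp: N_def)
    then have N0: "0 < N" and N1: "1 \<le> N" and N2: "2 \<le> N" by auto
    have Nmono: "N ^ u \<le> N ^ v" if "u \<le> v" for u v using that N1 by (rule power_increasing)
    have two: "2 ^ u \<le> N ^ u" for u using N2 by (intro power_mono) auto
    have M1: "1 \<le> M" using N1 by (simp add: M_def one_le_power)
    have am: "\<bar>a i j\<bar> \<le> M" if "i < n" "j < d" for i j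
    proof -
      have "real_of_int \<bar>A i j\<bar> \<le> real_of_int (int ((n + 2) ^ c0))" using A[OF that] by (simp only: of_int_le_iff)
      then show ?thesis by (simp add: a_def M_def N_def)
    qed
    have aZ: "a i j \<in> \<int>" for i j by (simp add: a_def)
    have k1: "k \<le> x" "k * k \<le> x" "E \<le> x" "1 \<le> x"
    proof -
      have kE: "k \<le> k * E" "E \<le> k * E" "1 \<le> k * E" using k E by auto
      have sq: "k * E \<le> x" unfolding x_def power2_eq_square using kE by (metis le_square)
      show "k \<le> x" "E \<le> x" "1 \<le> x" using kE sq by linarith+
      show "k * k \<le> x" unfolding x_def power2_eq_square using kE by (intro mult_le_mono)
    qed
    have BigN: "N ^ (c * x) \<le> real Big"
    proof -
      have "real ((n + 2) ^ (c * x)) \<le> real Big" using Big unfolding x_def by (simp only: of_nat_le_iff)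
      then show ?thesis by (simp add: N_def)
    qed
    have cost0: "0 \<le> cost p n d k a U V" for U V by (rule cost_nonneg)
    have low: "opt \<le> cost p n d k a U V" for U V using lower unfolding a_def .
    have app: "\<exists>U V. cost p n d k a U V < y" if "opt < y" for y using approx[OF that] unfolding a_def .
    have opt0: "0 \<le> opt"
    proof (rule ccontr)
      assume "\<not> 0 \<le> opt"
      then obtain U V where "cost p n d k a U V < 0" using app[of 0] by auto
      then show False using cost0[of U V] by simp
    qed
    define T where "T = (\<lambda>j i. a i j) ` {..<d}"
    have Tb: "\<bar>y i\<bar> \<le> M" if "y \<in> T" "i < n" for y i using that am by (auto simp: T_def)
    define goal where "goal \<longleftrightarrow> (\<exists>D U V. 1 \<le> D \<and> D \<le> Big \<and> (\<forall>i<n. \<forall>l<k. \<bar>U i l\<bar> \<le> int Big) \<and> (\<forall>l<k. \<forall>j<d. \<bar>V l j\<bar> \<le> int Big) \<and>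
      cost p n d k a (\<lambda>i l. of_int (U i l) / real D) (\<lambda>l j. of_int (V l j) / real D) \<le> (1 + 1 / real E) * opt)"
    have goalI: goal if "1 \<le> D" "real D \<le> N ^ (c * x)" "\<And>i l. i < n \<Longrightarrow> l < k \<Longrightarrow> \<bar>real_of_int (U i l)\<bar> \<le> N ^ (c * x)"
       "\<And>l j. l < k \<Longrightarrow> j < d \<Longrightarrow> \<bar>real_of_int (V l j)\<bar> \<le> N ^ (c * x)"
       "cost p n d k a (\<lambda>i l. of_int (U i l) / real D) (\<lambda>l j. of_int (V l j) / real D) \<le> (1 + 1 / real E) * opt" for D U V
    proof -
      have i: "\<bar>y\<bar> \<le> int Big" if "\<bar>real_of_int y\<bar> \<le> N ^ (c * x)" for y :: int
      proof -
        have "real_of_int \<bar>y\<bar> \<le> real_of_int (int Big)" using that BigN by simp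
        then show ?thesis by (simp only: of_int_le_iff)
      qed
      have "real D \<le> real Big" using that(2) BigN by linarith
      then have "D \<le> Big" by simp
      then show ?thesis unfolding goal_def by (intro exI[of _ D] exI[of _ U] exI[of _ V] conjI allI impI that(1,5) i that(3,4))
    qed
    have goal
    proof (cases "\<forall>I t. (\<forall>b<Suc k. t b \<in> T) \<longrightarrow> (\<forall>a<Suc k. I a < n) \<longrightarrow> minor (Suc k) I t = 0")
      case True
      show goal
      proof (rule spanner[of T n M k])
        show "minor (Suc k) I t = 0" if "\<And>b. b < Suc k \<Longrightarrow> t b \<in> T" "\<And>a. a < Suc k \<Longrightarrow> I a < n" for I t
          using True that by blast
        fix t :: "nat \<Rightarrow> nat \<Rightarrow> real" and D :: real and s :: nat
        assume t: "\<And>b. b < k \<Longrightarrow> t b \<in> T \<or> t b = (\<lambda>_. 0)" and D0: "D \<noteq> 0" and s: "s \<le> k" and Db: "\<bar>D\<bar> \<le> fact s * M ^ s"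
          and DZ: "(\<And>y i. y \<in> T \<Longrightarrow> i < n \<Longrightarrow> y i \<in> \<int>) \<Longrightarrow> D \<in> \<int>"
          and N': "\<And>y. y \<in> T \<Longrightarrow> \<exists>N. (\<forall>b<k. \<bar>N b\<bar> \<le> 2 * \<bar>D\<bar>) \<and> (\<forall>i<n. y i * D = (\<Sum>b<k. N b * t b i)) \<and>
             ((\<forall>y\<in>T. \<forall>i<n. y i \<in> \<int>) \<longrightarrow> (\<forall>b<k. N b \<in> \<int>))"
        have TZ: "y i \<in> \<int>" if "y \<in> T" for y i using that aZ by (auto simp: T_def)
        have "D \<in> \<int>" by (rule DZ) (rule TZ)
        then obtain Di where Di: "D = of_int Di" by (auto elim: Ints_cases)
        have allZ: "\<forall>y\<in>T. \<forall>i<n. y i \<in> \<int>" using TZ by simp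
        define good where "good j N \<longleftrightarrow> (\<forall>b<k. \<bar>N b\<bar> \<le> 2 * \<bar>D\<bar>) \<and> (\<forall>b<k. N b \<in> \<int>) \<and> (\<forall>i<n. a i j * D = (\<Sum>b<k. N b * t b i))" for j N
        have "\<exists>N. good j N" if "j \<in> {..<d}" for j
        proof -
          have "(\<lambda>i. a i j) \<in> T" unfolding T_def using that by (rule imageI)
          from N'[OF this] obtain N where N: "\<forall>b<k. \<bar>N b\<bar> \<le> 2 * \<bar>D\<bar>" "\<forall>i<n. a i j * D = (\<Sum>b<k. N b * t b i)"
             "(\<forall>y\<in>T. \<forall>i<n. y i \<in> \<int>) \<longrightarrow> (\<forall>b<k. N b \<in> \<int>)" by (elim exE conjE)
          show ?thesis unfolding good_def by (intro exI[of _ N] conjI N(1,2) mp[OF N(3) allZ])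
        qed
        then have "\<forall>j\<in>{..<d}. \<exists>N. good j N" by (rule ballI)
        from bchoice[OF this] obtain N'' where good: "\<forall>j\<in>{..<d}. good j (N'' j)" by (elim exE)
        have N'': "\<bar>N'' j b\<bar> \<le> 2 * \<bar>D\<bar> \<and> N'' j b \<in> \<int>" if "j < d" "b < k" for j b
          using bspec[OF good, of j] that by (simp add: good_def)
        have N''2: "a i j * D = (\<Sum>b<k. N'' j b * t b i)" if "i < n" "j < d" for i j
          using bspec[OF good, of j] that by (simp add: good_def)
        define Dn where "Dn = nat \<bar>Di\<bar>"
        have Dn: "real Dn = \<bar>D\<bar>" by (simp add: Dn_def Di)
        have Dn1: "1 \<le> Dn" using D0 Di by (simp add: Dn_def)
        \<comment> \<open>The columns \<open>t b\<close> are integral and the coefficients are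
          \<open>N'' j b / D\<close>. Multiplying the columns by \<open>Dn\<close> as well puts both
          factors over one denominator; the sign of \<open>D\<close> moves into
          \<open>V\<close>.\<close>
        define U where "U i b = \<lfloor>t b i\<rfloor> * int Dn" for i b
        define V where "V b j = sgn Di * \<lfloor>N'' j b\<rfloor>" for b j
        have tZ: "t b i \<in> \<int>" if "b < k" for b i using t[OF that] TZ by auto
        have U: "real_of_int (U i b) = t b i * \<bar>D\<bar>" if "b < k" for i b using tZ[OF that, of i] Dn by (auto elim!: Ints_cases simp: U_def)
        have V: "real_of_int (V b j) = sgn D * N'' j b" if "b < k" "j < d" for b j
          using N''[OF that(2,1)] by (auto elim!: Ints_cases simp: V_def Di sgn_if)
        have Dle: "\<bar>D\<bar> \<le> N ^ (k * k + c0 * k)"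
        proof -
          have "\<bar>D\<bar> \<le> fact s * M ^ s" by (rule Db)
          also have "\<dots> \<le> N ^ (k * k) * M ^ k"
          proof (intro mult_mono)
            show "fact s \<le> N ^ (k * k)" using fact_le_two_power[OF s k] two[of "k * k"] by linarith
            show "M ^ s \<le> M ^ k" using s M1 by (rule power_increasing)
          qed (use M1 N0 in auto)
          finally show ?thesis by (simp add: M_def power_add power_mult)
        qed
        have ck: "k * k + c0 * k + c0 + 1 \<le> c * x"
        proof -
          have "c0 * k \<le> c0 * x" "c0 \<le> c0 * x" using k1 by auto
          then have "k * k + c0 * k + c0 + 1 \<le> x + c0 * x + c0 * x + x" using k1 by linarith
          also have "\<dots> \<le> (2 * c1 + 2 * c0 + 30 + 17 * P) * x" by (simp add: algebra_simps)
          finally show ?thesis by (simp add: c_def)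
        qed
        have D3: "N ^ (k * k + c0 * k) * N ^ (c0 + 1) \<le> N ^ (c * x)" unfolding power_add[symmetric] by (rule Nmono) (use ck in simp)
        have Np: "0 \<le> N ^ (k * k + c0 * k)" "1 \<le> N ^ (c0 + 1)" "N \<le> N ^ (c0 + 1)" "M \<le> N ^ (c0 + 1)"
          using N0 N1 Nmono[of 1 "c0 + 1"] Nmono[of c0 "c0 + 1"] one_le_power[OF N1, of "c0 + 1"] by (simp_all add: M_def)
        show goal
        proof (rule goalI[of Dn U V])
          show "real Dn \<le> N ^ (c * x)"
            using mult_left_mono[OF Np(2,1)] Dle D3 by (simp add: Dn)
          show "\<bar>real_of_int (U i l)\<bar> \<le> N ^ (c * x)" if "i < n" "l < k" for i l
          proof -
            have "\<bar>t l i\<bar> \<le> M" using t[OF that(2)] Tb that(1) M1 by auto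
            then have "\<bar>t l i\<bar> * \<bar>D\<bar> \<le> N ^ (c0 + 1) * N ^ (k * k + c0 * k)" using Dle Np by (intro mult_mono) auto
            then show ?thesis using D3 U[OF that(2), of i] by (simp add: abs_mult mult.commute)
          qed
          show "\<bar>real_of_int (V l j)\<bar> \<le> N ^ (c * x)" if "l < k" "j < d" for l j
          proof -
            have "\<bar>sgn D * N'' j l\<bar> \<le> 2 * \<bar>D\<bar>" using N''[OF that(2,1)] D0 by (simp add: abs_mult)
            also have "\<dots> \<le> N ^ (c0 + 1) * N ^ (k * k + c0 * k)" using Dle Np order_trans[OF N2 Np(3)] by (intro mult_mono) auto
            finally show ?thesis using D3 V[OF that] by (simp add: mult.commute)
          qed
          have "a i j - (\<Sum>l<k. of_int (U i l) / real Dn * (of_int (V l j) / real Dn)) = 0" if "i < n" "j < d" for i j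
          proof -
            have "(\<Sum>l<k. of_int (U i l) / real Dn * (of_int (V l j) / real Dn)) = (\<Sum>l<k. 1 / D * (N'' j l * t l i))"
            proof (rule sum.cong)
              fix l assume "l \<in> {..<k}"
              then show "of_int (U i l) / real Dn * (of_int (V l j) / real Dn) = 1 / D * (N'' j l * t l i)"
                using U[of l i] V[of l j] that D0 by (simp add: Dn sgn_if)
            qed simp
            also have "\<dots> = 1 / D * (a i j * D)" using N''2[OF that] by (simp add: sum_distrib_left)
            finally show ?thesis using D0 by simp
          qed
          then have "cost p n d k a (\<lambda>i l. of_int (U i l) / real Dn) (\<lambda>l j. of_int (V l j) / real Dn) = 0"
            unfolding cost_def using p by (intro sum.neutral ballI) simp
          then show "cost p n d k a (\<lambda>i l. of_int (U i l) / real Dn) (\<lambda>l j. of_int (V l j) / real Dn) \<le> (1 + 1 / real E) * opt"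
            using opt0 by simp
        qed (use Dn1 in auto)
      qed (rule Tb)
    next
      case False
      then obtain I t0 where t0: "\<forall>b<Suc k. t0 b \<in> T" and I: "\<forall>a<Suc k. I a < n" and nz: "minor (Suc k) I t0 \<noteq> 0" by blast
      then have "\<forall>b. \<exists>j. b < Suc k \<longrightarrow> j < d \<and> t0 b = (\<lambda>i. a i j)" unfolding T_def by blast
      then obtain J where J: "\<And>b. b < Suc k \<Longrightarrow> J b < d \<and> t0 b = (\<lambda>i. a i (J b))" by metis
      have nz': "minor (Suc k) I (\<lambda>b i. a i (J b)) \<noteq> 0"
        
      proof -
        have "minor (Suc k) I t0 = minor (Suc k) I (\<lambda>b i. a i (J b))" by (rule minor_cong) (simp add: J)
        then show ?thesis using nz by argo
      qed
      define Q where "Q = 2 * fact (Suc k) * real (Suc k) * (M + 1) ^ Suc k"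
      have lb: "(1 / Q) powr p \<le> cost p n d k a U V" for U V
        unfolding Q_def by (rule cost_lower_bound[where A = a and M = M and I = I and J = J]) (use p aZ am M1 I J nz' in auto)
      have Q1: "0 < Q" unfolding Q_def using M1 by simp
      have lbopt: "(1 / Q) powr p \<le> opt"
      proof (rule ccontr)
        assume "\<not> ?thesis"
        then obtain U V where "cost p n d k a U V < (1 / Q) powr p" using app[of "(1 / Q) powr p"] by auto
        then show False using lb[of U V] by simp
      qed
      have "0 < (1 / Q) powr p" using Q1 by simp
      then have optpos: "0 < opt" using lbopt by linarith
      define \<eta> where "\<eta> = 1 / (8 * real E)"
      have \<eta>: "0 < \<eta>" "\<eta> \<le> 1 / 8" using E by (auto simp: \<eta>_def field_simps)
      have "opt < (1 + \<eta>) * opt" using optpos \<eta> by simp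
      from app[OF this] obtain U0 V0 where c0': "cost p n d k a U0 V0 < (1 + \<eta>) * opt" by blast
      define W where "W i j = (\<Sum>l<k. U0 i l * V0 l j)" for i j
      have powM: "\<bar>a i j\<bar> powr p \<le> M\<^sup>2" if "i < n" "j < d" for i j
      proof -
        have "\<bar>a i j\<bar> powr p \<le> M powr p" using am[OF that] p by (intro powr_mono2) auto
        also have "\<dots> \<le> M powr 2" using M1 p by (intro powr_mono) auto
        finally show ?thesis using M1 by simp
      qed
      have opt_ub: "opt \<le> N\<^sup>2 * M\<^sup>2"
      proof -
        have "opt \<le> cost p n d k a (\<lambda>_ _. 0) (\<lambda>_ _. 0)" by (rule low)
        also have "\<dots> \<le> (\<Sum>i<n. \<Sum>j<d. M\<^sup>2)" unfolding cost_def using powM by (intro sum_mono) simp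
        also have "\<dots> = real n * real d * M\<^sup>2" by simp
        also have "\<dots> \<le> N * N * M\<^sup>2" using nN dn N0 by (intro mult_right_mono mult_mono) auto
        finally show ?thesis by (simp add: power2_eq_square)
      qed
      define M' where "M' = N ^ c1"
      have M'1: "1 \<le> M'" using N1 by (simp add: M'_def one_le_power)
      have Wb: "\<bar>W i j\<bar> \<le> M'" if "i < n" "j < d" for i j
      proof -
        have w1: "\<bar>W i j\<bar> powr p \<le> 4 * (\<bar>a i j\<bar> powr p + \<bar>- (a i j - W i j)\<bar> powr p)"
          using abs_powr_add_le[of p "a i j" "- (a i j - W i j)"] p by simp
        have w2: "\<bar>- (a i j - W i j)\<bar> powr p \<le> 2 * (N\<^sup>2 * M\<^sup>2)"
        proof -
          have "\<bar>- (a i j - W i j)\<bar> powr p = \<bar>a i j - (\<Sum>l<k. U0 i l * V0 l j)\<bar> powr p" by (simp add: W_def abs_minus_commute)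
          also have "\<dots> \<le> cost p n d k a U0 V0" by (rule entry_le_cost[OF that])
          also have "\<dots> \<le> (1 + \<eta>) * opt" using c0' by simp
          also have "\<dots> \<le> 2 * opt" using \<eta> opt0 by (intro mult_right_mono) auto
          also have "\<dots> \<le> 2 * (N\<^sup>2 * M\<^sup>2)" using opt_ub by simp
          finally show ?thesis .
        qed
        have w3: "\<bar>a i j\<bar> powr p \<le> N\<^sup>2 * M\<^sup>2"
        proof -
          have "1 * M\<^sup>2 \<le> N\<^sup>2 * M\<^sup>2" using N1 by (intro mult_right_mono one_le_power) auto
          then show ?thesis using powM[OF that] by simp
        qed
        have "\<bar>W i j\<bar> powr p \<le> 12 * (N\<^sup>2 * M\<^sup>2)" using w1 w2 w3 by argo
        also have "\<dots> \<le> N ^ 4 * (N\<^sup>2 * M\<^sup>2)"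
          using power_mono[OF N3, of 4] by (intro mult_right_mono) auto
        also have "\<dots> = N ^ (2 * c0 + 6)"
        proof -
          have "M\<^sup>2 = N ^ (2 * c0)" unfolding M_def by (simp add: mult.commute flip: power_mult)
          then have "N ^ 4 * (N\<^sup>2 * M\<^sup>2) = N ^ (4 + (2 + 2 * c0))" by (simp only: power_add)
          then show ?thesis by (simp add: add.commute)
        qed
        finally have pw: "\<bar>W i j\<bar> powr p \<le> N ^ (2 * c0 + 6)" .
        have "\<bar>W i j\<bar> = (\<bar>W i j\<bar> powr p) powr (1 / p)" using p by (simp add: powr_powr)
        also have "\<dots> \<le> (N ^ (2 * c0 + 6)) powr (1 / p)" using pw p by (intro powr_mono2) auto
        also have "\<dots> \<le> (N ^ (2 * c0 + 6)) powr real P" using P N1 by (intro powr_mono one_le_power) auto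
        also have "\<dots> = M'" using N0 by (simp add: powr_realpow M'_def c1_def power_mult)
        finally show ?thesis .
      qed
      define T' where "T' = (\<lambda>j i. W i j) ` {..<d}"
      have T'b: "\<bar>y i\<bar> \<le> M'" if "y \<in> T'" "i < n" for y i using that Wb by (auto simp: T'_def)
      have rank': "minor (Suc k) I t = 0" if "\<And>b. b < Suc k \<Longrightarrow> t b \<in> T'" for I t
      proof -
        have "\<forall>b. \<exists>j. b < Suc k \<longrightarrow> t b = (\<lambda>i. W i j)" using that unfolding T'_def by blast
        then obtain j where j: "\<And>b. b < Suc k \<Longrightarrow> t b = (\<lambda>i. W i (j b))" by metis
        show ?thesis by (rule minor_rank[where P = "\<lambda>a l. U0 (I a) l" and Q = "\<lambda>l b. V0 l (j b)"]) (simp add: j W_def)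
      qed
      show goal
      proof (rule spanner[of T' n M' k])
        show "minor (Suc k) I t = 0" if "\<And>b. b < Suc k \<Longrightarrow> t b \<in> T'" "\<And>a. a < Suc k \<Longrightarrow> I a < n" for I t
          by (rule rank'[OF that(1)])
        fix t :: "nat \<Rightarrow> nat \<Rightarrow> real" and D0 :: real and s :: nat
        assume t: "\<And>b. b < k \<Longrightarrow> t b \<in> T' \<or> t b = (\<lambda>_. 0)" and D0: "D0 \<noteq> 0"
          and N': "\<And>y. y \<in> T' \<Longrightarrow> \<exists>N. (\<forall>b<k. \<bar>N b\<bar> \<le> 2 * \<bar>D0\<bar>) \<and> (\<forall>i<n. y i * D0 = (\<Sum>b<k. N b * t b i)) \<and>
             ((\<forall>y\<in>T'. \<forall>i<n. y i \<in> \<int>) \<longrightarrow> (\<forall>b<k. N b \<in> \<int>))"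
        define good where "good j N \<longleftrightarrow> (\<forall>b<k. \<bar>N b\<bar> \<le> 2 * \<bar>D0\<bar>) \<and> (\<forall>i<n. W i j * D0 = (\<Sum>b<k. N b * t b i))" for j N
        have "\<exists>N. good j N" if "j \<in> {..<d}" for j
        proof -
          have "(\<lambda>i. W i j) \<in> T'" unfolding T'_def using that by (rule imageI)
          from N'[OF this] obtain N where N: "\<forall>b<k. \<bar>N b\<bar> \<le> 2 * \<bar>D0\<bar>" "\<forall>i<n. W i j * D0 = (\<Sum>b<k. N b * t b i)" by (elim exE conjE)
          show ?thesis unfolding good_def by (intro exI[of _ N] conjI N)
        qed
        then have "\<forall>j\<in>{..<d}. \<exists>N. good j N" by (rule ballI)
        from bchoice[OF this] obtain N'' where good: "\<forall>j\<in>{..<d}. good j (N'' j)" by (elim exE)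
        have N''1: "\<bar>N'' j b\<bar> \<le> 2 * \<bar>D0\<bar>" if "j < d" "b < k" for j b
          using bspec[OF good, of j] that by (simp add: good_def)
        have N''2: "W i j * D0 = (\<Sum>b<k. N'' j b * t b i)" if "i < n" "j < d" for i j
          using bspec[OF good, of j] that by (simp add: good_def)
        define v where "v b j = N'' j b / D0" for b j
        have v2: "\<bar>v b j\<bar> \<le> 2" if "b < k" "j < d" for b j using N''1[OF that(2,1)] D0 by (simp add: v_def divide_le_eq)
        have Wv: "W i j = (\<Sum>b<k. t b i * v b j)" if "i < n" "j < d" for i j
        proof -
          have "(\<Sum>b<k. t b i * v b j) = (\<Sum>b<k. N'' j b * t b i) / D0" by (simp add: v_def sum_divide_distrib mult.commute)
          then show ?thesis unfolding N''2[OF that, symmetric] using D0 by simp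
        qed
        have tb: "\<bar>t b i\<bar> \<le> M'" if "b < k" "i < n" for b i using t[OF that(1)] T'b that(2) M'1 by auto
        \<comment> \<open>Large enough for the exponents that bound \<open>k\<close>,
          \<open>M' + 3\<close>, \<open>Q\<close> and \<open>R ^ P\<close> together, which makes the
          rounding error \<open>k * (M' + 3) / D\<close> at most
          \<open>1 / (Q * R ^ P)\<close>.\<close>
        define ed where "ed = (c1 + 2 * c0 + 20 + 17 * P) * x"
        define D where "D = (n + 2) ^ ed"
        have DN: "real D = N ^ ed" by (simp add: D_def N_def)
        have D1: "1 \<le> real D" using N1 unfolding DN by (rule one_le_power)
        define U where "U i b = \<lfloor>real D * t b i\<rfloor>" for i b
        define V where "V b j = \<lfloor>real D * v b j\<rfloor>" for b j
        define \<epsilon> where "\<epsilon> = real k * ((M' + 3) / real D)"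
        \<comment> \<open>At most \<open>N\<^sup>2\<close> entries, each with the penalty factor
          \<open>25 / \<eta>\<^sup>2 = 1600 * E\<^sup>2\<close>, then cost together no more than the
          fraction \<open>1 / (2 * E)\<close> of the lower bound for the optimum.\<close>
        define R where "R = 3200 * real E ^ 3 * N\<^sup>2"
        have E1: "1 \<le> real E" using E by simp
        have R1: "1 \<le> R"
        proof -
          have "1 * 1 * 1 \<le> 3200 * real E ^ 3 * N\<^sup>2" using E1 N1 by (intro mult_mono one_le_power) auto
          then show ?thesis by (simp add: R_def)
        qed
        have expo: "k + (c1 + 2) + (1 + Suc k * Suc k + Suc k + (c0 + 1) * Suc k) + (14 + 3 * E) * P \<le> ed"
        proof -
          have "Suc k * Suc k \<le> 4 * x" using k1 by simp
          moreover have "(c0 + 1) * Suc k \<le> (c0 + 1) * (2 * x)" using k1 by (intro mult_le_mono) auto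
          moreover have "(14 + 3 * E) * P \<le> (17 * x) * P" using k1 by (intro mult_le_mono1) linarith
          moreover have "c1 + 2 \<le> (c1 + 2) * x" using mult_le_mono2[OF k1(4), of "c1 + 2"] by simp
          ultimately have "k + (c1 + 2) + (1 + Suc k * Suc k + Suc k + (c0 + 1) * Suc k) + (14 + 3 * E) * P \<le>
            x + (c1 + 2) * x + (x + 4 * x + 2 * x + (c0 + 1) * (2 * x)) + 17 * x * P" using k1 by linarith
          also have "\<dots> \<le> ed" by (simp add: ed_def algebra_simps)
          finally show ?thesis .
        qed
        have bigprod: "real k * (M' + 3) * Q * R ^ P \<le> real D"
        proof -
          have natN: "real u \<le> N ^ u" for u :: nat using two[of u] of_nat_less_two_power[of u, where 'a = real] by linarith
          have M'3: "M' + 3 \<le> N ^ (c1 + 2)"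
          proof -
            have "M' + 3 \<le> M' * 2\<^sup>2" using M'1 by simp
            also have "\<dots> \<le> M' * N\<^sup>2" using two[of 2] M'1 by (intro mult_left_mono) auto
            finally show ?thesis by (simp only: M'_def power_add)
          qed
          have Qle: "Q \<le> N ^ 1 * N ^ (Suc k * Suc k) * N ^ Suc k * (N ^ (c0 + 1)) ^ Suc k"
            unfolding Q_def
          proof (intro mult_mono power_mono)
            show "2 \<le> N ^ 1" using N2 by simp
            show "fact (Suc k) \<le> N ^ (Suc k * Suc k)" using fact_le_two_power[of "Suc k" "Suc k"] two[of "Suc k * Suc k"] by (simp del: fact_Suc)
            show "real (Suc k) \<le> N ^ Suc k" by (rule natN)
            have "M + 1 \<le> 2 * M" "2 * M \<le> N * M" using M1 N2 by (auto intro: mult_right_mono)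
            moreover have "N * M = N ^ (c0 + 1)" by (simp add: M_def)
            ultimately show "M + 1 \<le> N ^ (c0 + 1)" by linarith
          qed (use N0 M1 in \<open>auto simp del: fact_Suc\<close>)
          also have "\<dots> = N ^ (1 + Suc k * Suc k + Suc k + (c0 + 1) * Suc k)" by (simp only: power_add power_mult)
          finally have Q2: "Q \<le> N ^ (1 + Suc k * Suc k + Suc k + (c0 + 1) * Suc k)" .
          have "R \<le> N ^ 12 * N ^ (3 * E) * N\<^sup>2" unfolding R_def
          proof (intro mult_mono)
            show "3200 \<le> N ^ 12" using two[of 12] by simp
            have "real E ^ 3 \<le> (N ^ E) ^ 3" by (intro power_mono natN) auto
            then show "real E ^ 3 \<le> N ^ (3 * E)" by (simp add: mult.commute flip: power_mult)
          qed (use N0 in auto)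
          also have "\<dots> = N ^ (14 + 3 * E)" by (simp flip: power_add)
          finally have "R ^ P \<le> (N ^ (14 + 3 * E)) ^ P" using R1 by (intro power_mono) auto
          then have RP: "R ^ P \<le> N ^ ((14 + 3 * E) * P)" by (simp only: power_mult)
          have "real k * (M' + 3) * Q * R ^ P \<le> N ^ k * N ^ (c1 + 2) * N ^ (1 + Suc k * Suc k + Suc k + (c0 + 1) * Suc k) * N ^ ((14 + 3 * E) * P)"
            using natN[of k] M'3 Q2 RP Q1 R1 M'1 N0 by (intro mult_mono) auto
          also have "\<dots> = N ^ (k + (c1 + 2) + (1 + Suc k * Suc k + Suc k + (c0 + 1) * Suc k) + (14 + 3 * E) * P)" by (simp only: power_add)
          also have "\<dots> \<le> N ^ ed" by (rule Nmono[OF expo])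
          finally show ?thesis unfolding DN .
        qed
        have \<epsilon>0: "0 \<le> \<epsilon>" using M'1 D1 by (simp add: \<epsilon>_def)
        have \<epsilon>p: "\<epsilon> powr p \<le> (1 / Q) powr p / R"
        proof -
          have "\<epsilon> * Q \<le> (1 / R) ^ P"
          proof -
            have RP0: "0 < R ^ P" using R1 by simp
            have "real k * (M' + 3) * Q \<le> real D / R ^ P" using bigprod by (simp add: pos_le_divide_eq RP0)
            then have "real k * (M' + 3) * Q / real D \<le> real D / R ^ P / real D" using D1 by (intro divide_right_mono) auto
            also have "\<dots> = (1 / R) ^ P" using D1 by (simp add: power_divide)
            finally show ?thesis by (simp add: \<epsilon>_def)
          qed
          then have "\<epsilon> \<le> (1 / R) ^ P / Q" using Q1 by (simp add: pos_le_divide_eq)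
          then have "\<epsilon> \<le> (1 / Q) * (1 / R) ^ P" by simp
          then have "\<epsilon> powr p \<le> ((1 / Q) * (1 / R) ^ P) powr p" using \<epsilon>0 p by (intro powr_mono2) auto
          also have "\<dots> = (1 / Q) powr p * ((1 / R) ^ P) powr p" by (rule powr_mult)
          also have "((1 / R) ^ P) powr p = (1 / R) powr (real P * p)" using R1 by (simp add: powr_powr flip: powr_realpow)
          also have "(1 / R) powr (real P * p) \<le> (1 / R) powr 1"
          proof (rule powr_mono')
            show "1 \<le> real P * p" using P p by (simp add: divide_le_eq)
          qed (use R1 in auto)
          also have "(1 / R) powr 1 = 1 / R" using R1 by simp
          finally show ?thesis by (simp add: mult_left_mono)
        qed
        define W' where "W' i j = (\<Sum>l<k. of_int (U i l) / real D * (of_int (V l j) / real D))" for i j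
        have close: "\<bar>W i j - W' i j\<bar> \<le> \<epsilon>" if "i < n" "j < d" for i j
        proof -
          have "\<bar>W' i j - W i j\<bar> \<le> (\<Sum>l<k. \<bar>of_int (U i l) / real D * (of_int (V l j) / real D) - t l i * v l j\<bar>)"
            unfolding W'_def Wv[OF that] sum_subtractf[symmetric] by (rule sum_abs)
          also have "\<dots> \<le> (\<Sum>l<k. (M' + 3) / real D)"
          proof (rule sum_mono)
            fix l assume "l \<in> {..<k}"
            then show "\<bar>of_int (U i l) / real D * (of_int (V l j) / real D) - t l i * v l j\<bar> \<le> (M' + 3) / real D"
              using round_product_error[OF D1 tb v2, of l i l j] that unfolding U_def V_def by (simp add: power2_eq_square)
          qed
          also have "\<dots> = \<epsilon>" by (simp add: \<epsilon>_def)
          finally show ?thesis by (simp add: abs_minus_commute)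
        qed
        show goal
        proof (rule goalI[of D U V])
          have edc: "ed + (c1 + 1) \<le> c * x"
          proof -
            have "c1 + 1 \<le> (c1 + 1) * x" using mult_le_mono2[OF k1(4), of "c1 + 1"] by simp
            then have "ed + (c1 + 1) \<le> (c1 + 2 * c0 + 20 + 17 * P) * x + (c1 + 1) * x" by (simp add: ed_def)
            also have "\<dots> \<le> c * x" by (simp add: c_def algebra_simps)
            finally show ?thesis .
          qed
          have DD: "real D * N ^ (c1 + 1) \<le> N ^ (c * x)" unfolding DN power_add[symmetric] by (rule Nmono[OF edc])
          have Nc: "3 \<le> N ^ (c1 + 1)" "M' + 1 \<le> N ^ (c1 + 1)"
          proof -
            show "3 \<le> N ^ (c1 + 1)" by (rule order_trans[OF N3]) (use Nmono[of 1 "c1 + 1"] in simp)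
            have "M' + 1 \<le> 2 * M'" "2 * M' \<le> N * M'" using M'1 N2 by (auto intro: mult_right_mono)
            moreover have "N * M' = N ^ (c1 + 1)" by (simp add: M'_def)
            ultimately show "M' + 1 \<le> N ^ (c1 + 1)" by linarith
          qed
          have D3: "real D * 3 \<le> N ^ (c * x)" using mult_left_mono[OF Nc(1), of "real D"] DD D1 by linarith
          show "1 \<le> D" using D1 by simp
          show "real D \<le> N ^ (c * x)" using D3 D1 by linarith
          show "\<bar>real_of_int (U i l)\<bar> \<le> N ^ (c * x)" if "i < n" "l < k" for i l
          proof -
            have "\<bar>real D * t l i\<bar> \<le> real D * M'" using tb[OF that(2,1)] D1 by (simp add: abs_mult)
            then have "\<bar>real_of_int (U i l)\<bar> \<le> real D * M' + 1" unfolding U_def by linarith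
            also have "\<dots> \<le> real D * (M' + 1)" using D1 by (simp add: algebra_simps)
            also have "\<dots> \<le> real D * N ^ (c1 + 1)" using Nc(2) D1 by (intro mult_left_mono) auto
            finally show ?thesis using DD by linarith
          qed
          show "\<bar>real_of_int (V l j)\<bar> \<le> N ^ (c * x)" if "l < k" "j < d" for l j
          proof -
            have "\<bar>real D * v l j\<bar> \<le> real D * 2" using v2[OF that] D1 by (simp add: abs_mult)
            then have "\<bar>real_of_int (V l j)\<bar> \<le> real D * 2 + 1" unfolding V_def by linarith
            then show ?thesis using D3 D1 by linarith
          qed
          have "cost p n d k a (\<lambda>i l. of_int (U i l) / real D) (\<lambda>l j. of_int (V l j) / real D) = (\<Sum>i<n. \<Sum>j<d. \<bar>(a i j - W i j) + (W i j - W' i j)\<bar> powr p)"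
            by (simp add: cost_def W'_def)
          also have "\<dots> \<le> (\<Sum>i<n. \<Sum>j<d. (1 + \<eta>) * \<bar>a i j - W i j\<bar> powr p + 1600 * (real E)\<^sup>2 * \<epsilon> powr p)"
          proof (intro sum_mono)
            fix i j assume "i \<in> {..<n}" "j \<in> {..<d}"
            then have ij: "i < n" "j < d" by auto
            have "\<bar>(a i j - W i j) + (W i j - W' i j)\<bar> powr p - \<bar>a i j - W i j\<bar> powr p \<le> \<eta> * \<bar>a i j - W i j\<bar> powr p + 25 / \<eta>\<^sup>2 * \<bar>W i j - W' i j\<bar> powr p"
              using abs_powr_diff_le[of p \<eta> "a i j - W i j" "W i j - W' i j"] p \<eta> by linarith
            moreover have "25 / \<eta>\<^sup>2 * \<bar>W i j - W' i j\<bar> powr p \<le> 25 / \<eta>\<^sup>2 * \<epsilon> powr p"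
              using close[OF ij] p by (intro mult_left_mono powr_mono2) auto
            moreover have "25 / \<eta>\<^sup>2 = 1600 * (real E)\<^sup>2" by (simp add: \<eta>_def power_divide power_mult_distrib)
            moreover have "(1 + \<eta>) * \<bar>a i j - W i j\<bar> powr p = \<bar>a i j - W i j\<bar> powr p + \<eta> * \<bar>a i j - W i j\<bar> powr p" by (simp add: distrib_right)
            ultimately show "\<bar>(a i j - W i j) + (W i j - W' i j)\<bar> powr p \<le> (1 + \<eta>) * \<bar>a i j - W i j\<bar> powr p + 1600 * (real E)\<^sup>2 * \<epsilon> powr p"
              by simp
          qed
          also have "\<dots> = (1 + \<eta>) * cost p n d k a U0 V0 + real n * real d * (1600 * (real E)\<^sup>2 * \<epsilon> powr p)"
            by (simp add: sum.distrib cost_def W_def sum_distrib_left)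
          also have "real n * real d * (1600 * (real E)\<^sup>2 * \<epsilon> powr p) \<le> N\<^sup>2 * (1600 * (real E)\<^sup>2 * ((1 / Q) powr p / R))"
            using nN dn N0 \<epsilon>p unfolding power2_eq_square[of N] by (intro mult_mono) auto
          also have "N\<^sup>2 * (1600 * (real E)\<^sup>2 * ((1 / Q) powr p / R)) = (1 / Q) powr p / (2 * real E)"
          proof -
            define X where "X = N\<^sup>2 * (1600 * (real E)\<^sup>2)"
            have RX: "R = X * (2 * real E)" by (simp add: R_def X_def power3_eq_cube power2_eq_square)
            have X0: "X \<noteq> 0" using N0 E1 by (simp add: X_def)
            have "N\<^sup>2 * (1600 * (real E)\<^sup>2 * ((1 / Q) powr p / R)) = X * ((1 / Q) powr p / R)" by (simp only: X_def mult.assoc)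
            also have "\<dots> = (1 / Q) powr p / (2 * real E)" unfolding RX using X0 by (simp only: times_divide_eq_right mult_divide_mult_cancel_left simp_thms not_False_eq_True)
            finally show ?thesis .
          qed
          also have "\<dots> \<le> opt / (2 * real E)" using lbopt E1 by (intro divide_right_mono) auto
          also have "(1 + \<eta>) * cost p n d k a U0 V0 \<le> (1 + \<eta>) * ((1 + \<eta>) * opt)" using c0' \<eta> by (intro mult_left_mono) auto
          also have "(1 + \<eta>) * ((1 + \<eta>) * opt) \<le> (1 + 3 * \<eta>) * opt"
          proof -
            have "\<eta> * \<eta> \<le> \<eta>" using \<eta> by (simp add: mult_left_le)
            then have "(1 + \<eta>) * (1 + \<eta>) \<le> 1 + 3 * \<eta>" by (simp add: algebra_simps)
            then have "(1 + \<eta>) * (1 + \<eta>) * opt \<le> (1 + 3 * \<eta>) * opt" using opt0 by (rule mult_right_mono)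
            then show ?thesis by (simp only: mult.assoc)
          qed
          \<comment> \<open>Of the allowance \<open>1 / E\<close>, three eighths go to
            near-optimality and relative error and four eighths to the additive rounding
            error.\<close>
          also have "(1 + 3 * \<eta>) * opt + opt / (2 * real E) \<le> (1 + 1 / real E) * opt"
          proof -
            define u where "u = 1 / real E"
            have e1: "(1 + 3 * \<eta>) * opt = opt + 3 / 8 * (u * opt)" by (simp add: \<eta>_def u_def distrib_right)
            have e2: "opt / (2 * real E) = 4 / 8 * (u * opt)" by (simp add: u_def)
            have e3: "(1 + 1 / real E) * opt = opt + u * opt" by (simp add: u_def distrib_right)
            have "0 \<le> u * opt" using opt0 by (simp add: u_def)
            then show ?thesis unfolding e1 e2 e3 by linarith
          qed
          finally show "cost p n d k a (\<lambda>i l. of_int (U i l) / real D) (\<lambda>l j. of_int (V l j) / real D) \<le> (1 + 1 / real E) * opt" by simp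
        qed
      qed (rule T'b)
    qed
    then show ?case unfolding goal_def a_def .
  qed
qed

section \<open>Compiling clipped loops to RAM code\<close>

text \<open>Jump targets are absolute, so code is generated for a given start address and has to be
  located in the program.\<close>

definition code_at :: "instr list \<Rightarrow> nat \<Rightarrow> instr list \<Rightarrow> bool" where
  "code_at P a c \<longleftrightarrow> (\<exists>xs ys. P = xs @ c @ ys \<and> length xs = a)"

lemma code_at_append:
  assumes "code_at P a (c1 @ c2)" "length c1 = l"
  shows "code_at P a c1" "code_at P (a + l) c2"
proof -
  obtain xs ys where P: "P = xs @ (c1 @ c2) @ ys" "length xs = a" using assms unfolding code_at_def by blast
  have "P = (xs @ c1) @ c2 @ ys" "length (xs @ c1) = a + l" "P = xs @ c1 @ (c2 @ ys)" using P assms(2) by auto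
  then show "code_at P a c1" "code_at P (a + l) c2" unfolding code_at_def using P(2) by blast+
qed

lemma code_at_single: "code_at P a [i] \<Longrightarrow> a < length P \<and> P ! a = i"
  unfolding code_at_def by auto

text \<open>The quantification over \<open>s\<close> leaves input and output arbitrary and
  untouched, so that pure computations are chained by program counter and memory alone.\<close>

definition runs :: "real \<Rightarrow> instr list \<Rightarrow> nat \<Rightarrow> (nat \<Rightarrow> int) \<Rightarrow> nat \<Rightarrow> nat \<Rightarrow> (nat \<Rightarrow> int) \<Rightarrow> bool" where
  "runs p P a \<mu> t a' \<mu>' \<longleftrightarrow>
     (\<forall>s. (step p P ^^ t) (s\<lparr>pc := a, mem := \<mu>\<rparr>) = s\<lparr>pc := a', mem := \<mu>'\<rparr>)"

lemma runs_0: "runs p P a \<mu> 0 a \<mu>" by (simp add: runs_def)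

lemma runs_trans [trans]:
  "runs p P a \<mu> t a' \<mu>' \<Longrightarrow> runs p P a' \<mu>' t' a'' \<mu>'' \<Longrightarrow> runs p P a \<mu> (t + t') a'' \<mu>''"
  unfolding runs_def by (subst add.commute) (auto simp: funpow_add)

lemma runs_instr:
  assumes "code_at P a [i]" "\<And>s. exec p i (s\<lparr>pc := a, mem := \<mu>\<rparr>) = s\<lparr>pc := a', mem := \<mu>'\<rparr>"
  shows "runs p P a \<mu> 1 a' \<mu>'"
  using code_at_single[OF assms(1)] assms(2) by (simp add: runs_def step_def halted_def)

lemma runs_Const: "code_at P a [Const i c] \<Longrightarrow> runs p P a \<mu> 1 (a + 1) (\<mu>(i := c))"
  by (erule runs_instr) simp

lemma runs_Add: "code_at P a [Add i j k] \<Longrightarrow> runs p P a \<mu> 1 (a + 1) (\<mu>(i := \<mu> j + \<mu> k))"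
  by (erule runs_instr) simp

lemma runs_Sub: "code_at P a [Sub i j k] \<Longrightarrow> runs p P a \<mu> 1 (a + 1) (\<mu>(i := \<mu> j - \<mu> k))"
  by (erule runs_instr) simp

lemma runs_jump: "code_at P a [JumpPos i l] \<Longrightarrow> 0 < \<mu> i \<Longrightarrow> runs p P a \<mu> 1 l \<mu>"
  by (erule runs_instr) simp

lemma runs_nojump: "code_at P a [JumpPos i l] \<Longrightarrow> \<not> 0 < \<mu> i \<Longrightarrow> runs p P a \<mu> 1 (a + 1) \<mu>"
  by (erule runs_instr) simp

text \<open>What a computed value may depend on: the registers below \<open>m\<close> and the memory
  from the address in register 1 upward, where the input lies. Scratch space in between is
  excluded.\<close>

definition agree :: "nat \<Rightarrow> (nat \<Rightarrow> int) \<Rightarrow> (nat \<Rightarrow> int) \<Rightarrow> bool" where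
  "agree m \<mu> \<mu>' \<longleftrightarrow> (\<forall>j. j < m \<or> \<mu> 1 \<le> int j \<longrightarrow> \<mu> j = \<mu>' j)"

definition same_outside :: "nat \<Rightarrow> nat \<Rightarrow> (nat \<Rightarrow> int) \<Rightarrow> (nat \<Rightarrow> int) \<Rightarrow> bool" where
  "same_outside m lm \<mu> \<mu>' \<longleftrightarrow> (\<forall>j. j < m \<or> lm \<le> j \<longrightarrow> \<mu>' j = \<mu> j)"

lemma same_outside_trans:
  "same_outside m l \<mu> \<mu>' \<Longrightarrow> same_outside m' l' \<mu>' \<mu>'' \<Longrightarrow> m0 \<le> m \<Longrightarrow> m0 \<le> m' \<Longrightarrow> l \<le> l0 \<Longrightarrow> l' \<le> l0 \<Longrightarrow> same_outside m0 l0 \<mu> \<mu>''"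
  unfolding same_outside_def by auto

lemma same_outside_upd:
  "same_outside m l \<mu> \<mu>' \<Longrightarrow> m \<le> i \<Longrightarrow> i < l \<Longrightarrow> same_outside m l \<mu> (\<mu>'(i := c))"
  unfolding same_outside_def by auto

lemma same_outside_mono:
  "same_outside m l \<mu> \<mu>' \<Longrightarrow> m0 \<le> m \<Longrightarrow> l \<le> l0 \<Longrightarrow> same_outside m0 l0 \<mu> \<mu>'"
  unfolding same_outside_def by auto

lemma same_outside_agree:
  "same_outside m l \<mu> \<mu>' \<Longrightarrow> int l \<le> \<mu> 1 \<Longrightarrow> m0 \<le> m \<Longrightarrow> agree m0 \<mu> \<mu>'"
  unfolding same_outside_def agree_def by fastforce

text \<open>Scratch space reaches from \<open>m\<close> to just below \<open>lm\<close>, and the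
  result lands in its first cell. The summand 2 keeps the base of the time bound positive for every
  content of register 0, so that bounds with different exponents can be merged.\<close>

definition realizes :: "real \<Rightarrow> nat \<Rightarrow> ((nat \<Rightarrow> int) \<Rightarrow> int) \<Rightarrow> nat \<Rightarrow> nat \<Rightarrow> nat \<Rightarrow> (nat \<Rightarrow> instr list) \<Rightarrow> nat \<Rightarrow> bool" where
  "realizes p m f C e lm gen L \<longleftrightarrow> m < lm \<and> (\<forall>a. length (gen a) = L) \<and>
    (\<forall>P a \<mu>. code_at P a (gen a) \<and> int lm \<le> \<mu> 1 \<longrightarrow>
      (\<exists>t \<mu>'. t \<le> C * (nat (\<mu> 0) + 2) ^ e \<and> runs p P a \<mu> t (a + L) \<mu>' \<and>
        \<mu>' m = f \<mu> \<and> same_outside m lm \<mu> \<mu>'))"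

text \<open>Register 0 bounds the number of iterations of every loop, and register 1 holds the address
  from which on the memory is read only. Everything between \<open>m\<close> and that address is scratch space;
  the quantification over all larger \<open>m'\<close> makes the code relocatable in memory.\<close>

definition rcomp :: "real \<Rightarrow> nat \<Rightarrow> ((nat \<Rightarrow> int) \<Rightarrow> int) \<Rightarrow> bool" where
  "rcomp p m f \<longleftrightarrow> 2 \<le> m \<and> (\<forall>\<mu> \<mu>'. agree m \<mu> \<mu>' \<longrightarrow> f \<mu> = f \<mu>') \<and>
     (\<forall>m'\<ge>m. \<exists>C e lm gen L. realizes p m' f C e lm gen L)"

lemma realizesE:
  assumes "realizes p m f C e lm gen L" "code_at P a (gen a)" "int lm \<le> \<mu> 1"
  obtains t \<mu>' where "t \<le> C * (nat (\<mu> 0) + 2) ^ e" "runs p P a \<mu> t (a + L) \<mu>'"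
        "\<mu>' m = f \<mu>" "same_outside m lm \<mu> \<mu>'"
  using assms unfolding realizes_def by blast

lemma realizes_len: "realizes p m f C e lm gen L \<Longrightarrow> length (gen a) = L"
  unfolding realizes_def by blast

lemma realizes_less: "realizes p m f C e lm gen L \<Longrightarrow> m < lm"
  unfolding realizes_def by blast

lemma realizesI:
  assumes "m < lm" "\<And>a. length (gen a) = L"
    "\<And>P a \<mu>. code_at P a (gen a) \<Longrightarrow> int lm \<le> \<mu> 1 \<Longrightarrow>
      \<exists>t \<mu>'. t \<le> C * (nat (\<mu> 0) + 2) ^ e \<and> runs p P a \<mu> t (a + L) \<mu>' \<and>
        \<mu>' m = f \<mu> \<and> same_outside m lm \<mu> \<mu>'"
  shows "realizes p m f C e lm gen L"
  using assms unfolding realizes_def by blast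

lemma rcomp_mono: "rcomp p m f \<Longrightarrow> m \<le> m' \<Longrightarrow> rcomp p m' f"
  unfolding rcomp_def agree_def by (meson le_trans less_le_trans)

lemma rcomp_agree: "rcomp p m f \<Longrightarrow> agree m \<mu> \<mu>' \<Longrightarrow> f \<mu> = f \<mu>'"
  unfolding rcomp_def by blast

lemma rcomp_ge2: "rcomp p m f \<Longrightarrow> 2 \<le> m" unfolding rcomp_def by blast

lemma rcomp_realizes:
  assumes "rcomp p m f" "m \<le> m'" obtains C e lm gen L where "realizes p m' f C e lm gen L"
  using assms unfolding rcomp_def by blast

lemma rcompI:
  assumes "2 \<le> m" "\<And>\<mu> \<mu>'. agree m \<mu> \<mu>' \<Longrightarrow> f \<mu> = f \<mu>'"
    "\<And>m'. m \<le> m' \<Longrightarrow> \<exists>C e lm gen L. realizes p m' f C e lm gen L"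
  shows "rcomp p m f"
  using assms unfolding rcomp_def by blast

lemma rcomp_const: "2 \<le> m \<Longrightarrow> rcomp p m (\<lambda>\<mu>. c)"
proof (rule rcompI, goal_cases)
  case (3 m')
  have "realizes p m' (\<lambda>\<mu>. c) 1 0 (m' + 1) (\<lambda>a. [Const m' c]) 1"
    apply (rule realizesI, simp, simp)
    subgoal for P a \<mu>
      apply (rule exI[of _ 1], rule exI[of _ "\<mu>(m' := c)"])
      using runs_Const[of P a m' c p \<mu>] by (auto simp: same_outside_def)
    done
  then show ?case by blast
qed auto

lemma rcomp_var: "2 \<le> m \<Longrightarrow> j < m \<Longrightarrow> rcomp p m (\<lambda>\<mu>. \<mu> j)"
proof (rule rcompI, goal_cases)
  case (3 m')
  \<comment> \<open>There is no instruction that copies between fixed addresses; a copy is the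
    addition of zero.\<close>
  have "realizes p m' (\<lambda>\<mu>. \<mu> j) 2 0 (m' + 2) (\<lambda>a. [Const (m' + 1) 0] @ [Add m' j (m' + 1)]) 2"
  proof (rule realizesI, simp, simp, goal_cases)
    case (1 P a \<mu>)
    have "runs p P a \<mu> (1 + 1) (a + 1 + 1) ((\<mu>(m' + 1 := 0))(m' := (\<mu>(m' + 1 := 0)) j + (\<mu>(m' + 1 := 0)) (m' + 1)))"
      apply (rule runs_trans)
       apply (rule runs_Const[of _ _ "m' + 1" 0])
      using code_at_append(1)[of P a "[Const (m' + 1) 0]" "[Add m' j (m' + 1)]"] 1 apply simp
      apply (rule runs_Add)
      using code_at_append(2)[of P a "[Const (m' + 1) 0]" "[Add m' j (m' + 1)]"] 1 by simp
    then show ?case using 3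
      by (intro exI[of _ 2] exI[of _ "\<mu>(m' + 1 := 0, m' := \<mu> j)"]) (auto simp: same_outside_def numeral_2_eq_2)
  qed
  then show ?case by blast
qed (auto simp: agree_def)

lemma bound_pow_le:
  fixes x :: nat assumes "1 \<le> x" "t \<le> C * x ^ e" "e \<le> e'"
  shows "t \<le> C * x ^ e'"
  using assms(2) mult_le_mono2[OF power_increasing[OF assms(3,1)], of C] by linarith

text \<open>The second operand is computed one cell higher, so the first result survives; and the
  first computation wrote only to scratch space, which the second value cannot see.\<close>

lemma rcomp_binop:
  assumes "rcomp p m f" "rcomp p m g"
    and op: "\<And>P a i j k \<mu>. code_at P a [ins i j k] \<Longrightarrow> runs p P a \<mu> 1 (a + 1) (\<mu>(i := F (\<mu> j) (\<mu> k)))"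
  shows "rcomp p m (\<lambda>\<mu>. F (f \<mu>) (g \<mu>))"
proof (rule rcompI, goal_cases)
  case 1 show ?case using assms rcomp_ge2 by blast
next
  case (2 \<mu> \<mu>')
  show ?case using rcomp_agree[OF assms(1) 2] rcomp_agree[OF assms(2) 2] by simp
next
  case m: (3 m')
  have m1: "m \<le> m' + 1" using m by simp
  obtain C1 e1 lm1 gen1 L1 where r1: "realizes p m' f C1 e1 lm1 gen1 L1" using rcomp_realizes[OF assms(1) m] .
  obtain C2 e2 lm2 gen2 L2 where r2: "realizes p (m' + 1) g C2 e2 lm2 gen2 L2" using rcomp_realizes[OF assms(2) m1] .
  note l1 = realizes_len[OF r1] realizes_less[OF r1] and l2 = realizes_len[OF r2] realizes_less[OF r2]
  have m2: "2 \<le> m'" using rcomp_ge2[OF assms(1)] m by simp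
  have "realizes p m' (\<lambda>\<mu>. F (f \<mu>) (g \<mu>)) (C1 + C2 + 1) (e1 + e2) (max lm1 lm2)
     (\<lambda>a. gen1 a @ gen2 (a + L1) @ [ins m' m' (m' + 1)]) (L1 + L2 + 1)"
  proof (rule realizesI, goal_cases)
    case (3 P a \<mu>)
    note c1 = code_at_append[OF 3(1) l1(1)]
    note c2 = code_at_append[OF c1(2) l2(1)]
    have b: "int lm1 \<le> \<mu> 1" "int lm2 \<le> \<mu> 1" using 3(2) by auto
    obtain t1 \<mu>1 where 1: "t1 \<le> C1 * (nat (\<mu> 0) + 2) ^ e1" "runs p P a \<mu> t1 (a + L1) \<mu>1"
        "\<mu>1 m' = f \<mu>" "same_outside m' lm1 \<mu> \<mu>1"
      using realizesE[OF r1 c1(1), where \<mu>=\<mu>, OF b(1)] .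
    have e0: "\<mu>1 0 = \<mu> 0" "\<mu>1 1 = \<mu> 1" using 1(4) m2 by (auto simp: same_outside_def)
    have ag: "agree m \<mu> \<mu>1" using same_outside_agree[OF 1(4) b(1) m] .
    have b2: "int lm2 \<le> \<mu>1 1" using b e0 by simp
    obtain t2 \<mu>2 where 2: "t2 \<le> C2 * (nat (\<mu>1 0) + 2) ^ e2" "runs p P (a + L1) \<mu>1 t2 (a + L1 + L2) \<mu>2"
        "\<mu>2 (m' + 1) = g \<mu>1" "same_outside (m' + 1) lm2 \<mu>1 \<mu>2"
      using realizesE[OF r2 c2(1), where \<mu>=\<mu>1, OF b2] .
    have g: "\<mu>2 (m' + 1) = g \<mu>" using 2(3) rcomp_agree[OF assms(2) ag] by simp
    have f: "\<mu>2 m' = f \<mu>" using 2(4) 1(3) by (simp add: same_outside_def)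
    define x where "x = nat (\<mu> 0) + 2"
    have x1: "1 \<le> x" by (simp add: x_def)
    have "runs p P a \<mu> (t1 + t2 + 1) (a + L1 + L2 + 1) (\<mu>2(m' := F (f \<mu>) (g \<mu>)))"
      using runs_trans[OF runs_trans[OF 1(2) 2(2)] op[OF c2(2)]] unfolding f g .
    moreover have "t1 \<le> C1 * x ^ (e1 + e2)" "t2 \<le> C2 * x ^ (e1 + e2)" "1 \<le> 1 * x ^ (e1 + e2)"
      using bound_pow_le[OF x1, of t1 C1 e1 "e1 + e2"] bound_pow_le[OF x1, of t2 C2 e2 "e1 + e2"]
        bound_pow_le[OF x1, of 1 1 0 "e1 + e2"] 1(1) 2(1) e0(1) by (simp_all add: x_def)
    then have "t1 + t2 + 1 \<le> (C1 + C2 + 1) * x ^ (e1 + e2)" unfolding add_mult_distrib by linarith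
    moreover have "same_outside m' (max lm1 lm2) \<mu> (\<mu>2(m' := F (f \<mu>) (g \<mu>)))"
      using l1(2) by (intro same_outside_upd same_outside_trans[OF 1(4) 2(4)]) auto
    ultimately show ?case
      by (intro exI[of _ "t1 + t2 + 1"] exI[of _ "\<mu>2(m' := F (f \<mu>) (g \<mu>))"]) (simp add: x_def add.assoc)
  qed (use l1 l2 in auto)
  then show ?case by blast
qed

lemma rcomp_add: "rcomp p m f \<Longrightarrow> rcomp p m g \<Longrightarrow> rcomp p m (\<lambda>\<mu>. f \<mu> + g \<mu>)"
  by (rule rcomp_binop[of p m f g Add "(+)"]) (assumption | erule runs_Add)+

lemma rcomp_sub: "rcomp p m f \<Longrightarrow> rcomp p m g \<Longrightarrow> rcomp p m (\<lambda>\<mu>. f \<mu> - g \<mu>)"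
  by (rule rcomp_binop[of p m f g Sub "(-)"]) (assumption | erule runs_Sub)+

lemma rcomp_unop:
  assumes "rcomp p m f"
    and op: "\<And>P a i \<mu>. code_at P a [ins i] \<Longrightarrow> runs p P a \<mu> 1 (a + 1) (\<mu>(i := F \<mu> (\<mu> i)))"
    and F: "\<And>\<mu> \<mu>' \<nu>. (\<And>j. j = 1 \<or> \<mu> 1 \<le> int j \<Longrightarrow> \<mu> j = \<mu>' j) \<Longrightarrow> F \<mu> (f \<nu>) = F \<mu>' (f \<nu>)"
  shows "rcomp p m (\<lambda>\<mu>. F \<mu> (f \<mu>))"
proof (rule rcompI, goal_cases)
  case 1 show ?case using assms rcomp_ge2 by blast
next
  case (2 \<mu> \<mu>')
  have "F \<mu> (f \<mu>) = F \<mu>' (f \<mu>)"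
    apply (rule F) using 2 rcomp_ge2[OF assms(1)] unfolding agree_def by auto
  then show ?case using rcomp_agree[OF assms(1) 2] by simp
next
  case m: (3 m')
  obtain C1 e1 lm1 gen1 L1 where r1: "realizes p m' f C1 e1 lm1 gen1 L1" using rcomp_realizes[OF assms(1) m] .
  note l1 = realizes_len[OF r1] realizes_less[OF r1]
  have m2: "2 \<le> m'" using rcomp_ge2[OF assms(1)] m by simp
  have "realizes p m' (\<lambda>\<mu>. F \<mu> (f \<mu>)) (C1 + 1) e1 lm1 (\<lambda>a. gen1 a @ [ins m']) (L1 + 1)"
  proof (rule realizesI, goal_cases)
    case (3 P a \<mu>)
    note c1 = code_at_append[OF 3(1) l1(1)]
    obtain t1 \<mu>1 where 1: "t1 \<le> C1 * (nat (\<mu> 0) + 2) ^ e1" "runs p P a \<mu> t1 (a + L1) \<mu>1"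
        "\<mu>1 m' = f \<mu>" "same_outside m' lm1 \<mu> \<mu>1"
      using realizesE[OF r1 c1(1), where \<mu>=\<mu>, OF 3(2)] .
    have 2: "F \<mu> (f \<mu>) = F \<mu>1 (f \<mu>)"
      apply (rule F) using 1(4) m2 3(2) by (auto simp: same_outside_def)
    have "runs p P a \<mu> (t1 + 1) (a + L1 + 1) (\<mu>1(m' := F \<mu> (f \<mu>)))"
      using runs_trans[OF 1(2) op[OF c1(2)]] unfolding 1(3) 2 .
    moreover have "1 \<le> (nat (\<mu> 0) + 2) ^ e1" by simp
    then have "t1 + 1 \<le> (C1 + 1) * (nat (\<mu> 0) + 2) ^ e1"
      using 1(1) unfolding add_mult_distrib by linarith
    moreover have "same_outside m' lm1 \<mu> (\<mu>1(m' := F \<mu> (f \<mu>)))"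
      using l1(2) by (intro same_outside_upd 1(4)) auto
    ultimately show ?case
      by (intro exI[of _ "t1 + 1"] exI[of _ "\<mu>1(m' := F \<mu> (f \<mu>))"]) (simp add: add.assoc)
  qed (use l1 in auto)
  then show ?case by blast
qed

lemma rcomp_digit: "rcomp p m f \<Longrightarrow> rcomp p m (\<lambda>\<mu>. binary_digit p (nat (f \<mu>)))"
  by (rule rcomp_unop[of p m f "\<lambda>i. Digit i i" "\<lambda>_ x. binary_digit p (nat x)"])
    (assumption | rule refl | (erule runs_instr, simp))+

text \<open>A nonnegative offset from register 1 always addresses the read-only part of the memory;
  this keeps an indirect access within what \<open>agree\<close> permits.\<close>

lemma rcomp_load:
  assumes "rcomp p m f" "\<And>\<mu>. 0 \<le> f \<mu>"
  shows "rcomp p m (\<lambda>\<mu>. \<mu> (nat (\<mu> 1 + f \<mu>)))"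
proof -
  have "2 \<le> m" using rcomp_ge2 assms by blast
  have c: "rcomp p (m + m') (\<lambda>\<mu>. \<mu> 1)" for m'
    by (rule rcomp_var) (use \<open>2 \<le> m\<close> in auto)
  show ?thesis
  proof (rule rcompI, goal_cases)
    case (2 \<mu> \<mu>')
    have 1: "\<mu> 1 = \<mu>' 1" "\<mu> 1 \<le> int (nat (\<mu> 1 + f \<mu>))"
      using 2 \<open>2 \<le> m\<close> assms(2)[of \<mu>] unfolding agree_def by (auto intro: le_add_same_cancel1[THEN iffD2])
    have "\<mu> (nat (\<mu> 1 + f \<mu>)) = \<mu>' (nat (\<mu> 1 + f \<mu>))" using 1(2) 2 unfolding agree_def by blast
    then show ?case using 1 rcomp_agree[OF assms(1) 2] by simp
  next
    case m: (3 m')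
    have f: "rcomp p m (\<lambda>\<mu>. \<mu> 1 + f \<mu>)" using rcomp_add[OF c[of 0] ] assms(1) by simp
    obtain C1 e1 lm1 gen1 L1 where r1: "realizes p m' (\<lambda>\<mu>. \<mu> 1 + f \<mu>) C1 e1 lm1 gen1 L1" using rcomp_realizes[OF f m] .
    note l1 = realizes_len[OF r1] realizes_less[OF r1]
    have m2: "2 \<le> m'" using rcomp_ge2[OF assms(1)] m by simp
    have "realizes p m' (\<lambda>\<mu>. \<mu> (nat (\<mu> 1 + f \<mu>))) (C1 + 1) e1 lm1 (\<lambda>a. gen1 a @ [Load m' m']) (L1 + 1)"
    proof (rule realizesI, goal_cases)
      case (3 P a \<mu>)
      note c1 = code_at_append[OF 3(1) l1(1)]
      obtain t1 \<mu>1 where 1: "t1 \<le> C1 * (nat (\<mu> 0) + 2) ^ e1" "runs p P a \<mu> t1 (a + L1) \<mu>1"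
          "\<mu>1 m' = \<mu> 1 + f \<mu>" "same_outside m' lm1 \<mu> \<mu>1"
        using realizesE[OF r1 c1(1), where \<mu>=\<mu>, OF 3(2)] .
      have "lm1 \<le> nat (\<mu> 1 + f \<mu>)" using assms(2)[of \<mu>] 3(2) by linarith
      then have 2: "\<mu>1 (nat (\<mu>1 m')) = \<mu> (nat (\<mu> 1 + f \<mu>))"
        using 1(4) unfolding same_outside_def 1(3) by auto
      have "runs p P (a + L1) \<mu>1 1 (a + L1 + 1) (\<mu>1(m' := \<mu>1 (nat (\<mu>1 m'))))"
        by (rule runs_instr[OF c1(2)]) simp
      then have "runs p P a \<mu> (t1 + 1) (a + L1 + 1) (\<mu>1(m' := \<mu> (nat (\<mu> 1 + f \<mu>))))"
        using runs_trans[OF 1(2)] unfolding 2 by blast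
      moreover have "1 \<le> (nat (\<mu> 0) + 2) ^ e1" by simp
      then have "t1 + 1 \<le> (C1 + 1) * (nat (\<mu> 0) + 2) ^ e1"
        using 1(1) unfolding add_mult_distrib by linarith
      moreover have "same_outside m' lm1 \<mu> (\<mu>1(m' := \<mu> (nat (\<mu> 1 + f \<mu>))))"
        using l1(2) by (intro same_outside_upd 1(4)) auto
      ultimately show ?case
        by (intro exI[of _ "t1 + 1"] exI[of _ "\<mu>1(m' := \<mu> (nat (\<mu> 1 + f \<mu>)))"]) (simp add: add.assoc)
    qed (use l1 in auto)
    then show ?case by blast
  qed (use \<open>2 \<le> m\<close> in auto)
qed

lemma rcomp_if:
  assumes "rcomp p m f" "rcomp p m g" "rcomp p m h"
  shows "rcomp p m (\<lambda>\<mu>. if 0 < f \<mu> then g \<mu> else h \<mu>)"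
proof (rule rcompI, goal_cases)
  case 1 show ?case using assms rcomp_ge2 by blast
next
  case (2 \<mu> \<mu>')
  show ?case using rcomp_agree[OF assms(1) 2] rcomp_agree[OF assms(2) 2]  rcomp_agree[OF assms(3) 2] by simp
next
  case m: (3 m')
  obtain C1 e1 lm1 gen1 L1 where r1: "realizes p m' f C1 e1 lm1 gen1 L1" using rcomp_realizes[OF assms(1) m] .
  obtain C2 e2 lm2 gen2 L2 where r2: "realizes p m' g C2 e2 lm2 gen2 L2" using rcomp_realizes[OF assms(2) m] .
  obtain C3 e3 lm3 gen3 L3 where r3: "realizes p m' h C3 e3 lm3 gen3 L3" using rcomp_realizes[OF assms(3) m] .
  note l1 = realizes_len[OF r1] realizes_less[OF r1] and l2 = realizes_len[OF r2] realizes_less[OF r2]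
   and l3 = realizes_len[OF r3] realizes_less[OF r3]
  have m2: "2 \<le> m'" using rcomp_ge2[OF assms(1)] m by simp
  define lm where "lm = Max {lm1, lm2, lm3, m' + 2}"
  have lm: "lm1 \<le> lm" "lm2 \<le> lm" "lm3 \<le> lm" "m' + 2 \<le> lm" unfolding lm_def by auto
  \<comment> \<open>The only jump is conditional, so the branch for \<open>h\<close> ends by setting
    a cell to 1 and jumping on it past the branch for \<open>g\<close>.\<close>
  let ?gen = "\<lambda>a. gen1 a @ [JumpPos m' (a + L1 + 1 + L3 + 1 + 1)] @ gen3 (a + L1 + 1) @ [Const (m' + 1) 1] @
      [JumpPos (m' + 1) (a + L1 + 1 + L3 + 1 + 1 + L2)] @ gen2 (a + L1 + 1 + L3 + 1 + 1)"
  have one: "length [i] = 1" for i :: instr by simp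
  have "realizes p m' (\<lambda>\<mu>. if 0 < f \<mu> then g \<mu> else h \<mu>) (C1 + C2 + C3 + 3) (e1 + e2 + e3) lm
     ?gen (L1 + 1 + L3 + 1 + 1 + L2)"
  proof (rule realizesI, goal_cases)
    case (3 P a \<mu>)
    note c1 = code_at_append[OF 3(1) l1(1)]
    note c2 = code_at_append[OF c1(2) one]
    note c3 = code_at_append[OF c2(2) l3(1)]
    note c4 = code_at_append[OF c3(2) one]
    note c5 = code_at_append[OF c4(2) one]
    have b: "int lm1 \<le> \<mu> 1" "int lm2 \<le> \<mu> 1" "int lm3 \<le> \<mu> 1" using 3(2) lm by linarith+
    obtain t1 \<mu>1 where 1: "t1 \<le> C1 * (nat (\<mu> 0) + 2) ^ e1" "runs p P a \<mu> t1 (a + L1) \<mu>1"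
        "\<mu>1 m' = f \<mu>" "same_outside m' lm1 \<mu> \<mu>1"
      using realizesE[OF r1 c1(1), where \<mu>=\<mu>, OF b(1)] .
    have e0: "\<mu>1 0 = \<mu> 0" "\<mu>1 1 = \<mu> 1" using 1(4) m2 by (auto simp: same_outside_def)
    have ag: "agree m \<mu> \<mu>1" using same_outside_agree[OF 1(4) b(1) m] .
    have b2: "int lm2 \<le> \<mu>1 1" "int lm3 \<le> \<mu>1 1" using b e0 by simp_all
    define x where "x = nat (\<mu> 0) + 2"
    have x1: "1 \<le> x" by (simp add: x_def)
    have t1: "t1 \<le> C1 * x ^ (e1 + e2 + e3)" "3 \<le> 3 * x ^ (e1 + e2 + e3)"
      using bound_pow_le[OF x1, of t1 C1 e1 "e1 + e2 + e3"] 1(1) 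
       bound_pow_le[OF x1, of 3 3 0 "e1 + e2 + e3"] by (simp_all add: x_def)
    show ?case
    proof (cases "0 < f \<mu>")
      case True
      obtain t2 \<mu>2 where 2: "t2 \<le> C2 * (nat (\<mu>1 0) + 2) ^ e2" "runs p P (a + L1 + 1 + L3 + 1 + 1) \<mu>1 t2 (a + L1 + 1 + L3 + 1 + 1 + L2) \<mu>2"
          "\<mu>2 m' = g \<mu>1" "same_outside m' lm2 \<mu>1 \<mu>2"
        using realizesE[OF r2 c5(2), where \<mu>=\<mu>1, OF b2(1)] .
      have "runs p P a \<mu> (t1 + 1 + t2) (a + L1 + 1 + L3 + 1 + 1 + L2) \<mu>2"
        using runs_trans[OF runs_trans[OF 1(2) runs_jump[OF c2(1)]] 2(2)] True 1(3) by simp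
      moreover have "t2 \<le> C2 * x ^ (e1 + e2 + e3)"
        using bound_pow_le[OF x1, of t2 C2 e2 "e1 + e2 + e3"] 2(1) e0(1) by (simp add: x_def)
      then have "t1 + 1 + t2 \<le> (C1 + C2 + C3 + 3) * x ^ (e1 + e2 + e3)" 
        unfolding add_mult_distrib using t1 by linarith
      moreover have "same_outside m' lm \<mu> \<mu>2"
        using lm by (intro same_outside_trans[OF 1(4) 2(4)]) auto
      ultimately show ?thesis using True 2(3) rcomp_agree[OF assms(2) ag]
        by (intro exI[of _ "t1 + 1 + t2"] exI[of _ \<mu>2]) (simp add: x_def add.assoc)
    next
      case False
      obtain t2 \<mu>2 where 2: "t2 \<le> C3 * (nat (\<mu>1 0) + 2) ^ e3" "runs p P (a + L1 + 1) \<mu>1 t2 (a + L1 + 1 + L3) \<mu>2"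
          "\<mu>2 m' = h \<mu>1" "same_outside m' lm3 \<mu>1 \<mu>2"
        using realizesE[OF r3 c3(1), where \<mu>=\<mu>1, OF b2(2)] .
      have "runs p P a \<mu> (t1 + 1 + t2 + 1 + 1) (a + L1 + 1 + L3 + 1 + 1 + L2) (\<mu>2(m' + 1 := 1))"
        using runs_trans[OF runs_trans[OF runs_trans[OF runs_trans[OF 1(2) runs_nojump[OF c2(1)]] 2(2)] runs_Const[OF c4(1)]] runs_jump[OF c5(1)]] False 1(3) by simp
      moreover have "t2 \<le> C3 * x ^ (e1 + e2 + e3)"
        using bound_pow_le[OF x1, of t2 C3 e3 "e1 + e2 + e3"] 2(1) e0(1) by (simp add: x_def)
      then have "t1 + 1 + t2 + 1 + 1 \<le> (C1 + C2 + C3 + 3) * x ^ (e1 + e2 + e3)" 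
        unfolding add_mult_distrib using t1 by linarith
      moreover have "same_outside m' lm \<mu> (\<mu>2(m' + 1 := 1))"
        using lm by (intro same_outside_upd same_outside_trans[OF 1(4) 2(4)]) auto
      ultimately show ?thesis using False 2(3) rcomp_agree[OF assms(3) ag]
        by (intro exI[of _ "t1 + 1 + t2 + 1 + 1"] exI[of _ "\<mu>2(m' + 1 := 1)"]) (simp add: x_def add.assoc)
    qed
  qed (use l1 l2 l3 lm in auto)
  then show ?case by blast
qed

definition iter :: "nat \<Rightarrow> (int \<Rightarrow> int \<Rightarrow> int) \<Rightarrow> int \<Rightarrow> int" where
  "iter b F x = fold (\<lambda>i. F (int i)) [0..<b] x"

lemma iter_0 [simp]: "iter 0 F x = x" by (simp add: iter_def)
lemma iter_Suc [simp]: "iter (Suc b) F x = F (int b) (iter b F x)" by (simp add: iter_def)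


text \<open>The body is assumed computable for arbitrary computable index and accumulator, which
  lets loops nest inside bodies; it is compiled once, for the two cells that hold these values. Time
  is multiplied by register 0, so a nesting level raises the exponent by one.\<close>

lemma rcomp_iter:
  assumes init: "rcomp p m x"
    and body: "\<And>m' g h. m \<le> m' \<Longrightarrow> rcomp p m' g \<Longrightarrow> rcomp p m' h \<Longrightarrow> rcomp p m' (\<lambda>\<mu>. F \<mu> (g \<mu>) (h \<mu>))"
  shows "rcomp p m (\<lambda>\<mu>. iter (nat (\<mu> 0)) (F \<mu>) (x \<mu>))"
proof (rule rcompI, goal_cases)
  case 1 show ?case using assms rcomp_ge2 by blast
next
  case (2 \<mu> \<mu>')
  have m2: "2 \<le> m" using init rcomp_ge2 by blast
  \<comment> \<open>Instantiating the body with constants shows that \<open>F\<close> itself depends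
    only on the permitted memory.\<close>
  have "F \<mu> i a = F \<mu>' i a" for i a
    using rcomp_agree[OF body[OF order_refl rcomp_const[OF m2, of p i] rcomp_const[OF m2, of p a]] 2] .
  then have "F \<mu> = F \<mu>'" by blast
  moreover have "\<mu> 0 = \<mu>' 0" using 2 m2 unfolding agree_def by auto
  ultimately show ?case using rcomp_agree[OF init 2] by simp
next
  case m: (3 m')
  have m2: "2 \<le> m" using init rcomp_ge2 by blast
  have Fag: "F \<mu> = F \<mu>'" if "agree m \<mu> \<mu>'" for \<mu> \<mu>'
  proof -
    have "F \<mu> i a = F \<mu>' i a" for i a
      using rcomp_agree[OF body[OF order_refl rcomp_const[OF m2, of p i] rcomp_const[OF m2, of p a]] that] .
    then show ?thesis by blast
  qed
  have m1: "m \<le> m' + 1" using m by simp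
  obtain C1 e1 lm1 gen1 L1 where r1: "realizes p (m' + 1) x C1 e1 lm1 gen1 L1" using rcomp_realizes[OF init m1] .
  have b: "rcomp p (m' + 4) (\<lambda>\<mu>. F \<mu> (\<mu> m') (\<mu> (m' + 1)))"
    by (rule body) (use m m2 in \<open>auto intro!: rcomp_var\<close>)
  obtain C2 e2 lm2 gen2 L2 where r2: "realizes p (m' + 4) (\<lambda>\<mu>. F \<mu> (\<mu> m') (\<mu> (m' + 1))) C2 e2 lm2 gen2 L2"
    using rcomp_realizes[OF b order_refl] .
  note l1 = realizes_len[OF r1] realizes_less[OF r1] and l2 = realizes_len[OF r2] realizes_less[OF r2]
  define lm where "lm = max lm1 lm2"
  have lm: "lm1 \<le> lm" "lm2 \<le> lm" "m' + 4 < lm" unfolding lm_def using l2 by auto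
  define top where "top a = a + L1 + 1 + 1 + 1 + 1" for a
  define fin where "fin a = top a + 1 + 1 + L2 + 1 + 1 + 1 + 1 + 1 + 1" for a
  \<comment> \<open>Cell \<open>m'\<close> holds the index, \<open>m' + 1\<close> the accumulator,
    \<open>m' + 2\<close> the number of iterations left and \<open>m' + 3\<close> the constant 1,
    set to 0 for copying; the body works from \<open>m' + 4\<close> on.\<close>
  let ?gen = "\<lambda>a. gen1 a @ [Const (m' + 3) 1] @ [Const m' 0] @ [Const (m' + 2) 0] @ [Add (m' + 2) (m' + 2) 0] @
      [JumpPos (m' + 2) (top a + 1 + 1)] @ [JumpPos (m' + 3) (fin a)] @ gen2 (top a + 1 + 1) @
      [Const (m' + 3) 0] @ [Add (m' + 1) (m' + 4) (m' + 3)] @ [Const (m' + 3) 1] @ [Add m' m' (m' + 3)] @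
      [Sub (m' + 2) (m' + 2) (m' + 3)] @ [JumpPos (m' + 3) (top a)] @ [Const (m' + 3) 0] @ [Add m' (m' + 1) (m' + 3)]"
  have one: "length [i] = 1" for i :: instr by simp
  have "realizes p m' (\<lambda>\<mu>. iter (nat (\<mu> 0)) (F \<mu>) (x \<mu>)) (C1 + C2 + 16) (e1 + e2 + 1) lm
     ?gen (L1 + 1 + 1 + 1 + 1 + 1 + 1 + L2 + 1 + 1 + 1 + 1 + 1 + 1 + 1 + 1)"
  proof (rule realizesI, goal_cases)
    case (3 P a \<mu>)
    note c1 = code_at_append[OF 3(1) l1(1)]
    note c2 = code_at_append[OF c1(2) one]
    note c3 = code_at_append[OF c2(2) one]
    note c4 = code_at_append[OF c3(2) one]
    note c5 = code_at_append[OF c4(2) one, folded top_def]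
    note c6 = code_at_append[OF c5(2) one]
    note c7 = code_at_append[OF c6(2) one]
    note c8 = code_at_append[OF c7(2) l2(1)]
    note c9 = code_at_append[OF c8(2) one]
    note c10 = code_at_append[OF c9(2) one]
    note c11 = code_at_append[OF c10(2) one]
    note c12 = code_at_append[OF c11(2) one]
    note c13 = code_at_append[OF c12(2) one]
    note c14 = code_at_append[OF c13(2) one, folded fin_def]
    note c15 = code_at_append[OF c14(2) one]
    have b: "int lm1 \<le> \<mu> 1" "int lm2 \<le> \<mu> 1" using 3(2) lm by linarith+
    obtain t1 \<mu>1 where 1: "t1 \<le> C1 * (nat (\<mu> 0) + 2) ^ e1" "runs p P a \<mu> t1 (a + L1) \<mu>1"
        "\<mu>1 (m' + 1) = x \<mu>" "same_outside (m' + 1) lm1 \<mu> \<mu>1"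
      using realizesE[OF r1 c1(1), where \<mu>=\<mu>, OF b(1)] .
    define B where "B = nat (\<mu> 0)"
    define TB where "TB = C2 * (B + 2) ^ e2"
    define \<mu>0 where "\<mu>0 = \<mu>1(m' + 3 := 1, m' := 0, m' + 2 := 0, m' + 2 := \<mu>1 0)"
    have e0: "\<mu>1 0 = \<mu> 0" "\<mu>1 1 = \<mu> 1" using 1(4) m m2 by (auto simp: same_outside_def)
    have "runs p P a \<mu> (t1 + 1 + 1 + 1 + 1) (a + L1 + 1 + 1 + 1 + 1) \<mu>0"
      unfolding \<mu>0_def
      using runs_trans[OF runs_trans[OF runs_trans[OF runs_trans[OF 1(2) runs_Const[OF c2(1)]] runs_Const[OF c3(1)]] runs_Const[OF c4(1)]] runs_Add[OF c5(1)]]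
        m m2 by simp
    then have start: "runs p P a \<mu> (t1 + 4) (top a) \<mu>0" unfolding top_def by (simp add: numeral_eq_Suc)
    define Inv where "Inv i \<nu> \<longleftrightarrow> \<nu> m' = int i \<and> \<nu> (m' + 1) = iter i (F \<mu>) (x \<mu>) \<and> \<nu> (m' + 2) = \<mu> 0 - int i \<and> \<nu> (m' + 3) = 1 \<and> same_outside m' lm \<mu> \<nu>" for i \<nu>
    have so0: "same_outside m' lm \<mu> \<mu>0" unfolding \<mu>0_def
      by (intro same_outside_upd same_outside_mono[OF 1(4)]) (use lm in auto)
    have loop: "\<exists>t \<nu>. t \<le> i * (TB + 7) \<and> runs p P (top a) \<mu>0 t (top a) \<nu> \<and> Inv i \<nu>" if "i \<le> B" for i
      using that
    proof (induction i)
      case 0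
      have "Inv 0 \<mu>0" unfolding Inv_def using so0 1(3) e0 by (simp add: \<mu>0_def)
      then show ?case using runs_0 by blast
    next
      case (Suc i)
      then obtain t \<nu> where IH: "t \<le> i * (TB + 7)" "runs p P (top a) \<mu>0 t (top a) \<nu>" "Inv i \<nu>" by auto
      note I = IH(3)[unfolded Inv_def]
      have pos: "0 < \<nu> (m' + 2)" using I Suc(2) B_def by auto
      have b2: "int lm2 \<le> \<nu> 1" "\<nu> 0 = \<mu> 0" using I b m m2 by (auto simp: same_outside_def)
      obtain t2 \<mu>2 where 2: "t2 \<le> C2 * (nat (\<nu> 0) + 2) ^ e2" "runs p P (top a + 1 + 1) \<nu> t2 (top a + 1 + 1 + L2) \<mu>2"
          "\<mu>2 (m' + 4) = F \<nu> (\<nu> m') (\<nu> (m' + 1))" "same_outside (m' + 4) lm2 \<nu> \<mu>2"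
        using realizesE[OF r2 c8(1), where \<mu>=\<nu>, OF b2(1)] .
      have "agree m \<mu> \<nu>" by (intro same_outside_agree[of m' lm]) (use I m 3(2) in auto)
      then have F: "F \<nu> = F \<mu>" using Fag by simp
      have v: "\<mu>2 (m' + 4) = iter (Suc i) (F \<mu>) (x \<mu>)" using 2(3) I F by simp
      have o: "\<mu>2 m' = int i" "\<mu>2 (m' + 2) = \<mu> 0 - int i" using 2(4) I by (auto simp: same_outside_def)
      let ?\<mu>3 = "\<mu>2(m' + 3 := 0, m' + 1 := \<mu>2 (m' + 4), m' + 3 := 1, m' := int i + 1, m' + 2 := \<mu> 0 - int i - 1)"
      have "runs p P (top a) \<nu> (1 + t2 + 1 + 1 + 1 + 1 + 1 + 1) (top a) ?\<mu>3"
        using runs_trans[OF runs_trans[OF runs_trans[OF runs_trans[OF runs_trans[OF runs_trans[OF runs_trans[OF runs_jump[OF c6(1), of \<nu>, OF pos] 2(2)]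
         runs_Const[OF c9(1)]] runs_Add[OF c10(1)]] runs_Const[OF c11(1)]] runs_Add[OF c12(1)]] runs_Sub[OF c13(1)]] runs_jump[OF c14(1)]] o
        by simp
      from runs_trans[OF IH(2) this]
      have "runs p P (top a) \<mu>0 (t + (t2 + 7)) (top a) ?\<mu>3"
        by (simp add: numeral_eq_Suc)
      moreover have "t + (t2 + 7) \<le> Suc i * (TB + 7)" using IH(1) 2(1) b2(2) by (simp add: TB_def B_def)
      moreover have "same_outside m' lm \<mu> \<mu>2"
        by (rule same_outside_trans[of m' lm \<mu> \<nu> "m' + 4" lm2]) (use I 2(4) lm in auto)
      then have "same_outside m' lm \<mu> ?\<mu>3"
        by (intro same_outside_upd) (use lm in auto)
      then have "Inv (Suc i) ?\<mu>3" unfolding Inv_def using v by simp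
      ultimately show ?case by (intro exI[of _ "t + (t2 + 7)"] exI[of _ ?\<mu>3] conjI)
    qed
    obtain t \<nu> where L: "t \<le> B * (TB + 7)" "runs p P (top a) \<mu>0 t (top a) \<nu>" "Inv B \<nu>" using loop[of B] by auto
    note I = L(3)[unfolded Inv_def]
    have np: "\<not> 0 < \<nu> (m' + 2)" using I B_def by auto
    have p3: "0 < \<nu> (m' + 3)" using I by auto
    have "runs p P (top a) \<nu> (1 + 1 + 1 + 1) (fin a + 1 + 1) (\<nu>(m' + 3 := 0, m' := \<nu> (m' + 1)))"
      using runs_trans[OF runs_trans[OF runs_trans[OF runs_nojump[OF c6(1), of \<nu>, OF np] runs_jump[OF c7(1), of \<nu>, OF p3]] runs_Const[OF c15(1)]] runs_Add[OF c15(2)]]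
      by simp
    from runs_trans[OF runs_trans[OF start L(2)] this]
    have "runs p P a \<mu> (t1 + 4 + t + 4) (fin a + 1 + 1) (\<nu>(m' + 3 := 0, m' := \<nu> (m' + 1)))"
      by (simp add: numeral_eq_Suc)
    moreover have "t1 + 4 + t + 4 \<le> (C1 + C2 + 16) * (B + 2) ^ (e1 + e2 + 1)"
    proof -
      define y where "y = B + 2"
      have y1: "1 \<le> y" by (simp add: y_def)
      have "t1 \<le> C1 * y ^ (e1 + e2 + 1)" "8 \<le> 8 * y ^ (e1 + e2 + 1)"
        using bound_pow_le[OF y1, of t1 C1 e1 "e1 + e2 + 1"] bound_pow_le[OF y1, of 8 8 0 "e1 + e2 + 1"] 1(1) by (simp_all add: B_def y_def)
      moreover have "t \<le> y * (C2 * y ^ e2 + 7 * y ^ e2)"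
      proof -
        have "1 \<le> y ^ e2" using one_le_power[OF y1] .
        then have "TB + 7 \<le> C2 * y ^ e2 + 7 * y ^ e2" unfolding TB_def y_def by linarith
        moreover have "B \<le> y" by (simp add: y_def)
        ultimately show ?thesis using L(1) mult_le_mono[of B y "TB + 7" "C2 * y ^ e2 + 7 * y ^ e2"] by linarith
      qed
      then have "t \<le> (C2 + 7) * y ^ (e2 + 1)" by (simp add: algebra_simps)
      then have "t \<le> (C2 + 7) * y ^ (e1 + e2 + 1)" using bound_pow_le[OF y1, of t "C2 + 7" "e2 + 1" "e1 + e2 + 1"] by simp
      ultimately have "t1 + 4 + t + 4 \<le> (C1 + C2 + 16) * y ^ (e1 + e2 + 1)" unfolding add_mult_distrib using one_le_power[OF y1, of "e1 + e2 + 1"] by linarith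
      then show ?thesis by (simp add: y_def)
    qed
    moreover have "same_outside m' lm \<mu> (\<nu>(m' + 3 := 0, m' := \<nu> (m' + 1)))"
      by (intro same_outside_upd) (use I lm in auto)
    ultimately show ?case using I
      by (intro exI[of _ "t1 + 4 + t + 4"] exI[of _ "\<nu>(m' + 3 := 0, m' := \<nu> (m' + 1))"]) (simp add: B_def fin_def top_def add.assoc)
  qed (use l1 l2 lm in auto)
  then show ?case by blast
qed

section \<open>Input, output and whole programs\<close>

definition st :: "nat \<Rightarrow> (nat \<Rightarrow> int) \<Rightarrow> int list \<Rightarrow> int list \<Rightarrow> state" where
  "st a \<mu> xs ys = \<lparr>pc = a, mem = \<mu>, inp = xs, outp = ys\<rparr>"

definition goes :: "real \<Rightarrow> instr list \<Rightarrow> state \<Rightarrow> nat \<Rightarrow> state \<Rightarrow> bool" where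
  "goes p P s t s' \<longleftrightarrow> (step p P ^^ t) s = s'"

lemma goes_trans: "goes p P s t s' \<Longrightarrow> goes p P s' t' s'' \<Longrightarrow> goes p P s (t + t') s''"
  unfolding goes_def by (subst add.commute) (auto simp: funpow_add)

lemma runs_goes: "runs p P a \<mu> t a' \<mu>' \<Longrightarrow> goes p P (st a \<mu> xs ys) t (st a' \<mu>' xs ys)"
  unfolding runs_def goes_def st_def
  by (drule spec[of _ "\<lparr>pc = a, mem = \<mu>, inp = xs, outp = ys\<rparr>"]) simp

lemma goes_instr:
  assumes "code_at P a [i]" "exec p i (st a \<mu> xs ys) = s'"
  shows "goes p P (st a \<mu> xs ys) 1 s'"
  using code_at_single[OF assms(1)] assms(2) by (simp add: goes_def step_def halted_def st_def)

definition read_loop :: "nat \<Rightarrow> instr list" where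
  "read_loop a = [JumpPos 6 (a + 1 + 1)] @ [JumpPos 5 (a + 1 + 1 + 1 + 1 + 1 + 1 + 1)] @ [Read 4] @ [Store 3 4] @
     [Add 3 3 5] @ [Sub 6 6 5] @ [JumpPos 5 a]"

lemma one_instr: "length [i] = 1" for i :: instr by simp

text \<open>Register 3 is the write pointer, 4 a buffer, 5 the constant 1 and 6 the number of items
  left; \<open>8 \<le> q\<close> keeps the items clear of these registers.\<close>

lemma read_loop:
  assumes code: "code_at P a (read_loop a)"
    and "\<mu> 5 = 1" "\<mu> 6 = int c" "\<mu> 3 = int q" "8 \<le> q"
  shows "\<exists>\<mu>'. goes p P (st a \<mu> xs ys) (c * 6 + 2) (st (a + 7) \<mu>' (drop c xs) ys) \<and>
    (\<forall>i<c. \<mu>' (q + i) = (if i < length xs then xs ! i else 0)) \<and>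
    (\<forall>j. j \<noteq> 3 \<and> j \<noteq> 4 \<and> j \<noteq> 6 \<and> (j < q \<or> q + c \<le> j) \<longrightarrow> \<mu>' j = \<mu> j) \<and> \<mu>' 3 = int (q + c)"
proof -
  note c1 = code_at_append[OF code[unfolded read_loop_def] one_instr]
  note c2 = code_at_append[OF c1(2) one_instr]
  note c3 = code_at_append[OF c2(2) one_instr]
  note c4 = code_at_append[OF c3(2) one_instr]
  note c5 = code_at_append[OF c4(2) one_instr]
  note c6 = code_at_append[OF c5(2) one_instr]
  show ?thesis using assms(2-)
  proof (induction c arbitrary: \<mu> q xs)
    case 0
    have "runs p P a \<mu> (1 + 1) (a + 1 + 1 + 1 + 1 + 1 + 1 + 1) \<mu>"
      using runs_trans[OF runs_nojump[OF c1(1), of \<mu>] runs_jump[OF c2(1), of \<mu>]] 0 by simp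
    then have "runs p P a \<mu> (0 * 6 + 2) (a + 7) \<mu>" by (simp add: numeral_eq_Suc)
    then show ?case using runs_goes 0 by (intro exI[of _ \<mu>]) auto
  next
    case (Suc c)
    define v where "v = (case xs of [] \<Rightarrow> 0 | x # _ \<Rightarrow> x)"
    have 1: "goes p P (st a \<mu> xs ys) 1 (st (a + 1 + 1) \<mu> xs ys)"
      by (rule goes_instr[OF c1(1)]) (use Suc in \<open>simp add: st_def\<close>)
    have 2: "goes p P (st (a + 1 + 1) \<mu> xs ys) 1 (st (a + 1 + 1 + 1) (\<mu>(4 := v)) (tl xs) ys)"
      by (rule goes_instr[OF c3(1)]) (use Suc in \<open>simp add: st_def v_def\<close>)
    have 3: "goes p P (st (a + 1 + 1 + 1) (\<mu>(4 := v)) (tl xs) ys) 1 (st (a + 1 + 1 + 1 + 1) (\<mu>(4 := v, q := v)) (tl xs) ys)"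
      by (rule goes_instr[OF c4(1)]) (use Suc in \<open>simp add: st_def v_def\<close>)
    have 4: "goes p P (st (a + 1 + 1 + 1 + 1) (\<mu>(4 := v, q := v)) (tl xs) ys) 1 (st (a + 1 + 1 + 1 + 1 + 1) (\<mu>(4 := v, q := v, 3 := int (Suc q))) (tl xs) ys)"
      by (rule goes_instr[OF c5(1)]) (use Suc.prems in \<open>simp add: st_def add.commute\<close>)
    have 5: "goes p P (st (a + 1 + 1 + 1 + 1 + 1) (\<mu>(4 := v, q := v, 3 := int (Suc q))) (tl xs) ys) 1
          (st (a + 1 + 1 + 1 + 1 + 1 + 1) (\<mu>(4 := v, q := v, 3 := int (Suc q), 6 := int c)) (tl xs) ys)"
      by (rule goes_instr[OF c6(1)]) (use Suc in \<open>simp add: st_def v_def\<close>)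
    let ?\<mu> = "\<mu>(4 := v, q := v, 3 := int (Suc q), 6 := int c)"
    have 6: "goes p P (st (a + 1 + 1 + 1 + 1 + 1 + 1) ?\<mu> (tl xs) ys) 1 (st a ?\<mu> (tl xs) ys)"
      by (rule goes_instr[OF c6(2)]) (use Suc in \<open>simp add: st_def v_def\<close>)
    have "?\<mu> 5 = 1" "?\<mu> 6 = int c" "?\<mu> 3 = int (Suc q)" "8 \<le> Suc q" using Suc by auto
    from Suc.IH[OF this, of "tl xs"] obtain \<mu>' where IH: "goes p P (st a ?\<mu> (tl xs) ys) (c * 6 + 2) (st (a + 7) \<mu>' (drop c (tl xs)) ys)"
      "\<forall>i<c. \<mu>' (Suc q + i) = (if i < length (tl xs) then tl xs ! i else 0)"
      "\<forall>j. j \<noteq> 3 \<and> j \<noteq> 4 \<and> j \<noteq> 6 \<and> (j < Suc q \<or> Suc q + c \<le> j) \<longrightarrow> \<mu>' j = ?\<mu> j" "\<mu>' 3 = int (Suc q + c)" by blast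
    have g: "goes p P (st a \<mu> xs ys) (Suc c * 6 + 2) (st (a + 7) \<mu>' (drop (Suc c) xs) ys)"
      using goes_trans[OF goes_trans[OF goes_trans[OF goes_trans[OF goes_trans[OF goes_trans[OF 1 2] 3] 4] 5] 6] IH(1)]
      by (simp add: drop_Suc add.commute numeral_eq_Suc)
    have "\<mu>' (q + i) = (if i < length xs then xs ! i else 0)" if "i < Suc c" for i
    proof (cases i)
      case 0
      have "\<mu>' q = v" using IH(3) Suc.prems by auto
      then show ?thesis using 0 by (cases xs) (auto simp: v_def)
    next
      case (Suc i')
      then show ?thesis using IH(2)[rule_format, of i'] that by (cases xs) auto
    qed
    moreover have "\<mu>' j = \<mu> j" if "j \<noteq> 3 \<and> j \<noteq> 4 \<and> j \<noteq> 6 \<and> (j < q \<or> q + Suc c \<le> j)" for j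
      using IH(3) that by auto
    ultimately show ?case using g IH(4) by (intro exI[of _ \<mu>']) auto
  qed
qed

text \<open>Computations work from cell 8 on. Their result is moved into one of the eight fixed
  registers, all others of which keep their contents.\<close>

definition assigns :: "real \<Rightarrow> nat \<Rightarrow> ((nat \<Rightarrow> int) \<Rightarrow> int) \<Rightarrow> nat \<Rightarrow> nat \<Rightarrow> nat \<Rightarrow> (nat \<Rightarrow> instr list) \<Rightarrow> nat \<Rightarrow> bool" where
  "assigns p j f C e lm gen L \<longleftrightarrow> (\<forall>a. length (gen a) = L) \<and>
    (\<forall>P a \<mu>. code_at P a (gen a) \<and> int lm \<le> \<mu> 1 \<longrightarrow>
      (\<exists>t \<mu>'. t \<le> C * (nat (\<mu> 0) + 2) ^ e \<and> runs p P a \<mu> t (a + L) \<mu>' \<and>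
        \<mu>' j = f \<mu> \<and> (\<forall>i. i \<noteq> j \<and> (i < 8 \<or> lm \<le> i) \<longrightarrow> \<mu>' i = \<mu> i)))"

lemma assigns_len: "assigns p j f C e lm gen L \<Longrightarrow> length (gen a) = L"
  unfolding assigns_def by blast

lemma assignsE:
  assumes "assigns p j f C e lm gen L" "code_at P a (gen a)" "int lm \<le> \<mu> 1"
  obtains t \<mu>' where "t \<le> C * (nat (\<mu> 0) + 2) ^ e" "runs p P a \<mu> t (a + L) \<mu>'"
        "\<mu>' j = f \<mu>" "\<And>i. i \<noteq> j \<Longrightarrow> i < 8 \<or> lm \<le> i \<Longrightarrow> \<mu>' i = \<mu> i"
  using assms unfolding assigns_def by blast

lemma rcomp_assigns:
  assumes "rcomp p 8 f" "j < 8"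
  shows "\<exists>C e lm gen L. assigns p j f C e lm gen L"
proof -
  obtain C e lm gen L where r: "realizes p 8 f C e lm gen L" using rcomp_realizes[OF assms(1) order_refl] .
  have "assigns p j f (C + 2) e (max lm 10) (\<lambda>a. gen a @ [Const 9 0] @ [Add j 8 9]) (L + 1 + 1)"
    unfolding assigns_def
  proof (intro conjI allI impI, goal_cases)
    case (2 P a \<mu>)
    then have 2: "code_at P a (gen a @ [Const 9 0] @ [Add j 8 9])" "int lm \<le> \<mu> 1" by auto
    note c1 = code_at_append[OF 2(1) realizes_len[OF r]]
    note c2 = code_at_append[OF c1(2) one_instr]
    obtain t1 \<mu>1 where 1: "t1 \<le> C * (nat (\<mu> 0) + 2) ^ e" "runs p P a \<mu> t1 (a + L) \<mu>1"
        "\<mu>1 8 = f \<mu>" "same_outside 8 lm \<mu> \<mu>1"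
      using realizesE[OF r c1(1), where \<mu>=\<mu>, OF 2(2)] .
    have "runs p P a \<mu> (t1 + 1 + 1) (a + L + 1 + 1) (\<mu>1(9 := 0, j := f \<mu>))"
      using runs_trans[OF runs_trans[OF 1(2) runs_Const[OF c2(1)]] runs_Add[OF c2(2)]] 1(3) by simp
    moreover have "1 \<le> (nat (\<mu> 0) + 2) ^ e" by simp
    then have "t1 + 1 + 1 \<le> (C + 2) * (nat (\<mu> 0) + 2) ^ e" using 1(1) unfolding add_mult_distrib by linarith
    ultimately show ?case using 1(4) assms(2)
      by (intro exI[of _ "t1 + 1 + 1"] exI[of _ "\<mu>1(9 := 0, j := f \<mu>)"]) (auto simp: add.assoc same_outside_def)
  qed (use realizes_len[OF r] in auto)
  then show ?thesis by blast
qed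

definition out_loop :: "nat \<Rightarrow> (nat \<Rightarrow> instr list) \<Rightarrow> nat \<Rightarrow> instr list" where
  "out_loop L gen a = [JumpPos 6 (a + 1 + 1)] @ [JumpPos 5 (a + 1 + 1 + L + 1 + 1 + 1 + 1)] @ gen (a + 1 + 1) @ [Print 8] @
     [Add 3 3 5] @ [Sub 6 6 5] @ [JumpPos 5 a]"

text \<open>The value is recomputed for every item, with the index in register 3. Computability from
  level 4 on lets \<open>f\<close> see that index but not the loop control in registers 5 and
  6.\<close>

lemma out_loop:
  assumes r: "realizes p 8 f C e lm gen L" and f: "rcomp p 4 f"
    and code: "code_at P a (out_loop L gen a)"
    and "int lm \<le> \<mu> 1" "\<mu> 5 = 1" "\<mu> 6 = int c" "\<mu> 3 = int q"
  shows "\<exists>t s. t \<le> c * (C * (nat (\<mu> 0) + 2) ^ e + 5) + 2 \<and> 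
    goes p P (st a \<mu> xs ys) t s \<and> pc s = a + L + 6 \<and> outp s = ys @ map (\<lambda>i. f (\<mu>(3 := int i))) [q..<q+c]"
proof -
  note c1 = code_at_append[OF code[unfolded out_loop_def] one_instr]
  note c2 = code_at_append[OF c1(2) one_instr]
  note c3 = code_at_append[OF c2(2) realizes_len[OF r]]
  note c4 = code_at_append[OF c3(2) one_instr]
  note c5 = code_at_append[OF c4(2) one_instr]
  note c6 = code_at_append[OF c5(2) one_instr]
  show ?thesis using assms(4-)
  proof (induction c arbitrary: \<mu> q ys)
    case 0
    have "runs p P a \<mu> (1 + 1) (a + 1 + 1 + L + 1 + 1 + 1 + 1) \<mu>"
      using runs_trans[OF runs_nojump[OF c1(1), of \<mu>] runs_jump[OF c2(1), of \<mu>]] 0 by simp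
    then have "runs p P a \<mu> 2 (a + L + 6) \<mu>" by (simp add: numeral_eq_Suc)
    then show ?case using runs_goes 0 by (intro exI[of _ 2] exI[of _ "st (a + L + 6) \<mu> xs ys"]) (auto simp: st_def)
  next
    case (Suc c)
    obtain t1 \<mu>1 where 1: "t1 \<le> C * (nat (\<mu> 0) + 2) ^ e" "runs p P (a + 1 + 1) \<mu> t1 (a + 1 + 1 + L) \<mu>1"
        "\<mu>1 8 = f \<mu>" "same_outside 8 lm \<mu> \<mu>1"
      using realizesE[OF r c3(1), where \<mu>=\<mu>, OF Suc.prems(1)] .
    have s: "\<mu>1 5 = 1" "\<mu>1 6 = int (Suc c)" "\<mu>1 3 = int q" using 1(4) Suc.prems by (auto simp: same_outside_def)
    have g0: "goes p P (st a \<mu> xs ys) 1 (st (a + 1 + 1) \<mu> xs ys)"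
      by (rule goes_instr[OF c1(1)]) (use Suc in \<open>simp add: st_def\<close>)
    have g1: "goes p P (st (a + 1 + 1) \<mu> xs ys) t1 (st (a + 1 + 1 + L) \<mu>1 xs ys)"
      using runs_goes[OF 1(2)] .
    have g2: "goes p P (st (a + 1 + 1 + L) \<mu>1 xs ys) 1 (st (a + 1 + 1 + L + 1) \<mu>1 xs (ys @ [f \<mu>]))"
      by (rule goes_instr[OF c4(1)]) (use 1 in \<open>simp add: st_def\<close>)
    let ?\<mu> = "\<mu>1(3 := int (Suc q), 6 := int c)"
    have g3: "goes p P (st (a + 1 + 1 + L + 1) \<mu>1 xs (ys @ [f \<mu>])) 1 (st (a + 1 + 1 + L + 1 + 1) (\<mu>1(3 := int (Suc q))) xs (ys @ [f \<mu>]))"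
      by (rule goes_instr[OF c5(1)]) (use s in \<open>simp add: st_def add.commute\<close>)
    have g4: "goes p P (st (a + 1 + 1 + L + 1 + 1) (\<mu>1(3 := int (Suc q))) xs (ys @ [f \<mu>])) 1 (st (a + 1 + 1 + L + 1 + 1 + 1) ?\<mu> xs (ys @ [f \<mu>]))"
      by (rule goes_instr[OF c6(1)]) (use s in \<open>simp add: st_def\<close>)
    have g5: "goes p P (st (a + 1 + 1 + L + 1 + 1 + 1) ?\<mu> xs (ys @ [f \<mu>])) 1 (st a ?\<mu> xs (ys @ [f \<mu>]))"
      by (rule goes_instr[OF c6(2)]) (use s in \<open>simp add: st_def\<close>)
    have so: "?\<mu> j = \<mu> j" if "j \<noteq> 3" "j \<noteq> 6" "j < 8 \<or> lm \<le> j" for j using that 1(4) by (auto simp: same_outside_def)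
    have "int lm \<le> ?\<mu> 1" "?\<mu> 5 = 1" "?\<mu> 6 = int c" "?\<mu> 3 = int (Suc q)" using Suc so by auto
    from Suc.IH[OF this, of "ys @ [f \<mu>]"] obtain t s where IH: "t \<le> c * (C * (nat (?\<mu> 0) + 2) ^ e + 5) + 2"
      "goes p P (st a ?\<mu> xs (ys @ [f \<mu>])) t s" "pc s = a + L + 6"
      "outp s = (ys @ [f \<mu>]) @ map (\<lambda>i. f (?\<mu>(3 := int i))) [Suc q..<Suc q+c]" by blast
    have g: "goes p P (st a \<mu> xs ys) (1 + t1 + 1 + 1 + 1 + 1 + t) s"
      using goes_trans[OF goes_trans[OF goes_trans[OF goes_trans[OF goes_trans[OF goes_trans[OF g0 g1] g2] g3] g4] g5] IH(2)] .
    have "1 + t1 + 1 + 1 + 1 + 1 + t \<le> Suc c * (C * (nat (\<mu> 0) + 2) ^ e + 5) + 2"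
      using IH(1) 1(1) so[of 0] by simp
    moreover have "f (?\<mu>(3 := int i)) = f (\<mu>(3 := int i))" for i
      apply (rule rcomp_agree[OF f]) unfolding agree_def using so Suc.prems(1) realizes_less[OF r] by auto
    then have "map (\<lambda>i. f (?\<mu>(3 := int i))) [Suc q..<Suc q+c] = map (\<lambda>i. f (\<mu>(3 := int i))) [Suc q..<Suc q+c]" by simp
    moreover have "\<mu>(3 := int q) = \<mu>" using Suc.prems by auto
    then have "map (\<lambda>i. f (\<mu>(3 := int i))) [q..<q+Suc c] = f \<mu> # map (\<lambda>i. f (\<mu>(3 := int i))) [Suc q..<Suc q+c]"
      by (subst upt_conv_Cons) (auto simp del: upt_Suc)
    ultimately show ?case using g IH(3,4)
      by (intro exI[of _ "1 + t1 + 1 + 1 + 1 + 1 + t"] exI[of _ s]) (simp del: upt_Suc fun_upd_apply)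
  qed
qed

text \<open>An idealized memory with the loop bound, the input address, the precision
  \<open>E\<close> and the input, and zero elsewhere. The real memory agrees with it at every stage,
  which removes scratch contents from all specifications.\<close>

definition amem :: "nat \<Rightarrow> int \<Rightarrow> int list \<Rightarrow> int \<Rightarrow> nat \<Rightarrow> int" where
  "amem bs E xs b j = (if j = 0 then b else if j = 1 then int bs else if j = 2 then E
     else if bs \<le> j \<and> j < bs + length xs then xs ! (j - bs) else 0)"

lemma amem_agree:
  assumes "\<mu> 0 = b" "\<mu> 1 = int bs" "\<mu> 2 = E" "\<And>i. \<mu> (bs + i) = (if i < length xs then xs ! i else 0)" "3 \<le> bs"
  shows "agree 3 \<mu> (amem bs E xs b)" "4 \<le> bs \<Longrightarrow> agree 4 (\<mu>(3 := c)) ((amem bs E xs b)(3 := c))"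
proof -
  have *: "\<mu> j = amem bs E xs b j" if "bs \<le> j" for j
    using assms(4)[of "j - bs"] assms(5) that by (auto simp: amem_def)
  show "agree 3 \<mu> (amem bs E xs b)" "4 \<le> bs \<Longrightarrow> agree 4 (\<mu>(3 := c)) ((amem bs E xs b)(3 := c))"
    using assms(1-3) * unfolding agree_def by (auto simp: amem_def numeral_eq_Suc less_Suc_eq)
qed

text \<open>Every computation is limited by register 0, including the one that produces a larger
  value for register 0. So the bound is raised in stages, from \<open>d\<close> through
  \<open>g1\<close> and \<open>g2\<close> to \<open>g3\<close>; the product \<open>n * d\<close>
  that controls reading is obtained as \<open>d\<close> additions of \<open>n\<close>.
  \<open>E\<close> is a constant in the program text, whereas \<open>C\<close>, \<open>e\<close> and
  \<open>bs\<close> do not depend on it, so a single polynomial can later serve all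
  precisions.\<close>

theorem rcomp_program:
  assumes g: "rcomp p 3 g1" "rcomp p 3 g2" "rcomp p 3 g3" "rcomp p 3 cnt" "rcomp p 4 out"
  obtains C e bs :: nat where "8 \<le> bs" "\<And>E. \<exists>P. \<forall>xs n d b1 b2 b3 c. length xs = 3 + n * d \<longrightarrow> xs ! 0 = int n \<longrightarrow> xs ! 1 = int d \<longrightarrow>
     b1 = g1 (amem bs E xs (int d)) \<longrightarrow> b2 = g2 (amem bs E xs b1) \<longrightarrow> b3 = g3 (amem bs E xs b2) \<longrightarrow>
     cnt (amem bs E xs b3) = int c \<longrightarrow>
     (\<exists>t \<le> C * (n * d + d + nat b1 + nat b2 + nat b3 + c + 2) ^ e.
       ram_computes p P xs t (map (\<lambda>i. out ((amem bs E xs b3)(3 := int i))) [0..<c]))"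
proof -
  have l1: "rcomp p 8 (\<lambda>\<mu>. \<mu> (nat (\<mu> 1 + 1)))" and l2: "rcomp p 8 (\<lambda>\<mu>. iter (nat (\<mu> 0)) (\<lambda>i a. a + \<mu> (nat (\<mu> 1 + 0))) 0)"
    by (intro rcomp_load rcomp_const rcomp_iter rcomp_add; simp add: rcomp_ge2)+
  obtain C0 e0 m0 gen0 L0 where a0: "assigns p 0 (\<lambda>\<mu>. \<mu> (nat (\<mu> 1 + 1))) C0 e0 m0 gen0 L0"
    using rcomp_assigns[OF l1, of 0] by (auto simp del: One_nat_def)
  obtain C1 e1 m1 gen1 L1 where a1: "assigns p 6 (\<lambda>\<mu>. iter (nat (\<mu> 0)) (\<lambda>i a. a + \<mu> (nat (\<mu> 1 + 0))) 0) C1 e1 m1 gen1 L1"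
    using rcomp_assigns[OF l2, of 6] by (auto simp del: One_nat_def)
  obtain C2 e2 m2 gen2 L2 where a2: "assigns p 0 g1 C2 e2 m2 gen2 L2"
    using rcomp_assigns[OF rcomp_mono[OF g(1)], of 0] by (auto simp del: One_nat_def)
  obtain C3 e3 m3 gen3 L3 where a3: "assigns p 0 g2 C3 e3 m3 gen3 L3"
    using rcomp_assigns[OF rcomp_mono[OF g(2)], of 0] by (auto simp del: One_nat_def)
  obtain C4 e4 m4 gen4 L4 where a4: "assigns p 0 g3 C4 e4 m4 gen4 L4"
    using rcomp_assigns[OF rcomp_mono[OF g(3)], of 0] by (auto simp del: One_nat_def)
  obtain C5 e5 m5 gen5 L5 where a5: "assigns p 6 cnt C5 e5 m5 gen5 L5"
    using rcomp_assigns[OF rcomp_mono[OF g(4)], of 6] by (auto simp del: One_nat_def)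
  obtain C6 e6 m6 gen6 L6 where a6: "realizes p 8 out C6 e6 m6 gen6 L6"
    by (rule rcomp_realizes[OF g(5), of 8]) auto
  note len = assigns_len[OF a0] assigns_len[OF a1] assigns_len[OF a2] assigns_len[OF a3] assigns_len[OF a4] assigns_len[OF a5] realizes_len[OF a6]
  \<comment> \<open>The input starts above the scratch space of every component.\<close>
  define bs where "bs = 8 + m0 + m1 + m2 + m3 + m4 + m5 + m6"
  have bs: "8 \<le> bs" "m0 \<le> bs" "m1 \<le> bs" "m2 \<le> bs" "m3 \<le> bs" "m4 \<le> bs" "m5 \<le> bs" "m6 \<le> bs" unfolding bs_def by simp_all
  define e where "e = e0 + e1 + e2 + e3 + e4 + e5 + e6 + 1"
  define C where "C = C0 + C1 + C2 + C3 + C4 + C5 + C6 + 100"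
  have rlen: "length (read_loop a) = 7" for a by (simp add: read_loop_def)
  have olen: "length (out_loop L6 gen6 a) = L6 + 6" for a by (simp add: out_loop_def len)
  show ?thesis
  proof (rule that[of bs C e, OF bs(1)], goal_cases)
    case (1 E)
    define q0 where "q0 = (0 + 1 + 1 + 1 + 1 + 1 :: nat)"
    define q1 where "q1 = q0 + 7"
    define q2 where "q2 = q1 + L0"
    define q3 where "q3 = q2 + L1"
    define q4 where "q4 = q3 + 7"
    define q5 where "q5 = q4 + L2"
    define q6 where "q6 = q5 + L3"
    define q7 where "q7 = q6 + L4"
    define q8 where "q8 = q7 + L5"
    define q9 where "q9 = q8 + 1"
    note q = q0_def[symmetric] q1_def[symmetric] q2_def[symmetric] q3_def[symmetric] q4_def[symmetric]
      q5_def[symmetric] q6_def[symmetric] q7_def[symmetric] q8_def[symmetric] q9_def[symmetric]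
    define P where "P = [Const 1 (int bs)] @ [Const 2 E] @ [Const 5 1] @ [Const 3 (int bs)] @ [Const 6 3] @
      read_loop q0 @ gen0 q1 @ gen1 q2 @ read_loop q3 @ gen2 q4 @ gen3 q5 @ gen4 q6 @ gen5 q7 @ [Const 3 0] @ out_loop L6 gen6 q9"
    have Plen: "length P = q9 + L6 + 6" by (simp add: P_def len rlen olen q0_def q1_def q2_def q3_def q4_def q5_def q6_def q7_def q8_def q9_def)
    have c0: "code_at P 0 P" unfolding code_at_def by auto
    note d1 = code_at_append[OF c0[unfolded P_def] one_instr, folded P_def]
    note d2 = code_at_append[OF d1(2) one_instr]
    note d3 = code_at_append[OF d2(2) one_instr]
    note d4 = code_at_append[OF d3(2) one_instr]
    note d5 = code_at_append[OF d4(2) one_instr, unfolded q]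
    note d6 = code_at_append[OF d5(2) rlen, unfolded q]
    note d7 = code_at_append[OF d6(2) len(1), unfolded q]
    note d8 = code_at_append[OF d7(2) len(2), unfolded q]
    note d9 = code_at_append[OF d8(2) rlen, unfolded q]
    note d10 = code_at_append[OF d9(2) len(3), unfolded q]
    note d11 = code_at_append[OF d10(2) len(4), unfolded q]
    note d12 = code_at_append[OF d11(2) len(5), unfolded q]
    note d13 = code_at_append[OF d12(2) len(6), unfolded q]
    note d14 = code_at_append[OF d13(2) one_instr, unfolded q]
    show ?case
    proof (intro exI[of _ P] allI impI, goal_cases)
      case (1 xs n d b1 b2 b3 c)
      define arr where "arr i = (if i < length xs then xs ! i else 0)" for i
      define \<mu>0 :: "nat \<Rightarrow> int" where "\<mu>0 = (\<lambda>_. 0)(1 := int bs, 2 := E, 5 := 1, 3 := int bs, 6 := 3)"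
      have "runs p P 0 (\<lambda>_. 0) (1 + 1 + 1 + 1 + 1) q0 \<mu>0" unfolding \<mu>0_def
        using runs_trans[OF runs_trans[OF runs_trans[OF runs_trans[OF runs_Const[OF d1(1)] runs_Const[OF d2(1)]] runs_Const[OF d3(1)]] runs_Const[OF d4(1)]] runs_Const[OF d5(1)], unfolded q] .
      from runs_goes[OF this, of xs "[]"] have G0: "goes p P (st 0 (\<lambda>_. 0) xs []) 5 (st q0 \<mu>0 xs [])"
        by (simp add: numeral_eq_Suc)
      have "\<mu>0 5 = 1" "\<mu>0 6 = int 3" "\<mu>0 3 = int bs" by (auto simp: \<mu>0_def)
      from read_loop[OF d6(1) this bs(1), of p xs "[]", unfolded q] obtain \<mu>1 where
        G1: "goes p P (st q0 \<mu>0 xs []) (3 * 6 + 2) (st q1 \<mu>1 (drop 3 xs) [])"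
        and r1: "\<forall>i<3. \<mu>1 (bs + i) = (if i < length xs then xs ! i else 0)"
        "\<forall>j. j \<noteq> 3 \<and> j \<noteq> 4 \<and> j \<noteq> 6 \<and> (j < bs \<or> bs + 3 \<le> j) \<longrightarrow> \<mu>1 j = \<mu>0 j" "\<mu>1 3 = int (bs + 3)" by (elim exE conjE)
      have s1: "\<mu>1 0 = 0" "\<mu>1 1 = int bs" "\<mu>1 2 = E" "\<mu>1 5 = 1" "\<mu>1 bs = int n" "\<mu>1 (bs + 1) = int d"
        using r1(1)[rule_format, of 0] r1(1)[rule_format, of 1] r1(2)[rule_format, of 0] r1(2)[rule_format, of 1]
          r1(2)[rule_format, of 2] r1(2)[rule_format, of 5] 1(1,2,3) bs(1) by (auto simp: \<mu>0_def)
      have lm0: "int m0 \<le> \<mu>1 1" using s1(2) bs(2) by linarith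
      obtain t2 \<mu>2 where 2: "t2 \<le> C0 * (nat (\<mu>1 0) + 2) ^ e0" "runs p P q1 \<mu>1 t2 q2 \<mu>2"
         "\<mu>2 0 = \<mu>1 (nat (\<mu>1 1 + 1))" "\<And>i. i \<noteq> 0 \<Longrightarrow> i < 8 \<or> m0 \<le> i \<Longrightarrow> \<mu>2 i = \<mu>1 i"
        by (rule assignsE[OF a0 d7(1), where \<mu>=\<mu>1, OF lm0, unfolded q]) (rule that)
      have s2: "\<mu>2 0 = int d" using 2(3) s1 by (simp add: nat_add_distrib)
      have k2: "\<mu>2 i = \<mu>1 i" if "i \<noteq> 0" "i < 8 \<or> bs \<le> i" for i
        by (rule 2(4)[OF that(1)], rule disj_forward[OF that(2)], assumption, erule le_trans[OF bs(2)])
      have k2': "\<mu>2 1 = int bs" "\<mu>2 bs = int n" "int m1 \<le> \<mu>2 1" using k2[of 1] k2[of bs] s1(2,5) bs(1,3) by simp_all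
      obtain t3 \<mu>3 where 3: "t3 \<le> C1 * (nat (\<mu>2 0) + 2) ^ e1" "runs p P q2 \<mu>2 t3 q3 \<mu>3"
         "\<mu>3 6 = iter (nat (\<mu>2 0)) (\<lambda>i a. a + \<mu>2 (nat (\<mu>2 1 + 0))) 0" "\<And>i. i \<noteq> 6 \<Longrightarrow> i < 8 \<or> m1 \<le> i \<Longrightarrow> \<mu>3 i = \<mu>2 i"
        by (rule assignsE[OF a1 d8(1), where \<mu>=\<mu>2, OF k2'(3), unfolded q]) (rule that)
      have "iter k (\<lambda>i a. a + int n) 0 = int (n * k)" for k by (induction k) (auto simp: algebra_simps)
      then have s3: "\<mu>3 6 = int (n * d)" using 3(3) k2' s2 by simp
      have k3: "\<mu>3 i = \<mu>1 i" if "i \<noteq> 0" "i \<noteq> 6" "i < 8 \<or> bs \<le> i" for i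
        using 3(4)[OF that(2) disj_forward[OF that(3) _ le_trans[OF bs(3)]]] k2[OF that(1,3)] by simp
      have k3': "\<mu>3 5 = 1" "\<mu>3 3 = int (bs + 3)" "8 \<le> bs + 3" using k3[of 5] k3[of 3] s1(4) r1(3) bs(1) by simp_all
      from read_loop[OF d9(1) k3'(1) s3 k3'(2,3), of p "drop 3 xs" "[]", unfolded q] obtain \<mu>4 where
        G4: "goes p P (st q3 \<mu>3 (drop 3 xs) []) (n * d * 6 + 2) (st q4 \<mu>4 (drop (n * d) (drop 3 xs)) [])"
        and r4: "\<forall>i<n*d. \<mu>4 (bs + 3 + i) = (if i < length (drop 3 xs) then drop 3 xs ! i else 0)"
        "\<forall>j. j \<noteq> 3 \<and> j \<noteq> 4 \<and> j \<noteq> 6 \<and> (j < bs + 3 \<or> bs + 3 + n * d \<le> j) \<longrightarrow> \<mu>4 j = \<mu>3 j" by (elim exE conjE)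
      have lxs: "length xs = 3 + n * d" using 1(1) .
      have arr: "\<mu>4 (bs + i) = arr i" for i
      proof -
        consider "i < 3" | "3 \<le> i" "i < 3 + n * d" | "3 + n * d \<le> i" by linarith
        then show ?thesis
        proof cases
          case 1
          then have "\<mu>4 (bs + i) = \<mu>1 (bs + i)" using r4(2)[rule_format, of "bs + i"] k3[of "bs + i"] bs(1) by simp
          then show ?thesis using r1(1)[rule_format, OF 1] by (simp add: arr_def)
        next
          case 2
          then show ?thesis using r4(1)[rule_format, of "i - 3"] lxs by (auto simp: arr_def)
        next
          case 3
          then have "\<mu>4 (bs + i) = \<mu>1 (bs + i)" using r4(2)[rule_format, of "bs + i"] k3[of "bs + i"] bs(1) by simp
          moreover have "\<mu>1 (bs + i) = \<mu>0 (bs + i)" using r1(2)[rule_format, of "bs + i"] 3 bs(1) by simp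
          ultimately show ?thesis using 3 bs(1) lxs by (auto simp: arr_def \<mu>0_def)
        qed
      qed
      have s4: "\<mu>4 0 = int d" "\<mu>4 1 = int bs" "\<mu>4 2 = E" "\<mu>4 5 = 1"
        using r4(2)[rule_format, of 0] r4(2)[rule_format, of 1] r4(2)[rule_format, of 2] r4(2)[rule_format, of 5]
          k3[of 1] k3[of 2] k3[of 5] s1(2,3,4) s2 3(4)[of 0] bs(1) by simp_all
      have lm2: "int m2 \<le> \<mu>4 1" using s4(2) bs(4) by linarith
      obtain t5 \<mu>5 where 5: "t5 \<le> C2 * (nat (\<mu>4 0) + 2) ^ e2" "runs p P q4 \<mu>4 t5 q5 \<mu>5"
         "\<mu>5 0 = g1 \<mu>4" "\<And>i. i \<noteq> 0 \<Longrightarrow> i < 8 \<or> m2 \<le> i \<Longrightarrow> \<mu>5 i = \<mu>4 i"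
        by (rule assignsE[OF a2 d10(1), where \<mu>=\<mu>4, OF lm2, unfolded q]) (rule that)
      have ag5: "agree 3 \<mu>4 (amem bs E xs (int d))"
        by (rule amem_agree(1)) (use s4(1,2,3) arr bs(1) in \<open>simp_all add: arr_def\<close>)
      have keep5: "\<mu>5 i = \<mu>4 i" if "i \<noteq> 0" "i < 8 \<or> bs \<le> i" for i
        by (rule 5(4)[OF that(1)], rule disj_forward[OF that(2)], assumption, erule le_trans[OF bs(4)])
      have s5: "\<mu>5 0 = b1" "\<mu>5 1 = int bs" "\<mu>5 2 = E" "\<mu>5 5 = 1" "\<And>i. \<mu>5 (bs + i) = arr i"
        subgoal by (rule trans[OF 5(3) trans[OF rcomp_agree[OF g(1) ag5] 1(4)[symmetric]]])
        subgoal using keep5[of 1] s4(2) by simp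
        subgoal using keep5[of 2] s4(3) by simp
        subgoal using keep5[of 5] s4(4) by simp
        subgoal for i using keep5[of "bs + i"] arr bs(1) by simp
        done
      have lm3: "int m3 \<le> \<mu>5 1" using s5(2) bs(5) by linarith
      obtain t6 \<mu>6 where 6: "t6 \<le> C3 * (nat (\<mu>5 0) + 2) ^ e3" "runs p P q5 \<mu>5 t6 q6 \<mu>6"
         "\<mu>6 0 = g2 \<mu>5" "\<And>i. i \<noteq> 0 \<Longrightarrow> i < 8 \<or> m3 \<le> i \<Longrightarrow> \<mu>6 i = \<mu>5 i"
        by (rule assignsE[OF a3 d11(1), where \<mu>=\<mu>5, OF lm3, unfolded q]) (rule that)
      have ag6: "agree 3 \<mu>5 (amem bs E xs (b1))"
        by (rule amem_agree(1)) (use s5(1,2,3) s5(5) bs(1) in \<open>simp_all add: arr_def\<close>)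
      have keep6: "\<mu>6 i = \<mu>5 i" if "i \<noteq> 0" "i < 8 \<or> bs \<le> i" for i
        by (rule 6(4)[OF that(1)], rule disj_forward[OF that(2)], assumption, erule le_trans[OF bs(5)])
      have s6: "\<mu>6 0 = b2" "\<mu>6 1 = int bs" "\<mu>6 2 = E" "\<mu>6 5 = 1" "\<And>i. \<mu>6 (bs + i) = arr i"
        subgoal by (rule trans[OF 6(3) trans[OF rcomp_agree[OF g(2) ag6] 1(5)[symmetric]]])
        subgoal using keep6[of 1] s5(2) by simp
        subgoal using keep6[of 2] s5(3) by simp
        subgoal using keep6[of 5] s5(4) by simp
        subgoal for i using keep6[of "bs + i"] s5(5) bs(1) by simp
        done
      have lm4: "int m4 \<le> \<mu>6 1" using s6(2) bs(6) by linarith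
      obtain t7 \<mu>7 where 7: "t7 \<le> C4 * (nat (\<mu>6 0) + 2) ^ e4" "runs p P q6 \<mu>6 t7 q7 \<mu>7"
         "\<mu>7 0 = g3 \<mu>6" "\<And>i. i \<noteq> 0 \<Longrightarrow> i < 8 \<or> m4 \<le> i \<Longrightarrow> \<mu>7 i = \<mu>6 i"
        by (rule assignsE[OF a4 d12(1), where \<mu>=\<mu>6, OF lm4, unfolded q]) (rule that)
      have ag7: "agree 3 \<mu>6 (amem bs E xs (b2))"
        by (rule amem_agree(1)) (use s6(1,2,3) s6(5) bs(1) in \<open>simp_all add: arr_def\<close>)
      have keep7: "\<mu>7 i = \<mu>6 i" if "i \<noteq> 0" "i < 8 \<or> bs \<le> i" for i
        by (rule 7(4)[OF that(1)], rule disj_forward[OF that(2)], assumption, erule le_trans[OF bs(6)])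
      have s7: "\<mu>7 0 = b3" "\<mu>7 1 = int bs" "\<mu>7 2 = E" "\<mu>7 5 = 1" "\<And>i. \<mu>7 (bs + i) = arr i"
        subgoal by (rule trans[OF 7(3) trans[OF rcomp_agree[OF g(3) ag7] 1(6)[symmetric]]])
        subgoal using keep7[of 1] s6(2) by simp
        subgoal using keep7[of 2] s6(3) by simp
        subgoal using keep7[of 5] s6(4) by simp
        subgoal for i using keep7[of "bs + i"] s6(5) bs(1) by simp
        done
      have lm5: "int m5 \<le> \<mu>7 1" using s7(2) bs(7) by linarith
      obtain t8 \<mu>8 where 8: "t8 \<le> C5 * (nat (\<mu>7 0) + 2) ^ e5" "runs p P q7 \<mu>7 t8 q8 \<mu>8"
         "\<mu>8 6 = cnt \<mu>7" "\<And>i. i \<noteq> 6 \<Longrightarrow> i < 8 \<or> m5 \<le> i \<Longrightarrow> \<mu>8 i = \<mu>7 i"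
        by (rule assignsE[OF a5 d13(1), where \<mu>=\<mu>7, OF lm5, unfolded q]) (rule that)
      have ag8: "agree 3 \<mu>7 (amem bs E xs (b3))"
        by (rule amem_agree(1)) (use s7(1,2,3) s7(5) bs(1) in \<open>simp_all add: arr_def\<close>)
      have keep8: "\<mu>8 i = \<mu>7 i" if "i \<noteq> 6" "i < 8 \<or> bs \<le> i" for i
        by (rule 8(4)[OF that(1)], rule disj_forward[OF that(2)], assumption, erule le_trans[OF bs(7)])
      have s8: "\<mu>8 0 = b3" "\<mu>8 1 = int bs" "\<mu>8 2 = E" "\<mu>8 5 = 1" "\<And>i. \<mu>8 (bs + i) = arr i" "\<mu>8 6 = int c"
        subgoal using keep8[of 0] s7(1) by simp
        subgoal using keep8[of 1] s7(2) by simp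
        subgoal using keep8[of 2] s7(3) by simp
        subgoal using keep8[of 5] s7(4) by simp
        subgoal for i using keep8[of "bs + i"] s7(5) bs(1) by simp
        subgoal by (rule trans[OF 8(3) trans[OF rcomp_agree[OF g(4) ag8] 1(7)]])
        done
      let ?\<mu>9 = "\<mu>8(3 := 0)"
      have G9: "runs p P q8 \<mu>8 1 q9 ?\<mu>9" using runs_Const[OF d14(1), unfolded q] .
      have s9: "int m6 \<le> ?\<mu>9 1" "?\<mu>9 5 = 1" "?\<mu>9 6 = int c" "?\<mu>9 3 = int 0" using s8 bs by auto
      from out_loop[OF a6 g(5) d14(2) s9, of "drop (n * d) (drop 3 xs)" "[]"] obtain t10 s where
         10: "t10 \<le> c * (C6 * (nat (?\<mu>9 0) + 2) ^ e6 + 5) + 2"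
         "goes p P (st q9 ?\<mu>9 (drop (n * d) (drop 3 xs)) []) t10 s" "pc s = q9 + L6 + 6"
         "outp s = [] @ map (\<lambda>i. out (?\<mu>9(3 := int i))) [0..<0+c]" by (elim exE conjE)
      have out: "out (\<mu>8(3 := int i)) = out ((amem bs E xs b3)(3 := int i))" for i
        by (rule rcomp_agree[OF g(5)], rule amem_agree(2)) (use s8 bs(1) in \<open>simp_all add: arr_def\<close>)
      define t where "t = 5 + (3 * 6 + 2) + t2 + t3 + (n * d * 6 + 2) + t5 + t6 + t7 + t8 + 1 + t10"
      have "goes p P (st 0 (\<lambda>_. 0) xs []) t s" unfolding t_def
        using goes_trans[OF goes_trans[OF goes_trans[OF goes_trans[OF goes_trans[OF goes_trans[OF goes_trans[OF goes_trans[OF goes_trans[OF goes_trans[OF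
           G0 G1] runs_goes[OF 2(2)]] runs_goes[OF 3(2)]] G4] runs_goes[OF 5(2)]] runs_goes[OF 6(2)]] runs_goes[OF 7(2)]] runs_goes[OF 8(2)]] runs_goes[OF G9]] 10(2)] .
      then have "ram_computes p P xs t (map (\<lambda>i. out ((amem bs E xs b3)(3 := int i))) [0..<c])"
        unfolding ram_computes_def Let_def init_def goes_def st_def using 10(3,4) by (simp add: halted_def Plen out[simplified])
      moreover have "t \<le> C * (n * d + d + nat b1 + nat b2 + nat b3 + c + 2) ^ e"
      proof -
        define y where "y = n * d + d + nat b1 + nat b2 + nat b3 + c + 2"
        have y1: "1 \<le> y" by (simp add: y_def)
        have bb: "u \<le> K * y ^ e" if "u \<le> K * z ^ f" "z \<le> y" "f \<le> e" for u K z f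
        proof -
          have "u \<le> K * y ^ f" using that(1) mult_le_mono2[OF power_mono[OF that(2) le0], of K f] by (rule le_trans)
          then show ?thesis using bound_pow_le[OF y1 _ that(3)] by blast
        qed
        have "t2 \<le> C0 * y ^ e" by (rule bb[OF 2(1)]) (auto simp: s1 y_def e_def)
        moreover have "t3 \<le> C1 * y ^ e" by (rule bb[OF 3(1)]) (auto simp: s2 y_def e_def)
        moreover have "t5 \<le> C2 * y ^ e" by (rule bb[OF 5(1)]) (auto simp: s4 y_def e_def)
        moreover have "t6 \<le> C3 * y ^ e" by (rule bb[OF 6(1)]) (auto simp: s5 y_def e_def)
        moreover have "t7 \<le> C4 * y ^ e" by (rule bb[OF 7(1)]) (auto simp: s6 y_def e_def)
        moreover have "t8 \<le> C5 * y ^ e" by (rule bb[OF 8(1)]) (auto simp: s7 y_def e_def)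
        moreover have "t10 \<le> (C6 + 5) * y ^ e + 2"
        proof -
          have "C6 * (nat (?\<mu>9 0) + 2) ^ e6 \<le> C6 * y ^ e6"
            using s8(1) by (intro mult_le_mono2 power_mono) (auto simp: y_def)
          moreover have "5 \<le> 5 * y ^ e6" using one_le_power[OF y1, of e6] by linarith
          ultimately have A: "C6 * (nat (?\<mu>9 0) + 2) ^ e6 + 5 \<le> (C6 + 5) * y ^ e6" unfolding add_mult_distrib by linarith
          have "c \<le> y" by (simp add: y_def)
          then have "c * (C6 * (nat (?\<mu>9 0) + 2) ^ e6 + 5) \<le> y * ((C6 + 5) * y ^ e6)"
            using A by (rule mult_le_mono)
          also have "\<dots> = (C6 + 5) * y ^ (e6 + 1)" by simp
          finally have "c * (C6 * (nat (?\<mu>9 0) + 2) ^ e6 + 5) \<le> (C6 + 5) * y ^ (e6 + 1)" .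
          then have "c * (C6 * (nat (?\<mu>9 0) + 2) ^ e6 + 5) \<le> (C6 + 5) * y ^ e"
            by (rule bb[OF _ order_refl]) (simp add: e_def)
          then show ?thesis using 10(1) by linarith
        qed
        moreover have "n * d * 6 \<le> 6 * y ^ 1" by (simp add: y_def)
        then have "n * d * 6 \<le> 6 * y ^ e" by (rule bb[OF _ order_refl]) (simp add: e_def)
        moreover have "1 \<le> y ^ e" using one_le_power[OF y1, of e] by linarith
        moreover have "C * y ^ e = C0 * y ^ e + C1 * y ^ e + C2 * y ^ e + C3 * y ^ e + C4 * y ^ e + C5 * y ^ e + C6 * y ^ e + 100 * y ^ e"
          by (simp only: C_def add_mult_distrib)
        moreover have "(C6 + 5) * y ^ e = C6 * y ^ e + 5 * y ^ e" by (simp only: add_mult_distrib)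
        ultimately have "t \<le> C * y ^ e" unfolding t_def by linarith
        then show ?thesis by (simp add: y_def)
      qed
      ultimately show ?case by (intro exI[of _ t] conjI)
    qed
  qed
qed

section \<open>The algorithm as a clipped program\<close>

type_synonym mem = "nat \<Rightarrow> int"

text \<open>Negative indices are clipped to 0, which supplies the nonnegative offset for
  \<open>rcomp_load\<close>.\<close>

definition arr :: "mem \<Rightarrow> int \<Rightarrow> int" where
  "arr \<mu> i = \<mu> (nat (\<mu> 1 + (if 0 < i then i else 0)))"

definition csum :: "mem \<Rightarrow> int \<Rightarrow> (int \<Rightarrow> int) \<Rightarrow> int" where
  "csum \<mu> n f = iter (nat (\<mu> 0)) (\<lambda>i s. if 0 < n - i then s + f i else s) 0"

definition cmin :: "mem \<Rightarrow> int \<Rightarrow> (int \<Rightarrow> int) \<Rightarrow> int" where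
  "cmin \<mu> n f = iter (nat (\<mu> 0)) (\<lambda>i a. if 0 < n - i then if 0 < f a - f i then i else a else a) 0"

definition cmul :: "mem \<Rightarrow> int \<Rightarrow> int \<Rightarrow> int" where
  "cmul \<mu> x y = csum \<mu> y (\<lambda>_. x)"

definition smul :: "mem \<Rightarrow> int \<Rightarrow> int \<Rightarrow> int" where
  "smul \<mu> x y = (if 0 < y then cmul \<mu> x y else 0 - cmul \<mu> x (0 - y))"

text \<open>The start value \<open>s\<close> and the result may exceed register 0 by far; only the
  base, as a count of additions, and the exponent have to stay within it. This makes the huge powers
  compared in the algorithm affordable.\<close>

definition cpow :: "mem \<Rightarrow> int \<Rightarrow> int \<Rightarrow> int \<Rightarrow> int" where
  "cpow \<mu> s x y = iter (nat (\<mu> 0)) (\<lambda>i a. if 0 < y - i then cmul \<mu> a x else a) s"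

text \<open>Counts the positive multiples of \<open>y\<close> up to \<open>x\<close>, so it is the
  quotient as long as that fits into register 0.\<close>

definition cdiv :: "mem \<Rightarrow> int \<Rightarrow> int \<Rightarrow> int" where
  "cdiv \<mu> x y = csum \<mu> (\<mu> 0) (\<lambda>i. if 0 < cmul \<mu> y (i + 1) - x then 0 else 1)"

definition crem :: "mem \<Rightarrow> int \<Rightarrow> int \<Rightarrow> int" where
  "crem \<mu> x y = x - cmul \<mu> y (cdiv \<mu> x y)"

definition cabs :: "int \<Rightarrow> int" where
  "cabs x = (if 0 < x then x else 0 - x)"

text \<open>The number of samples and all exponents of the algorithm are monomials in
  \<open>k * E\<close>, with \<open>k\<close> from the input and \<open>E\<close> from register
  2.\<close>

primrec monom_kE :: "mem \<Rightarrow> int \<Rightarrow> nat \<Rightarrow> int" where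
  "monom_kE \<mu> c 0 = c"
| "monom_kE \<mu> c (Suc i) = cmul \<mu> (cmul \<mu> (monom_kE \<mu> c i) (arr \<mu> 2)) (\<mu> 2)"

lemma rcomp_iter':
  assumes "rcomp p m x" "\<And>m' g h. m \<le> m' \<Longrightarrow> rcomp p m' g \<Longrightarrow> rcomp p m' h \<Longrightarrow> rcomp p m' (\<lambda>\<mu>. F \<mu> (g \<mu>) (h \<mu>))"
  shows "rcomp p m (\<lambda>\<mu>. iter (nat (\<mu> 0)) (\<lambda>i a. F \<mu> i a) (x \<mu>))"
  using rcomp_iter[OF assms] .

lemma rcomp_arr: "rcomp p m i \<Longrightarrow> rcomp p m (\<lambda>\<mu>. arr \<mu> (i \<mu>))"
  unfolding arr_def by (rule rcomp_load) (auto intro!: rcomp_if rcomp_const rcomp_ge2)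

lemma rcomp_csum:
  assumes n: "rcomp p m n" and f: "\<And>m' g. m \<le> m' \<Longrightarrow> rcomp p m' g \<Longrightarrow> rcomp p m' (\<lambda>\<mu>. F \<mu> (g \<mu>))"
  shows "rcomp p m (\<lambda>\<mu>. csum \<mu> (n \<mu>) (\<lambda>i. F \<mu> i))"
  unfolding csum_def
  by (rule rcomp_iter', rule rcomp_const, rule rcomp_ge2[OF n])
    (rule rcomp_if rcomp_sub rcomp_add | assumption | rule rcomp_mono[OF n] | rule f)+

lemma rcomp_cmin:
  assumes n: "rcomp p m n" and f: "\<And>m' g. m \<le> m' \<Longrightarrow> rcomp p m' g \<Longrightarrow> rcomp p m' (\<lambda>\<mu>. F \<mu> (g \<mu>))"
  shows "rcomp p m (\<lambda>\<mu>. cmin \<mu> (n \<mu>) (\<lambda>i. F \<mu> i))"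
  unfolding cmin_def
  by (rule rcomp_iter', rule rcomp_const, rule rcomp_ge2[OF n])
    (rule rcomp_if rcomp_sub rcomp_add | assumption | rule rcomp_mono[OF n] | rule f)+

lemma rcomp_cmul: "rcomp p m x \<Longrightarrow> rcomp p m y \<Longrightarrow> rcomp p m (\<lambda>\<mu>. cmul \<mu> (x \<mu>) (y \<mu>))"
  unfolding cmul_def by (rule rcomp_csum) (assumption | erule rcomp_mono)+

lemma rcomp_zero: "rcomp p m x \<Longrightarrow> rcomp p m (\<lambda>_. 0)" by (rule rcomp_const) (rule rcomp_ge2)
lemma rcomp_beta: "rcomp p m x \<Longrightarrow> rcomp p m (\<lambda>\<mu>. \<mu> 0)" by (rule rcomp_var) (auto dest: rcomp_ge2)

lemma rcomp_smul: "rcomp p m x \<Longrightarrow> rcomp p m y \<Longrightarrow> rcomp p m (\<lambda>\<mu>. smul \<mu> (x \<mu>) (y \<mu>))"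
  unfolding smul_def by (intro rcomp_if rcomp_sub rcomp_cmul rcomp_zero; assumption)

lemma rcomp_cpow: "rcomp p m s \<Longrightarrow> rcomp p m x \<Longrightarrow> rcomp p m y \<Longrightarrow> rcomp p m (\<lambda>\<mu>. cpow \<mu> (s \<mu>) (x \<mu>) (y \<mu>))"
  unfolding cpow_def
  by (rule rcomp_iter') (assumption | rule rcomp_if rcomp_sub rcomp_cmul | erule rcomp_mono, assumption)+

lemma rcomp_cdiv: "rcomp p m x \<Longrightarrow> rcomp p m y \<Longrightarrow> rcomp p m (\<lambda>\<mu>. cdiv \<mu> (x \<mu>) (y \<mu>))"
  unfolding cdiv_def
  by (rule rcomp_csum, erule rcomp_beta)
   (assumption | rule rcomp_if rcomp_sub rcomp_add rcomp_cmul | erule rcomp_mono, assumption | rule rcomp_const, erule rcomp_ge2)+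

lemma rcomp_crem: "rcomp p m x \<Longrightarrow> rcomp p m y \<Longrightarrow> rcomp p m (\<lambda>\<mu>. crem \<mu> (x \<mu>) (y \<mu>))"
  unfolding crem_def by (intro rcomp_sub rcomp_cmul rcomp_cdiv; assumption)

lemma rcomp_cabs: "rcomp p m x \<Longrightarrow> rcomp p m (\<lambda>\<mu>. cabs (x \<mu>))"
  unfolding cabs_def by (intro rcomp_if rcomp_sub rcomp_zero; assumption)

lemma rcomp_monom_kE: "3 \<le> m \<Longrightarrow> rcomp p m (\<lambda>\<mu>. monom_kE \<mu> c i)"
proof (induction i)
  case 0 then show ?case by (simp add: rcomp_const)
next
  case (Suc i)
  then show ?case unfolding monom_kE.simps by (intro rcomp_cmul rcomp_arr rcomp_var rcomp_const) auto
qed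

named_theorems rc
lemmas [rc] = rcomp_arr rcomp_cmul rcomp_smul rcomp_cpow rcomp_cdiv rcomp_crem rcomp_cabs rcomp_monom_kE rcomp_add rcomp_sub rcomp_if

text \<open>A guess \<open>g\<close> is a number in base \<open>W\<close>. Its digit 0 is \<open>D - 1\<close>; the \<open>t\<close>-th of the following blocks of
  \<open>k + 2\<close> digits, starting at position \<open>off t\<close>, holds the index of the \<open>t\<close>-th sampled row, its weight, and
  the entries of that row of \<open>U\<close>, shifted by \<open>X\<close> to make them nonnegative. Rows of \<open>U\<close> and columns of
  \<open>V\<close> are coded by \<open>k\<close> shifted digits in the same way.

  \<open>T D N\<close> is the least integer \<open>y\<close> with \<open>y\<^sup>M D\<^bsup>2a\<^esup> \<ge> X\<^bsup>12M\<^esup> N\<^sup>a\<close>, where \<open>a / M\<close> is \<open>p\<close> rounded down: up to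
  rounding, \<open>X\<^bsup>12\<^esup> (N / D\<^sup>2)\<^sup>p\<close>. The scale \<open>X\<^bsup>12\<^esup>\<close> does not depend on \<open>D\<close>, which makes the costs of
  guesses with different denominators comparable.\<close>

locale algo =
  fixes p :: real and cr :: int and er :: nat and cx :: int and ex :: nat
begin

definition nn where "nn \<mu> = arr \<mu> 0"
definition dd where "dd \<mu> = arr \<mu> 1"
definition kk where "kk \<mu> = arr \<mu> 2"
definition Aent where "Aent \<mu> i j = arr \<mu> (cmul \<mu> (dd \<mu>) i + j + 3)"
definition rr where "rr \<mu> = monom_kE \<mu> cr er"
definition X where "X \<mu> = cpow \<mu> 1 (nn \<mu> + 2) (monom_kE \<mu> cx ex)"
definition W where "W \<mu> = X \<mu> + X \<mu> + 1"
definition lgM where "lgM \<mu> = csum \<mu> (\<mu> 0) (\<lambda>i. if 0 < cpow \<mu> 1 (X \<mu>) 8 - cpow \<mu> 1 2 i then 1 else 0)"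
definition M where "M \<mu> = cpow \<mu> 1 2 (lgM \<mu>)"
definition a where "a \<mu> = iter (nat (\<mu> 0)) (\<lambda>i s. if 0 < lgM \<mu> - i then s + s + binary_digit p (nat (i + 1)) else s) (binary_digit p (nat 0))"
definition T where "T \<mu> D N = (if 0 < N then csum \<mu> (\<mu> 0) (\<lambda>y.
   if 0 < cpow \<mu> (cpow \<mu> 1 (cpow \<mu> 1 (X \<mu>) 12) (M \<mu>)) N (a \<mu>) - cpow \<mu> (cpow \<mu> 1 y (M \<mu>)) D (a \<mu> + a \<mu>) then 1 else 0) else 0)"
definition dig where "dig \<mu> g i = crem \<mu> (cdiv \<mu> g (cpow \<mu> 1 (W \<mu>) i)) (W \<mu>)"
definition off where "off \<mu> t = cmul \<mu> (kk \<mu> + 2) t + 1"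
definition den where "den \<mu> g = dig \<mu> g 0 + 1"
definition resid where "resid \<mu> g s i j = cabs (s - cmul \<mu> (cmul \<mu> (Aent \<mu> i j) (den \<mu> g)) (den \<mu> g))"
definition colcost where "colcost \<mu> g j x = csum \<mu> (rr \<mu>) (\<lambda>t. cmul \<mu> (T \<mu> (den \<mu> g) (resid \<mu> g
   (csum \<mu> (kk \<mu>) (\<lambda>l. smul \<mu> (dig \<mu> g (off \<mu> t + 2 + l) - X \<mu>) (dig \<mu> x l - X \<mu>))) (dig \<mu> g (off \<mu> t)) j))
   (dig \<mu> g (off \<mu> t + 1)))"
definition xs where "xs \<mu> g j = cmin \<mu> (cpow \<mu> 1 (W \<mu>) (kk \<mu>)) (\<lambda>x. colcost \<mu> g j x)"
definition rowcost where "rowcost \<mu> g i u = csum \<mu> (dd \<mu>) (\<lambda>j. T \<mu> (den \<mu> g) (resid \<mu> g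
   (csum \<mu> (kk \<mu>) (\<lambda>l. smul \<mu> (dig \<mu> u l - X \<mu>) (dig \<mu> (xs \<mu> g j) l - X \<mu>))) i j))"
definition us where "us \<mu> g i = cmin \<mu> (cpow \<mu> 1 (W \<mu>) (kk \<mu>)) (\<lambda>u. rowcost \<mu> g i u)"
definition total where "total \<mu> g = csum \<mu> (nn \<mu>) (\<lambda>i. rowcost \<mu> g i (us \<mu> g i))"
definition best where "best \<mu> = cmin \<mu> (cpow \<mu> 1 (W \<mu>) (off \<mu> (rr \<mu>))) (\<lambda>g. total \<mu> g)"
definition count where "count \<mu> = cmul \<mu> (cmul \<mu> (nn \<mu>) (kk \<mu>) + cmul \<mu> (kk \<mu>) (dd \<mu>)) 2"
definition entry where "entry \<mu> m = (if 0 < cmul \<mu> (nn \<mu>) (kk \<mu>) - m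
   then dig \<mu> (us \<mu> (best \<mu>) (cdiv \<mu> m (kk \<mu>))) (crem \<mu> m (kk \<mu>)) - X \<mu>
   else dig \<mu> (xs \<mu> (best \<mu>) (crem \<mu> (m - cmul \<mu> (nn \<mu>) (kk \<mu>)) (dd \<mu>))) (cdiv \<mu> (m - cmul \<mu> (nn \<mu>) (kk \<mu>)) (dd \<mu>)) - X \<mu>)"
definition out where "out \<mu> i = (if 0 < crem \<mu> i 2 then den \<mu> (best \<mu>) else entry \<mu> (cdiv \<mu> i 2))"
text \<open>Each stage is computed under the previous value of register 0: additions alone give
  \<open>k + E\<close>, which permits the products in \<open>monom_kE\<close>; the resulting
  monomial together with \<open>n + 2\<close> permits the power in \<open>bound3\<close>.\<close>

definition bound1 where "bound1 \<mu> = kk \<mu> + \<mu> 2"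
definition bound2 where "bound2 cb eb \<mu> = nn \<mu> + 2 + kk \<mu> + \<mu> 2 + monom_kE \<mu> cb eb"
definition bound3 where "bound3 cb eb \<mu> = cpow \<mu> 1 (nn \<mu> + 2) (monom_kE \<mu> cb eb)"

section \<open>Computability of the quantities of the algorithm\<close>

lemma rcomp_nn [rc]: "3 \<le> m \<Longrightarrow> rcomp p m (\<lambda>\<mu>. nn \<mu>)"
  unfolding nn_def by (assumption | rule rc | rule rcomp_csum rcomp_cmin | (rule rcomp_const rcomp_var rcomp_monom_kE, linarith) | (erule rcomp_mono, linarith) | linarith)+

lemma rcomp_dd [rc]: "3 \<le> m \<Longrightarrow> rcomp p m (\<lambda>\<mu>. dd \<mu>)"
  unfolding dd_def by (assumption | rule rc | rule rcomp_csum rcomp_cmin | (rule rcomp_const rcomp_var rcomp_monom_kE, linarith) | (erule rcomp_mono, linarith) | linarith)+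

lemma rcomp_kk [rc]: "3 \<le> m \<Longrightarrow> rcomp p m (\<lambda>\<mu>. kk \<mu>)"
  unfolding kk_def by (assumption | rule rc | rule rcomp_csum rcomp_cmin | (rule rcomp_const rcomp_var rcomp_monom_kE, linarith) | (erule rcomp_mono, linarith) | linarith)+

lemma rcomp_Aent [rc]: "3 \<le> m \<Longrightarrow> rcomp p m i \<Longrightarrow> rcomp p m j \<Longrightarrow> rcomp p m (\<lambda>\<mu>. Aent \<mu> (i \<mu>) (j \<mu>))"
  unfolding Aent_def by (assumption | rule rc | rule rcomp_csum rcomp_cmin | (rule rcomp_const rcomp_var rcomp_monom_kE, linarith) | (erule rcomp_mono, linarith) | linarith)+

lemma rcomp_rr [rc]: "3 \<le> m \<Longrightarrow> rcomp p m (\<lambda>\<mu>. rr \<mu>)"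
  unfolding rr_def by (assumption | rule rc | rule rcomp_csum rcomp_cmin | (rule rcomp_const rcomp_var rcomp_monom_kE, linarith) | (erule rcomp_mono, linarith) | linarith)+

lemma rcomp_X [rc]: "3 \<le> m \<Longrightarrow> rcomp p m (\<lambda>\<mu>. X \<mu>)"
  unfolding X_def by (assumption | rule rc | rule rcomp_csum rcomp_cmin | (rule rcomp_const rcomp_var rcomp_monom_kE, linarith) | (erule rcomp_mono, linarith) | linarith)+

lemma rcomp_W [rc]: "3 \<le> m \<Longrightarrow> rcomp p m (\<lambda>\<mu>. W \<mu>)"
  unfolding W_def by (assumption | rule rc | rule rcomp_csum rcomp_cmin | (rule rcomp_const rcomp_var rcomp_monom_kE, linarith) | (erule rcomp_mono, linarith) | linarith)+

lemma rcomp_lgM [rc]: "3 \<le> m \<Longrightarrow> rcomp p m (\<lambda>\<mu>. lgM \<mu>)"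
  unfolding lgM_def by (assumption | rule rc | rule rcomp_csum rcomp_cmin | (rule rcomp_const rcomp_var rcomp_monom_kE, linarith) | (erule rcomp_mono, linarith) | linarith)+

lemma rcomp_M [rc]: "3 \<le> m \<Longrightarrow> rcomp p m (\<lambda>\<mu>. M \<mu>)"
  unfolding M_def by (assumption | rule rc | rule rcomp_csum rcomp_cmin | (rule rcomp_const rcomp_var rcomp_monom_kE, linarith) | (erule rcomp_mono, linarith) | linarith)+

lemma rcomp_a [rc]: "3 \<le> m \<Longrightarrow> rcomp p m (\<lambda>\<mu>. a \<mu>)"
  unfolding a_def by (assumption | rule rc rcomp_iter' rcomp_digit | rule rcomp_csum rcomp_cmin | (rule rcomp_const rcomp_var rcomp_monom_kE, linarith) | (erule rcomp_mono, linarith) | linarith)+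

lemma rcomp_T [rc]: "3 \<le> m \<Longrightarrow> rcomp p m D \<Longrightarrow> rcomp p m N \<Longrightarrow> rcomp p m (\<lambda>\<mu>. T \<mu> (D \<mu>) (N \<mu>))"
  unfolding T_def by (assumption | rule rc | rule rcomp_csum rcomp_cmin | (rule rcomp_const rcomp_var rcomp_monom_kE, linarith) | (erule rcomp_mono, linarith) | linarith)+

lemma rcomp_dig [rc]: "3 \<le> m \<Longrightarrow> rcomp p m g \<Longrightarrow> rcomp p m i \<Longrightarrow> rcomp p m (\<lambda>\<mu>. dig \<mu> (g \<mu>) (i \<mu>))"
  unfolding dig_def by (assumption | rule rc | rule rcomp_csum rcomp_cmin | (rule rcomp_const rcomp_var rcomp_monom_kE, linarith) | (erule rcomp_mono, linarith) | linarith)+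

lemma rcomp_off [rc]: "3 \<le> m \<Longrightarrow> rcomp p m t \<Longrightarrow> rcomp p m (\<lambda>\<mu>. off \<mu> (t \<mu>))"
  unfolding off_def by (assumption | rule rc | rule rcomp_csum rcomp_cmin | (rule rcomp_const rcomp_var rcomp_monom_kE, linarith) | (erule rcomp_mono, linarith) | linarith)+

lemma rcomp_den [rc]: "3 \<le> m \<Longrightarrow> rcomp p m g \<Longrightarrow> rcomp p m (\<lambda>\<mu>. den \<mu> (g \<mu>))"
  unfolding den_def by (assumption | rule rc | rule rcomp_csum rcomp_cmin | (rule rcomp_const rcomp_var rcomp_monom_kE, linarith) | (erule rcomp_mono, linarith) | linarith)+

lemma rcomp_resid [rc]: "3 \<le> m \<Longrightarrow> rcomp p m g \<Longrightarrow> rcomp p m s \<Longrightarrow> rcomp p m i \<Longrightarrow> rcomp p m j \<Longrightarrow> rcomp p m (\<lambda>\<mu>. resid \<mu> (g \<mu>) (s \<mu>) (i \<mu>) (j \<mu>))"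
  unfolding resid_def by (assumption | rule rc | rule rcomp_csum rcomp_cmin | (rule rcomp_const rcomp_var rcomp_monom_kE, linarith) | (erule rcomp_mono, linarith) | linarith)+

lemma rcomp_colcost [rc]: "3 \<le> m \<Longrightarrow> rcomp p m g \<Longrightarrow> rcomp p m j \<Longrightarrow> rcomp p m x \<Longrightarrow> rcomp p m (\<lambda>\<mu>. colcost \<mu> (g \<mu>) (j \<mu>) (x \<mu>))"
  unfolding colcost_def by (assumption | rule rc | rule rcomp_csum rcomp_cmin | (rule rcomp_const rcomp_var rcomp_monom_kE, linarith) | (erule rcomp_mono, linarith) | linarith)+

lemma rcomp_xs [rc]: "3 \<le> m \<Longrightarrow> rcomp p m g \<Longrightarrow> rcomp p m j \<Longrightarrow> rcomp p m (\<lambda>\<mu>. xs \<mu> (g \<mu>) (j \<mu>))"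
  unfolding xs_def by (assumption | rule rc | rule rcomp_csum rcomp_cmin | (rule rcomp_const rcomp_var rcomp_monom_kE, linarith) | (erule rcomp_mono, linarith) | linarith)+

lemma rcomp_rowcost [rc]: "3 \<le> m \<Longrightarrow> rcomp p m g \<Longrightarrow> rcomp p m i \<Longrightarrow> rcomp p m u \<Longrightarrow> rcomp p m (\<lambda>\<mu>. rowcost \<mu> (g \<mu>) (i \<mu>) (u \<mu>))"
  unfolding rowcost_def by (assumption | rule rc | rule rcomp_csum rcomp_cmin | (rule rcomp_const rcomp_var rcomp_monom_kE, linarith) | (erule rcomp_mono, linarith) | linarith)+

lemma rcomp_us [rc]: "3 \<le> m \<Longrightarrow> rcomp p m g \<Longrightarrow> rcomp p m i \<Longrightarrow> rcomp p m (\<lambda>\<mu>. us \<mu> (g \<mu>) (i \<mu>))"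
  unfolding us_def by (assumption | rule rc | rule rcomp_csum rcomp_cmin | (rule rcomp_const rcomp_var rcomp_monom_kE, linarith) | (erule rcomp_mono, linarith) | linarith)+

lemma rcomp_total [rc]: "3 \<le> m \<Longrightarrow> rcomp p m g \<Longrightarrow> rcomp p m (\<lambda>\<mu>. total \<mu> (g \<mu>))"
  unfolding total_def by (assumption | rule rc | rule rcomp_csum rcomp_cmin | (rule rcomp_const rcomp_var rcomp_monom_kE, linarith) | (erule rcomp_mono, linarith) | linarith)+

lemma rcomp_best [rc]: "3 \<le> m \<Longrightarrow> rcomp p m (\<lambda>\<mu>. best \<mu>)"
  unfolding best_def by (assumption | rule rc | rule rcomp_csum rcomp_cmin | (rule rcomp_const rcomp_var rcomp_monom_kE, linarith) | (erule rcomp_mono, linarith) | linarith)+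

lemma rcomp_count [rc]: "3 \<le> m \<Longrightarrow> rcomp p m (\<lambda>\<mu>. count \<mu>)"
  unfolding count_def by (assumption | rule rc | rule rcomp_csum rcomp_cmin | (rule rcomp_const rcomp_var rcomp_monom_kE, linarith) | (erule rcomp_mono, linarith) | linarith)+

lemma rcomp_entry [rc]: "3 \<le> m \<Longrightarrow> rcomp p m i \<Longrightarrow> rcomp p m (\<lambda>\<mu>. entry \<mu> (i \<mu>))"
  unfolding entry_def by (assumption | rule rc | rule rcomp_csum rcomp_cmin | (rule rcomp_const rcomp_var rcomp_monom_kE, linarith) | (erule rcomp_mono, linarith) | linarith)+

lemma rcomp_out [rc]: "3 \<le> m \<Longrightarrow> rcomp p m i \<Longrightarrow> rcomp p m (\<lambda>\<mu>. out \<mu> (i \<mu>))"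
  unfolding out_def by (assumption | rule rc | rule rcomp_csum rcomp_cmin | (rule rcomp_const rcomp_var rcomp_monom_kE, linarith) | (erule rcomp_mono, linarith) | linarith)+

lemma rcomp_bound1 [rc]: "3 \<le> m \<Longrightarrow> rcomp p m (\<lambda>\<mu>. bound1 \<mu>)"
  unfolding bound1_def by (assumption | rule rc | rule rcomp_csum rcomp_cmin | (rule rcomp_const rcomp_var rcomp_monom_kE, linarith) | (erule rcomp_mono, linarith) | linarith)+

lemma rcomp_bound2 [rc]: "3 \<le> m \<Longrightarrow> rcomp p m (\<lambda>\<mu>. bound2 cb eb \<mu>)"
  unfolding bound2_def by (assumption | rule rc | rule rcomp_csum rcomp_cmin | (rule rcomp_const rcomp_var rcomp_monom_kE, linarith) | (erule rcomp_mono, linarith) | linarith)+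

lemma rcomp_bound3 [rc]: "3 \<le> m \<Longrightarrow> rcomp p m (\<lambda>\<mu>. bound3 cb eb \<mu>)"
  unfolding bound3_def by (assumption | rule rc | rule rcomp_csum rcomp_cmin | (rule rcomp_const rcomp_var rcomp_monom_kE, linarith) | (erule rcomp_mono, linarith) | linarith)+

end

section \<open>Accuracy of the integer powers and values of the clipped operations\<close>

lemma sum_if_less: "m \<le> b \<Longrightarrow> (\<And>i. i < b \<Longrightarrow> P i \<longleftrightarrow> i < m) \<Longrightarrow> (\<Sum>i<b. if P i then 1 else 0 :: int) = int m"
proof -
  assume m: "m \<le> b" and P: "\<And>i. i < b \<Longrightarrow> P i \<longleftrightarrow> i < m"
  have "(\<Sum>i<b. if P i then 1 else 0 :: int) = (\<Sum>i<b. if i < m then 1 else 0)" using P by (intro sum.cong) auto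
  also have "\<dots> = (\<Sum>i\<in>{i \<in> {..<b}. i < m}. 1)" by (rule sum.inter_filter[symmetric]) simp
  also have "{i \<in> {..<b}. i < m} = {..<m}" using m by auto
  finally show ?thesis by simp
qed

text \<open>Since \<open>ln Y \<le> Y - 1\<close>, the exponent \<open>h * ln Y\<close> is at most
  \<open>(Y - 1) / Y\<^sup>2\<close>. This is the effect of rounding \<open>p\<close> on a ratio
  between \<open>1 / Y\<close> and \<open>Y\<close>.\<close>

lemma powr_near_one:
  fixes q h Y :: real
  assumes Y: "1 \<le> Y" and q: "1 / Y \<le> q" "q \<le> Y" and h: "0 \<le> h" "h \<le> 1 / Y\<^sup>2"
  shows "1 - 1 / Y \<le> q powr (- h)" "q powr (- h) \<le> 1 + 1 / Y"
proof -
  have q0: "0 < q" using q(1) Y by (auto intro: less_le_trans[of 0 "1 / Y"])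
  have h1: "h \<le> 1"
  proof -
    have "1 / Y\<^sup>2 \<le> 1" using Y by (simp add: one_le_power)
    then show ?thesis using h by linarith
  qed
  have b: "x powr h \<le> 1 + 1 / Y" if "0 < x" "x \<le> Y" for x
  proof -
    define u where "u = 1 / Y\<^sup>2 * (Y - 1)"
    have u: "0 \<le> u" "u = 1 / Y - 1 / Y\<^sup>2" 
    proof -
      show "0 \<le> u" unfolding u_def using Y by (intro mult_nonneg_nonneg) auto
      show "u = 1 / Y - 1 / Y\<^sup>2" using Y by (simp add: u_def right_diff_distrib power2_eq_square)
    qed
    have Yi: "1 / Y \<le> 1" "0 \<le> 1 / Y\<^sup>2" using Y by auto
    have "x powr h \<le> Y powr h" using that h by (intro powr_mono2) auto
    also have "Y powr h = exp (h * ln Y)" using Y by (simp add: powr_def)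
    also have "\<dots> \<le> exp u"
    proof -
      have "h * ln Y \<le> 1 / Y\<^sup>2 * (Y - 1)" using h Y ln_le_minus_one[of Y] by (intro mult_mono) auto
      then show ?thesis by (simp add: u_def)
    qed
    also have "\<dots> \<le> 1 + u + u\<^sup>2" using u Yi by (intro exp_bound) linarith+
    also have "u\<^sup>2 \<le> (1 / Y)\<^sup>2" using u Yi by (intro power_mono) linarith+
    also have "1 + u + (1 / Y)\<^sup>2 \<le> 1 + 1 / Y" using u by (simp add: power_divide)
    finally show ?thesis by simp
  qed
  have "q powr (- h) = (1 / q) powr h" using q0 by (simp add: powr_minus powr_divide inverse_eq_divide)
  also have "\<dots> \<le> 1 + 1 / Y" using q q0 Y by (intro b) (simp_all add: divide_le_eq mult.commute)
  finally show "q powr (- h) \<le> 1 + 1 / Y" .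
  have "1 - 1 / Y \<le> 1 / (1 + 1 / Y)"
  proof -
    have "(1 - 1 / Y) * (1 + 1 / Y) = 1 - (1 / Y)\<^sup>2" by (simp add: algebra_simps power2_eq_square)
    then have "(1 - 1 / Y) * (1 + 1 / Y) \<le> 1" by simp
    then show ?thesis using Y by (simp add: pos_le_divide_eq add_pos_nonneg)
  qed
  also have "\<dots> \<le> 1 / q powr h" using b[OF q0 q(2)] q0 Y by (intro divide_left_mono) (auto intro!: mult_pos_pos add_pos_nonneg)
  also have "\<dots> = q powr (- h)" by (simp add: powr_minus inverse_eq_divide)
  finally show "1 - 1 / Y \<le> q powr (- h)" .
qed

text \<open>The condition on \<open>y\<close> amounts to \<open>y < R\<close> for
  \<open>R = Y ^ 3 * q powr \<alpha>\<close>, so \<open>t\<close> is \<open>R\<close> rounded up. As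
  \<open>\<alpha> \<le> 2\<close>, the cube guarantees \<open>Y \<le> R\<close> even for the
  smallest ratio \<open>1 / Y\<close>, so that rounding up is a relative error of order
  \<open>1 / Y\<close>; on the other side \<open>R \<le> Y ^ 5\<close> stays inside the range of
  summation. Rounding the exponent costs another \<open>1 / Y\<close>.\<close>

lemma table_accuracy:
  fixes p :: real and Y M D N a b :: nat
  assumes p: "0 < p" "p < 2" and Y: "1 \<le> Y" and M: "Y\<^sup>2 \<le> M" and a: "int a = \<lfloor>p * real M\<rfloor>"
    and D: "1 \<le> D" "D\<^sup>2 \<le> Y" and N: "1 \<le> N" "N \<le> Y" and b: "Y ^ 5 < b"
  defines "t \<equiv> (\<Sum>y<b. if y ^ M * D ^ (2 * a) < (Y ^ 3) ^ M * N ^ a then 1 else 0 :: int)"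
  defines "v \<equiv> real Y ^ 3 * (real N / real (D\<^sup>2)) powr p"
  shows "(1 - 4 / real Y) * v \<le> of_int t" "of_int t \<le> (1 + 4 / real Y) * v"
proof -
  define \<alpha> where "\<alpha> = real a / real M"
  have Y1: "1 \<le> real Y" using Y by simp
  have M0: "0 < M" using M Y by (metis le_zero_eq neq0_conv not_one_le_zero power_eq_0_iff)
  define D' where "D' = real (D\<^sup>2)"
  have D0: "1 \<le> D'" "D' \<le> real Y" "0 < D'" using D by (auto simp: D'_def simp del: of_nat_power)
  define q where "q = real N / D'"
  have q: "1 / real Y \<le> q" "q \<le> real Y"
  proof -
    have "1 / real Y \<le> 1 / D'" using D0 Y1 by (intro divide_left_mono mult_pos_pos) linarith+
    also have "\<dots> \<le> q" unfolding q_def using N D0 by (intro divide_right_mono) auto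
    finally show "1 / real Y \<le> q" .
    have "q \<le> real N / 1" unfolding q_def using D0 by (intro divide_left_mono mult_pos_pos) linarith+
    then show "q \<le> real Y" using N by simp
  qed
  have q0: "0 < q" using q(1) Y1 by (auto intro: less_le_trans[of 0 "1 / real Y"])
  have a1: "real a \<le> p * real M" "p * real M < real a + 1" using a by linarith+
  have \<alpha>: "\<alpha> \<le> p" "p - \<alpha> \<le> 1 / real M" "0 \<le> \<alpha>"
  proof -
    have M0': "0 < real M" using M0 by simp
    have e: "p = p * real M / real M" using M0' by simp
    show "0 \<le> \<alpha>" by (simp add: \<alpha>_def)
    show "\<alpha> \<le> p" unfolding \<alpha>_def using a1 M0' by (simp add: divide_le_eq)
    have "p \<le> (real a + 1) / real M" using a1 M0' by (simp add: pos_le_divide_eq)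
    then show "p - \<alpha> \<le> 1 / real M" by (simp add: \<alpha>_def add_divide_distrib)
  qed
  define R where "R = real Y ^ 3 * q powr \<alpha>"
  have R0: "0 < R" unfolding R_def using Y1 q0 by simp
  have Rup: "R \<le> real Y ^ 5"
  proof -
    have "q powr \<alpha> \<le> real Y powr \<alpha>" using q q0 \<alpha> by (intro powr_mono2) auto
    also have "\<dots> \<le> real Y powr 2" using Y1 \<alpha> p by (intro powr_mono) auto
    finally have "q powr \<alpha> \<le> real Y ^ 2" using Y1 by simp
    then have "R \<le> real Y ^ 3 * real Y ^ 2" unfolding R_def by (intro mult_left_mono) auto
    then show ?thesis by (simp flip: power_add)
  qed
  have Rlo: "real Y \<le> R"
  proof -
    have "(1 / real Y) powr 2 \<le> (1 / real Y) powr \<alpha>" using Y1 \<alpha> p by (intro powr_mono') auto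
    also have "\<dots> \<le> q powr \<alpha>" using q q0 Y1 \<alpha> by (intro powr_mono2) auto
    finally have "(1 / real Y) ^ 2 \<le> q powr \<alpha>" using Y1 by simp
    then have "real Y ^ 3 * (1 / real Y) ^ 2 \<le> R" unfolding R_def by (intro mult_left_mono) auto
    moreover have "real Y ^ 3 * (1 / real Y) ^ 2 = real Y" using Y1 by (simp add: power_divide power3_eq_cube power2_eq_square)
    ultimately show ?thesis by simp
  qed
  have RM: "R ^ M = (real Y ^ 3) ^ M * q ^ a"
  proof -
    have "(q powr \<alpha>) ^ M = q powr (\<alpha> * real M)" using q0 by (simp add: powr_realpow[symmetric] powr_powr)
    also have "\<dots> = q ^ a" using M0 q0 by (simp add: \<alpha>_def powr_realpow)
    finally show ?thesis by (simp add: R_def power_mult_distrib)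
  qed
  have iff: "y ^ M * D ^ (2 * a) < (Y ^ 3) ^ M * N ^ a \<longleftrightarrow> y < nat \<lceil>R\<rceil>" for y
  proof -
    have "y ^ M * D ^ (2 * a) < (Y ^ 3) ^ M * N ^ a \<longleftrightarrow> real (y ^ M * D ^ (2 * a)) < real ((Y ^ 3) ^ M * N ^ a)"
      by (simp only: of_nat_less_iff)
    also have "\<dots> \<longleftrightarrow> real y ^ M * D' ^ a < (real Y ^ 3) ^ M * real N ^ a" by (simp add: power_mult D'_def)
    also have "\<dots> \<longleftrightarrow> real y ^ M < (real Y ^ 3) ^ M * real N ^ a / D' ^ a"
      by (rule pos_less_divide_eq[symmetric]) (use D0 in simp)
    also have "(real Y ^ 3) ^ M * real N ^ a / D' ^ a = R ^ M" by (simp only: RM q_def power_divide times_divide_eq_right)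
    also have "real y ^ M < R ^ M \<longleftrightarrow> real y < R"
      using R0 M0 power_strict_mono[of "real y" R M] power_mono[of R "real y" M] by (auto simp: not_less[symmetric])
    also have "real y < R \<longleftrightarrow> y < nat \<lceil>R\<rceil>" by linarith
    finally show ?thesis .
  qed
  have t: "t = \<lceil>R\<rceil>"
  proof -
    have "real (Y ^ 5) < real b" using b by (simp only: of_nat_less_iff)
    then have "R \<le> real b" using Rup unfolding of_nat_power by linarith
    then have "nat \<lceil>R\<rceil> \<le> b" by (simp add: ceiling_le_iff nat_le_iff)
    then have "t = int (nat \<lceil>R\<rceil>)" unfolding t_def by (rule sum_if_less) (rule iff)
    then show ?thesis using R0 by simp
  qed
  have v: "v = real Y ^ 3 * q powr p" by (simp add: v_def q_def D'_def)
  have Rv: "R = v * q powr (- (p - \<alpha>))"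
    unfolding v R_def mult.assoc using q0 by (simp flip: powr_add)
  have h: "0 \<le> p - \<alpha>" "p - \<alpha> \<le> 1 / (real Y)\<^sup>2"
  proof -
    have "real (Y\<^sup>2) \<le> real M" using M by (simp only: of_nat_le_iff)
    then have "1 / real M \<le> 1 / (real Y)\<^sup>2" using Y1 M0 by (intro divide_left_mono mult_pos_pos) auto
    then show "0 \<le> p - \<alpha>" "p - \<alpha> \<le> 1 / (real Y)\<^sup>2" using \<alpha> by linarith+
  qed
  note near = powr_near_one[OF Y1 q h]
  have v0: "0 \<le> v" by (simp add: v_def)
  define w where "w = v / real Y"
  have w0: "0 \<le> w" "w \<le> v" using v0 Y1 divide_left_mono[of 1 "real Y" v] by (auto simp: w_def)
  have e: "(1 - 4 / real Y) * v = v - 4 * w" "(1 + 4 / real Y) * v = v + 4 * w" by (auto simp: w_def algebra_simps)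
  have R1: "v - w \<le> R"
  proof -
    have "v * (1 - 1 / real Y) \<le> R" unfolding Rv using near(1) v0 by (intro mult_left_mono)
    then show ?thesis by (simp add: w_def algebra_simps)
  qed
  have R2: "R \<le> v + w"
  proof -
    have "R \<le> v * (1 + 1 / real Y)" unfolding Rv using near(2) v0 by (intro mult_left_mono)
    then show ?thesis by (simp add: w_def algebra_simps)
  qed
  have one: "1 \<le> 2 * w"
  proof -
    have "real Y \<le> 2 * v" using Rlo R2 w0 by linarith
    then show ?thesis using Y1 by (simp add: w_def pos_le_divide_eq)
  qed
  show "(1 - 4 / real Y) * v \<le> of_int t" unfolding e t using R1 w0 by linarith
  show "of_int t \<le> (1 + 4 / real Y) * v" unfolding e t using R2 one w0 by linarith
qed

lemma csum_eq:
  assumes "0 \<le> n" "n \<le> \<mu> 0"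
  shows "csum \<mu> n f = (\<Sum>i<nat n. f (int i))"
proof -
  have "iter b (\<lambda>i s. if 0 < n - i then s + f i else s) 0 = (\<Sum>i<min b (nat n). f (int i))" for b
  proof (induction b)
    case (Suc b)
    show ?case
    proof (cases "int b < n")
      case True
      then have "min (Suc b) (nat n) = Suc b" "min b (nat n) = b" by auto
      then show ?thesis using Suc True by simp
    next
      case False
      then have "min (Suc b) (nat n) = nat n" "min b (nat n) = nat n" by auto
      then show ?thesis using Suc False by simp
    qed
  qed simp
  moreover have "min (nat (\<mu> 0)) (nat n) = nat n" using assms by simp
  ultimately show ?thesis by (simp add: csum_def)
qed

lemma cmin_spec:
  assumes "0 < n" "n \<le> \<mu> 0"
  shows "0 \<le> cmin \<mu> n f" "cmin \<mu> n f < n" "\<And>j. 0 \<le> j \<Longrightarrow> j < n \<Longrightarrow> f (cmin \<mu> n f) \<le> f j"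
proof -
  define F where "F = (\<lambda>i a. if 0 < n - i then if 0 < f a - f i then i else a else a)"
  have *: "0 \<le> iter b F 0 \<and> iter b F 0 < n \<and> (\<forall>j. 0 \<le> j \<and> j < n \<and> j < int b \<longrightarrow> f (iter b F 0) \<le> f j)" for b
  proof (induction b)
    case 0 then show ?case using assms by simp
  next
    case (Suc b)
    define a where "a = iter b F 0"
    have a: "0 \<le> a" "a < n" "\<And>j. 0 \<le> j \<Longrightarrow> j < n \<Longrightarrow> j < int b \<Longrightarrow> f a \<le> f j" using Suc by (auto simp: a_def)
    have s: "iter (Suc b) F 0 = F (int b) a" by (simp add: a_def)
    show ?case unfolding s
    proof (intro conjI allI impI)
      show "0 \<le> F (int b) a" "F (int b) a < n" using a by (auto simp: F_def)
      fix j assume j: "0 \<le> j \<and> j < n \<and> j < int (Suc b)"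
      have "f (F (int b) a) \<le> f a" by (auto simp: F_def)
      moreover have "f (F (int b) a) \<le> f (int b)" if "int b < n" using that by (auto simp: F_def)
      moreover have "j < int b \<or> (j = int b \<and> int b < n)" using j by auto
      ultimately show "f (F (int b) a) \<le> f j" using a(3)[of j] j by (elim disjE conjE) (force, simp)
    qed
  qed
  have c: "cmin \<mu> n f = iter (nat (\<mu> 0)) F 0" by (simp add: cmin_def F_def)
  show "0 \<le> cmin \<mu> n f" "cmin \<mu> n f < n" unfolding c using *[of "nat (\<mu> 0)"] by simp_all
  show "f (cmin \<mu> n f) \<le> f j" if "0 \<le> j" "j < n" for j
    unfolding c using *[of "nat (\<mu> 0)"] that assms by auto
qed

lemma cmul_eq: "0 \<le> y \<Longrightarrow> y \<le> \<mu> 0 \<Longrightarrow> cmul \<mu> x y = x * y"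
  by (simp add: cmul_def csum_eq)

lemma smul_eq: "\<bar>y\<bar> \<le> \<mu> 0 \<Longrightarrow> smul \<mu> x y = x * y"
  unfolding smul_def by (auto simp: cmul_eq)

lemma cabs_eq: "cabs x = \<bar>x\<bar>" by (simp add: cabs_def)

lemma cpow_eq:
  assumes "0 \<le> x" "x \<le> \<mu> 0" "0 \<le> y" "y \<le> \<mu> 0"
  shows "cpow \<mu> s x y = s * x ^ nat y"
proof -
  have "iter b (\<lambda>i a. if 0 < y - i then cmul \<mu> a x else a) s = s * x ^ min b (nat y)" for b
  proof (induction b)
    case (Suc b)
    show ?case
    proof (cases "int b < y")
      case True
      then have "min (Suc b) (nat y) = Suc b" "min b (nat y) = b" by auto
      then show ?thesis using Suc True assms by (simp add: cmul_eq)
    next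
      case False
      then have "min (Suc b) (nat y) = nat y" "min b (nat y) = nat y" by auto
      then show ?thesis using Suc False by simp
    qed
  qed simp
  moreover have "min (nat (\<mu> 0)) (nat y) = nat y" using assms by simp
  ultimately show ?thesis by (simp add: cpow_def)
qed

lemma cdiv_eq:
  assumes "0 \<le> x" "0 < y" "x div y \<le> \<mu> 0"
  shows "cdiv \<mu> x y = x div y"
proof -
  have d: "0 \<le> x div y" using assms by (simp add: pos_imp_zdiv_nonneg_iff)
  have c: "cmul \<mu> y (int i + 1) = y * (int i + 1)" if "i < nat (\<mu> 0)" for i using that by (simp add: cmul_eq)
  have "cdiv \<mu> x y = (\<Sum>i<nat (\<mu> 0). if 0 < cmul \<mu> y (int i + 1) - x then 0 else 1)"
    unfolding cdiv_def using assms d by (subst csum_eq) auto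
  also have "\<dots> = (\<Sum>i<nat (\<mu> 0). if \<not> 0 < cmul \<mu> y (int i + 1) - x then 1 else 0)" by (intro sum.cong) auto
  also have "\<dots> = int (nat (x div y))"
  proof (rule sum_if_less)
    show "nat (x div y) \<le> nat (\<mu> 0)" using assms by linarith
    fix i assume i: "i < nat (\<mu> 0)"
    have "(int i + 1) \<le> x div y \<longleftrightarrow> (int i + 1) * y \<le> x" 
    proof -
      have x: "x = x div y * y + x mod y" "0 \<le> x mod y" "x mod y < y" using assms(2) by auto
      show ?thesis
      proof
        assume "int i + 1 \<le> x div y"
        then have "(int i + 1) * y \<le> x div y * y" using assms(2) by (intro mult_right_mono) auto
        then show "(int i + 1) * y \<le> x" using x by linarith
      next
        assume le: "(int i + 1) * y \<le> x"
        show "int i + 1 \<le> x div y"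
        proof (rule ccontr)
          assume "\<not> ?thesis"
          then have "(x div y + 1) * y \<le> (int i + 1) * y" using assms(2) by (intro mult_right_mono) auto
          then show False using x le distrib_right[of "x div y" 1 y] by linarith
        qed
      qed
    qed
    then show "(\<not> 0 < cmul \<mu> y (int i + 1) - x) = (i < nat (x div y))" unfolding c[OF i] by (auto simp: mult.commute)
  qed
  finally show ?thesis using d by simp
qed

lemma crem_eq: "0 \<le> x \<Longrightarrow> 0 < y \<Longrightarrow> x div y \<le> \<mu> 0 \<Longrightarrow> crem \<mu> x y = x mod y"
  by (simp add: crem_def cdiv_eq cmul_eq pos_imp_zdiv_nonneg_iff minus_mult_div_eq_mod)

lemma monom_kE_eq:
  "0 \<le> arr \<mu> 2 \<Longrightarrow> arr \<mu> 2 \<le> \<mu> 0 \<Longrightarrow> 0 \<le> \<mu> 2 \<Longrightarrow> \<mu> 2 \<le> \<mu> 0 \<Longrightarrow> monom_kE \<mu> c i = c * (arr \<mu> 2 * \<mu> 2) ^ i"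
  by (induction i) (simp_all add: cmul_eq ac_simps)

text \<open>Horner's scheme. Because of \<open>p < 2\<close> the integer part is a single binary
  digit, so position 0 is a complete start value.\<close>

lemma binary_expansion:
  assumes "0 \<le> p" "p < 2"
  shows "iter b (\<lambda>i s. if 0 < int m - i then s + s + binary_digit p (nat (i + 1)) else s) (binary_digit p (nat 0)) = \<lfloor>p * 2 ^ min b m\<rfloor>"
proof (induction b)
  case 0
  have "0 \<le> \<lfloor>p\<rfloor>" "\<lfloor>p\<rfloor> < 2" using assms by (auto simp: floor_less_iff)
  then show ?case by (simp add: binary_digit_def)
next
  case (Suc b)
  show ?case
  proof (cases "b < m")
    case True
    then have m: "min (Suc b) m = Suc b" "min b m = b" by auto
    define x where "x = p * 2 ^ b"
    have "\<lfloor>2 * x\<rfloor> = \<lfloor>x\<rfloor> + \<lfloor>x\<rfloor> + \<lfloor>2 * x\<rfloor> mod 2"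
    proof -
      have "\<lfloor>2 * x\<rfloor> = 2 * \<lfloor>x\<rfloor> \<or> \<lfloor>2 * x\<rfloor> = 2 * \<lfloor>x\<rfloor> + 1" by linarith
      then show ?thesis by auto
    qed
    moreover have "binary_digit p (nat (int b + 1)) = \<lfloor>2 * x\<rfloor> mod 2"
      by (simp add: binary_digit_def x_def nat_add_distrib mult.left_commute)
    ultimately show ?thesis using True Suc m by (simp add: x_def mult.left_commute)
  next
    case False
    then have "min (Suc b) m = m" "min b m = m" by auto
    then show ?thesis using Suc False by simp
  qed
qed

lemma digits_exist:
  fixes W :: nat
  assumes "\<And>i. i < L \<Longrightarrow> f i < W"
  shows "\<exists>g < W ^ L. \<forall>i<L. g div W ^ i mod W = f i"
  using assms
proof (induction L)
  case (Suc L)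
  then obtain g where g: "g < W ^ L" "\<forall>i<L. g div W ^ i mod W = f i" by auto
  have W: "0 < W" "f L < W" using Suc(2)[of L] by auto
  define h where "h = g + f L * W ^ L"
  have "h < W ^ Suc L"
  proof -
    have "h < W ^ L + f L * W ^ L" using g by (simp add: h_def)
    also have "\<dots> = (f L + 1) * W ^ L" by simp
    also have "\<dots> \<le> W * W ^ L" using W by (intro mult_right_mono) auto
    finally show ?thesis by simp
  qed
  moreover have "h div W ^ i mod W = f i" if "i < Suc L" for i
  proof (cases "i < L")
    case True
    then have e: "W ^ L = W ^ i * (W * W ^ (L - Suc i))" by (simp flip: power_Suc power_add)
    have "h div W ^ i = g div W ^ i + f L * (W * W ^ (L - Suc i))"
      unfolding h_def e using W by (simp add: mult.left_commute[of "f L"] div_mult_self2 mult.assoc)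
    also have "\<dots> mod W = g div W ^ i mod W" by (simp add: mult.left_commute[of "f L"])
    finally show ?thesis using g True by simp
  next
    case False
    then have "i = L" using that by simp
    then show ?thesis using g W by (simp add: h_def)
  qed
  ultimately show ?case by blast
qed simp

section \<open>Correctness of the algorithm\<close>

text \<open>A memory in which register 0 is large enough for every loop: \<open>x21\<close> covers
  the arithmetic, including the range beyond \<open>Y ^ 5 = x ^ 20\<close> in \<open>T\<close>, and
  \<open>Wb\<close> covers the enumeration of all guesses. Under these bounds the clipped operations
  take their intended values.\<close>

locale run = algo p "int cr" er "int cx" ex for p :: real and cr er cx ex :: nat +
  fixes \<mu> :: mem and n d k E c0 b :: nat and A :: "nat \<Rightarrow> nat \<Rightarrow> int" and R x :: nat
  assumes p: "0 < p" "p < 2" and n: "1 \<le> n" and d: "1 \<le> d" and k: "1 \<le> k"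
    and dims: "arr \<mu> 0 = int n" "arr \<mu> 1 = int d" "arr \<mu> 2 = int k" "\<mu> 2 = int E"
    and entries: "\<And>i j. i < n \<Longrightarrow> j < d \<Longrightarrow> arr \<mu> (int d * int i + int j + 3) = A i j"
    and A: "\<And>i j. i < n \<Longrightarrow> j < d \<Longrightarrow> \<bar>A i j\<bar> \<le> int ((n + 2) ^ c0)"
    and R: "R = cr * (k * E) ^ er" and R1: "1 \<le> R" and x: "x = (n + 2) ^ (cx * (k * E) ^ ex)"
    and b: "\<mu> 0 = int b" and x21: "x ^ 21 < b" and Wb: "(2 * x + 1) ^ (1 + R * (k + 2)) \<le> b"
    and nx: "n + 2 \<le> x" "d \<le> x" "k \<le> x" "E \<le> x" "16 \<le> x" "10 * (n + 2) ^ c0 \<le> x"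
begin

definition w where "w = 2 * x + 1"
definition Y where "Y = x ^ 4"

lemma x_le: "i \<le> 21 \<Longrightarrow> x ^ i \<le> b"
  using power_increasing[of i 21 x] nx(5) x21 by linarith

lemma xb: "x \<le> b" "2 * x + 1 \<le> b"
proof -
  have "16 * x \<le> x * x" using nx(5) by (intro mult_le_mono1)
  moreover have "x * x \<le> b" using x_le[of 2] by (simp add: power2_eq_square)
  ultimately show "x \<le> b" "2 * x + 1 \<le> b" using nx(5) by linarith+
qed

lemma wL: "i \<le> 1 + R * (k + 2) \<Longrightarrow> w ^ i \<le> b"
  using power_increasing[of i "1 + R * (k + 2)" w] Wb by (simp add: w_def)

lemma Lb: "1 + R * (k + 2) \<le> b"
proof -
  have "1 + R * (k + 2) < 2 ^ (1 + R * (k + 2))" by (rule less_exp)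
  also have "\<dots> \<le> (2 * x + 1) ^ (1 + R * (k + 2))" using nx(5) by (intro power_mono) auto
  finally show ?thesis using Wb by linarith
qed

lemma kEb: "k \<le> b" "E \<le> b" "n + 2 \<le> b" "d \<le> b" using xb nx by auto

lemma mono_value: "monom_kE \<mu> (int c) i = int (c * (k * E) ^ i)"
  using monom_kE_eq[of \<mu> "int c" i] kEb by (simp add: dims b)

lemma rr_value: "rr \<mu> = int R" by (simp only: rr_def mono_value R)

lemma X_value: "X \<mu> = int x"
proof -
  have "cx * (k * E) ^ ex < 2 ^ (cx * (k * E) ^ ex)" by (rule less_exp)
  also have "\<dots> \<le> x" unfolding x by (intro power_mono) auto
  finally have "cx * (k * E) ^ ex \<le> b" using xb by linarith
  then have "X \<mu> = 1 * (int n + 2) ^ nat (int (cx * (k * E) ^ ex))"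
    unfolding X_def nn_def dims mono_value using kEb by (intro cpow_eq) (auto simp: b simp del: of_nat_mult of_nat_power)
  also have "\<dots> = int x" by (simp add: x nat_mult_distrib add.commute del: of_nat_mult)
  finally show ?thesis .
qed

lemma W_value: "W \<mu> = int w" by (simp add: W_def X_value w_def)

lemma dig_value: "0 \<le> g \<Longrightarrow> g \<le> int b \<Longrightarrow> 0 \<le> i \<Longrightarrow> i \<le> int b \<Longrightarrow> dig \<mu> g i = g div int w ^ nat i mod int w"
proof -
  assume g: "0 \<le> g" "g \<le> int b" and i: "0 \<le> i" "i \<le> int b"
  have w0: "0 < int w" by (simp add: w_def)
  have wb: "int w \<le> \<mu> 0" using xb by (simp add: w_def b)
  have 1: "cpow \<mu> 1 (int w) i = int w ^ nat i" using cpow_eq[of "int w" \<mu> i 1] w0 wb i by (simp add: b)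
  have le: "h div m \<le> h" "0 \<le> h div m" if "0 \<le> h" "0 < m" for h m :: int
    using that zdiv_mono2[of h 1 m] by (simp_all add: pos_imp_zdiv_nonneg_iff)
  have wp: "0 < int w ^ nat i" using w0 by simp
  have 2: "cdiv \<mu> g (int w ^ nat i) = g div int w ^ nat i" using le[OF g(1) wp] g wp by (intro cdiv_eq) (auto simp: b)
  show ?thesis unfolding dig_def W_value 1 2 using le[OF g(1) wp] g le(1)[OF le(2)[OF g(1) wp] w0] w0
    by (intro crem_eq) (auto simp: b)
qed

lemma dig_range: "0 \<le> g \<Longrightarrow> g \<le> int b \<Longrightarrow> 0 \<le> i \<Longrightarrow> i \<le> int b \<Longrightarrow> 0 \<le> dig \<mu> g i \<and> dig \<mu> g i \<le> 2 * int x"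
  using pos_mod_bound[of "int w" "g div int w ^ nat i"] pos_mod_sign[of "int w" "g div int w ^ nat i"] dig_value[of g i]
  unfolding w_def by linarith

lemma digits_code:
  assumes "\<And>i. i < m \<Longrightarrow> f i \<le> 2 * x" "m \<le> 1 + R * (k + 2)"
  obtains g where "0 \<le> g" "g < int w ^ m" "\<And>i. i < m \<Longrightarrow> dig \<mu> g (int i) = int (f i)"
proof -
  have "\<And>i. i < m \<Longrightarrow> f i < w" using assms(1) by (auto simp: w_def intro: le_imp_less_Suc)
  from digits_exist[of m f w, OF this] obtain g where g: "g < w ^ m" "\<forall>i<m. g div w ^ i mod w = f i" by auto
  show ?thesis
  proof (rule that[of "int g"])
    show "int g < int w ^ m" using g(1) by (simp flip: of_nat_power)
    fix i assume i: "i < m"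
    have "g \<le> b" using g(1) wL[OF assms(2)] by linarith
    moreover have "i \<le> b" using i assms(2) Lb by linarith
    ultimately have "dig \<mu> (int g) (int i) = int (g div w ^ i mod w)"
      by (subst dig_value) (auto simp: zdiv_int zmod_int)
    then show "dig \<mu> (int g) (int i) = int (f i)" using g(2) i by simp
  qed simp
qed

definition vec where "vec u l = dig \<mu> u (int l) - int x"

lemma kL: "k \<le> 1 + R * (k + 2)"
  using mult_le_mono1[OF R1, of "k + 2"] by simp

lemma T_accuracy:
  assumes D: "1 \<le> D" "D\<^sup>2 \<le> Y" and N: "N \<le> Y"
  defines "v \<equiv> real Y ^ 3 * (real N / real (D\<^sup>2)) powr p"
  shows "(1 - 4 / real Y) * v \<le> of_int (T \<mu> (int D) (int N))" "of_int (T \<mu> (int D) (int N)) \<le> (1 + 4 / real Y) * v"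
proof -
  \<comment> \<open>\<open>2 ^ m\<close> is the least power of two that reaches
    \<open>Y\<^sup>2 = x ^ 8\<close>; leastness keeps it at most \<open>2 * x ^ 8\<close>, within
    the loop bound.\<close>
  define m where "m = (LEAST i. x ^ 8 \<le> 2 ^ i)"
  have "x ^ 8 \<le> 2 ^ (x ^ 8)" using less_exp[of "x ^ 8"] by (rule less_imp_le)
  then have m: "x ^ 8 \<le> 2 ^ m" unfolding m_def by (rule LeastI)
  have m2: "2 ^ i < x ^ 8" if "i < m" for i using not_less_Least[OF that[unfolded m_def]] by (simp only: not_le)
  have x8: "1 \<le> x ^ 8" using nx(5) by (intro one_le_power) simp
  have M2: "(2 :: nat) ^ m \<le> 2 * x ^ 8"
  proof (cases m)
    case 0
    then show ?thesis using x8 by simp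
  next
    case (Suc i)
    then have "2 ^ i < x ^ 8" by (intro m2) simp
    then show ?thesis unfolding Suc power_Suc by linarith
  qed
  have x9: "2 * x ^ 8 \<le> x ^ 9" "8 * x ^ 8 \<le> x ^ 9"
  proof -
    have "x ^ 9 = x * x ^ 8" by (simp add: eval_nat_numeral)
    moreover have "16 * x ^ 8 \<le> x * x ^ 8" using nx(5) by (rule mult_le_mono1)
    ultimately show "2 * x ^ 8 \<le> x ^ 9" "8 * x ^ 8 \<le> x ^ 9" by linarith+
  qed
  have mb: "m \<le> b" using less_exp[of m] M2 x9 x_le[of 9] by linarith
  have Mb: "2 ^ m \<le> b" using M2 x9 x_le[of 9] by linarith
  have lg: "lgM \<mu> = int m"
  proof -
    have "lgM \<mu> = (\<Sum>i<b. if 0 < cpow \<mu> 1 (int x) 8 - cpow \<mu> 1 2 (int i) then 1 else 0)"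
      unfolding lgM_def X_value by (subst csum_eq) (auto simp: b)
    also have "\<dots> = int m"
    proof (rule sum_if_less[OF mb])
      fix i assume i: "i < b"
      have "cpow \<mu> 1 (int x) 8 = int (x ^ 8)" using cpow_eq[of "int x" \<mu> 8 1] xb nx by (simp add: b)
      moreover have "cpow \<mu> 1 2 (int i) = int (2 ^ i)" using cpow_eq[of 2 \<mu> "int i" 1] xb nx i by (simp add: b)
      ultimately have "0 < cpow \<mu> 1 (int x) 8 - cpow \<mu> 1 2 (int i) \<longleftrightarrow> 2 ^ i < x ^ 8" by (simp del: of_nat_power)
      also have "\<dots> \<longleftrightarrow> i < m"
      proof
        assume "2 ^ i < x ^ 8"
        then have "(2::nat) ^ i < 2 ^ m" using m by linarith
        then show "i < m" by simp
      qed (rule m2)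
      finally show "0 < cpow \<mu> 1 (int x) 8 - cpow \<mu> 1 2 (int i) \<longleftrightarrow> i < m" .
    qed
    finally show ?thesis .
  qed
  have M: "M \<mu> = int (2 ^ m)" unfolding M_def lg using cpow_eq[of 2 \<mu> "int m" 1] mb xb nx by (simp add: b)
  define al where "al = nat \<lfloor>p * real (2 ^ m)\<rfloor>"
  have al: "int al = \<lfloor>p * real (2 ^ m)\<rfloor>" unfolding al_def using p by simp
  have a: "a \<mu> = int al"
  proof -
    have "a \<mu> = \<lfloor>p * 2 ^ min b m\<rfloor>"
      unfolding a_def lg b nat_int using p by (intro binary_expansion) linarith+
    then show ?thesis using mb al by (simp only: min_absorb2 of_nat_power of_nat_numeral)
  qed
  have alb: "2 * al \<le> b"
  proof -
    have "real al \<le> p * real (2 ^ m)" using al by linarith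
    also have "\<dots> \<le> 2 * real (2 ^ m)" using p by (intro mult_right_mono) auto
    finally have "real al \<le> real (2 * 2 ^ m)" by simp
    then have "al \<le> 2 * 2 ^ m" by (simp only: of_nat_le_iff)
    then show ?thesis using M2 x9 x_le[of 9] by linarith
  qed
  have Y1: "1 \<le> Y" using nx(5) by (simp add: Y_def)
  have Yb: "Y \<le> b" using x_le[of 4] by (simp add: Y_def)
  have Db: "D \<le> b" using D(2) Yb self_le_power[of D 2] D(1) by linarith
  have "(1 - 4 / real Y) * v \<le> of_int (T \<mu> (int D) (int N)) \<and> of_int (T \<mu> (int D) (int N)) \<le> (1 + 4 / real Y) * v"
  proof (cases "N = 0")
    case True
    then show ?thesis by (simp add: v_def T_def)
  next
    case False
    then have N1: "1 \<le> N" by simp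
    have YM: "Y\<^sup>2 \<le> 2 ^ m" using m by (simp add: Y_def flip: power_mult)
    have Y5: "Y ^ 5 < b" 
  proof -
    have "x ^ 20 \<le> x ^ 21" using nx(5) by (intro power_increasing) auto
    moreover have "Y ^ 5 = x ^ 20" by (simp add: Y_def flip: power_mult)
    ultimately show ?thesis using x21 by linarith
  qed
    have "cpow \<mu> 1 (int x) 12 = int x ^ 12" using cpow_eq[of "int x" \<mu> 12 1] xb nx by (simp add: b)
    then have K: "cpow \<mu> 1 (int x) 12 = int (Y ^ 3)" by (simp add: Y_def flip: power_mult)
    have Kb: "Y ^ 3 \<le> b" using x_le[of 12] by (simp add: Y_def flip: power_mult)
    have "cpow \<mu> 1 (int (Y ^ 3)) (int (2 ^ m)) = 1 * int (Y ^ 3) ^ nat (int (2 ^ m))"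
      by (rule cpow_eq) (use Kb Mb in \<open>simp_all add: b del: of_nat_power\<close>)
    then have 1: "cpow \<mu> 1 (int (Y ^ 3)) (int (2 ^ m)) = int ((Y ^ 3) ^ 2 ^ m)" unfolding nat_int mult_1 by (simp only: of_nat_power)
    have "cpow \<mu> (int ((Y ^ 3) ^ 2 ^ m)) (int N) (int al) = int ((Y ^ 3) ^ 2 ^ m) * int N ^ nat (int al)"
      by (rule cpow_eq) (use N Yb alb in \<open>simp_all add: b\<close>)
    then have 2: "cpow \<mu> (int ((Y ^ 3) ^ 2 ^ m)) (int N) (int al) = int ((Y ^ 3) ^ 2 ^ m * N ^ al)" by simp
    have 3: "cpow \<mu> (cpow \<mu> 1 (int y) (int (2 ^ m))) (int D) (int al + int al) = int (y ^ 2 ^ m * D ^ (2 * al))" if "y < b" for y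
    proof -
      have "cpow \<mu> 1 (int y) (int (2 ^ m)) = 1 * int y ^ nat (int (2 ^ m))"
        by (rule cpow_eq) (use that Mb in \<open>simp_all add: b del: of_nat_power\<close>)
      then have e: "cpow \<mu> 1 (int y) (int (2 ^ m)) = int (y ^ 2 ^ m)" unfolding nat_int mult_1 by (simp only: of_nat_power)
      have "cpow \<mu> (int (y ^ 2 ^ m)) (int D) (int al + int al) = int (y ^ 2 ^ m) * int D ^ nat (int al + int al)"
        by (rule cpow_eq) (use Db alb in \<open>simp_all add: b\<close>)
      also have "nat (int al + int al) = 2 * al" by simp
      finally show ?thesis unfolding e by (simp only: of_nat_mult of_nat_power)
    qed
    have "T \<mu> (int D) (int N) = (\<Sum>y<b. if 0 < int ((Y ^ 3) ^ 2 ^ m * N ^ al) - cpow \<mu> (cpow \<mu> 1 (int y) (int (2 ^ m))) (int D) (int al + int al) then 1 else 0)"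
      unfolding T_def M a X_value K 1 2 using N1 by (subst csum_eq) (simp_all add: b)
    also have "\<dots> = (\<Sum>y<b. if y ^ 2 ^ m * D ^ (2 * al) < (Y ^ 3) ^ 2 ^ m * N ^ al then 1 else 0)"
    proof (rule sum.cong)
      fix y assume "y \<in> {..<b}"
      then have y: "y < b" by simp
      have "0 < int u - int v \<longleftrightarrow> v < u" for u v by simp
      then show "(if 0 < int ((Y ^ 3) ^ 2 ^ m * N ^ al) - cpow \<mu> (cpow \<mu> 1 (int y) (int (2 ^ m))) (int D) (int al + int al) then 1 else 0 :: int)
        = (if y ^ 2 ^ m * D ^ (2 * al) < (Y ^ 3) ^ 2 ^ m * N ^ al then 1 else 0)" unfolding 3[OF y] by (simp only:)
    qed simp
    finally have e: "T \<mu> (int D) (int N) = (\<Sum>y<b. if y ^ 2 ^ m * D ^ (2 * al) < (Y ^ 3) ^ 2 ^ m * N ^ al then 1 else 0)" .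
    show ?thesis unfolding e v_def
      by (intro conjI table_accuracy[OF p Y1 YM al D N1 N Y5])
  qed
  then show "(1 - 4 / real Y) * v \<le> of_int (T \<mu> (int D) (int N))" "of_int (T \<mu> (int D) (int N)) \<le> (1 + 4 / real Y) * v" by simp_all
qed

end

text \<open>Clearing denominators makes all residuals integers; the common factor
  \<open>real (D\<^sup>2) powr p\<close> is the one that \<open>T\<close> divides out.\<close>

lemma cost_scale:
  assumes "1 \<le> D" "0 < p"
  shows "cost p n d k (\<lambda>i j. of_int (A i j)) (\<lambda>i l. of_int (U i l) / real D) (\<lambda>l j. of_int (V l j) / real D)
    = (\<Sum>i<n. \<Sum>j<d. \<bar>real_of_int ((\<Sum>l<k. U i l * V l j) - A i j * int (D\<^sup>2))\<bar> powr p) / real (D\<^sup>2) powr p"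
proof -
  have D: "real D \<noteq> 0" "0 < real (D\<^sup>2)" using assms by auto
  have "\<bar>of_int (A i j) - (\<Sum>l<k. of_int (U i l) / real D * (of_int (V l j) / real D))\<bar> powr p
     = \<bar>real_of_int ((\<Sum>l<k. U i l * V l j) - A i j * int (D\<^sup>2))\<bar> powr p / real (D\<^sup>2) powr p" for i j
  proof -
    have "(\<Sum>l<k. of_int (U i l) / real D * (of_int (V l j) / real D)) = real_of_int (\<Sum>l<k. U i l * V l j) / real (D\<^sup>2)"
      by (simp add: sum_divide_distrib power2_eq_square)
    then have "of_int (A i j) - (\<Sum>l<k. of_int (U i l) / real D * (of_int (V l j) / real D))
      = - (real_of_int ((\<Sum>l<k. U i l * V l j) - A i j * int (D\<^sup>2)) / real (D\<^sup>2))"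
      using D(1) by (simp add: diff_divide_distrib)
    then show ?thesis using D(2) by (simp add: abs_divide powr_divide del: of_nat_power of_int_diff)
  qed
  then show ?thesis unfolding cost_def by (simp only: sum_divide_distrib)
qed

context run
begin

definition \<eta> :: real where "\<eta> = 4 / real Y"

lemma Y_big: "16 \<le> real Y" "0 < \<eta>" "\<eta> \<le> 1 / 4"
proof -
  have "x \<le> Y" unfolding Y_def using nx(5) by (intro self_le_power) auto
  then show "16 \<le> real Y" using nx(5) by simp
  then show "0 < \<eta>" "\<eta> \<le> 1 / 4" by (auto simp: \<eta>_def divide_le_eq)
qed

lemma vec_range: "0 \<le> u \<Longrightarrow> u < int w ^ k \<Longrightarrow> l < k \<Longrightarrow> \<bar>vec u l\<bar> \<le> int x"
proof -
  assume u: "0 \<le> u" "u < int w ^ k" and l: "l < k"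
  have "int w ^ k \<le> int b" using wL[OF kL] by (simp flip: of_nat_power)
  then show ?thesis using dig_range[of u "int l"] u l kEb(1) unfolding vec_def by linarith
qed

lemma vec_code:
  assumes "\<And>l. l < k \<Longrightarrow> \<bar>v l\<bar> \<le> int x"
  obtains u where "0 \<le> u" "u < int w ^ k" "\<And>l. l < k \<Longrightarrow> vec u l = v l"
proof -
  have v: "- int x \<le> v l" "v l \<le> int x" if "l < k" for l using assms[OF that] by linarith+
  have "nat (v l + int x) \<le> 2 * x" if "l < k" for l using v[OF that] by linarith
  from digits_code[of k "\<lambda>l. nat (v l + int x)", OF this kL]
  obtain u where u: "0 \<le> u" "u < int w ^ k" "\<And>l. l < k \<Longrightarrow> dig \<mu> u (int l) = int (nat (v l + int x))" by blast
  show ?thesis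
  proof (rule that[OF u(1,2)])
    fix l assume l: "l < k"
    then show "vec u l = v l" using u(3)[OF l] v[OF l] unfolding vec_def by linarith
  qed
qed

lemma w_power: "0 < int w ^ m" "m \<le> 1 + R * (k + 2) \<Longrightarrow> int w ^ m \<le> \<mu> 0"
  unfolding b of_nat_power[symmetric] of_nat_le_iff by (simp add: w_def, rule wL)

lemma Wk: "cpow \<mu> 1 (W \<mu>) (kk \<mu>) = int w ^ k" "int w ^ k \<le> \<mu> 0" "0 < int w ^ k"
proof -
  have "cpow \<mu> 1 (int w) (int k) = 1 * int w ^ nat (int k)"
    by (rule cpow_eq) (use xb kEb in \<open>auto simp: b w_def\<close>)
  then show "cpow \<mu> 1 (W \<mu>) (kk \<mu>) = int w ^ k" by (simp add: W_value kk_def dims)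
  show "int w ^ k \<le> \<mu> 0" "0 < int w ^ k" by (rule w_power(2)[OF kL], rule w_power(1))
qed

lemma xs_range: "0 \<le> xs \<mu> g j" "xs \<mu> g j < int w ^ k" and us_range: "0 \<le> us \<mu> g i" "us \<mu> g i < int w ^ k"
  unfolding xs_def us_def Wk(1) by (intro cmin_spec Wk(2,3))+

lemma xs_min: "0 \<le> u \<Longrightarrow> u < int w ^ k \<Longrightarrow> colcost \<mu> g j (xs \<mu> g j) \<le> colcost \<mu> g j u"
  and us_min: "0 \<le> u \<Longrightarrow> u < int w ^ k \<Longrightarrow> rowcost \<mu> g i (us \<mu> g i) \<le> rowcost \<mu> g i u"
  unfolding xs_def us_def Wk(1) by (rule cmin_spec(3), rule Wk(3), rule Wk(2), assumption+)+

lemma Aent_value: "i < n \<Longrightarrow> j < d \<Longrightarrow> Aent \<mu> (int i) (int j) = A i j"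
  unfolding Aent_def dd_def dims using entries[of i j] kEb by (simp add: cmul_eq b)

definition dn where "dn g = nat (den \<mu> g)"

lemma den_value: "0 \<le> g \<Longrightarrow> g \<le> int b \<Longrightarrow> den \<mu> g = int (dn g) \<and> 1 \<le> dn g \<and> dn g \<le> 2 * x + 1"
  using dig_range[of g 0] unfolding dn_def den_def by linarith

definition res where "res D s i j = s - A i j * int (D\<^sup>2)"

lemma resid_value: "0 \<le> g \<Longrightarrow> g \<le> int b \<Longrightarrow> i < n \<Longrightarrow> j < d \<Longrightarrow> resid \<mu> g s (int i) (int j) = \<bar>res (dn g) s i j\<bar>"
proof -
  assume g: "0 \<le> g" "g \<le> int b" and ij: "i < n" "j < d"
  have "int (dn g) \<le> \<mu> 0" using den_value[OF g] xb by (simp add: b)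
  then show ?thesis unfolding resid_def Aent_value[OF ij] conjunct1[OF den_value[OF g]] cabs_eq res_def
    by (simp add: cmul_eq power2_eq_square mult.assoc)
qed

lemma dot_value: "0 \<le> v \<Longrightarrow> v < int w ^ k \<Longrightarrow>
  csum \<mu> (kk \<mu>) (\<lambda>l. smul \<mu> (h l) (dig \<mu> v l - X \<mu>)) = (\<Sum>l<k. h (int l) * vec v l)"
proof -
  assume v: "0 \<le> v" "v < int w ^ k"
  have "csum \<mu> (kk \<mu>) (\<lambda>l. smul \<mu> (h l) (dig \<mu> v l - X \<mu>)) = (\<Sum>l<k. smul \<mu> (h (int l)) (vec v l))"
    using kEb by (subst csum_eq) (simp_all add: kk_def dims b X_value vec_def)
  also have "\<dots> = (\<Sum>l<k. h (int l) * vec v l)"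
  proof (rule sum.cong)
    fix l assume "l \<in> {..<k}"
    then have "\<bar>vec v l\<bar> \<le> int x" using vec_range[OF v] by simp
    then show "smul \<mu> (h (int l)) (vec v l) = h (int l) * vec v l" using xb by (intro smul_eq) (simp add: b)
  qed simp
  finally show ?thesis .
qed

lemma dot_bound:
  assumes "\<And>l. l < k \<Longrightarrow> \<bar>u l\<bar> \<le> int x" "\<And>l. l < k \<Longrightarrow> \<bar>v l\<bar> \<le> int x"
  shows "\<bar>\<Sum>l<k. u l * v l\<bar> \<le> int (x ^ 3)"
proof -
  have "\<bar>\<Sum>l<k. u l * v l\<bar> \<le> (\<Sum>l<k. \<bar>u l * v l\<bar>)" by (rule sum_abs)
  also have "\<dots> \<le> (\<Sum>l<k. int x * int x)" using assms by (intro sum_mono) (auto simp: abs_mult intro!: mult_mono)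
  also have "\<dots> = int k * (int x * int x)" by simp
  also have "\<dots> \<le> int x * (int x * int x)" using nx by (intro mult_right_mono) auto
  finally show ?thesis by (simp add: power3_eq_cube)
qed

lemma denom_bound: "D \<le> 2 * x + 1 \<Longrightarrow> D\<^sup>2 \<le> 9 * x\<^sup>2"
proof -
  assume "D \<le> 2 * x + 1"
  then have "D \<le> 3 * x" using nx(5) by linarith
  then have "D\<^sup>2 \<le> (3 * x)\<^sup>2" by (rule power_mono) simp
  then show ?thesis by (simp add: power_mult_distrib)
qed

lemma x_powers: "16 * x\<^sup>2 \<le> x ^ 3" "16 * x ^ 3 \<le> Y"
proof -
  have "x ^ 3 = x * x\<^sup>2" "Y = x * x ^ 3" by (simp_all add: Y_def eval_nat_numeral)
  then show "16 * x\<^sup>2 \<le> x ^ 3" "16 * x ^ 3 \<le> Y" using nx(5) by (simp_all only: mult_le_mono1)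
qed

text \<open>The factor by which \<open>T\<close> multiplies the \<open>p\<close>-th power of an
  integer residual over the denominator \<open>D\<close>, up to relative error
  \<open>\<eta>\<close>. Times a sum of such powers it equals \<open>Y ^ 3\<close> times the true
  cost, for every \<open>D\<close>.\<close>

definition scale where "scale D = real Y ^ 3 / real (D\<^sup>2) powr p"

lemma scale_pos: "1 \<le> D \<Longrightarrow> 0 < scale D" using Y_big by (simp add: scale_def)

text \<open>The residual is at most \<open>10 * x ^ 3\<close>: \<open>x ^ 3\<close> from the inner
  product and \<open>9 * x ^ 3\<close> from an entry of \<open>A\<close> times
  \<open>D\<^sup>2\<close>. Hence the choice of \<open>x ^ 4\<close> for \<open>Y\<close>, the range
  in which \<open>T\<close> is accurate.\<close>

lemma T_res:
  assumes D: "1 \<le> D" "D \<le> 2 * x + 1" and s: "\<bar>s\<bar> \<le> int (x ^ 3)" and ij: "i < n" "j < d"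
  defines "v \<equiv> scale D * \<bar>real_of_int (res D s i j)\<bar> powr p"
  shows "(1 - \<eta>) * v \<le> of_int (T \<mu> (int D) \<bar>res D s i j\<bar>)" "of_int (T \<mu> (int D) \<bar>res D s i j\<bar>) \<le> (1 + \<eta>) * v"
proof -
  define N where "N = nat \<bar>res D s i j\<bar>"
  have N: "int N = \<bar>res D s i j\<bar>" by (simp add: N_def)
  have D9: "D\<^sup>2 \<le> 9 * x\<^sup>2" using denom_bound[OF D(2)] .
  have DY: "D\<^sup>2 \<le> Y" using D9 x_powers by linarith
  have "\<bar>A i j * int (D\<^sup>2)\<bar> \<le> int (10 * (n + 2) ^ c0) * int (9 * x\<^sup>2)"
    unfolding abs_mult using A[OF ij] D9 by (intro mult_mono) (auto simp del: of_nat_power)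
  also have "\<dots> \<le> int x * int (9 * x\<^sup>2)" using nx(6) by (intro mult_right_mono) (auto simp del: of_nat_power of_nat_mult)
  also have "\<dots> = int (9 * x ^ 3)" by (simp add: power3_eq_cube power2_eq_square)
  finally have "\<bar>res D s i j\<bar> \<le> int (10 * x ^ 3)" using s unfolding res_def by simp
  then have "N \<le> 10 * x ^ 3" using N by linarith
  then have NY: "N \<le> Y" using x_powers(2) by linarith
  have "real N = \<bar>real_of_int (res D s i j)\<bar>" by (simp add: N_def)
  then have v: "v = real Y ^ 3 * (real N / real (D\<^sup>2)) powr p" by (simp add: v_def scale_def powr_divide)
  show "(1 - \<eta>) * v \<le> of_int (T \<mu> (int D) \<bar>res D s i j\<bar>)" "of_int (T \<mu> (int D) \<bar>res D s i j\<bar>) \<le> (1 + \<eta>) * v"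
    unfolding v N[symmetric] \<eta>_def by (rule T_accuracy[OF D(1) DY NY])+
qed

lemma rowcost_value:
  assumes g: "0 \<le> g" "g \<le> int b" and i: "i < n"
  shows "rowcost \<mu> g (int i) u = (\<Sum>j<d. T \<mu> (int (dn g)) \<bar>res (dn g) (\<Sum>l<k. vec u l * vec (xs \<mu> g (int j)) l) i j\<bar>)"
proof -
  have "rowcost \<mu> g (int i) u = (\<Sum>j<d. T \<mu> (den \<mu> g) (resid \<mu> g
    (csum \<mu> (kk \<mu>) (\<lambda>l. smul \<mu> (dig \<mu> u l - X \<mu>) (dig \<mu> (xs \<mu> g (int j)) l - X \<mu>))) (int i) (int j)))"
    unfolding rowcost_def using kEb by (subst csum_eq) (simp_all add: dd_def dims b)
  also have "\<dots> = (\<Sum>j<d. T \<mu> (int (dn g)) \<bar>res (dn g) (\<Sum>l<k. vec u l * vec (xs \<mu> g (int j)) l) i j\<bar>)"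
  proof (rule sum.cong)
    fix j assume "j \<in> {..<d}"
    then have j: "j < d" by simp
    show "T \<mu> (den \<mu> g) (resid \<mu> g (csum \<mu> (kk \<mu>) (\<lambda>l. smul \<mu> (dig \<mu> u l - X \<mu>) (dig \<mu> (xs \<mu> g (int j)) l - X \<mu>))) (int i) (int j))
      = T \<mu> (int (dn g)) \<bar>res (dn g) (\<Sum>l<k. vec u l * vec (xs \<mu> g (int j)) l) i j\<bar>"
      unfolding dot_value[OF xs_range] resid_value[OF g i j] conjunct1[OF den_value[OF g]] by (simp only: vec_def X_value)
  qed simp
  finally show ?thesis .
qed

lemma rowcost_bounds:
  assumes g: "0 \<le> g" "g \<le> int b" and i: "i < n" and u: "0 \<le> u" "u < int w ^ k"
  defines "s \<equiv> \<Sum>j<d. \<bar>real_of_int (res (dn g) (\<Sum>l<k. vec u l * vec (xs \<mu> g (int j)) l) i j)\<bar> powr p"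
  shows "(1 - \<eta>) * scale (dn g) * s \<le> of_int (rowcost \<mu> g (int i) u)"
    "of_int (rowcost \<mu> g (int i) u) \<le> (1 + \<eta>) * scale (dn g) * s"
proof -
  have D: "1 \<le> dn g" "dn g \<le> 2 * x + 1" using den_value[OF g] by auto
  have b: "\<bar>\<Sum>l<k. vec u l * vec (xs \<mu> g (int j)) l\<bar> \<le> int (x ^ 3)" for j
    by (rule dot_bound) (simp_all add: vec_range u xs_range)
  show "(1 - \<eta>) * scale (dn g) * s \<le> of_int (rowcost \<mu> g (int i) u)"
    unfolding rowcost_value[OF g i] of_int_sum s_def sum_distrib_left mult.assoc
    by (rule sum_mono) (use T_res(1)[OF D b i] in simp)
  show "of_int (rowcost \<mu> g (int i) u) \<le> (1 + \<eta>) * scale (dn g) * s"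
    unfolding rowcost_value[OF g i] of_int_sum s_def sum_distrib_left mult.assoc
    by (rule sum_mono) (use T_res(2)[OF D b i] in simp)
qed

lemma total_value: "total \<mu> g = (\<Sum>i<n. rowcost \<mu> g (int i) (us \<mu> g (int i)))"
  unfolding total_def using kEb by (subst csum_eq) (simp_all add: nn_def dims b)

definition L where "L = 1 + R * (k + 2)"

lemma off_value: "t \<le> R \<Longrightarrow> off \<mu> (int t) = int (1 + t * (k + 2))"
proof -
  assume "t \<le> R"
  then have "t \<le> L" unfolding L_def using mult_le_mono[of t R 1 "k + 2"] by simp
  then have "int t \<le> \<mu> 0" using Lb by (simp add: b L_def)
  then show ?thesis unfolding off_def kk_def dims by (simp add: cmul_eq algebra_simps)
qed

lemma best_spec: "0 \<le> best \<mu>" "best \<mu> < int w ^ L" "0 \<le> g \<Longrightarrow> g < int w ^ L \<Longrightarrow> total \<mu> (best \<mu>) \<le> total \<mu> g"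
proof -
  have "cpow \<mu> 1 (int w) (int L) = 1 * int w ^ nat (int L)"
    by (rule cpow_eq) (use xb Lb in \<open>auto simp: b w_def L_def simp del: of_nat_add of_nat_mult\<close>)
  moreover have "off \<mu> (rr \<mu>) = int L" unfolding rr_value off_value[OF order_refl] by (simp only: L_def)
  ultimately have e: "cpow \<mu> 1 (W \<mu>) (off \<mu> (rr \<mu>)) = int w ^ L" by (simp only: W_value nat_int mult_1)
  have l: "0 < int w ^ L" "int w ^ L \<le> \<mu> 0" by (rule w_power(1), rule w_power(2)) (simp only: L_def order_refl)
  show "0 \<le> best \<mu>" "best \<mu> < int w ^ L" "0 \<le> g \<Longrightarrow> g < int w ^ L \<Longrightarrow> total \<mu> (best \<mu>) \<le> total \<mu> g"
    unfolding best_def e by (intro cmin_spec l; assumption?)+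
qed

lemma guess_le: "g < int w ^ L \<Longrightarrow> g \<le> int b"
  using w_power(2)[of L] unfolding b L_def by simp

end

context run
begin

definition guess :: "nat \<Rightarrow> (nat \<Rightarrow> nat) \<Rightarrow> (nat \<Rightarrow> nat) \<Rightarrow> (nat \<Rightarrow> nat \<Rightarrow> int) \<Rightarrow> nat \<Rightarrow> nat" where
  "guess D \<omega> wt U i = (if i = 0 then D - 1 else
     let t = (i - 1) div (k + 2); s = (i - 1) mod (k + 2)
     in if s = 0 then \<omega> t else if s = 1 then wt t else nat (U (\<omega> t) (s - 2) + int x))"

text \<open>Denominator, row indices, weights and shifted entries are all at most
  \<open>2 * x\<close>, so each fits into one digit and the enumeration meets the intended
  sample.\<close>

lemma guess:
  assumes D: "1 \<le> D" "D \<le> x" and \<omega>: "\<And>t. t < R \<Longrightarrow> \<omega> t < n" and wt: "\<And>t. t < R \<Longrightarrow> wt t \<le> 2 * x"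
    and U: "\<And>i l. i < n \<Longrightarrow> l < k \<Longrightarrow> \<bar>U i l\<bar> \<le> int x"
  obtains g where "0 \<le> g" "g < int w ^ L" "dn g = D"
    "\<And>t. t < R \<Longrightarrow> dig \<mu> g (off \<mu> (int t)) = int (\<omega> t)"
    "\<And>t. t < R \<Longrightarrow> dig \<mu> g (off \<mu> (int t) + 1) = int (wt t)"
    "\<And>t l. t < R \<Longrightarrow> l < k \<Longrightarrow> dig \<mu> g (off \<mu> (int t) + 2 + int l) = U (\<omega> t) l + int x"
proof -
  define f where "f = guess D \<omega> wt U"
  have pos: "1 + t * (k + 2) + s < L" if "t < R" "s < k + 2" for t s
  proof -
    have "(t + 1) * (k + 2) \<le> R * (k + 2)" using that by (intro mult_le_mono1) simp
    moreover have "(t + 1) * (k + 2) = t * (k + 2) + (k + 2)" by simp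
    ultimately show ?thesis using that(2) unfolding L_def by linarith
  qed
  have fv: "f (1 + t * (k + 2) + s) = (if s = 0 then \<omega> t else if s = 1 then wt t else nat (U (\<omega> t) (s - 2) + int x))"
    if "s < k + 2" for t s
  proof -
    have "(1 + t * (k + 2) + s - 1) div (k + 2) = t" "(1 + t * (k + 2) + s - 1) mod (k + 2) = s"
      using that by (simp_all add: add.commute[of "t * (k + 2)"] del: mult_Suc_right add_2_eq_Suc')
    then show ?thesis by (simp only: f_def guess_def Let_def) simp
  qed
  have f_le: "f i \<le> 2 * x" if i: "i < 1 + R * (k + 2)" for i
  proof (cases "i = 0")
    case True
    then show ?thesis using D by (simp add: f_def guess_def)
  next
    case False
    define t where "t = (i - 1) div (k + 2)"
    define s where "s = (i - 1) mod (k + 2)"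
    have t: "t < R" unfolding t_def using i False by (simp add: div_less_iff_less_mult)
    have s: "s < k + 2" by (simp add: s_def)
    have ie: "i = 1 + t * (k + 2) + s" using False div_mult_mod_eq[of "i - 1" "k + 2"] unfolding t_def s_def by linarith
    have "nat (U (\<omega> t) (s - 2) + int x) \<le> 2 * x" if "s \<noteq> 0" "s \<noteq> 1"

    proof -
      have "s - 2 < k" using that s by linarith
      from U[OF \<omega>[OF t] this] show ?thesis by linarith
    qed
    then show ?thesis unfolding ie fv[OF s] using \<omega>[OF t] wt[OF t] nx(1) by auto
  qed
  from digits_code[of "1 + R * (k + 2)" f, OF f_le order_refl, folded L_def]
  obtain g where g: "0 \<le> g" "g < int w ^ L" "\<And>i. i < L \<Longrightarrow> dig \<mu> g (int i) = int (f i)" by blast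
  have at: "dig \<mu> g (off \<mu> (int t) + int s) = int (f (1 + t * (k + 2) + s))" if "t < R" "s < k + 2" for t s
    using g(3)[OF pos[OF that]] off_value[of t] that(1) by (simp only: of_nat_add less_imp_le)
  show ?thesis
  proof (rule that[OF g(1,2)])
    have "0 < L" by (simp add: L_def)
    from g(3)[OF this] have "dig \<mu> g 0 = int (D - 1)" by (simp add: f_def guess_def)
    then show "dn g = D" using D by (simp add: dn_def den_def)
    show "dig \<mu> g (off \<mu> (int t)) = int (\<omega> t)" if "t < R" for t
      using at[OF that, of 0] fv[of 0 t] by simp
    show "dig \<mu> g (off \<mu> (int t) + 1) = int (wt t)" if "t < R" for t
      using at[OF that, of 1] fv[of 1 t] k by simp
    show "dig \<mu> g (off \<mu> (int t) + 2 + int l) = U (\<omega> t) l + int x" if t: "t < R" and l: "l < k" for t l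
    proof -
      have u: "0 \<le> U (\<omega> t) l + int x" using U[OF \<omega>[OF t] l] by linarith
      have "off \<mu> (int t) + 2 + int l = off \<mu> (int t) + int (l + 2)" by simp
      then have "dig \<mu> g (off \<mu> (int t) + 2 + int l) = int (f (1 + t * (k + 2) + (l + 2)))"
        using at[OF t, of "l + 2"] l by (simp only: add_less_cancel_right)
      also have "f (1 + t * (k + 2) + (l + 2)) = nat (U (\<omega> t) l + int x)" using fv[of "l + 2" t] l by simp
      finally show ?thesis using u by simp
    qed
  qed
qed

lemma colcost_value:
  assumes g: "0 \<le> g" "g \<le> int b" and \<omega>: "\<And>t. t < R \<Longrightarrow> \<omega> t < n"
    and wt: "\<And>t. t < R \<Longrightarrow> wt t \<le> 2 * x"
    and U: "\<And>i l. i < n \<Longrightarrow> l < k \<Longrightarrow> \<bar>U i l\<bar> \<le> int x"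
    and dg: "\<And>t. t < R \<Longrightarrow> dig \<mu> g (off \<mu> (int t)) = int (\<omega> t)"
    "\<And>t. t < R \<Longrightarrow> dig \<mu> g (off \<mu> (int t) + 1) = int (wt t)"
    "\<And>t l. t < R \<Longrightarrow> l < k \<Longrightarrow> dig \<mu> g (off \<mu> (int t) + 2 + int l) = U (\<omega> t) l + int x"
    and j: "j < d" and u: "0 \<le> u" "u < int w ^ k"
  shows "colcost \<mu> g (int j) u = (\<Sum>t<R. T \<mu> (int (dn g)) \<bar>res (dn g) (\<Sum>l<k. U (\<omega> t) l * vec u l) (\<omega> t) j\<bar> * int (wt t))"
proof -
  have Rb: "int R \<le> \<mu> 0" using Lb unfolding b by (simp add: algebra_simps)
  have "colcost \<mu> g (int j) u = (\<Sum>t<R. cmul \<mu> (T \<mu> (den \<mu> g) (resid \<mu> g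
   (csum \<mu> (kk \<mu>) (\<lambda>l. smul \<mu> (dig \<mu> g (off \<mu> (int t) + 2 + l) - X \<mu>) (dig \<mu> u l - X \<mu>))) (dig \<mu> g (off \<mu> (int t))) (int j)))
   (dig \<mu> g (off \<mu> (int t) + 1)))"
    unfolding colcost_def rr_value using Rb by (subst csum_eq) simp_all
  also have "\<dots> = (\<Sum>t<R. T \<mu> (int (dn g)) \<bar>res (dn g) (\<Sum>l<k. U (\<omega> t) l * vec u l) (\<omega> t) j\<bar> * int (wt t))"
  proof (rule sum.cong)
    fix t assume "t \<in> {..<R}"
    then have t: "t < R" by simp
    have "(\<Sum>l<k. (dig \<mu> g (off \<mu> (int t) + 2 + int l) - X \<mu>) * vec u l) = (\<Sum>l<k. U (\<omega> t) l * vec u l)"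
      by (rule sum.cong) (simp_all add: dg(3)[OF t] X_value)
    moreover have "int (wt t) \<le> \<mu> 0" using wt[OF t] xb by (simp add: b)
    ultimately show "cmul \<mu> (T \<mu> (den \<mu> g) (resid \<mu> g
       (csum \<mu> (kk \<mu>) (\<lambda>l. smul \<mu> (dig \<mu> g (off \<mu> (int t) + 2 + l) - X \<mu>) (dig \<mu> u l - X \<mu>))) (dig \<mu> g (off \<mu> (int t))) (int j)))
       (dig \<mu> g (off \<mu> (int t) + 1)) = T \<mu> (int (dn g)) \<bar>res (dn g) (\<Sum>l<k. U (\<omega> t) l * vec u l) (\<omega> t) j\<bar> * int (wt t)"
      unfolding dot_value[OF u] dg(1,2)[OF t] resid_value[OF g \<omega>[OF t] j] conjunct1[OF den_value[OF g]] by (simp add: cmul_eq)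
  qed simp
  finally show ?thesis .
qed

text \<open>Comparing two values of \<open>T\<close>, one from below and one from above, loses the
  ratio \<open>(1 + \<eta>) / (1 - \<eta>)\<close>, which is at most \<open>1 + 3 * \<eta>\<close>
  because \<open>\<eta> \<le> 1 / 4\<close>.\<close>

lemma cancel_accuracy: "(1 - \<eta>) * a \<le> (1 + \<eta>) * c \<Longrightarrow> 0 \<le> c \<Longrightarrow> a \<le> (1 + 3 * \<eta>) * c" for a c :: real
proof -
  assume le: "(1 - \<eta>) * a \<le> (1 + \<eta>) * c" and c: "0 \<le> c"
  have "0 \<le> \<eta> * (1 - 3 * \<eta>)" using Y_big by (intro mult_nonneg_nonneg) auto
  then have "1 + \<eta> \<le> (1 - \<eta>) * (1 + 3 * \<eta>)" by (simp add: algebra_simps)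
  then have "(1 + \<eta>) * c \<le> (1 - \<eta>) * (1 + 3 * \<eta>) * c" using c by (rule mult_right_mono)
  then have "(1 - \<eta>) * a \<le> (1 - \<eta>) * ((1 + 3 * \<eta>) * c)" using le unfolding mult.assoc by linarith
  then show "a \<le> (1 + 3 * \<eta>) * c" using Y_big by (simp add: mult_le_cancel_left_pos)
qed

definition Uout where "Uout i l = vec (us \<mu> (best \<mu>) (int i)) l"
definition Vout where "Vout l j = vec (xs \<mu> (best \<mu>) (int j)) l"
definition Dout where "Dout = dn (best \<mu>)"

text \<open>For the guess \<open>g\<close> that encodes the intended sample, every column found by
  \<open>xs\<close> is on the sample nearly as good as the reference column, so \<open>samp\<close>
  bounds the cost of \<open>U\<close> with these columns, and the rows found by \<open>us\<close>
  cost hardly more. The best guess is at least as good in \<open>total\<close>, which evaluates the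
  full cost of the factors actually output; whatever sample it encodes, its output is sound.\<close>

lemma run_cost:
  fixes \<delta> :: real
  assumes D: "1 \<le> D" "D \<le> x" and \<omega>: "\<And>t. t < R \<Longrightarrow> \<omega> t < n" and wt: "\<And>t. t < R \<Longrightarrow> wt t \<le> 2 * x"
    and U: "\<And>i l. i < n \<Longrightarrow> l < k \<Longrightarrow> \<bar>U i l\<bar> \<le> int x" and V: "\<And>l j. l < k \<Longrightarrow> j < d \<Longrightarrow> \<bar>V l j\<bar> \<le> int x"
    and samp: "\<And>V' :: nat \<Rightarrow> nat \<Rightarrow> int. (\<And>j. j < d \<Longrightarrow>
        (\<Sum>t<R. real (wt t) * \<bar>real_of_int ((\<Sum>l<k. U (\<omega> t) l * V' l j) - A (\<omega> t) j * int (D\<^sup>2))\<bar> powr p)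
        \<le> (1 + 3 * \<eta>) * (\<Sum>t<R. real (wt t) * \<bar>real_of_int ((\<Sum>l<k. U (\<omega> t) l * V l j) - A (\<omega> t) j * int (D\<^sup>2))\<bar> powr p)) \<Longrightarrow>
      (\<Sum>i<n. \<Sum>j<d. \<bar>real_of_int ((\<Sum>l<k. U i l * V' l j) - A i j * int (D\<^sup>2))\<bar> powr p)
        \<le> (1 + \<delta>) * (\<Sum>i<n. \<Sum>j<d. \<bar>real_of_int ((\<Sum>l<k. U i l * V l j) - A i j * int (D\<^sup>2))\<bar> powr p)"
    and \<delta>: "0 \<le> \<delta>"
  shows "cost p n d k (\<lambda>i j. of_int (A i j)) (\<lambda>i l. of_int (Uout i l) / real Dout) (\<lambda>l j. of_int (Vout l j) / real Dout)
    \<le> (1 + 3 * \<eta>) * ((1 + \<delta>) * cost p n d k (\<lambda>i j. of_int (A i j)) (\<lambda>i l. of_int (U i l) / real D) (\<lambda>l j. of_int (V l j) / real D))"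
proof -
  obtain g where g: "0 \<le> g" "g < int w ^ L" "dn g = D"
    and dg: "\<And>t. t < R \<Longrightarrow> dig \<mu> g (off \<mu> (int t)) = int (\<omega> t)"
    "\<And>t. t < R \<Longrightarrow> dig \<mu> g (off \<mu> (int t) + 1) = int (wt t)"
    "\<And>t l. t < R \<Longrightarrow> l < k \<Longrightarrow> dig \<mu> g (off \<mu> (int t) + 2 + int l) = U (\<omega> t) l + int x"
    by (rule guess[of D \<omega> wt U]) (use D \<omega> wt U in blast)+
  have gb: "g \<le> int b" by (rule guess_le[OF g(2)])
  have D2: "D \<le> 2 * x + 1" using D by simp
  have sc: "0 < scale D" by (rule scale_pos[OF D(1)])
  define X' where "X' l j = vec (xs \<mu> g (int j)) l" for l j
  define col where "col V' j = (\<Sum>t<R. real (wt t) * \<bar>real_of_int (res D (\<Sum>l<k. U (\<omega> t) l * V' l) (\<omega> t) j)\<bar> powr p)" for V' j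
  have colT: "(1 - \<eta>) * (scale D * col (vec u) j) \<le> of_int (colcost \<mu> g (int j) u)"
    "of_int (colcost \<mu> g (int j) u) \<le> (1 + \<eta>) * (scale D * col (vec u) j)" if j: "j < d" and u: "0 \<le> u" "u < int w ^ k" for u j
  proof -
    have e: "colcost \<mu> g (int j) u = (\<Sum>t<R. T \<mu> (int D) \<bar>res D (\<Sum>l<k. U (\<omega> t) l * vec u l) (\<omega> t) j\<bar> * int (wt t))"
      by (rule colcost_value[OF g(1) gb \<omega> wt U dg j u, unfolded g(3)])
    have bnd: "\<bar>\<Sum>l<k. U (\<omega> t) l * vec u l\<bar> \<le> int (x ^ 3)" if "t < R" for t
      by (rule dot_bound) (use U \<omega>[OF that] vec_range[OF u] in auto)
    have t1: "(1 - \<eta>) * (scale D * (real (wt t) * \<bar>real_of_int (res D (\<Sum>l<k. U (\<omega> t) l * vec u l) (\<omega> t) j)\<bar> powr p))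
       \<le> of_int (T \<mu> (int D) \<bar>res D (\<Sum>l<k. U (\<omega> t) l * vec u l) (\<omega> t) j\<bar>) * real (wt t)" if "t < R" for t
      using mult_right_mono[OF T_res(1)[OF D(1) D2 bnd[OF that] \<omega>[OF that] j], of "real (wt t)"] by (simp add: mult_ac)
    have t2: "of_int (T \<mu> (int D) \<bar>res D (\<Sum>l<k. U (\<omega> t) l * vec u l) (\<omega> t) j\<bar>) * real (wt t)
       \<le> (1 + \<eta>) * (scale D * (real (wt t) * \<bar>real_of_int (res D (\<Sum>l<k. U (\<omega> t) l * vec u l) (\<omega> t) j)\<bar> powr p))" if "t < R" for t
      using mult_right_mono[OF T_res(2)[OF D(1) D2 bnd[OF that] \<omega>[OF that] j], of "real (wt t)"] by (simp add: mult_ac)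
    show "(1 - \<eta>) * (scale D * col (vec u) j) \<le> of_int (colcost \<mu> g (int j) u)"
      unfolding e of_int_sum of_int_mult of_int_of_nat_eq col_def sum_distrib_left by (rule sum_mono) (use t1 in simp)
    show "of_int (colcost \<mu> g (int j) u) \<le> (1 + \<eta>) * (scale D * col (vec u) j)"
      unfolding e of_int_sum of_int_mult of_int_of_nat_eq col_def sum_distrib_left by (rule sum_mono) (use t2 in simp)
  qed
  have cond: "col (\<lambda>l. X' l j) j \<le> (1 + 3 * \<eta>) * col (\<lambda>l. V l j) j" if j: "j < d" for j
  proof -
    obtain u where u: "0 \<le> u" "u < int w ^ k" "\<And>l. l < k \<Longrightarrow> vec u l = V l j"
      by (rule vec_code[of "\<lambda>l. V l j"]) (use V j in blast)+
    have cu: "col (vec u) j = col (\<lambda>l. V l j) j" unfolding col_def by (intro sum.cong) (simp_all add: u(3))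
    have "(1 - \<eta>) * (scale D * col (\<lambda>l. X' l j) j) \<le> of_int (colcost \<mu> g (int j) (xs \<mu> g (int j)))"
      using colT(1)[OF j xs_range] by (simp only: X'_def)
    also have "\<dots> \<le> of_int (colcost \<mu> g (int j) u)" using xs_min[OF u(1,2), of g "int j"] by simp
    also have "\<dots> \<le> (1 + \<eta>) * (scale D * col (\<lambda>l. V l j) j)" using colT(2)[OF j u(1,2)] by (simp only: cu)
    finally have "scale D * ((1 - \<eta>) * col (\<lambda>l. X' l j) j) \<le> scale D * ((1 + \<eta>) * col (\<lambda>l. V l j) j)"
      by (simp only: mult.left_commute)
    then have "(1 - \<eta>) * col (\<lambda>l. X' l j) j \<le> (1 + \<eta>) * col (\<lambda>l. V l j) j" using sc by (simp only: mult_le_cancel_left_pos)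
    then show ?thesis by (rule cancel_accuracy) (simp add: col_def sum_nonneg)
  qed
  define S where "S D U V = (\<Sum>i<n. \<Sum>j<d. \<bar>real_of_int (res D (\<Sum>l<k. U i l * V l j) i j)\<bar> powr p)" for D and U V :: "nat \<Rightarrow> nat \<Rightarrow> int"
  have SX: "S D U X' \<le> (1 + \<delta>) * S D U V"
    unfolding S_def res_def by (rule samp) (rule cond[unfolded col_def res_def])
  have tot: "of_int (total \<mu> g) \<le> (1 + \<eta>) * (scale D * S D U X')"
  proof -
    have "of_int (rowcost \<mu> g (int i) (us \<mu> g (int i))) \<le>
      (1 + \<eta>) * (scale D * (\<Sum>j<d. \<bar>real_of_int (res D (\<Sum>l<k. U i l * X' l j) i j)\<bar> powr p))" if i: "i < n" for i
    proof -
      obtain u where u: "0 \<le> u" "u < int w ^ k" "\<And>l. l < k \<Longrightarrow> vec u l = U i l"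
        by (rule vec_code[of "\<lambda>l. U i l"]) (use U i in blast)+
      have "(\<Sum>l<k. vec u l * vec (xs \<mu> g (int j)) l) = (\<Sum>l<k. U i l * X' l j)" for j
        by (rule sum.cong) (simp_all add: u(3) X'_def)
      then have "of_int (rowcost \<mu> g (int i) u) \<le> (1 + \<eta>) * scale D * (\<Sum>j<d. \<bar>real_of_int (res D (\<Sum>l<k. U i l * X' l j) i j)\<bar> powr p)"
        using rowcost_bounds(2)[OF g(1) gb i u(1,2)] by (simp only: g(3))
      moreover have "rowcost \<mu> g (int i) (us \<mu> g (int i)) \<le> rowcost \<mu> g (int i) u" by (rule us_min[OF u(1,2)])
      ultimately show ?thesis unfolding mult.assoc by linarith
    qed
    then show ?thesis unfolding total_value S_def of_int_sum sum_distrib_left[of "scale D"] sum_distrib_left[of "1 + \<eta>"]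
      by (intro sum_mono) simp
  qed
  have bb: "0 \<le> best \<mu>" "best \<mu> \<le> int b" using best_spec(1) guess_le[OF best_spec(2)] by auto
  have D1: "1 \<le> Dout" unfolding Dout_def using den_value[OF bb] by simp
  have "(1 - \<eta>) * (scale Dout * S Dout Uout Vout) \<le> of_int (total \<mu> (best \<mu>))"
  proof -
    have "(1 - \<eta>) * (scale Dout * (\<Sum>j<d. \<bar>real_of_int (res Dout (\<Sum>l<k. Uout i l * Vout l j) i j)\<bar> powr p))
      \<le> of_int (rowcost \<mu> (best \<mu>) (int i) (us \<mu> (best \<mu>) (int i)))" if i: "i < n" for i
      using rowcost_bounds(1)[OF bb i us_range] by (simp only: Uout_def Vout_def Dout_def mult.assoc)
    then show ?thesis unfolding total_value S_def of_int_sum sum_distrib_left[of "scale Dout"] sum_distrib_left[of "1 - \<eta>"]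
      by (intro sum_mono) simp
  qed
  also have "\<dots> \<le> of_int (total \<mu> g)" using best_spec(3)[OF g(1,2)] by simp
  also note tot
  finally have "scale Dout * S Dout Uout Vout \<le> (1 + 3 * \<eta>) * (scale D * S D U X')"
    by (rule cancel_accuracy) (use sc in \<open>simp add: S_def sum_nonneg\<close>)
  also have "\<dots> \<le> (1 + 3 * \<eta>) * (scale D * ((1 + \<delta>) * S D U V))"
    using SX sc Y_big by (intro mult_left_mono) auto
  finally have fin: "scale Dout * S Dout Uout Vout \<le> (1 + 3 * \<eta>) * (scale D * ((1 + \<delta>) * S D U V))" .
  define c where "c = real Y ^ 3"
  have c: "0 < c" using Y_big by (simp add: c_def)
  have cs: "scale D' * S D' U' V' = c * cost p n d k (\<lambda>i j. of_int (A i j)) (\<lambda>i l. of_int (U' i l) / real D') (\<lambda>l j. of_int (V' l j) / real D')"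
    if "1 \<le> D'" for D' U' V'
    unfolding cost_scale[OF that p(1)] scale_def S_def res_def c_def by (simp only: times_divide_eq_right times_divide_eq_left)
  have "c * cost p n d k (\<lambda>i j. of_int (A i j)) (\<lambda>i l. of_int (Uout i l) / real Dout) (\<lambda>l j. of_int (Vout l j) / real Dout)
    \<le> (1 + 3 * \<eta>) * ((1 + \<delta>) * (scale D * S D U V))" using fin unfolding cs[OF D1] by (simp only: mult.left_commute)
  then have "c * cost p n d k (\<lambda>i j. of_int (A i j)) (\<lambda>i l. of_int (Uout i l) / real Dout) (\<lambda>l j. of_int (Vout l j) / real Dout)
    \<le> c * ((1 + 3 * \<eta>) * ((1 + \<delta>) * cost p n d k (\<lambda>i j. of_int (A i j)) (\<lambda>i l. of_int (U i l) / real D) (\<lambda>l j. of_int (V l j) / real D)))"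
    unfolding cs[OF D(1)] by (simp only: mult.left_commute)
  then show ?thesis using c by (simp only: mult_le_cancel_left_pos)
qed

lemma count_value: "count \<mu> = int (2 * (n * k + k * d))"
  using kEb b unfolding count_def nn_def kk_def dd_def dims by (simp add: cmul_eq)

lemma nkd: "2 * (n * k + k * d) \<le> b"
proof -
  have "n * k \<le> x * x" "k * d \<le> x * x" using nx by (auto intro!: mult_le_mono)
  then have "2 * (n * k + k * d) \<le> 4 * x\<^sup>2" by (simp add: power2_eq_square)
  also have "\<dots> \<le> x ^ 3" using x_powers by linarith
  also have "\<dots> \<le> b" by (rule x_le) simp
  finally show ?thesis .
qed

lemma div_mod_nat:
  assumes "m \<le> b" "0 < y"
  shows "cdiv \<mu> (int m) (int y) = int (m div y)" "crem \<mu> (int m) (int y) = int (m mod y)"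
proof -
  have "int m div int y \<le> \<mu> 0" unfolding b zdiv_int[symmetric] of_nat_le_iff using assms(1) div_le_dividend[of m y] by linarith
  then show "cdiv \<mu> (int m) (int y) = int (m div y)" "crem \<mu> (int m) (int y) = int (m mod y)"
    using assms by (simp_all add: cdiv_eq crem_eq zdiv_int zmod_int)
qed

lemma nk_value: "cmul \<mu> (nn \<mu>) (kk \<mu>) = int (n * k)"
  unfolding nn_def kk_def dims using kEb by (simp add: cmul_eq b)

lemma out_value:
  assumes "m < n * k + k * d"
  shows "out \<mu> (int (2 * m + 1)) = int Dout" "1 \<le> Dout"
    "out \<mu> (int (2 * m)) = (if m < n * k then Uout (m div k) (m mod k) else Vout ((m - n * k) div d) ((m - n * k) mod d))"
proof -
  have bb: "0 \<le> best \<mu>" "best \<mu> \<le> int b" using best_spec(1) guess_le[OF best_spec(2)] by auto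
  have mb: "2 * m + 1 \<le> b" "2 * m \<le> b" "m \<le> b" "m - n * k \<le> b" 
  proof -
    define q where "q = n * k + k * d"
    have "m < q" "2 * q \<le> b" using assms nkd by (simp_all only: q_def)
    then show "2 * m + 1 \<le> b" "2 * m \<le> b" "m \<le> b" "m - n * k \<le> b" by linarith+
  qed
  show "1 \<le> Dout" unfolding Dout_def using den_value[OF bb] by simp
  have "crem \<mu> (int (2 * m + 1)) (int 2) = int ((2 * m + 1) mod 2)" by (rule div_mod_nat(2)[OF mb(1)]) simp
  also have "(2 * m + 1) mod 2 = (1 :: nat)" by simp
  finally have m1: "crem \<mu> (int (2 * m + 1)) 2 = 1" unfolding of_nat_numeral of_nat_1 .
  show "out \<mu> (int (2 * m + 1)) = int Dout" unfolding out_def m1 Dout_def using den_value[OF bb] by simp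
  have "crem \<mu> (int (2 * m)) (int 2) = int ((2 * m) mod 2)" by (rule div_mod_nat(2)[OF mb(2)]) simp
  also have "(2 * m) mod 2 = (0 :: nat)" by simp
  finally have m0: "crem \<mu> (int (2 * m)) 2 = 0" unfolding of_nat_numeral of_nat_0 .
  have "cdiv \<mu> (int (2 * m)) (int 2) = int ((2 * m) div 2)" by (rule div_mod_nat(1)[OF mb(2)]) simp
  also have "(2 * m) div 2 = m" by simp
  finally have d0: "cdiv \<mu> (int (2 * m)) 2 = int m" unfolding of_nat_numeral .
  have o: "out \<mu> (int (2 * m)) = entry \<mu> (int m)" unfolding out_def m0 d0 by simp
  have kd: "kk \<mu> = int k" "dd \<mu> = int d" by (simp_all add: kk_def dd_def dims)
  have iff: "0 < int (n * k) - int m \<longleftrightarrow> m < n * k" by linarith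
  show "out \<mu> (int (2 * m)) = (if m < n * k then Uout (m div k) (m mod k) else Vout ((m - n * k) div d) ((m - n * k) mod d))"
  proof (cases "m < n * k")
    case True
    have k0: "0 < k" using k by simp
    show ?thesis unfolding o entry_def nk_value iff unfolding kd div_mod_nat[OF mb(3) k0] using True
      by (simp add: Uout_def vec_def X_value del: of_nat_mult)
  next
    case False
    have d0: "0 < d" using d by simp
    have e: "int m - int (n * k) = int (m - n * k)" using False by simp
    show ?thesis unfolding o entry_def nk_value iff unfolding kd e div_mod_nat[OF mb(4) d0] using False
      by (simp add: Vout_def vec_def X_value)
  qed
qed

end

section \<open>Choice of parameters and assembly\<close>

lemma poly_le_power: "\<exists>c. \<forall>n. poly b (real n) \<le> real ((n + 2) ^ c)" for b :: "real poly"
proof (induction b)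
  case 0
  then show ?case by (intro exI[of _ 0]) simp
next
  case (pCons a q)
  then obtain c where c: "\<And>n. poly q (real n) \<le> real ((n + 2) ^ c)" by blast
  define m where "m = nat \<lceil>a\<rceil>"
  have "poly (pCons a q) (real n) \<le> real ((n + 2) ^ (m + c + 2))" for n
  proof -
    define N where "N = real (n + 2)"
    have N: "2 \<le> N" "real n \<le> N" by (simp_all add: N_def)
    have "a \<le> real m" unfolding m_def by linarith
    also have "\<dots> \<le> 2 ^ m" using of_nat_less_two_power[of m, where 'a = real] by linarith
    also have "\<dots> \<le> N ^ m" using N by (intro power_mono) auto
    also have "\<dots> \<le> N ^ (m + c + 1)" using N by (intro power_increasing) auto
    finally have 1: "a \<le> N ^ (m + c + 1)" .
    have "real n * poly q (real n) \<le> real n * N ^ c" using c[of n] by (intro mult_left_mono) (simp_all add: N_def)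
    also have "\<dots> \<le> N * N ^ c" using N by (intro mult_right_mono) auto
    also have "\<dots> = N ^ (c + 1)" by simp
    also have "\<dots> \<le> N ^ (m + c + 1)" using N by (intro power_increasing) auto
    finally have 2: "real n * poly q (real n) \<le> N ^ (m + c + 1)" .
    have "poly (pCons a q) (real n) \<le> 2 * N ^ (m + c + 1)" using 1 2 by simp
    also have "\<dots> \<le> N * N ^ (m + c + 1)" using N by (intro mult_right_mono) auto
    also have "\<dots> = N ^ (m + c + 2)" by simp
    also have "\<dots> = real ((n + 2) ^ (m + c + 2))" by (simp only: N_def of_nat_power)
    finally show ?thesis .
  qed
  then show ?case by blast
qed

lemma lp_error_cost:
  assumes A: "A \<in> carrier_mat n d" and U: "U \<in> carrier_mat n k" and V: "V \<in> carrier_mat k d"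
  shows "lp_error p A U V = cost p n d k (\<lambda>i j. of_int (A $$ (i, j))) (\<lambda>i l. U $$ (i, l)) (\<lambda>l j. V $$ (l, j))"
proof -
  have dims: "dim_row (map_mat real_of_int A - U * V) = n" "dim_col (map_mat real_of_int A - U * V) = d" using U V by auto
  have "(map_mat real_of_int A - U * V) $$ (i, j) = of_int (A $$ (i, j)) - (\<Sum>l<k. U $$ (i, l) * V $$ (l, j))"
    if "i < n" "j < d" for i j
    using that A U V by (simp add: scalar_prod_def atLeast0LessThan)
  then show ?thesis unfolding lp_error_def lp_norm_pow_def cost_def dims by (intro sum.cong refl) simp
qed

lemma cost_cong:
  assumes "\<And>i l. i < n \<Longrightarrow> l < k \<Longrightarrow> U i l = U' i l" "\<And>l j. l < k \<Longrightarrow> j < d \<Longrightarrow> V l j = V' l j"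
  shows "cost p n d k A U V = cost p n d k A U' V'"
  unfolding cost_def using assms by (intro sum.cong refl arg_cong[of _ _ "\<lambda>y. \<bar>A _ _ - y\<bar> powr p"]) auto

lemma lp_error_mat:
  assumes "A \<in> carrier_mat n d"
  shows "lp_error p A (mat n k (\<lambda>(i, l). U i l)) (mat k d (\<lambda>(l, j). V l j)) = cost p n d k (\<lambda>i j. of_int (A $$ (i, j))) U V"
proof -
  have "lp_error p A (mat n k (\<lambda>(i, l). U i l)) (mat k d (\<lambda>(l, j). V l j)) =
    cost p n d k (\<lambda>i j. of_int (A $$ (i, j))) (\<lambda>i l. mat n k (\<lambda>(i, l). U i l) $$ (i, l)) (\<lambda>l j. mat k d (\<lambda>(l, j). V l j) $$ (l, j))"
    by (rule lp_error_cost[OF assms]) auto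
  also have "\<dots> = cost p n d k (\<lambda>i j. of_int (A $$ (i, j))) U V" by (rule cost_cong) auto
  finally show ?thesis .
qed

text \<open>The infimum enters the argument only as a lower bound that is approached, never through
  a minimizer.\<close>

lemma lp_rank_opt:
  assumes A: "A \<in> carrier_mat n d"
  shows "lp_rank_opt p k A \<le> cost p n d k (\<lambda>i j. of_int (A $$ (i, j))) U V"
    "lp_rank_opt p k A < y \<Longrightarrow> \<exists>U V. cost p n d k (\<lambda>i j. of_int (A $$ (i, j))) U V < y"
proof -
  define S where "S = (carrier_mat n k :: real mat set) \<times> (carrier_mat k d :: real mat set)"
  have opt: "lp_rank_opt p k A = (INF s\<in>S. lp_error p A (fst s) (snd s))"
    using A by (simp add: lp_rank_opt_def S_def case_prod_unfold)
  have low: "0 \<le> lp_error p A (fst s) (snd s)" for s :: "real mat \<times> real mat"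
    by (simp add: lp_error_def lp_norm_pow_def sum_nonneg)
  have bdd: "bdd_below ((\<lambda>s. lp_error p A (fst s) (snd s)) ` S)" by (rule bdd_belowI2[of _ 0]) (rule low)
  have mem: "(mat n k (\<lambda>(i, l). U i l), mat k d (\<lambda>(l, j). V l j)) \<in> S" by (simp add: S_def)
  from cINF_lower[OF bdd mem] show "lp_rank_opt p k A \<le> cost p n d k (\<lambda>i j. of_int (A $$ (i, j))) U V"
    unfolding opt by (simp only: fst_conv snd_conv lp_error_mat[OF A])
  assume "lp_rank_opt p k A < y"
  then obtain s where s: "s \<in> S" "lp_error p A (fst s) (snd s) < y"
    unfolding opt using cINF_less_iff[of S "\<lambda>s. lp_error p A (fst s) (snd s)" y] bdd mem by blast
  have "fst s \<in> carrier_mat n k" "snd s \<in> carrier_mat k d" using s(1) by (auto simp: S_def)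
  from lp_error_cost[OF A this] s(2) show "\<exists>U V. cost p n d k (\<lambda>i j. of_int (A $$ (i, j))) U V < y" by auto
qed

text \<open>With \<open>u = k * E\<close> and \<open>y = N ^ (u\<^sup>2)\<close>, both
  \<open>u\<close> and \<open>N\<close> are at most \<open>y\<close>, and \<open>x\<close> is a
  power of \<open>y\<close>; each bound is then a count of exponents. The largest constant, four
  times the cube of 100000, is below \<open>2 ^ 52\<close>.\<close>

lemma size_bounds:
  fixes n k E c0 cx :: nat
  assumes n: "1 \<le> n" and k: "1 \<le> k" and E: "1 \<le> E" and cx: "c0 + 60 \<le> cx"
  defines "x \<equiv> (n + 2) ^ (cx * (k * E)\<^sup>2)"
  shows "4 * (100000 * (k * E)) ^ 3 * (n + 2) \<le> x" "10 * (n + 2) ^ c0 \<le> x" "n + 2 \<le> x" "k * E \<le> x" "16 \<le> x"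
proof -
  define N where "N = n + 2"
  define u where "u = k * E"
  define y where "y = N ^ (u\<^sup>2)"
  have u: "1 \<le> u" using k E by (simp add: u_def)
  have N: "2 \<le> N" by (simp add: N_def)
  have uu: "u \<le> u\<^sup>2" "1 \<le> u\<^sup>2" using u by (simp_all add: power2_nat_le_imp_le power2_eq_square)
  have "u\<^sup>2 < 2 ^ (u\<^sup>2)" by (rule less_exp)
  also have "\<dots> \<le> y" unfolding y_def using N by (intro power_mono) auto
  finally have uy: "u \<le> y" using uu by linarith
  have Ny: "N \<le> y" using power_increasing[OF uu(2), of N] N by (simp add: y_def)
  have y2: "2 \<le> y" using N Ny by linarith
  have x: "x = y ^ cx" unfolding x_def y_def N_def u_def power_mult[symmetric] by (simp only: mult.commute)
  have mono: "y ^ i \<le> x" if "i \<le> c0 + 60" for i unfolding x using y2 cx that by (intro power_increasing) auto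
  have pw: "2 ^ i \<le> y ^ i" for i using y2 by (intro power_mono) auto
  have "4 * (100000 * u) ^ 3 * N = 4000000000000000 * u ^ 3 * N" by (simp add: power_mult_distrib)
  also have "\<dots> \<le> y ^ 52 * y ^ 3 * y ^ 1"
    using pw[of 52] uy Ny by (intro mult_le_mono power_mono) simp_all
  also have "\<dots> = y ^ (52 + 3 + 1)" by (simp only: power_add)
  also have "\<dots> \<le> x" by (rule mono) simp
  finally show "4 * (100000 * (k * E)) ^ 3 * (n + 2) \<le> x" by (simp only: u_def N_def)
  have "10 * N ^ c0 \<le> y ^ 4 * y ^ c0" using pw[of 4] Ny by (intro mult_le_mono power_mono) simp_all
  also have "\<dots> = y ^ (4 + c0)" by (simp only: power_add)
  also have "\<dots> \<le> x" by (rule mono) simp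
  finally show "10 * (n + 2) ^ c0 \<le> x" by (simp only: N_def)
  show "n + 2 \<le> x" using Ny mono[of 1] by (simp add: N_def)
  show "k * E \<le> x" using uy mono[of 1] by (simp add: u_def)
  show "16 \<le> x" using pw[of 4] mono[of 4] by simp
qed

text \<open>Let \<open>r\<close> be the number of samples and \<open>u = k * E\<close>. From
  \<open>2 * x + 1 \<le> x\<^sup>2\<close> and \<open>1 + r * (k + 2) \<le> 4 * (r * u)\<close> the
  number of guesses is at most \<open>x ^ (8 * (r * u))\<close>, which explains the summand
  \<open>8 * cr * cx\<close> and the power \<open>er + 3\<close>. The summand \<open>22 * cx\<close>
  makes room for \<open>x ^ 22\<close>.\<close>

lemma loop_bound:
  fixes k E cr er cx N :: nat
  assumes k: "1 \<le> k" and E: "1 \<le> E" and cr: "1 \<le> cr" and cx: "1 \<le> cx" and N: "2 \<le> N"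
  defines "x \<equiv> N ^ (cx * (k * E)\<^sup>2)" and "b \<equiv> N ^ ((8 * cr * cx + 22 * cx) * (k * E) ^ (er + 3))"
  assumes x: "16 \<le> x"
  shows "(2 * x + 1) ^ (1 + cr * (k * E) ^ er * (k + 2)) \<le> b" "x ^ 21 < b" "(8 * cr * cx + 22 * cx) * (k * E) ^ (er + 3) < b"
proof -
  define u where "u = k * E"
  have u: "1 \<le> u" "k \<le> u" using k E by (simp_all add: u_def)
  have up: "u ^ i \<le> u ^ j" if "i \<le> j" for i j using u(1) that by (intro power_increasing) auto
  have xe: "x ^ i = N ^ (i * cx * u\<^sup>2)" for i by (simp add: x_def u_def ac_simps flip: power_mult)
  have Nm: "N ^ i \<le> N ^ j" if "i \<le> j" for i j using N that by (intro power_increasing) auto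
  have "16 * x \<le> x * x" using x by (intro mult_le_mono1)
  then have w: "2 * x + 1 \<le> x\<^sup>2" using x unfolding power2_eq_square by linarith
  define r where "r = cr * u ^ er"
  have r1: "1 \<le> r" using cr u by (simp add: r_def)
  have "r \<le> r * k" using k by simp
  then have "1 + r * (k + 2) \<le> 4 * (r * k)" using r1 unfolding distrib_left by linarith
  also have "\<dots> \<le> 4 * (r * u)" using u by simp
  finally have L: "1 + r * (k + 2) \<le> 4 * (r * u)" .
  have "(2 * x + 1) ^ (1 + r * (k + 2)) \<le> (x\<^sup>2) ^ (1 + r * (k + 2))" using w by (intro power_mono) auto
  also have "\<dots> \<le> (x\<^sup>2) ^ (4 * (r * u))" using L x by (intro power_increasing) auto
  also have "\<dots> = x ^ (8 * (r * u))" by (simp flip: power_mult)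
  also have "\<dots> \<le> b" unfolding xe b_def u_def[symmetric]
  proof (rule Nm)
    have "8 * (r * u) * cx * u\<^sup>2 = 8 * cr * cx * u ^ (er + 3)" by (simp add: r_def power_add power2_eq_square power3_eq_cube ac_simps)
    also have "\<dots> \<le> (8 * cr * cx + 22 * cx) * u ^ (er + 3)" by (intro mult_le_mono1) simp
    finally show "8 * (r * u) * cx * u\<^sup>2 \<le> (8 * cr * cx + 22 * cx) * u ^ (er + 3)" .
  qed
  finally show "(2 * x + 1) ^ (1 + cr * (k * E) ^ er * (k + 2)) \<le> b" by (simp only: r_def u_def)
  have "x ^ 21 < x ^ 22" using x by (intro power_strict_increasing) auto
  also have "\<dots> \<le> b" unfolding xe b_def u_def[symmetric]
  proof (rule Nm)
    have "22 * cx * u\<^sup>2 \<le> (8 * cr * cx + 22 * cx) * u ^ (er + 3)" by (intro mult_le_mono up) auto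
    then show "22 * cx * u\<^sup>2 \<le> (8 * cr * cx + 22 * cx) * u ^ (er + 3)" .
  qed
  finally show "x ^ 21 < b" .
  have "(8 * cr * cx + 22 * cx) * u ^ (er + 3) < 2 ^ ((8 * cr * cx + 22 * cx) * u ^ (er + 3))" by (rule less_exp)
  also have "\<dots> \<le> b" unfolding b_def u_def[symmetric] using N by (intro power_mono) auto
  finally show "(8 * cr * cx + 22 * cx) * (k * E) ^ (er + 3) < b" by (simp only: u_def)
qed

text \<open>Guessed weights are integers, namely \<open>H * w t\<close> rounded up. As
  \<open>w t \<ge> 1\<close>, this is a relative error of at most \<open>1 / H\<close>; with
  \<open>H = 4 * q\<close> it fits, together with the evaluation error \<open>e\<close>, into
  \<open>1 / q\<close>.\<close>

lemma weighted_transfer: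
  fixes H q e :: real
  assumes H: "H = 4 * q" "1 \<le> q" and e: "0 \<le> e" "e \<le> 1 / (4 * q)"
    and w: "\<And>t. t < r \<Longrightarrow> H * w t \<le> real (wt t) \<and> real (wt t) \<le> H * w t + 1 \<and> 1 \<le> w t"
    and a: "\<And>t. 0 \<le> a t" "\<And>t. 0 \<le> c t"
    and le: "(\<Sum>t<r. real (wt t) * a t) \<le> (1 + e) * (\<Sum>t<r. real (wt t) * c t)"
  shows "(\<Sum>t<r. w t * a t) \<le> (1 + 1 / q) * (\<Sum>t<r. w t * c t)"
proof -
  have H0: "0 < H" using H by simp
  have s0: "0 \<le> (\<Sum>t<r. w t * c t)" using w a by (intro sum_nonneg mult_nonneg_nonneg) (auto intro: order_trans[of 0 1])
  have "H * (\<Sum>t<r. w t * a t) \<le> (\<Sum>t<r. real (wt t) * a t)"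
    unfolding sum_distrib_left mult.assoc[symmetric] using w a by (intro sum_mono mult_right_mono) auto
  also note le
  also have "(1 + e) * (\<Sum>t<r. real (wt t) * c t) \<le> (1 + e) * ((H + 1) * (\<Sum>t<r. w t * c t))"
  proof (intro mult_left_mono)
    show "(\<Sum>t<r. real (wt t) * c t) \<le> (H + 1) * (\<Sum>t<r. w t * c t)"
      unfolding sum_distrib_left mult.assoc[symmetric]
    proof (intro sum_mono mult_right_mono a)
      fix t assume "t \<in> {..<r}"
      then show "real (wt t) \<le> (H + 1) * w t" using w[of t] by (simp add: distrib_right)
    qed
  qed (use e in simp)
  also have "\<dots> \<le> (H * (1 + 1 / q)) * (\<Sum>t<r. w t * c t)"
    unfolding mult.assoc[symmetric]
  proof (intro mult_right_mono s0)
    have "(1 + e) * (H + 1) \<le> (1 + 1 / (4 * q)) * (H + 1)" using e H0 by (intro mult_right_mono) auto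
    also have "\<dots> = 4 * q + 2 + 1 / (4 * q)" using H by (simp add: distrib_left distrib_right)
    also have "\<dots> \<le> 4 * q + 4" using H(2) by (simp add: divide_le_eq)
    also have "\<dots> = H * (1 + 1 / q)" using H by (simp add: distrib_left)
    finally show "(1 + e) * (H + 1) \<le> H * (1 + 1 / q)" .
  qed
  finally have "H * (\<Sum>t<r. w t * a t) \<le> H * ((1 + 1 / q) * (\<Sum>t<r. w t * c t))" by (simp only: mult.assoc)
  then show ?thesis using H0 by (simp only: mult_le_cancel_left_pos)
qed

context run
begin

text \<open>Three losses of at most \<open>1 / E\<close> each: the grid, the sample with
  \<open>14000 / z\<^sup>2\<close>, and the approximate powers with \<open>3 * \<eta>\<close>. The
  constant in \<open>z\<close> makes the second one small and satisfies the lower bounds on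
  \<open>z\<close> in \<open>sampling_exists\<close>.\<close>

lemma run_approx:
  fixes opt :: real
  assumes E: "1 \<le> E" and z: "z = 100000 * (k * E)" and Rz: "real z ^ 60 * real z powr (44 / p) \<le> real R"
    and xz: "4 * z ^ 3 * (n + 2) \<le> x" and opt: "0 \<le> opt"
    and grid: "\<exists>D U V. 1 \<le> D \<and> D \<le> x \<and> (\<forall>i<n. \<forall>l<k. \<bar>U i l\<bar> \<le> int x) \<and> (\<forall>l<k. \<forall>j<d. \<bar>V l j\<bar> \<le> int x) \<and>
      cost p n d k (\<lambda>i j. of_int (A i j)) (\<lambda>i l. of_int (U i l) / real D) (\<lambda>l j. of_int (V l j) / real D) \<le> (1 + 1 / real E) * opt"
  shows "cost p n d k (\<lambda>i j. of_int (A i j)) (\<lambda>i l. of_int (Uout i l) / real Dout) (\<lambda>l j. of_int (Vout l j) / real Dout)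
    \<le> (1 + 1 / real E) ^ 3 * opt"
proof -
  from grid obtain D U V where D: "1 \<le> D" "D \<le> x" and U: "\<forall>i<n. \<forall>l<k. \<bar>U i l\<bar> \<le> int x" and V: "\<forall>l<k. \<forall>j<d. \<bar>V l j\<bar> \<le> int x"
    and co: "cost p n d k (\<lambda>i j. of_int (A i j)) (\<lambda>i l. of_int (U i l) / real D) (\<lambda>l j. of_int (V l j) / real D) \<le> (1 + 1 / real E) * opt"
    by (elim exE conjE)
  have kE: "1 \<le> k * E" "k \<le> k * E" "E \<le> k * E" using k E by simp_all
  have z1: "100000 \<le> z" "2 * k \<le> z" "100000 * E \<le> z" using kE unfolding z by linarith+
  define \<zeta> where "\<zeta> = real z"
  have \<zeta>: "100000 \<le> \<zeta>" "2 * real k \<le> \<zeta>" "100000 * real E \<le> \<zeta>"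
    unfolding \<zeta>_def using z1 by linarith+
  define q where "q = \<zeta>\<^sup>2"
  have q: "\<zeta> \<le> q" "1 \<le> q" unfolding q_def using \<zeta> self_le_power[of \<zeta> 2] by auto
  have zp: "p \<le> 2" "10000 \<le> \<zeta>" using p \<zeta> by auto
  obtain \<omega> w where \<omega>: "\<And>t. t < R \<Longrightarrow> \<omega> t < n" and wr: "\<And>t. t < R \<Longrightarrow> 1 \<le> w t \<and> w t \<le> \<zeta> * real n"
    and samp: "\<And>X'. (\<And>j. j < d \<Longrightarrow> (\<Sum>t<R. w t * \<bar>(\<Sum>l<k. of_int (U (\<omega> t) l) * X' l j) - of_int (A (\<omega> t) j * int (D\<^sup>2))\<bar> powr p)
        \<le> (1 + 1 / \<zeta>\<^sup>2) * (\<Sum>t<R. w t * \<bar>(\<Sum>l<k. of_int (U (\<omega> t) l) * of_int (V l j)) - of_int (A (\<omega> t) j * int (D\<^sup>2))\<bar> powr p)) \<Longrightarrow>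
      (\<Sum>j<d. \<Sum>i<n. \<bar>(\<Sum>l<k. of_int (U i l) * X' l j) - of_int (A i j * int (D\<^sup>2))\<bar> powr p)
        \<le> (1 + 14000 / \<zeta>\<^sup>2) * (\<Sum>j<d. \<Sum>i<n. \<bar>(\<Sum>l<k. of_int (U i l) * of_int (V l j)) - of_int (A i j * int (D\<^sup>2))\<bar> powr p)"
  proof (rule sampling_exists[OF p(1) zp(1,2) \<zeta>(2) k n Rz[folded \<zeta>_def],
        of d "\<lambda>i l. of_int (U i l)" "\<lambda>i j. of_int (A i j * int (D\<^sup>2))" "\<lambda>l j. of_int (V l j)"], goal_cases)
    case (1 \<omega> w)
    show ?case by (rule that[of \<omega> w]; fact 1)
  qed
  define H where "H = 4 * q"
  define wt where "wt t = nat \<lceil>H * w t\<rceil>" for t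
  have H0: "0 < H" using q by (simp add: H_def)
  have wtr: "H * w t \<le> real (wt t) \<and> real (wt t) \<le> H * w t + 1 \<and> 1 \<le> w t" if "t < R" for t
  proof -
    have "0 \<le> H * w t" using wr[OF that] H0 by simp
    then show ?thesis using wr[OF that] unfolding wt_def by linarith
  qed
  have wtx: "wt t \<le> 2 * x" if t: "t < R" for t
  proof -
    have "real (wt t) \<le> H * (\<zeta> * real n) + 1" using wtr[OF t] mult_left_mono[of "w t" "\<zeta> * real n" H] wr[OF t] H0 by linarith
    also have "H * (\<zeta> * real n) = real (4 * z ^ 3 * n)" by (simp add: H_def q_def \<zeta>_def power3_eq_cube power2_eq_square)
    also have "\<dots> \<le> real x"
    proof -
      have "4 * z ^ 3 * n \<le> 4 * z ^ 3 * (n + 2)" by (intro mult_le_mono2) simp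
      then have "4 * z ^ 3 * n \<le> x" using xz by linarith
      then show ?thesis by (simp only: of_nat_le_iff)
    qed
    also have "real x + 1 \<le> real (2 * x)" using nx(5) by simp
    finally show ?thesis by (simp only: of_nat_le_iff)
  qed
  have e3: "0 \<le> 3 * \<eta>" "3 * \<eta> \<le> 1 / (4 * q)"
  proof -
    show "0 \<le> 3 * \<eta>" using Y_big by simp
    have "4 * z ^ 3 * 1 \<le> 4 * z ^ 3 * (n + 2)" by (intro mult_le_mono2) simp
    then have "4 * z ^ 3 \<le> x" using xz by linarith
    then have "real (4 * z ^ 3) \<le> real x" by (simp only: of_nat_le_iff)
    then have "4 * \<zeta> * q \<le> real x" by (simp add: \<zeta>_def q_def power3_eq_cube power2_eq_square)
    moreover have "48 * q \<le> 4 * \<zeta> * q" using \<zeta> q by (intro mult_right_mono) auto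
    moreover have "real x \<le> real Y" unfolding Y_def of_nat_le_iff using nx(5) by (intro self_le_power) auto
    ultimately have "48 * q \<le> real Y" by linarith
    then show "3 * \<eta> \<le> 1 / (4 * q)" using Y_big q by (simp add: \<eta>_def divide_le_eq pos_le_divide_eq mult.commute)
  qed
  have cost_le: "cost p n d k (\<lambda>i j. of_int (A i j)) (\<lambda>i l. of_int (Uout i l) / real Dout) (\<lambda>l j. of_int (Vout l j) / real Dout)
    \<le> (1 + 3 * \<eta>) * ((1 + 14000 / q) * cost p n d k (\<lambda>i j. of_int (A i j)) (\<lambda>i l. of_int (U i l) / real D) (\<lambda>l j. of_int (V l j) / real D))"
  proof (rule run_cost[OF D \<omega> wtx])
    show "\<bar>U i l\<bar> \<le> int x" if "i < n" "l < k" for i l using U that by blast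
    show "\<bar>V l j\<bar> \<le> int x" if "l < k" "j < d" for l j using V that by blast
    show "0 \<le> 14000 / q" using q by simp
    fix V' :: "nat \<Rightarrow> nat \<Rightarrow> int"
    assume le: "\<And>j. j < d \<Longrightarrow>
        (\<Sum>t<R. real (wt t) * \<bar>real_of_int ((\<Sum>l<k. U (\<omega> t) l * V' l j) - A (\<omega> t) j * int (D\<^sup>2))\<bar> powr p)
        \<le> (1 + 3 * \<eta>) * (\<Sum>t<R. real (wt t) * \<bar>real_of_int ((\<Sum>l<k. U (\<omega> t) l * V l j) - A (\<omega> t) j * int (D\<^sup>2))\<bar> powr p)"
    have conv: "real_of_int ((\<Sum>l<k. U i l * Z l j) - A i j * int (D\<^sup>2)) = (\<Sum>l<k. of_int (U i l) * of_int (Z l j)) - of_int (A i j * int (D\<^sup>2))"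
      for i j and Z :: "nat \<Rightarrow> nat \<Rightarrow> int" by (simp only: of_int_diff of_int_sum of_int_mult)
    have "(\<Sum>j<d. \<Sum>i<n. \<bar>(\<Sum>l<k. of_int (U i l) * of_int (V' l j)) - of_int (A i j * int (D\<^sup>2))\<bar> powr p)
        \<le> (1 + 14000 / \<zeta>\<^sup>2) * (\<Sum>j<d. \<Sum>i<n. \<bar>(\<Sum>l<k. of_int (U i l) * of_int (V l j)) - of_int (A i j * int (D\<^sup>2))\<bar> powr p)"
    proof (rule samp)
      fix j assume j: "j < d"
      show "(\<Sum>t<R. w t * \<bar>(\<Sum>l<k. of_int (U (\<omega> t) l) * of_int (V' l j)) - of_int (A (\<omega> t) j * int (D\<^sup>2))\<bar> powr p)
        \<le> (1 + 1 / \<zeta>\<^sup>2) * (\<Sum>t<R. w t * \<bar>(\<Sum>l<k. of_int (U (\<omega> t) l) * of_int (V l j)) - of_int (A (\<omega> t) j * int (D\<^sup>2))\<bar> powr p)"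
        unfolding q_def[symmetric]
        by (rule weighted_transfer[OF H_def q(2) e3 wtr _ _ le[OF j, unfolded conv]]) simp_all
    qed
    then show "(\<Sum>i<n. \<Sum>j<d. \<bar>real_of_int ((\<Sum>l<k. U i l * V' l j) - A i j * int (D\<^sup>2))\<bar> powr p)
        \<le> (1 + 14000 / q) * (\<Sum>i<n. \<Sum>j<d. \<bar>real_of_int ((\<Sum>l<k. U i l * V l j) - A i j * int (D\<^sup>2))\<bar> powr p)"
      unfolding conv q_def by (subst (1 2) sum.swap)
  qed
  define h where "h = 1 / real E"
  have h0: "0 \<le> h" by (simp add: h_def)
  have E1: "1 \<le> real E" using E by simp
  have qE: "14000 * real E \<le> q" using \<zeta> q by linarith
  have h1: "14000 / q \<le> h" unfolding h_def using qE q E1 by (simp add: divide_le_eq pos_le_divide_eq mult.commute)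
  have h2: "3 * \<eta> \<le> h"
  proof -
    have "1 / (4 * q) \<le> 14000 / q" using q by (simp add: divide_le_eq)
    then show ?thesis using e3 h1 by linarith
  qed
  define c1 where "c1 = cost p n d k (\<lambda>i j. of_int (A i j)) (\<lambda>i l. of_int (U i l) / real D) (\<lambda>l j. of_int (V l j) / real D)"
  have c1: "0 \<le> c1" "c1 \<le> (1 + h) * opt" using co by (simp_all add: c1_def h_def cost_nonneg)
  have "(1 + 3 * \<eta>) * ((1 + 14000 / q) * c1) \<le> (1 + h) * ((1 + h) * ((1 + h) * opt))"
    using h1 h2 c1 h0 e3 q by (intro mult_mono) auto
  then show ?thesis using cost_le unfolding c1_def h_def by (simp add: power3_eq_cube mult.assoc)
qed

lemma run_encodes:
  assumes ys: "ys = map (\<lambda>i. out \<mu> (int i)) [0..<2 * (n * k + k * d)]"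
  shows "encodes_factors n k d ys (mat n k (\<lambda>(i, l). of_int (Uout i l) / real Dout)) (mat k d (\<lambda>(l, j). of_int (Vout l j) / real Dout))"
proof -
  have nth: "ys ! i = out \<mu> (int i)" if "i < 2 * (n * k + k * d)" for i using that by (simp add: ys)
  have ix: "i * y + l < m * y" if "i < m" "l < y" for i y l m :: nat
  proof -
    have "(i + 1) * y \<le> m * y" using that by (intro mult_le_mono1) simp
    then show ?thesis using that by simp
  qed
  have lt: "2 * m < 2 * q" "2 * m + 1 < 2 * q" if "m < q" for m q :: nat using that by linarith+
  have odd: "ys ! (2 * m + 1) = int Dout" "1 \<le> Dout" if "m < n * k + k * d" for m
  proof -
    have "2 * m + 1 < 2 * (n * k + k * d)" by (rule lt(2)[OF that])
    then show "ys ! (2 * m + 1) = int Dout" "1 \<le> Dout" using out_value(1,2)[OF that] by (simp_all only: nth)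
  qed
  have even: "ys ! (2 * m) = (if m < n * k then Uout (m div k) (m mod k) else Vout ((m - n * k) div d) ((m - n * k) mod d))"
    if "m < n * k + k * d" for m
  proof -
    have "2 * m < 2 * (n * k + k * d)" by (rule lt(1)[OF that])
    then show ?thesis using out_value(3)[OF that] by (simp only: nth)
  qed
  show ?thesis unfolding encodes_factors_def
  proof (intro conjI allI impI)
    show "length ys = 2 * (n * k + k * d)" by (simp add: ys)
    show "ys ! (2 * m + 1) \<noteq> 0" if "m < n * k + k * d" for m using odd[OF that] by simp
    show "mat n k (\<lambda>(i, l). of_int (Uout i l) / real Dout) = rat_mat n k ys"
      unfolding rat_mat_def
    proof (rule eq_matI)
      fix i l assume il: "i < dim_row (mat n k (\<lambda>(i, j). real_of_int (ys ! (2 * (i * k + j))) / real_of_int (ys ! (2 * (i * k + j) + 1))))"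
        "l < dim_col (mat n k (\<lambda>(i, j). real_of_int (ys ! (2 * (i * k + j))) / real_of_int (ys ! (2 * (i * k + j) + 1))))"
      then have i: "i < n" "l < k" by auto
      have m: "i * k + l < n * k" by (rule ix[OF i])
      then have m': "i * k + l < n * k + k * d" by simp
      show "mat n k (\<lambda>(i, l). of_int (Uout i l) / real Dout) $$ (i, l) =
        mat n k (\<lambda>(i, j). real_of_int (ys ! (2 * (i * k + j))) / real_of_int (ys ! (2 * (i * k + j) + 1))) $$ (i, l)"
        using i m by (simp only: index_mat prod.case odd[OF m'] even[OF m']) simp
    qed auto
    show "mat k d (\<lambda>(l, j). of_int (Vout l j) / real Dout) = rat_mat k d (drop (2 * (n * k)) ys)"
      unfolding rat_mat_def
    proof (rule eq_matI)
      let ?zs = "drop (2 * (n * k)) ys"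
      fix l j assume lj: "l < dim_row (mat k d (\<lambda>(i, j). real_of_int (?zs ! (2 * (i * d + j))) / real_of_int (?zs ! (2 * (i * d + j) + 1))))"
        "j < dim_col (mat k d (\<lambda>(i, j). real_of_int (?zs ! (2 * (i * d + j))) / real_of_int (?zs ! (2 * (i * d + j) + 1))))"
      then have l: "l < k" "j < d" by auto
      have m: "l * d + j < k * d" by (rule ix[OF l])
      then have m': "n * k + (l * d + j) < n * k + k * d" by simp
      have len: "2 * (n * k) \<le> length ys" by (simp add: ys)
      have z1: "?zs ! (2 * (l * d + j)) = ys ! (2 * (n * k + (l * d + j)))"
        unfolding nth_drop[OF len] by (simp only: distrib_left)
      have z2: "?zs ! (2 * (l * d + j) + 1) = ys ! (2 * (n * k + (l * d + j)) + 1)"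
        unfolding nth_drop[OF len] by (simp only: distrib_left add.assoc)
      have dm: "(n * k + (l * d + j) - n * k) div d = l" "(n * k + (l * d + j) - n * k) mod d = j" using l by simp_all
      have nl: "\<not> n * k + (l * d + j) < n * k" by simp
      show "mat k d (\<lambda>(l, j). of_int (Vout l j) / real Dout) $$ (l, j) =
        mat k d (\<lambda>(i, j). real_of_int (?zs ! (2 * (i * d + j))) / real_of_int (?zs ! (2 * (i * d + j) + 1))) $$ (l, j)"
        unfolding index_mat(1)[OF l] prod.case z1 z2 odd(1)[OF m'] even[OF m'] dm using nl by simp
    qed auto
  qed
qed

end

lemma instance_input_nth:
  assumes A: "A \<in> carrier_mat n d"
  shows "length (instance_input A k) = 3 + n * d" "instance_input A k ! 0 = int n" "instance_input A k ! 1 = int d"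
    "instance_input A k ! 2 = int k" "i < n \<Longrightarrow> j < d \<Longrightarrow> instance_input A k ! (3 + (d * i + j)) = A $$ (i, j)"
proof -
  have dims: "dim_row A = n" "dim_col A = d" using A by auto
  define f where "f m = map (\<lambda>j. A $$ (m, j)) [0..<d]" for m
  have len: "length (concat (map f [0..<m])) = m * d" for m by (induction m) (simp_all add: f_def)
  have nth: "concat (map f [0..<m]) ! (d * i + j) = A $$ (i, j)" if "i < m" "j < d" for i j m
    using that(1)
  proof (induction m)
    case (Suc m)
    have e: "concat (map f [0..<Suc m]) = concat (map f [0..<m]) @ f m" by simp
    show ?case
    proof (cases "i < m")
      case True
      have "(i + 1) * d \<le> m * d" using True by (intro mult_le_mono1) simp
      then have "d * i + j < m * d" using that(2) by (simp add: mult.commute)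
      then show ?thesis unfolding e using Suc.IH[OF True] by (simp add: nth_append len)
    next
      case False
      then have "i = m" using Suc.prems by simp
      then show ?thesis unfolding e using that(2) by (simp add: nth_append len f_def mult.commute)
    qed
  qed simp
  have I: "instance_input A k = [int n, int d, int k] @ concat (map f [0..<n])"
    unfolding instance_input_def dims f_def by simp
  show "length (instance_input A k) = 3 + n * d" unfolding I by (simp add: len del: append_Cons)
  show "instance_input A k ! 0 = int n" "instance_input A k ! 1 = int d" "instance_input A k ! 2 = int k" unfolding I by simp_all
  show "i < n \<Longrightarrow> j < d \<Longrightarrow> instance_input A k ! (3 + (d * i + j)) = A $$ (i, j)"
    unfolding I using nth[of i n j] by (simp add: numeral_3_eq_3)
qed

lemma amem_arr:
  assumes "8 \<le> bs" "i < length xs"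
  shows "arr (amem bs E xs b) (int i) = xs ! i"
proof -
  have "nat (int bs + (if 0 < int i then int i else 0)) = bs + i" by (simp add: nat_add_distrib)
  moreover have "amem bs E xs b 1 = int bs" by (simp add: amem_def)
  ultimately have "arr (amem bs E xs b) (int i) = amem bs E xs b (bs + i)" unfolding arr_def by simp
  then show ?thesis using assms by (simp add: amem_def)
qed

text \<open>Constants are turned into powers of \<open>max 2 n\<close>, which is at least 2 also for
  \<open>n = 1\<close> and whose square is at least \<open>n + 2\<close>.\<close>

lemma time_bound:
  fixes C e F n t m :: nat
  assumes t: "t \<le> C * m ^ e" and m: "m \<le> 16 * (n + 2) ^ F" and n: "1 \<le> n"
  shows "real t \<le> real (max 2 n) powr (2 * (real C + 4 * real e + real e * real F))"
proof -
  define N where "N = real (max 2 n)"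
  have N: "2 \<le> N" by (simp add: N_def)
  have nN: "real (n + 2) \<le> N\<^sup>2"
  proof (cases "n = 1")
    case False
    then have "2 \<le> n" using n by simp
    then have "n + 2 \<le> n * n" using mult_le_mono1[of 2 n n] by linarith
    then have "real (n + 2) \<le> real (n * n)" by (simp only: of_nat_le_iff)
    then show ?thesis using \<open>2 \<le> n\<close> by (simp add: N_def power2_eq_square)
  qed (simp add: N_def)
  have NC: "real C \<le> (N\<^sup>2) ^ C"
  proof -
    have "real C \<le> 2 ^ C" using of_nat_less_two_power[of C, where 'a = real] by linarith
    also have "\<dots> \<le> (N\<^sup>2) ^ C" using N self_le_power[of N 2] by (intro power_mono) auto
    finally show ?thesis .
  qed
  have "real m \<le> 16 * real (n + 2) ^ F" using m by (metis of_nat_le_iff of_nat_mult of_nat_numeral of_nat_power)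
  also have "\<dots> \<le> (N\<^sup>2) ^ 4 * (N\<^sup>2) ^ F"
  proof (intro mult_mono power_mono nN)
    have "2 ^ 4 \<le> (N\<^sup>2) ^ 4" using N self_le_power[of N 2] by (intro power_mono) auto
    then show "16 \<le> (N\<^sup>2) ^ 4" by simp
  qed auto
  finally have "real m \<le> (N\<^sup>2) ^ (4 + F)" by (simp only: power_add)
  then have "real m ^ e \<le> ((N\<^sup>2) ^ (4 + F)) ^ e" by (intro power_mono) auto
  then have me: "real m ^ e \<le> (N\<^sup>2) ^ ((4 + F) * e)" by (simp only: power_mult)
  have "real t \<le> real (C * m ^ e)" using t by (simp only: of_nat_le_iff)
  also have "\<dots> = real C * real m ^ e" by simp
  also have "\<dots> \<le> (N\<^sup>2) ^ C * (N\<^sup>2) ^ ((4 + F) * e)" using NC me by (intro mult_mono) auto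
  also have "\<dots> = N ^ (2 * (C + (4 + F) * e))" by (simp only: power_add power_mult)
  also have "\<dots> = N powr real (2 * (C + (4 + F) * e))" using N by (intro powr_realpow[symmetric]) auto
  also have "real (2 * (C + (4 + F) * e)) = 2 * (real C + 4 * real e + real e * real F)" by (simp add: algebra_simps)
  finally show ?thesis unfolding N_def .
qed

theorem theorem1p1:
  fixes p :: real and b :: "real poly"
  assumes "0 < p" and "p < 2"
  shows "\<exists>q :: real poly. \<forall>\<epsilon> :: real. 0 < \<epsilon> \<and> \<epsilon> < 1 \<longrightarrow>
    (\<exists>P :: instr list. \<forall>(n :: nat) (d :: nat) (k :: nat) (A :: int mat).
       1 \<le> d \<and> d \<le> n \<and> 1 \<le> k \<and> A \<in> carrier_mat n d \<and>
       (\<forall>i<n. \<forall>j<d. real_of_int \<bar>A $$ (i, j)\<bar> \<le> poly b (real n)) \<longrightarrow>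
       (\<exists>t ys U V.
          ram_computes p P (instance_input A k) t ys \<and>
          real t \<le> real (max 2 n) powr poly q (real k / \<epsilon>) \<and>
          encodes_factors n k d ys U V \<and>
          lp_error p A U V \<le> (1 + \<epsilon>) * lp_rank_opt p k A))"
proof -
  obtain c0 where c0: "\<And>n. poly b (real n) \<le> real ((n + 2) ^ c0)" using poly_le_power[of b] by blast
  obtain cg where grid: "\<And>n d k E Big (A :: nat \<Rightarrow> nat \<Rightarrow> int) opt.
    1 \<le> n \<Longrightarrow> d \<le> n \<Longrightarrow> 1 \<le> k \<Longrightarrow> 1 \<le> E \<Longrightarrow>
    (\<And>i j. i < n \<Longrightarrow> j < d \<Longrightarrow> \<bar>A i j\<bar> \<le> int ((n + 2) ^ c0)) \<Longrightarrow> (n + 2) ^ (cg * (k * E)\<^sup>2) \<le> Big \<Longrightarrow>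
    (\<And>U V. opt \<le> cost p n d k (\<lambda>i j. of_int (A i j)) U V) \<Longrightarrow>
    (\<And>x. opt < x \<Longrightarrow> \<exists>U V. cost p n d k (\<lambda>i j. of_int (A i j)) U V < x) \<Longrightarrow>
    \<exists>D U V. 1 \<le> D \<and> D \<le> Big \<and> (\<forall>i<n. \<forall>l<k. \<bar>U i l\<bar> \<le> int Big) \<and> (\<forall>l<k. \<forall>j<d. \<bar>V l j\<bar> \<le> int Big) \<and>
      cost p n d k (\<lambda>i j. of_int (A i j)) (\<lambda>i l. of_int (U i l) / real D) (\<lambda>l j. of_int (V l j) / real D) \<le> (1 + 1 / real E) * opt"
  proof (rule grid_exists[OF assms, of c0], goal_cases)
    case (1 c)
    show ?case by (rule that[of c], fact 1)
  qed
  \<comment> \<open>The sample size must reach \<open>z ^ 60 * z powr (44 / p)\<close> for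
    \<open>z = 100000 * (k * E)\<close>. As \<open>p\<close> is fixed, rounding the exponent up
    turns this into the monomial \<open>cr * (k * E) ^ er\<close>.\<close>
  define e0 where "e0 = nat \<lceil>44 / p\<rceil>"
  define er where "er = 60 + e0"
  define cr :: nat where "cr = 100000 ^ er"
  define cx where "cx = cg + c0 + 60"
  define cb where "cb = 8 * cr * cx + 22 * cx"
  define eb where "eb = er + 3"
  have cr1: "1 \<le> cr" by (simp add: cr_def)
  have cx1: "1 \<le> cx" "c0 + 60 \<le> cx" by (simp_all add: cx_def)
  interpret al: algo p "int cr" er "int cx" 2 .
  have rout: "rcomp p 4 (\<lambda>\<mu>. al.out \<mu> (\<mu> 3))" by (rule al.rcomp_out) (auto intro!: rcomp_var)
  obtain C e bs where bs: "8 \<le> bs" and prog: "\<And>E. \<exists>P. \<forall>xs n d b1 b2 b3 c. length xs = 3 + n * d \<longrightarrow> xs ! 0 = int n \<longrightarrow> xs ! 1 = int d \<longrightarrow>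
     b1 = al.bound1 (amem bs E xs (int d)) \<longrightarrow> b2 = al.bound2 (int cb) eb (amem bs E xs b1) \<longrightarrow> b3 = al.bound3 (int cb) eb (amem bs E xs b2) \<longrightarrow>
     al.count (amem bs E xs b3) = int c \<longrightarrow>
     (\<exists>t \<le> C * (n * d + d + nat b1 + nat b2 + nat b3 + c + 2) ^ e.
       ram_computes p P xs t (map (\<lambda>i. al.out ((amem bs E xs b3)(3 := int i)) (((amem bs E xs b3)(3 := int i)) 3)) [0..<c]))"
  proof (rule rcomp_program[OF al.rcomp_bound1[OF order_refl] al.rcomp_bound2[OF order_refl, of "int cb" eb]
      al.rcomp_bound3[OF order_refl, of "int cb" eb] al.rcomp_count[OF order_refl] rout], goal_cases)
    case (1 C e bs)
    show ?case by (rule that[of bs C e]; fact 1)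
  qed
  \<comment> \<open>The loop bound is \<open>n + 2\<close> to the power
    \<open>F = cb * (k * E) ^ eb\<close>, and \<open>E \<le> 16 / \<epsilon>\<close> bounds
    \<open>F\<close> by a monomial in \<open>k / \<epsilon>\<close>; \<open>C\<close> and
    \<open>e\<close> come from the time bound of the program.\<close>
  define q where "q = [:2 * (real C + 4 * real e):] + monom (2 * real e * real cb * 16 ^ eb) eb"
  show ?thesis
  proof (intro exI[of _ q] allI impI, elim conjE)
    fix \<epsilon> :: real
    assume \<epsilon>: "0 < \<epsilon>" "\<epsilon> < 1"
    \<comment> \<open>Three factors \<open>1 + 1 / E\<close> multiply to at most
      \<open>1 + 7 / E\<close>, and \<open>1 / E \<le> \<epsilon> / 8\<close>.\<close>
    define E where "E = 8 * nat \<lceil>1 / \<epsilon>\<rceil>"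
    have i\<epsilon>: "1 < 1 / \<epsilon>" using \<epsilon> by simp
    have Eup: "real E \<le> 16 / \<epsilon>" and Elo: "8 / \<epsilon> \<le> real E"
    proof -
      have "real (nat \<lceil>1 / \<epsilon>\<rceil>) \<le> 1 / \<epsilon> + 1" using i\<epsilon> by linarith
      then have "real E \<le> 8 * (1 / \<epsilon> + 1)" by (simp add: E_def)
      also have "8 * (1 / \<epsilon> + 1) \<le> 8 * (1 / \<epsilon> + 1 / \<epsilon>)" using i\<epsilon> by (intro mult_left_mono add_left_mono) auto
      also have "\<dots> = 16 / \<epsilon>" by simp
      finally show "real E \<le> 16 / \<epsilon>" .
      have "1 / \<epsilon> \<le> real (nat \<lceil>1 / \<epsilon>\<rceil>)" by linarith
      then show "8 / \<epsilon> \<le> real E" by (simp add: E_def)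
    qed
    have E1: "1 \<le> E" using Elo i\<epsilon> by linarith
    from prog[of "int E"] obtain P where P: "\<forall>xs n d b1 b2 b3 c. length xs = 3 + n * d \<longrightarrow> xs ! 0 = int n \<longrightarrow> xs ! 1 = int d \<longrightarrow>
     b1 = al.bound1 (amem bs (int E) xs (int d)) \<longrightarrow> b2 = al.bound2 (int cb) eb (amem bs (int E) xs b1) \<longrightarrow> b3 = al.bound3 (int cb) eb (amem bs (int E) xs b2) \<longrightarrow>
     al.count (amem bs (int E) xs b3) = int c \<longrightarrow>
     (\<exists>t \<le> C * (n * d + d + nat b1 + nat b2 + nat b3 + c + 2) ^ e.
       ram_computes p P xs t (map (\<lambda>i. al.out ((amem bs (int E) xs b3)(3 := int i)) (((amem bs (int E) xs b3)(3 := int i)) 3)) [0..<c]))" ..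
    show "\<exists>P :: instr list. \<forall>(n :: nat) (d :: nat) (k :: nat) (A :: int mat).
       1 \<le> d \<and> d \<le> n \<and> 1 \<le> k \<and> A \<in> carrier_mat n d \<and>
       (\<forall>i<n. \<forall>j<d. real_of_int \<bar>A $$ (i, j)\<bar> \<le> poly b (real n)) \<longrightarrow>
       (\<exists>t ys U V.
          ram_computes p P (instance_input A k) t ys \<and>
          real t \<le> real (max 2 n) powr poly q (real k / \<epsilon>) \<and>
          encodes_factors n k d ys U V \<and>
          lp_error p A U V \<le> (1 + \<epsilon>) * lp_rank_opt p k A)"
    proof (intro exI[of _ P] allI impI, elim conjE)
      fix n d k :: nat and A :: "int mat"
      assume d1: "1 \<le> d" and dn: "d \<le> n" and k1: "1 \<le> k" and Ac: "A \<in> carrier_mat n d"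
        and Ab: "\<forall>i<n. \<forall>j<d. real_of_int \<bar>A $$ (i, j)\<bar> \<le> poly b (real n)"
      have n1: "1 \<le> n" using d1 dn by simp
      define xs where "xs = instance_input A k"
      note inp = instance_input_nth[OF Ac, where k = k, folded xs_def]
      define u where "u = k * E"
      define x where "x = (n + 2) ^ (cx * (k * E)\<^sup>2)"
      define F where "F = cb * (k * E) ^ eb"
      define \<beta> where "\<beta> = (n + 2) ^ F"
      define R where "R = cr * (k * E) ^ er"
      have u1: "1 \<le> k * E" "k \<le> k * E" "E \<le> k * E" using k1 E1 by simp_all
      note sz = size_bounds[OF n1 k1 E1 cx1(2), folded x_def]
      have N2: "2 \<le> n + 2" by simp
      note lb = loop_bound[OF k1 E1 cr1 cx1(1) N2, folded x_def, OF sz(5), of er, folded eb_def cb_def, folded F_def, folded \<beta>_def R_def]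
      have A': "\<bar>A $$ (i, j)\<bar> \<le> int ((n + 2) ^ c0)" if "i < n" "j < d" for i j
      proof -
        have "real_of_int \<bar>A $$ (i, j)\<bar> \<le> real ((n + 2) ^ c0)" using Ab that c0[of n] by (meson order_trans)
        then have "real_of_int \<bar>A $$ (i, j)\<bar> \<le> real_of_int (int ((n + 2) ^ c0))" by (simp only: of_int_of_nat_eq)
        then show ?thesis by (simp only: of_int_le_iff)
      qed
      define mm where "mm b = amem bs (int E) xs b" for b
      have arr: "arr (mm b) 0 = int n" "arr (mm b) 1 = int d" "arr (mm b) 2 = int k" "mm b 2 = int E" "mm b 0 = b" for b
        using amem_arr[OF bs, of 0 xs "int E" b] amem_arr[OF bs, of 1 xs "int E" b] amem_arr[OF bs, of 2 xs "int E" b] inp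
        by (simp_all add: mm_def) (simp_all add: amem_def)
      have ent: "arr (mm b) (int d * int i + int j + 3) = A $$ (i, j)" if ij: "i < n" "j < d" for i j b
      proof -
        have "(i + 1) * d \<le> n * d" using ij(1) by (intro mult_le_mono1) simp
        then have "3 + (d * i + j) < length xs" using ij(2) inp(1) by (simp add: mult.commute)
        from amem_arr[OF bs this, of "int E" b] inp(5)[OF ij] have "arr (mm b) (int (3 + (d * i + j))) = A $$ (i, j)" by (simp only: mm_def)
        moreover have "int (3 + (d * i + j)) = int d * int i + int j + 3" by simp
        ultimately show ?thesis by (simp only:)
      qed
      define b1 where "b1 = al.bound1 (mm (int d))"
      have b1: "b1 = int (k + E)" by (simp add: b1_def al.bound1_def al.kk_def arr)
      define b2 where "b2 = al.bound2 (int cb) eb (mm b1)"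
      have mono1: "monom_kE (mm b) (int cb) eb = int F" if "int k \<le> b" "int E \<le> b" for b
        using monom_kE_eq[of "mm b" "int cb" eb] that by (simp add: arr F_def)
      have b2: "b2 = int (n + 2 + k + E + F)"
        unfolding b2_def al.bound2_def al.nn_def al.kk_def arr using mono1[of b1] b1 by simp
      define b3 where "b3 = al.bound3 (int cb) eb (mm b2)"
      have b3: "b3 = int \<beta>"
      proof -
        have "monom_kE (mm b2) (int cb) eb = int F" by (rule mono1) (simp_all add: b2)
        moreover have "mm b2 0 = int (n + 2 + k + E + F)" by (simp only: arr b2)
        then have "cpow (mm b2) 1 (int n + 2) (int F) = 1 * (int n + 2) ^ nat (int F)" by (intro cpow_eq) simp_all
        ultimately show ?thesis unfolding b3_def al.bound3_def al.nn_def arr by (simp add: \<beta>_def add.commute)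
      qed
      define \<mu> where "\<mu> = mm (int \<beta>)"
      have "run p cr er cx 2 \<mu> n d k E c0 \<beta> (\<lambda>i j. A $$ (i, j)) R x"
      proof unfold_locales
        show "1 \<le> R" unfolding R_def using cr1 u1(1) by (simp add: one_le_power)
        show "\<mu> 0 = int \<beta>" by (simp add: \<mu>_def arr)
        show "arr \<mu> 0 = int n" "arr \<mu> 1 = int d" "arr \<mu> 2 = int k" "\<mu> 2 = int E" by (simp_all only: \<mu>_def arr)
        show "arr \<mu> (int d * int i + int j + 3) = A $$ (i, j)" if "i < n" "j < d" for i j unfolding \<mu>_def by (rule ent[OF that])
        show "R = cr * (k * E) ^ er" "x = (n + 2) ^ (cx * (k * E)\<^sup>2)" by (rule R_def, rule x_def)
        show "k \<le> x" "E \<le> x" "d \<le> x" using sz u1 dn by linarith+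
      qed (rule assms n1 d1 k1 A' lb sz | assumption)+
      then interpret rn: run p cr er cx 2 \<mu> n d k E c0 \<beta> "\<lambda>i j. A $$ (i, j)" R x .
      define c where "c = 2 * (n * k + k * d)"
      have cnt: "al.count (amem bs (int E) xs b3) = int c" using rn.count_value by (simp only: \<mu>_def mm_def b3 c_def)
      from P[rule_format, OF inp(1,2,3) b1_def[unfolded mm_def] b2_def[unfolded mm_def] b3_def[unfolded mm_def] cnt]
      obtain t where t: "t \<le> C * (n * d + d + nat b1 + nat b2 + nat b3 + c + 2) ^ e"
        and ram: "ram_computes p P xs t (map (\<lambda>i. al.out ((amem bs (int E) xs b3)(3 := int i)) (((amem bs (int E) xs b3)(3 := int i)) 3)) [0..<c])"
        by blast
      define ys where "ys = map (\<lambda>i. al.out \<mu> (int i)) [0..<2 * (n * k + k * d)]"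
      \<comment> \<open>During printing, register 3 holds the index of the current item. For a
        constant index the output is computable from level 3 on, hence independent of that
        register.\<close>
      have oi: "al.out ((amem bs (int E) xs b3)(3 := int i)) (((amem bs (int E) xs b3)(3 := int i)) 3) = al.out \<mu> (int i)" for i
      proof -
        have r: "rcomp p 3 (\<lambda>\<mu>. al.out \<mu> (int i))" by (rule al.rcomp_out) (auto intro!: rcomp_const)
        have "\<mu> 1 = int bs" by (simp add: \<mu>_def mm_def amem_def)
        then have "agree 3 \<mu> (\<mu>(3 := int i))" unfolding agree_def using bs by auto
        from rcomp_agree[OF r this] show ?thesis by (simp add: \<mu>_def mm_def b3)
      qed
      have ram': "ram_computes p P (instance_input A k) t ys" using ram unfolding oi by (simp only: ys_def xs_def c_def)
      define U where "U = mat n k (\<lambda>(i, l). real_of_int (rn.Uout i l) / real rn.Dout)"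
      define V where "V = mat k d (\<lambda>(l, j). real_of_int (rn.Vout l j) / real rn.Dout)"
      have enc: "encodes_factors n k d ys U V" unfolding U_def V_def by (rule rn.run_encodes[OF ys_def])
      have time: "real t \<le> real (max 2 n) powr (2 * (real C + 4 * real e + real e * real F))"
      proof (rule time_bound[OF t _ n1])
        have xb: "x ^ 2 \<le> \<beta>" "x \<le> \<beta>" using rn.x_le[of 2] rn.x_le[of 1] by simp_all
        have "n * d \<le> x * x" using rn.nx by (intro mult_le_mono) linarith+
        then have "n * d \<le> \<beta>" using xb by (simp add: power2_eq_square)
        moreover have "c \<le> \<beta>" unfolding c_def by (rule rn.nkd)
        moreover have "nat b1 = k + E" "nat b2 = n + 2 + k + E + F" "nat b3 = \<beta>" unfolding b1 b2 b3 by (rule nat_int)+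
        moreover have "F < \<beta>" by (rule lb(3))
        ultimately have "n * d + d + nat b1 + nat b2 + nat b3 + c + 2 \<le> 16 * \<beta>" using rn.nx xb(2) by linarith
        then show "n * d + d + nat b1 + nat b2 + nat b3 + c + 2 \<le> 16 * (n + 2) ^ F" by (simp only: \<beta>_def)
      qed
      also have "\<dots> \<le> real (max 2 n) powr poly q (real k / \<epsilon>)"
      proof (rule powr_mono)
        have "real k * real E \<le> real k * (16 / \<epsilon>)" by (intro mult_left_mono Eup) simp
        also have "\<dots> = 16 * (real k / \<epsilon>)" by simp
        finally have "real (k * E) \<le> 16 * (real k / \<epsilon>)" by (simp only: of_nat_mult)
        then have "real (k * E) ^ eb \<le> (16 * (real k / \<epsilon>)) ^ eb" by (intro power_mono) auto
        then have "real F \<le> real cb * (16 ^ eb * (real k / \<epsilon>) ^ eb)"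
          unfolding F_def of_nat_mult[of cb] of_nat_power power_mult_distrib[of 16] by (intro mult_left_mono) auto
        then have "2 * real e * real F \<le> 2 * real e * (real cb * (16 ^ eb * (real k / \<epsilon>) ^ eb))" by (intro mult_left_mono) auto
        then show "2 * (real C + 4 * real e + real e * real F) \<le> poly q (real k / \<epsilon>)"
          unfolding q_def poly_add poly_monom by (simp add: mult.assoc)
      qed simp
      finally have time': "real t \<le> real (max 2 n) powr poly q (real k / \<epsilon>)" .
      define opt where "opt = lp_rank_opt p k A"
      have opt_le: "opt \<le> cost p n d k (\<lambda>i j. of_int (A $$ (i, j))) U V" for U V unfolding opt_def by (rule lp_rank_opt(1)[OF Ac])
      have opt_ap: "\<exists>U V. cost p n d k (\<lambda>i j. of_int (A $$ (i, j))) U V < y" if "opt < y" for y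
        using lp_rank_opt(2)[OF Ac] that unfolding opt_def .
      have opt0: "0 \<le> opt"
      proof (rule ccontr)
        assume "\<not> 0 \<le> opt"
        then have "opt < 0" by simp
        from opt_ap[OF this] show False using cost_nonneg[of p n d k "\<lambda>i j. of_int (A $$ (i, j))"] by (meson not_le)
      qed
      have big: "(n + 2) ^ (cg * (k * E)\<^sup>2) \<le> x" unfolding x_def cx_def by (intro power_increasing mult_le_mono1) simp_all
      note gr = grid[of n d k E "\<lambda>i j. A $$ (i, j)" x opt, OF n1 dn k1 E1 A' big opt_le opt_ap]
      define z where "z = 100000 * (k * E)"
      have Rz: "real z ^ 60 * real z powr (44 / p) \<le> real R"
      proof -
        have "1 \<le> z" using u1(1) unfolding z_def by linarith
        then have "1 \<le> real z" by simp
        have "real z powr (44 / p) \<le> real z powr real e0"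
          using \<open>1 \<le> real z\<close> by (intro powr_mono) (auto simp: e0_def, linarith)
        also have "\<dots> = real z ^ e0" using \<open>1 \<le> real z\<close> by (intro powr_realpow) simp
        finally have "real z ^ 60 * real z powr (44 / p) \<le> real z ^ 60 * real z ^ e0" by (intro mult_left_mono) auto
        also have "\<dots> = real (z ^ er)" by (simp add: er_def power_add)
        also have "z ^ er = R" unfolding z_def R_def cr_def by (rule power_mult_distrib)
        finally show ?thesis .
      qed
      have "cost p n d k (\<lambda>i j. of_int (A $$ (i, j))) (\<lambda>i l. of_int (rn.Uout i l) / real rn.Dout) (\<lambda>l j. of_int (rn.Vout l j) / real rn.Dout)
        \<le> (1 + 1 / real E) ^ 3 * opt"
        by (rule rn.run_approx[OF E1 z_def Rz _ opt0 gr]) (simp only: z_def sz(1))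
      also have "\<dots> \<le> (1 + \<epsilon>) * opt"
      proof (rule mult_right_mono[OF _ opt0])
        define h where "h = 1 / real E"
        have "1 / real E \<le> 1 / (8 / \<epsilon>)" using Elo \<epsilon> E1 by (intro divide_left_mono mult_pos_pos divide_pos_pos) auto
        then have h: "0 \<le> h" "h \<le> \<epsilon> / 8" "h \<le> 1" using \<epsilon> by (simp_all add: h_def)
        have hh: "h * h \<le> h" "h * h * h \<le> h"
        proof -
          show "h * h \<le> h" using h by (simp add: mult_left_le)
          then have "h * h * h \<le> h * h" using h by (intro mult_right_mono) auto
          then show "h * h * h \<le> h" using \<open>h * h \<le> h\<close> by linarith
        qed
        have "(1 + h) ^ 3 = 1 + 3 * h + 3 * (h * h) + h * h * h" by (simp add: power3_eq_cube algebra_simps)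
        then have "(1 + h) ^ 3 \<le> 1 + \<epsilon>" using hh h by linarith
        then show "(1 + 1 / real E) ^ 3 \<le> 1 + \<epsilon>" by (simp only: h_def)
      qed
      finally have err: "lp_error p A U V \<le> (1 + \<epsilon>) * lp_rank_opt p k A"
        unfolding U_def V_def opt_def lp_error_mat[OF Ac] .
      show "\<exists>t ys U V. ram_computes p P (instance_input A k) t ys \<and> real t \<le> real (max 2 n) powr poly q (real k / \<epsilon>) \<and>
          encodes_factors n k d ys U V \<and> lp_error p A U V \<le> (1 + \<epsilon>) * lp_rank_opt p k A"
        by (intro exI conjI) (rule ram', rule time', rule enc, rule err)
    qed
  qed
qed

end
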